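(* Let $P$ be an $n$-element unit interval order labeled by $[n]$ so that for each pair $x,y\in P$ satisfying $$\#\{z\in P : z<x\}-\#\{z\in P : z>x\} < \#\{z\in P : z<y\}-\#\{z\in P : z>y\},$$ the label of $x$ is less than the label of $y$. Let $v\in\mathfrak{S}_n$ be the (unique) permutation avoiding $312$ with $P(F_v)\cong P$, and let $w\in\mathfrak{S}_n$ be any permutation avoiding the patterns $3412$ and $4231$ and satisfying $P(F_w)\cong P(F_v)$. Then $$X_{P,q}=\sum_{\lambda\vdash n}\epsilon_q^\lambda\big(q^{\ell(w)/2}\, C'_w(q)\big)\,m_\lambda.$$
   Context: A unit interval order is a finite poset with no induced subposet that is a disjoint union of a 3-element chain and a 1-element chain, nor one that is a disjoint union of two 2-element chains. $m_\lambda$ is the monomial symmetric function in $x_1,x_2,\dotsc$. Chromatic quasisymmetric function. For a labeled poset $P$ (elements identified with labels in $[n]$), $\mathrm{inc}(P)=([n],E)$ is its incomparability graph. A proper coloring is a map $\kappa:[n]\to\{1,2,3,\dotsc\}$ with $\kappa(i)\ne\kappa(j)$ whenever $(i,j)\in E$; $\mathrm{asc}(\kappa)=\#\{(i,j)\in E : i<j,\ \kappa(i)<\kappa(j)\}$; and $X_{P,q}=\sum_\kappa q^{\mathrm{asc}(\kappa)}x_{\kappa(1)}\cdots x_{\kappa(n)}$, summed over all proper colorings. Hecke algebra. $H_n(q)$ is the $\mathbb{Z}[q^{1/2},q^{-1/2}]$-algebra with identity $T_e$, generators $T_{s_1},\dotsc,T_{s_{n-1}}$ and relations $T_{s_i}^2=(q-1)T_{s_i}+qT_e$,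 $T_{s_i}T_{s_j}T_{s_i}=T_{s_j}T_{s_i}T_{s_j}$ for $|i-j|=1$, $T_{s_i}T_{s_j}=T_{s_j}T_{s_i}$ for $|i-j|\ge 2$; $T_w=T_{s_{i_1}}\cdots T_{s_{i_\ell}}$ for a reduced expression $w=s_{i_1}\cdots s_{i_\ell}$, and $\ell(w)=\ell$ is the length (number of inversions) of $w$. The signless Kazhdan-Lusztig basis is $C'_w(q)=q^{-\ell(w)/2}\sum_{v\le w}P_{v,w}(q)T_v$, with $\le$ the Bruhat order and $P_{v,w}$ the Kazhdan-Lusztig polynomials (it is known that $P_{v,w}=1$ for all $v\le w$ when $w$ avoids $3412$ and $4231$). $\chi_q^\lambda$ are the irreducible $H_n(q)$-characters, specializing at $q^{1/2}=1$ to the irreducible $\mathfrak{S}_n$-characters $\chi^\lambda$ (so $\chi_q^{(n)}(T_w)=q^{\ell(w)}$). The induced sign characters are $\epsilon_q^\lambda=\sum_\mu K_{\mu^\top,\lambda}\chi_q^\mu$, with $K$ the Kostka numbers. Zig-zag networks. Permutations are in one-line notation $w_1\cdots w_n$; $w$ avoids a pattern $p$ if no subword of $w_1\cdots w_n$ has letters in the same relative order as $p$. $[n]=\{1,\dotsc,n\}$. A planar network of order $n$ is an acyclic directed planar graph embedded in a disc with $2n$ boundary vertices labeled clockwise source $1,\dotsc,$ source $n$ (indegree $0$), sink $n,\dotsc,$ sink $1$ (outdegree $0$); two networks are isomorphic if for all $i,j$ they have equally many paths from source $i$ to sink $j$. The star network $G_{[a,b]}$ ($[a,b]\subseteq[n]$)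 has one edge from source $i$ to sink $i$ for each $i\notin[a,b]$, and a central vertex with an edge from each source $i$ and an edge to each sink $i$, $i\in[a,b]$. In the concatenation $G\circ H$, for each $i$, sink $i$ of $G$ and source $i$ of $H$ are dropped and the edge of $G$ into sink $i$ and the edge of $H$ out of source $i$ are merged into one edge. Consider concatenations $G=G_{[c_1,d_1]}\circ\cdots\circ G_{[c_t,d_t]}$ such that (1) the intervals are distinct and pairwise nonnesting; (2) for $i<j<k$, if $[c_i,d_i]\cap[c_j,d_j]\ne\emptyset$ and $[c_j,d_j]\cap[c_k,d_k]\ne\emptyset$, then $c_i<c_j<c_k$ or $c_i>c_j>c_k$. (Every index of $[n]$ lies in some interval, trivial intervals $[i,i]$ being used where needed.) Let $[c_i,d_i]\prec\!\cdot\,[c_k,d_k]$ if $i<k$, $[c_i,d_i]\cap[c_k,d_k]\neq\emptyset$ and $[c_i,d_i]\cap[c_j,d_j]\cap[c_k,d_k]=\emptyset$ for $i<j<k$; this is the covering relation of a partial order $\preceq$ on the intervals. The zig-zag network $F$ of $G$ is obtained by deleting, for each covering pair with $|[c_i,d_i]\cap[c_j,d_j]|=k$, all but one of the $k$ paths (edges) from the central vertex of $G_{[c_i,d_i]}$ to that of $G_{[c_j,d_j]}$. Let $G'$ be obtained from $G$ by inserting, for each covering pair $[c_i,d_i]\prec\!\cdot\,[c_j,d_j]$ with $|[c_i,d_i]\cap[c_j,d_j]|>1$, the star $G_{[c_i,d_i]\cap[c_j,d_j]}$ immediately after $G_{[c_i,d_i]}$ (in either order if there are two). If $G'=G_{[a_1,b_1]}\circ\cdots\circ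 G_{[a_m,b_m]}$, define $w(F)$ by letting $w(F)_i$ be the image of $i$ under successively applying, for $k=1,\dotsc,m$, the map sending $j\mapsto a_k+b_k-j$ for $j\in[a_k,b_k]$ and fixing other $j$. It is known that $F\mapsto w(F)$ is a bijection from zig-zag networks of order $n$ (up to isomorphism) to permutations in $\mathfrak{S}_n$ avoiding $3412$ and $4231$; $F_w$ denotes the zig-zag network with $w(F_w)=w$. Permutations avoiding $312$ also avoid $3412$ and $4231$. Path poset. In $F_w$ there is exactly one path $\pi_i$ from source $i$ to sink $i$ for each $i\in[n]$. $P(F_w)$ is the poset on $\{\pi_1,\dotsc,\pi_n\}$ with $\pi_i<\pi_j$ iff $i<j$ and $\pi_i,\pi_j$ share no vertex. (The map $v\mapsto P(F_v)$ induces a bijection from $312$-avoiding permutations in $\mathfrak{S}_n$ to isomorphism classes of $n$-element unit interval orders.) *)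

theory Defs
  imports
    "HOL-Library.FuncSet"
    "HOL-Library.Poly_Mapping"
    "HOL-Computational_Algebra.Polynomial_Factorial"
    "HOL-Combinatorics.Permutations"
    "HOL-Algebra.QuotRing"
    "HOL-Algebra.Sym_Groups"
    "Jordan_Normal_Form.VS_Connect"
    "Graph_Theory.Arc_Walk"
begin

section \<open>Unit interval orders\<close>

text \<open>Posets are given by their strict order relation.\<close>

definition strict_poset_on :: "'a set \<Rightarrow> 'a rel \<Rightarrow> bool" where
  "strict_poset_on A P \<longleftrightarrow> P \<subseteq> A \<times> A \<and> irrefl P \<and> trans P"

definition incomparable :: "'a rel \<Rightarrow> 'a \<Rightarrow> 'a \<Rightarrow> bool" where
  "incomparable P x y \<longleftrightarrow> x \<noteq> y \<and> (x, y) \<notin> P \<and> (y, x) \<notin> P"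

definition unit_interval_order :: "'a set \<Rightarrow> 'a rel \<Rightarrow> bool" where
  "unit_interval_order A P \<longleftrightarrow> finite A \<and> strict_poset_on A P \<and>
     \<not> (\<exists>a\<in>A. \<exists>b\<in>A. \<exists>c\<in>A. \<exists>d\<in>A. (a, b) \<in> P \<and> (b, c) \<in> P \<and>
          incomparable P d a \<and> incomparable P d b \<and> incomparable P d c) \<and>
     \<not> (\<exists>a\<in>A. \<exists>b\<in>A. \<exists>c\<in>A. \<exists>d\<in>A. (a, b) \<in> P \<and> (c, d) \<in> P \<and>
          incomparable P a c \<and> incomparable P a d \<and> incomparable P b c \<and> incomparable P b d)"

definition poset_iso :: "'a set \<Rightarrow> 'a rel \<Rightarrow> 'b set \<Rightarrow> 'b rel \<Rightarrow> bool" where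
  "poset_iso A P B Q \<longleftrightarrow>
     (\<exists>f. bij_betw f A B \<and> (\<forall>x\<in>A. \<forall>y\<in>A. (x, y) \<in> P \<longleftrightarrow> (f x, f y) \<in> Q))"

definition altitude :: "'a set \<Rightarrow> 'a rel \<Rightarrow> 'a \<Rightarrow> int" where
  "altitude A P x = int (card {z\<in>A. (z, x) \<in> P}) - int (card {z\<in>A. (x, z) \<in> P})"

text \<open>The elements of \<open>P\<close> are identified with their labels, so that the ground set is
  \<^term>\<open>{1..n}\<close>.\<close>

definition altitude_respecting :: "nat \<Rightarrow> nat rel \<Rightarrow> bool" where
  "altitude_respecting n P \<longleftrightarrow>
     (\<forall>x\<in>{1..n}. \<forall>y\<in>{1..n}. altitude {1..n} P x < altitude {1..n} P y \<longrightarrow> x < y)"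


section \<open>Scalars and formal power series\<close>

text \<open>The ring of Laurent polynomials in the square root of \<open>q\<close> with integer coefficients. The
  exponent \<open>k\<close> stands for the \<open>k\<close>-th power of the square root, so that \<^term>\<open>q_half k\<close> below
  is \<open>q\<close> to the power \<open>k / 2\<close>.\<close>

type_synonym laurent = "int \<Rightarrow>\<^sub>0 int"

definition q_half :: "int \<Rightarrow> laurent" where
  "q_half k = Poly_Mapping.single k 1"

abbreviation q_var :: laurent where
  "q_var \<equiv> q_half 2"

text \<open>Specialization at 1 of the square root of \<open>q\<close>.\<close>

definition laurent_at_one :: "laurent \<Rightarrow> int" where
  "laurent_at_one c = (\<Sum>k\<in>Poly_Mapping.keys c. Poly_Mapping.lookup c k)"

text \<open>A formal power series in commuting variables indexed by the positive integers is
  represented by its coefficient function; the monomial with exponents \<open>\<alpha>\<close> is identified with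
  \<open>\<alpha>\<close>. The index \<open>0\<close> is not used: coefficients at \<open>\<alpha>\<close> with \<open>\<alpha>\<close> nonzero at \<open>0\<close> vanish.\<close>

type_synonym series = "(nat \<Rightarrow>\<^sub>0 nat) \<Rightarrow> laurent"

definition partitions :: "nat \<Rightarrow> nat list set" where
  "partitions n = {\<nu>. sorted_wrt (\<ge>) \<nu> \<and> (\<forall>x\<in>set \<nu>. 0 < x) \<and> sum_list \<nu> = n}"

definition monomial_sym :: "nat list \<Rightarrow> series" where
  "monomial_sym \<nu> = (\<lambda>\<alpha>.
     if 0 \<notin> Poly_Mapping.keys \<alpha> \<and>
        image_mset (Poly_Mapping.lookup \<alpha>) (mset_set (Poly_Mapping.keys \<alpha>)) = mset \<nu>
     then 1 else 0)"

definition proper_colorings :: "nat \<Rightarrow> nat rel \<Rightarrow> (nat \<Rightarrow> nat) set" where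
  "proper_colorings n P = {\<kappa> \<in> {1..n} \<rightarrow>\<^sub>E {1..}.
     \<forall>i\<in>{1..n}. \<forall>j\<in>{1..n}. incomparable P i j \<longrightarrow> \<kappa> i \<noteq> \<kappa> j}"

definition asc :: "nat \<Rightarrow> nat rel \<Rightarrow> (nat \<Rightarrow> nat) \<Rightarrow> nat" where
  "asc n P \<kappa> = card {(i, j). i \<in> {1..n} \<and> j \<in> {1..n} \<and> incomparable P i j \<and> i < j \<and> \<kappa> i < \<kappa> j}"

definition chromatic_quasisym :: "nat \<Rightarrow> nat rel \<Rightarrow> series" where
  "chromatic_quasisym n P = (\<lambda>\<alpha>.
     \<Sum>\<kappa> | \<kappa> \<in> proper_colorings n P \<and>
           (\<forall>c. Poly_Mapping.lookup \<alpha> c = card {i\<in>{1..n}. \<kappa> i = c}).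
        q_var ^ asc n P \<kappa>)"


section \<open>Permutations\<close>

definition perm_length :: "nat \<Rightarrow> (nat \<Rightarrow> nat) \<Rightarrow> nat" where
  "perm_length n w = card {(i, j). 1 \<le> i \<and> i < j \<and> j \<le> n \<and> w j < w i}"

text \<open>Patterns are given in one-line notation.\<close>

definition avoids :: "nat \<Rightarrow> (nat \<Rightarrow> nat) \<Rightarrow> nat list \<Rightarrow> bool" where
  "avoids n w p \<longleftrightarrow>
     \<not> (\<exists>f. f ` {..<length p} \<subseteq> {1..n} \<and> strict_mono_on {..<length p} f \<and>
          (\<forall>a<length p. \<forall>b<length p. w (f a) < w (f b) \<longleftrightarrow> p ! a < p ! b))"

abbreviation simple_transposition :: "nat \<Rightarrow> nat \<Rightarrow> nat" where
  "simple_transposition i \<equiv> Transposition.transpose i (Suc i)"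

definition reduced_word :: "nat \<Rightarrow> (nat \<Rightarrow> nat) \<Rightarrow> nat list \<Rightarrow> bool" where
  "reduced_word n w is \<longleftrightarrow> set is \<subseteq> {1..<n} \<and> length is = perm_length n w \<and>
     w = foldr (\<lambda>i u. simple_transposition i \<circ> u) is id"

definition bruhat_le :: "nat \<Rightarrow> (nat \<Rightarrow> nat) \<Rightarrow> (nat \<Rightarrow> nat) \<Rightarrow> bool" where
  "bruhat_le n v w \<longleftrightarrow> v permutes {1..n} \<and> w permutes {1..n} \<and>
     (\<lambda>u u'. \<exists>a b. 1 \<le> a \<and> a < b \<and> b \<le> n \<and> u' = u \<circ> Transposition.transpose a b \<and>
         perm_length n u < perm_length n u')\<^sup>*\<^sup>* v w"


section \<open>The Hecke algebra\<close>

text \<open>The free algebra on the generators with indices in \<^term>\<open>{1..<n}\<close> is the ring of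
  finitely supported functions on words, with convolution product. The Hecke algebra is its
  quotient by the two-sided ideal generated by the defining relations.\<close>

datatype gen_word = Word (letters: "nat list")

instantiation gen_word :: monoid_add
begin
definition zero_gen_word :: gen_word where "0 = Word []"
definition plus_gen_word :: "gen_word \<Rightarrow> gen_word \<Rightarrow> gen_word" where
  "u + v = Word (letters u @ letters v)"
instance
  by standard (auto simp: zero_gen_word_def plus_gen_word_def)
end

definition free_alg :: "nat \<Rightarrow> (gen_word \<Rightarrow>\<^sub>0 laurent) ring" where
  "free_alg n = \<lparr>carrier = {p. \<forall>u\<in>Poly_Mapping.keys p. set (letters u) \<subseteq> {1..<n}},
     monoid.mult = (*), one = 1, zero = 0, add = (+)\<rparr>"

abbreviation wterm :: "laurent \<Rightarrow> nat list \<Rightarrow> (gen_word \<Rightarrow>\<^sub>0 laurent)" where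
  "wterm c is \<equiv> Poly_Mapping.single (Word is) c"

definition hecke_relations :: "nat \<Rightarrow> (gen_word \<Rightarrow>\<^sub>0 laurent) set" where
  "hecke_relations n =
     {wterm 1 [i, i] - (wterm (q_var - 1) [i] + wterm q_var []) | i. i \<in> {1..<n}} \<union>
     {wterm 1 [i, j, i] - wterm 1 [j, i, j] | i j.
        i \<in> {1..<n} \<and> j \<in> {1..<n} \<and> \<bar>int i - int j\<bar> = 1} \<union>
     {wterm 1 [i, j] - wterm 1 [j, i] | i j.
        i \<in> {1..<n} \<and> j \<in> {1..<n} \<and> \<bar>int i - int j\<bar> \<ge> 2}"

definition hecke_ideal :: "nat \<Rightarrow> (gen_word \<Rightarrow>\<^sub>0 laurent) set" where
  "hecke_ideal n = genideal (free_alg n) (hecke_relations n)"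

type_synonym hecke = "(gen_word \<Rightarrow>\<^sub>0 laurent) set"

definition Hecke :: "nat \<Rightarrow> hecke ring" where
  "Hecke n = free_alg n Quot hecke_ideal n"

definition hecke_const :: "nat \<Rightarrow> laurent \<Rightarrow> hecke" where
  "hecke_const n c = hecke_ideal n +>\<^bsub>free_alg n\<^esub> wterm c []"

definition hecke_gen :: "nat \<Rightarrow> nat \<Rightarrow> hecke" where
  "hecke_gen n i = hecke_ideal n +>\<^bsub>free_alg n\<^esub> wterm 1 [i]"

definition hecke_scale :: "nat \<Rightarrow> laurent \<Rightarrow> hecke \<Rightarrow> hecke" where
  "hecke_scale n c h = hecke_const n c \<otimes>\<^bsub>Hecke n\<^esub> h"

text \<open>The choice of a reduced word does not matter, by Matsumoto's theorem.\<close>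

definition hecke_T :: "nat \<Rightarrow> (nat \<Rightarrow> nat) \<Rightarrow> hecke" where
  "hecke_T n w = foldr (\<lambda>i h. hecke_gen n i \<otimes>\<^bsub>Hecke n\<^esub> h) (SOME is. reduced_word n w is) \<one>\<^bsub>Hecke n\<^esub>"


subsection \<open>The signless Kazhdan-Lusztig basis\<close>

text \<open>The candidate for the basis element of \<open>w\<close> determined by polynomials \<open>p v\<close>.\<close>

definition kl_element :: "nat \<Rightarrow> ((nat \<Rightarrow> nat) \<Rightarrow> int poly) \<Rightarrow> (nat \<Rightarrow> nat) \<Rightarrow> hecke" where
  "kl_element n p w = hecke_scale n (q_half (- int (perm_length n w)))
     (finsum (Hecke n) (\<lambda>v. hecke_scale n (poly (map_poly of_int (p v)) q_var) (hecke_T n v))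
        {v. bruhat_le n v w})"

text \<open>The bar involution inverts the square root of \<open>q\<close> and the generators.\<close>

definition bar_involution :: "nat \<Rightarrow> (hecke \<Rightarrow> hecke) \<Rightarrow> bool" where
  "bar_involution n f \<longleftrightarrow> f \<in> Ring.ring_hom (Hecke n) (Hecke n) \<and>
     f (hecke_const n (q_half 1)) = hecke_const n (q_half (- 1)) \<and>
     (\<forall>i\<in>{1..<n}. f (hecke_gen n i) \<otimes>\<^bsub>Hecke n\<^esub> hecke_gen n i = \<one>\<^bsub>Hecke n\<^esub>)"

text \<open>The Kazhdan-Lusztig theorem states that for each \<open>w\<close> there is exactly one such family.\<close>

definition kl_family :: "nat \<Rightarrow> (nat \<Rightarrow> nat) \<Rightarrow> ((nat \<Rightarrow> nat) \<Rightarrow> int poly) \<Rightarrow> bool" where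
  "kl_family n w p \<longleftrightarrow> p w = 1 \<and> (\<forall>v. \<not> bruhat_le n v w \<longrightarrow> p v = 0) \<and>
     (\<forall>v. bruhat_le n v w \<and> v \<noteq> w \<longrightarrow>
        2 * degree (p v) + 1 + perm_length n v \<le> perm_length n w) \<and>
     (\<exists>f. bar_involution n f \<and> f (kl_element n p w) = kl_element n p w)"

definition kl_poly :: "nat \<Rightarrow> (nat \<Rightarrow> nat) \<Rightarrow> (nat \<Rightarrow> nat) \<Rightarrow> int poly" where
  "kl_poly n v w = (THE p. kl_family n w p) v"

definition kl_basis :: "nat \<Rightarrow> (nat \<Rightarrow> nat) \<Rightarrow> hecke" where
  "kl_basis n w = kl_element n (\<lambda>v. kl_poly n v w) w"


section \<open>Characters\<close>

definition mat_trace :: "'a::comm_monoid_add mat \<Rightarrow> 'a" where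
  "mat_trace A = (\<Sum>i<dim_row A. A $$ (i, i))"

definition irreducible_mats :: "nat \<Rightarrow> 'a::field mat set \<Rightarrow> bool" where
  "irreducible_mats d M \<longleftrightarrow> d > 0 \<and>
     (\<forall>W. VectorSpace.subspace class_ring W (module_vec TYPE('a) d) \<and>
          (\<forall>A\<in>M. \<forall>x\<in>W. A *\<^sub>v x \<in> W) \<longrightarrow> W = {0\<^sub>v d} \<or> W = carrier_vec d)"


subsection \<open>Symmetric groups\<close>

definition sym_irr_char :: "nat \<Rightarrow> ((nat \<Rightarrow> nat) \<Rightarrow> complex) \<Rightarrow> bool" where
  "sym_irr_char n \<chi> \<longleftrightarrow>
     (\<exists>d \<rho>. \<rho> \<in> hom (sym_group n) (ring_mat TYPE(complex) d ()) \<and> \<rho> id = 1\<^sub>m d \<and>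
        irreducible_mats d (\<rho> ` carrier (sym_group n)) \<and>
        \<chi> = (\<lambda>\<sigma>\<in>carrier (sym_group n). mat_trace (\<rho> \<sigma>)))"

definition char_inner :: "nat \<Rightarrow> ((nat \<Rightarrow> nat) \<Rightarrow> complex) \<Rightarrow> ((nat \<Rightarrow> nat) \<Rightarrow> complex) \<Rightarrow> complex" where
  "char_inner n \<chi> \<psi> = (\<Sum>\<sigma>\<in>carrier (sym_group n). \<chi> \<sigma> * cnj (\<psi> \<sigma>)) / fact n"

definition induced_char ::
    "nat \<Rightarrow> (nat \<Rightarrow> nat) set \<Rightarrow> ((nat \<Rightarrow> nat) \<Rightarrow> complex) \<Rightarrow> (nat \<Rightarrow> nat) \<Rightarrow> complex" where
  "induced_char n H \<phi> \<sigma> =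
     (\<Sum>\<tau>\<in>carrier (sym_group n).
        let \<sigma>' = inv_into UNIV \<tau> \<circ> \<sigma> \<circ> \<tau> in if \<sigma>' \<in> H then \<phi> \<sigma>' else 0) / of_nat (card H)"

definition young_subgroup :: "nat list \<Rightarrow> (nat \<Rightarrow> nat) set" where
  "young_subgroup \<nu> = {\<sigma>. \<sigma> permutes {1..sum_list \<nu>} \<and>
     (\<forall>k<length \<nu>. let B = {sum_list (take k \<nu>) <.. sum_list (take (Suc k) \<nu>)} in \<sigma> ` B = B)}"

fun conjugate :: "nat list \<Rightarrow> nat list" where
  "conjugate [] = []"
| "conjugate (x # xs) = map (\<lambda>j. length (filter (\<lambda>y. j < y) (x # xs))) [0..<x]"

text \<open>The irreducible character indexed by \<open>\<nu>\<close> (the character of the Specht module) is the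
  unique common irreducible constituent of the trivial character induced from the Young subgroup
  of \<open>\<nu>\<close> and of the sign character induced from the Young subgroup of the conjugate partition.
  In particular the partition \<open>(n)\<close> indexes the trivial character.\<close>

definition sym_char :: "nat \<Rightarrow> nat list \<Rightarrow> (nat \<Rightarrow> nat) \<Rightarrow> complex" where
  "sym_char n \<nu> = (THE \<chi>. sym_irr_char n \<chi> \<and>
     char_inner n \<chi> (induced_char n (young_subgroup \<nu>) (\<lambda>_. 1)) \<noteq> 0 \<and>
     char_inner n \<chi> (induced_char n (young_subgroup (conjugate \<nu>)) (\<lambda>\<sigma>. of_int (sign \<sigma>))) \<noteq> 0)"


subsection \<open>Hecke algebras\<close>

text \<open>Irreducibility refers to matrix representations over the field of fractions of the scalar
  ring, which is a splitting field of the Hecke algebra. The character values lie in the scalar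
  ring itself, and can therefore be specialized.\<close>

definition hecke_irr_char :: "nat \<Rightarrow> (hecke \<Rightarrow> laurent) \<Rightarrow> bool" where
  "hecke_irr_char n \<chi> \<longleftrightarrow>
     (\<exists>d \<rho>. \<rho> \<in> Ring.ring_hom (Hecke n) (ring_mat TYPE(laurent fract) d ()) \<and>
        (\<forall>c. \<rho> (hecke_const n c) = to_fract c \<cdot>\<^sub>m 1\<^sub>m d) \<and>
        irreducible_mats d (\<rho> ` carrier (Hecke n)) \<and>
        \<chi> \<in> extensional (carrier (Hecke n)) \<and>
        (\<forall>h\<in>carrier (Hecke n). to_fract (\<chi> h) = mat_trace (\<rho> h)))"

definition hecke_char :: "nat \<Rightarrow> nat list \<Rightarrow> hecke \<Rightarrow> laurent" where
  "hecke_char n \<nu> = (THE \<chi>. hecke_irr_char n \<chi> \<and>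
     (\<forall>w\<in>carrier (sym_group n).
        of_int (laurent_at_one (\<chi> (hecke_T n w))) = sym_char n \<nu> w))"

definition young_diagram :: "nat list \<Rightarrow> (nat \<times> nat) set" where
  "young_diagram \<mu> = (SIGMA i:{..<length \<mu>}. {..<\<mu> ! i})"

text \<open>Semistandard tableaux of shape \<open>\<mu>\<close> and content \<open>\<nu>\<close>; rows, columns and entries are numbered
  from \<open>0\<close>.\<close>

definition semistandard_tableaux :: "nat list \<Rightarrow> nat list \<Rightarrow> (nat \<times> nat \<Rightarrow> nat) set" where
  "semistandard_tableaux \<mu> \<nu> = {t \<in> young_diagram \<mu> \<rightarrow>\<^sub>E {..<length \<nu>}.
     (\<forall>i j j'. (i, j) \<in> young_diagram \<mu> \<and> (i, j') \<in> young_diagram \<mu> \<and> j < j' \<longrightarrow> t (i, j) \<le> t (i, j')) \<and>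
     (\<forall>i i' j. (i, j) \<in> young_diagram \<mu> \<and> (i', j) \<in> young_diagram \<mu> \<and> i < i' \<longrightarrow> t (i, j) < t (i', j)) \<and>
     (\<forall>k<length \<nu>. card {x\<in>young_diagram \<mu>. t x = k} = \<nu> ! k)}"

definition kostka :: "nat list \<Rightarrow> nat list \<Rightarrow> nat" where
  "kostka \<mu> \<nu> = card (semistandard_tableaux \<mu> \<nu>)"

definition hecke_induced_sign :: "nat \<Rightarrow> nat list \<Rightarrow> hecke \<Rightarrow> laurent" where
  "hecke_induced_sign n \<nu> h =
     (\<Sum>\<mu>\<in>partitions n. of_nat (kostka (conjugate \<mu>) \<nu>) * hecke_char n \<mu> h)"


section \<open>Zig-zag networks\<close>

definition ivl :: "nat \<times> nat \<Rightarrow> nat set" where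
  "ivl I = {fst I..snd I}"

text \<open>Sequences of intervals, numbered from \<open>0\<close>, satisfying the conditions that define zig-zag
  networks. An interval is given by its endpoints.\<close>

definition zigzag_sequence :: "nat \<Rightarrow> (nat \<times> nat) list \<Rightarrow> bool" where
  "zigzag_sequence n Is \<longleftrightarrow>
     (\<forall>I\<in>set Is. 1 \<le> fst I \<and> fst I \<le> snd I \<and> snd I \<le> n) \<and>
     (\<Union>I\<in>set Is. ivl I) = {1..n} \<and>
     distinct Is \<and>
     (\<forall>I\<in>set Is. \<forall>J\<in>set Is. I \<noteq> J \<longrightarrow> \<not> ivl I \<subseteq> ivl J) \<and>
     (\<forall>i j k. i < j \<and> j < k \<and> k < length Is \<and>
        ivl (Is ! i) \<inter> ivl (Is ! j) \<noteq> {} \<and> ivl (Is ! j) \<inter> ivl (Is ! k) \<noteq> {} \<longrightarrow>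
        (fst (Is ! i) < fst (Is ! j) \<and> fst (Is ! j) < fst (Is ! k)) \<or>
        (fst (Is ! i) > fst (Is ! j) \<and> fst (Is ! j) > fst (Is ! k)))"

definition covers :: "(nat \<times> nat) list \<Rightarrow> nat \<Rightarrow> nat \<Rightarrow> bool" where
  "covers Is i k \<longleftrightarrow> i < k \<and> k < length Is \<and> ivl (Is ! i) \<inter> ivl (Is ! k) \<noteq> {} \<and>
     (\<forall>j. i < j \<and> j < k \<longrightarrow> ivl (Is ! i) \<inter> ivl (Is ! j) \<inter> ivl (Is ! k) = {})"

datatype net_vertex = Source nat | Sink nat | Center nat

text \<open>In a concatenation of star networks, the edges attached to the index \<open>i\<close> link up to one
  path from source \<open>i\<close> to sink \<open>i\<close>, through the central vertices of those stars whose interval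
  contains \<open>i\<close>.\<close>

definition strand :: "(nat \<times> nat) list \<Rightarrow> nat \<Rightarrow> net_vertex list" where
  "strand Is i =
     Source i # map Center (filter (\<lambda>k. i \<in> ivl (Is ! k)) [0..<length Is]) @ [Sink i]"

text \<open>The arc \<open>(x, i, y)\<close> goes from \<open>x\<close> to \<open>y\<close>; the middle component is the index of its strand
  and tells parallel arcs apart.\<close>

type_synonym network = "(net_vertex, net_vertex \<times> nat \<times> net_vertex) pre_digraph"

definition star_concat :: "nat \<Rightarrow> (nat \<times> nat) list \<Rightarrow> network" where
  "star_concat n Is =
     \<lparr>verts = (\<Union>i\<in>{1..n}. set (strand Is i)),
      arcs = {(x, i, y). i \<in> {1..n} \<and> (x, y) \<in> set (zip (strand Is i) (tl (strand Is i)))},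
      tail = fst,
      head = (\<lambda>a. snd (snd a))\<rparr>"

text \<open>Of the parallel arcs joining the centers of a covering pair the one with the smallest index
  is kept. Keeping another one gives the same network up to isomorphism.\<close>

definition zigzag_network :: "nat \<Rightarrow> (nat \<times> nat) list \<Rightarrow> network" where
  "zigzag_network n Is = (let G = star_concat n Is in
     G\<lparr>arcs := {a \<in> arcs G. \<not> (\<exists>j k i i'. covers Is j k \<and> a = (Center j, i, Center k) \<and>
                  (Center j, i', Center k) \<in> arcs G \<and> i' < i)}\<rparr>)"

definition expanded_sequence :: "(nat \<times> nat) list \<Rightarrow> (nat \<times> nat) list" where
  "expanded_sequence Is = concat (map (\<lambda>j. Is ! j #
     map (\<lambda>k. (max (fst (Is ! j)) (fst (Is ! k)), min (snd (Is ! j)) (snd (Is ! k))))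
       (filter (\<lambda>k. covers Is j k \<and> card (ivl (Is ! j) \<inter> ivl (Is ! k)) > 1) [0..<length Is]))
     [0..<length Is])"

definition reverse_ivl :: "nat \<times> nat \<Rightarrow> nat \<Rightarrow> nat" where
  "reverse_ivl I x = (if x \<in> ivl I then fst I + snd I - x else x)"

definition zigzag_perm :: "(nat \<times> nat) list \<Rightarrow> nat \<Rightarrow> nat" where
  "zigzag_perm Is i = fold reverse_ivl (expanded_sequence Is) i"

definition diagonal_path :: "network \<Rightarrow> nat \<Rightarrow> (net_vertex \<times> nat \<times> net_vertex) list" where
  "diagonal_path F i = (THE p. pre_digraph.apath F (Source i) p (Sink i))"

text \<open>The path from source \<open>i\<close> to sink \<open>i\<close> is represented by its index \<open>i\<close>, so that the ground set
  is \<^term>\<open>{1..n}\<close>.\<close>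

definition path_poset :: "nat \<Rightarrow> network \<Rightarrow> nat rel" where
  "path_poset n F = {(i, j). i \<in> {1..n} \<and> j \<in> {1..n} \<and> i < j \<and>
     set (pre_digraph.awalk_verts F (Source i) (diagonal_path F i)) \<inter>
     set (pre_digraph.awalk_verts F (Source j) (diagonal_path F j)) = {}}"

end

theory Submission
  imports Defs
begin

text \<open>Let the Hecke algebra act on words by signed permutation of tensor factors. The trace on the
 words of content \<open>\<nu>\<close> is the induced sign character: these words form a cyclic module, and a
 seminormal representation occurs in it as often as it contains vectors that are sign-isotypic for
 the Young subgroup, which is a Kostka number. As Kostka numbers are unitriangular, the seminormal
 characters have Laurent polynomial values; at \<open>q = 1\<close> they are the characters of the Specht modules.
 On the other hand, the Kazhdan-Lusztig element of a zig-zag permutation is up to scalars a product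
 of stars. Hence its diagonal coefficient at a word \<open>\<kappa>\<close> is \<open>q\<close> to the power \<open>asc \<kappa>\<close> if \<open>\<kappa>\<close> is
 injective on each interval, and \<open>0\<close> otherwise. The altitude condition forces the poset to be the
 path poset, so the words that contribute are its proper colorings.\<close>

text \<open>The characters on the right are given by definite descriptions:
  \<open>hecke_char\<close> is the irreducible character over the fraction field whose values
  specialize to \<open>sym_char\<close>, which in turn is described by induced characters. So the
  irreducible characters have to be classified for generic \<open>q\<close> and at
  \<open>q = 1\<close>, and the two lists compared. One locale, \<open>snorm\<close>, serves both
  cases: quantum integers enter only through an addition rule in which nothing is divided by
  \<open>q - 1\<close>. Completeness comes from counting: the Jucys-Murphy elements separate the
  standard fillings and so yield matrix units, and there are \<open>fact n\<close> of these, as many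
  as basis elements \<open>Tw n w\<close>. For the comparison, one integral recursion computes the
  characters in both specializations. On the other side, words with distinct letters form the
  regular representation; its faithfulness turns congruences modulo the Hecke ideal into equations
  between coefficients. Multiplying by a star creates the Poincare polynomial of an overlap; it is
  nonzero and is cancelled each time.\<close>

abbreviation (input) eqv :: "bool => bool => bool" (infixr "<->" 25) where "P <-> Q == P = Q"
type_synonym cell = "nat \<times> nat"
type_synonym falg = "gen_word \<Rightarrow>\<^sub>0 laurent"
abbreviation (input) "qh == q_half"
abbreviation (input) "qv == q_var"
abbreviation (input) "tf == to_fract"
abbreviation (input) "YD == young_diagram"
abbreviation (input) "ble == bruhat_le"
abbreviation (input) "zzp == zigzag_perm"
abbreviation (input) "rvi == reverse_ivl"
abbreviation (input) "zzseq == zigzag_sequence"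
abbreviation (input) "exseq == expanded_sequence"
abbreviation (input) "stc == star_concat"
abbreviation (input) "hid == hecke_ideal"
abbreviation (input) "sgl == Poly_Mapping.single"
abbreviation (input) "swp == prod.swap"
abbreviation (input) "keys == Poly_Mapping.keys"
abbreviation (input) "lookup == Poly_Mapping.lookup"
abbreviation (input) "trp == Transposition.transpose"
abbreviation (input) "plen == perm_length"
abbreviation (input) "rword == reduced_word"

section \<open>Lengths and reduced words\<close>

abbreviation (input) "sw == simple_transposition"

abbreviation pinv :: "(nat => nat) => nat => nat" where
 "pinv == inv_into UNIV"

definition Sym :: "nat => (nat => nat) set" where
 "Sym n = {w. w permutes {1..n}}"

lemma fin_Sym [simp]: "finite (Sym n)"
 by (simp add:Sym_def finite_permutations)

lemma card_Sym: "card (Sym n) = fact n"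
 by (simp add:Sym_def card_permutations)

lemma permsD: "w:Sym n ==> w permutes {1..n}"
 by (simp add:Sym_def)

lemma id_Sym [simp]: "id:Sym n"
 by (simp add:Sym_def)

lemma sw_permutes: "i:{1..<n} ==> sw i permutes {1..n}"
 by (rule permutes_swap_id) simp_all

lemma sw_Sym [simp]: "i:{1..<n} ==> sw i:Sym n"
 unfolding Sym_def by (blast intro:sw_permutes)

lemma comp_Sym: "u:Sym n ==> w:Sym n ==> u o w:Sym n"
 by (auto simp:Sym_def intro:permutes_compose)

lemma pinv_Sym: "w:Sym n ==> pinv w:Sym n"
 by (auto simp:Sym_def intro:permutes_inv)

lemma Sym_inj: "w:Sym n ==> inj w"
 by (auto simp:Sym_def dest:permutes_inj)

lemma pinv_app [simp]:
 assumes "w:Sym n" shows "pinv w (w k) = k" "w (pinv w k) = k"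
 using permutes_inverses[OF permsD[OF assms]] by auto

lemma pinv_comp [simp]:
 assumes "w:Sym n" shows "pinv w o w = id" "w o pinv w = id"
 using assms by (auto)

lemma pinv_comp_dis:
 "u:Sym n ==> w:Sym n ==> pinv (u o w) = pinv w o pinv u"
 by (rule inv_unique_comp) (simp_all add:fun_eq_iff)

lemma pinv_sw [simp]: "pinv (sw i) = sw i"
 by (rule inv_unique_comp) simp_all

lemma pinv_sw_comp: "w:Sym n ==> pinv (sw i o w) = pinv w o sw i"
 by (rule inv_unique_comp) (simp_all add:fun_eq_iff)

lemma sw_sw_comp [simp]: "sw i o (sw i o w) = w"
 by (simp add:fun_eq_iff)

lemma Sym_mem: "w:Sym n ==> w k:{1..n} <-> k:{1..n}"
 using permutes_in_image[of w "{1..n}"] by (simp add:Sym_def)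

lemma Sym_out: "w:Sym n ==> k ~: {1..n} ==> w k = k"
 unfolding Sym_def mem_Collect_eq by (rule permutes_not_in)

definition invs :: "nat => (nat => nat) => cell set" where
 "invs n w = {(i, j). 1 <= i & i < j & j <= n & w j < w i}"

lemma fin_invs [simp]: "finite (invs n w)"
 by (rule finite_subset[of _ "{1..n} \<times> {1..n}"]) (auto simp:invs_def)

lemma plen_invs: "plen n w = card (invs n w)"
 by (simp add:perm_length_def invs_def)

lemma plen_id [simp]: "plen n id = 0"
proof -
 have "invs n id = {}" by (auto simp:invs_def)
 thus ?thesis by (simp add:plen_invs)
qed

text \<open>Exchanging the values \<open>i\<close> and \<open>Suc i\<close> changes a comparison
  only at the two positions that hold them, so exactly one inversion is created.\<close>

lemma plen_sw:
 assumes w: "w:Sym n" and i: "i:{1..<n}" and lt: "pinv w i < pinv w (Suc i)"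
 shows "plen n (sw i o w) = Suc (plen n w)"
proof -
 define p q where "p = pinv w i" and "q = pinv w (Suc i)"
 have wp: "w p = i" "w q = Suc i" using w by (simp_all add:p_def q_def)
 have pq: "p:{1..n}" "q:{1..n}" "p < q"
  using Sym_mem[OF w, of p] Sym_mem[OF w, of q] i lt wp by (auto simp:p_def q_def)
 have inj: "w j = w k <-> j = k" for j k using Sym_inj[OF w] by (auto dest:injD)
 have ip: "w j = i <-> j = p" "w j = Suc i <-> j = q" for j using wp inj by metis+
 have "invs n (sw i o w) = insert (p, q) (invs n w)"
 proof (rule Set.set_eqI)
  fix jk :: "cell"
  obtain j k where jk: "jk = (j, k)" by fastforce
  have aux: "(sw i (w k) < sw i (w j)) <-> (w k < w j & (j,k) ~= (q,p)) \<or> (j,k) = (p,q)"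
  if "j ~= k"
  proof -
  have "w j ~= w k" using inj that by simp
  thus ?thesis
  using ip[of j] ip[of k] pq(3) by (auto simp:transpose_def)
  qed
  show "(jk:invs n (sw i o w)) = (jk:insert (p, q) (invs n w))"
  using aux pq by (auto simp:invs_def jk)
 qed
 moreover have "(p, q) ~: invs n w" using wp by (simp add:invs_def)
 ultimately show ?thesis by (simp add:plen_invs)
qed

lemma plen_sw':
 assumes w: "w:Sym n" and i: "i:{1..<n}" and gt: "pinv w (Suc i) < pinv w i"
 shows "plen n w = Suc (plen n (sw i o w))"
proof -
 have "pinv (sw i o w) i < pinv (sw i o w) (Suc i)"
  using gt by (simp add:pinv_sw_comp[OF w])
 from plen_sw[OF comp_Sym[OF sw_Sym[OF i] w] i this] show ?thesis by simp
qed

lemma pinv_sw_cases: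
 assumes w: "w:Sym n"
 shows "pinv w i < pinv w (Suc i) \<or> pinv w (Suc i) < pinv w i"
 using Sym_inj[OF pinv_Sym[OF w]] by (metis injD n_not_Suc_n nat_neq_iff)

lemma plen_trp:
 assumes w: "w:Sym n" and ab: "1 <= a" "a < b" "b <= n" and lt: "w a < w b"
 shows "plen n w < plen n (w o trp a b)"
proof -
 define t where "t = trp a b"
 \<comment> \<open>An inversion moves along the transposition where this keeps its positions
   increasing and stays put otherwise; \<open>(a, b)\<close> is an inversion of the product outside
   the image.\<close>
 define g where "g = (%(i, j). if t i < t j then (t i, t j) else (i, j))"
 have inj: "w j = w k <-> j = k" for j k using Sym_inj[OF w] by (auto dest:injD)
 have tt: "t (t k) = k" for k by (simp add:t_def)
 have "inj_on g (invs n w)"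
 proof (rule inj_onI)
  fix x y assume "x:invs n w" "y:invs n w" "g x = g y"
  moreover have "t j = t k <-> j = k" for j k by (metis tt)
  moreover have "t j = k <-> j = t k" for j k by (metis tt)
  ultimately show "x = y"
  by (cases x; cases y) (auto simp:g_def invs_def tt split: if_splits)
 qed
 moreover have "g ` invs n w \<subseteq> invs n (w o t) - {(a, b)}"
 proof (rule image_subsetI)
  fix x assume "x:invs n w"
  then obtain i j where x: "x = (i, j)" and ij: "(i, j):invs n w" by (cases x) auto
  hence o: "1 <= i" "i < j" "j <= n" "w j < w i" by (auto simp:invs_def)
  have rng: "1 <= t k & t k <= n" if "1 <= k" "k <= n" for k
  using that ab by (auto simp:t_def transpose_def)
  show "g x:invs n (w o t) - {(a, b)}"
  proof (cases "t i < t j")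
  case True
  hence "(t i, t j) ~= (a, b)" using o by (auto simp:t_def transpose_eq_iff)
  thus ?thesis using True o rng[of i] rng[of j] by (auto simp:x g_def invs_def tt)
  next
  case False
  have ne: "(i, j) ~= (a, b)" using o lt by auto
  hence "i = a & j < b \<or> j = b & a < i"
  using False o ab by (auto simp:t_def transpose_def split: if_splits)
  hence "w (t j) < w (t i)"
  proof
  assume "i = a & j < b"
  hence "t i = b" "t j = j" "w j < w a" using o by (auto simp:t_def)
  thus ?thesis using lt by simp
  next
  assume "j = b & a < i"
  hence "t j = a" "t i = i" "w b < w i" using o by (auto simp:t_def)
  thus ?thesis using lt by simp
  qed
  thus ?thesis using False o ne by (simp add:x g_def invs_def)
  qed
 qed
 ultimately have "card (invs n w) <= card (invs n (w o t) - {(a, b)})"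
  by (intro card_inj_on_le) auto
 also have "... < card (invs n (w o t))"
  by (intro card_Diff1_less) (use ab lt in "simp_all add:t_def", simp add:invs_def)
 finally show ?thesis by (simp add:plen_invs t_def)
qed

lemma incr_perm_id:
 assumes w: "w:Sym n" and inc: "!!i. i:{1..<n} ==> w i < w (Suc i)"
 shows "w = id"
proof -
 have le: "k <= w k" if "k:{1..n}" for k
  using that
 proof (induction k)
  case (Suc k)
  show ?case
  proof (cases "k = 0")
  case True thus ?thesis using Sym_mem[OF w, of 1] Suc by auto
  next
  case False thus ?thesis using Suc inc[of k] by auto
  qed
 qed auto
 have "n - k <= n - w k" if "k:{1..n}" for k
 proof -
  have "w (n - j) <= n - j" if "j < n" for j
  using that
  proof (induction j)
  case 0 thus ?case using Sym_mem[OF w, of n] by auto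
  next
  case (Suc j)
  hence "Suc (n - Suc j) = n - j" by simp
  hence "w (n - Suc j) < w (n - j)" using inc[of "n - Suc j"] Suc by auto
  thus ?case using Suc by auto
  qed
  from this[of "n - k"] that show ?thesis by auto
 qed
 thus ?thesis
  using le Sym_out[OF w] Sym_mem[OF w]
  by (intro ext) (metis atLeastAtMost_iff diff_le_mono2 diff_diff_cancel id_apply le_antisym)
qed

definition "wperm ts = foldr (%i u. sw i o u) ts id"

lemma wperm_Nil [simp]: "wperm [] = id"
 and word_perm_Cons [simp]: "wperm (i # ts) = sw i o wperm ts"
 by (simp_all add:wperm_def)

lemma wperm_append [simp]: "wperm (ts @ us) = wperm ts o wperm us"
 by (induction ts) (auto)

lemma rword_iff:
 "rword n w ts <-> set ts \<subseteq> {1..<n} & length ts = plen n w & w = wperm ts"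
 by (simp add:reduced_word_def wperm_def)

lemma wperm_Sym: "set ts \<subseteq> {1..<n} ==> wperm ts:Sym n"
 by (induction ts) (auto intro:comp_Sym)

lemma plen_sw_le:
 assumes "w:Sym n" "i:{1..<n}"
 shows "plen n (sw i o w) <= Suc (plen n w)"
 using pinv_sw_cases[OF assms(1), of i] plen_sw[OF assms] plen_sw'[OF assms] by auto

lemma plen_wd: "set ts \<subseteq> {1..<n} ==> plen n (wperm ts) <= length ts"
proof (induction ts)
 case (Cons i ts)
 thus ?case
  using plen_sw_le[OF wperm_Sym, of ts n i] by (simp del:comp_apply)
qed simp

text \<open>The first letter must be a left descent, because \<open>wperm ts\<close> has at most
  \<open>length ts\<close> inversions. This recursion drives the inductions along reduced
  words.\<close>

lemma rword_Cons:
 assumes w: "w:Sym n"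
 shows "rword n w (i # ts) <->
  i:{1..<n} & pinv w (Suc i) < pinv w i & rword n (sw i o w) ts"
proof
 assume L: "rword n w (i # ts)"
 hence i: "i:{1..<n}" and ts: "set ts \<subseteq> {1..<n}" and len: "Suc (length ts) = plen n w"
  and weq: "w = sw i o wperm ts" by (auto simp:rword_iff)
 have "sw i o w = wperm ts" by (simp add:weq)
 moreover have "~ pinv w i < pinv w (Suc i)"
  using plen_sw[OF w i] plen_wd[OF ts] len calculation by auto
 ultimately show "i:{1..<n} & pinv w (Suc i) < pinv w i & rword n (sw i o w) ts"
  using i ts len pinv_sw_cases[OF w, of i] plen_sw'[OF w i] by (auto simp:rword_iff)
next
 assume R: "i:{1..<n} & pinv w (Suc i) < pinv w i & rword n (sw i o w) ts"
 hence "sw i o w = wperm ts" by (simp add:rword_iff)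
 hence "w = sw i o wperm ts" by (metis sw_sw_comp)
 thus "rword n w (i # ts)"
  using R plen_sw'[OF w, of i] by (auto simp:rword_iff)
qed

lemma rword_Nil: "rword n w [] <-> w = id"
 by (auto simp:rword_iff)

lemma rword_ex:
 assumes "w:Sym n" shows "EX ts. rword n w ts"
 using assms
proof (induction "plen n w" arbitrary: w rule:less_induct)
 case less
 show ?case
 proof (cases "EX i:{1..<n}. pinv w (Suc i) < pinv w i")
  case True
  then obtain i where i: "i:{1..<n}" "pinv w (Suc i) < pinv w i" by blast
  have "plen n (sw i o w) < plen n w" using plen_sw'[OF less.prems i] by simp
  then obtain ts where "rword n (sw i o w) ts"
  using less.hyps comp_Sym[OF sw_Sym[OF i(1)] less.prems] by blast
  thus ?thesis using rword_Cons[OF less.prems] i by blast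
 next
  case False
  hence "pinv w = id"
  by (intro incr_perm_id[OF pinv_Sym[OF less.prems]]) (use pinv_sw_cases[OF less.prems] in blast)
  hence "w = id" using pinv_comp(2)[OF less.prems] by simp
  thus ?thesis using rword_Nil by blast
 qed
qed

lemma plen_0: "w:Sym n ==> plen n w = 0 ==> w = id"
 using rword_ex[of w n] by (auto simp:rword_iff)

section \<open>The Hecke algebra\<close>

abbreviation "fa n == carrier (free_alg n)"

lemma wt_mult: "wterm a us * wterm b vs = wterm (a * b) (us @ vs)"
 by (simp add:mult_single plus_gen_word_def)

lemma one_eq_wt: "(1 :: falg) = wterm 1 []"
 by (simp flip:single_one add:zero_gen_word_def)

lemma wt_add: "wterm (a + b) us = wterm a us + wterm b us"
 by (rule single_add)

lemma wt_fa [simp]: "set us \<subseteq> {1..<n} ==> wterm c us:fa n"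
 by (simp add:free_alg_def)

lemma one_fa [simp]: "1:fa n"
 by (simp add:one_eq_wt)

lemma zero_fa [simp]: "0:fa n"
 by (simp add:free_alg_def)

lemma add_fa [simp]: "p:fa n ==> r:fa n ==> p + r:fa n"
 using keys_add[of p r] by (auto simp:free_alg_def)

lemma um_fa [simp]: "p:fa n ==> - p:fa n"
 by (simp add:free_alg_def)

lemma diff_fa [simp]: "p:fa n ==> r:fa n ==> p - r:fa n"
 using add_fa[of p n "- r"] by simp

lemma mult_fa [simp]: "p:fa n ==> r:fa n ==> p * r:fa n"
 using keys_mult[of p r] by (fastforce simp:free_alg_def plus_gen_word_def)

lemma sum_fa [simp]: "(!!x. x:A ==> f x:fa n) ==> sum f A:fa n"
 by (induction A rule:infinite_finite_induct) auto

lemma free_alg_simps [simp]: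
 "p \<otimes>\<^bsub>free_alg n\<^esub> r = p * r" "\<one>\<^bsub>free_alg n\<^esub> = 1" "\<zero>\<^bsub>free_alg n\<^esub> = 0"
 "p \<oplus>\<^bsub>free_alg n\<^esub> r = p + r"
 by (simp_all add:free_alg_def)

lemma ring_free_alg: "ring (free_alg n)"
proof (rule ringI)
 show "abelian_group (free_alg n)"
 proof (rule abelian_groupI)
  fix p assume "p:fa n"
  thus "EX r:fa n. r \<oplus>\<^bsub>free_alg n\<^esub> p = \<zero>\<^bsub>free_alg n\<^esub>" by (intro bexI[of _ "- p"]) auto
 qed (auto simp:algebra_simps)
 show "Group.monoid (free_alg n)"
  by (rule monoidI) (auto simp:algebra_simps)
qed (auto simp:algebra_simps)

lemma hk_rel_fa: "hecke_relations n \<subseteq> fa n"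
 by (auto simp:hecke_relations_def)

lemma idl_hk: "ideal (hid n) (free_alg n)"
 unfolding hecke_ideal_def by (rule ring.genideal_ideal[OF ring_free_alg hk_rel_fa])

lemma hk_idl_zero [simp]: "0:hid n"
 using additive_subgroup.zero_closed[OF ideal.axioms(1)[OF idl_hk], of n] by simp

lemma hk_idl_add: "p:hid n ==> r:hid n ==> p + r:hid n"
 using additive_subgroup.a_closed[OF ideal.axioms(1)[OF idl_hk], of p n r] by simp

lemma hk_idl_mult:
 assumes "p:hid n" "r:fa n"
 shows "r * p:hid n" "p * r:hid n"
 using ideal.I_l_closed[OF idl_hk assms] ideal.I_r_closed[OF idl_hk assms] by simp_all

lemma hk_idl_um: "p:hid n ==> - p:hid n"
 using hk_idl_mult(1)[of p n "- 1"] by simp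

lemma hk_idl_minimal:
 assumes "ideal J (free_alg n)" "hecke_relations n \<subseteq> J" shows "hid n \<subseteq> J"
 unfolding hecke_ideal_def by (rule ring.genideal_minimal[OF ring_free_alg assms])

lemma hk_rel_idl: "p:hecke_relations n ==> p:hid n"
 unfolding hecke_ideal_def using ring.genideal_self[OF ring_free_alg hk_rel_fa] by blast

text \<open>Congruence modulo the Hecke ideal. Computations stay with representatives in the free
  algebra, where they chain by transitivity; cosets enter only through \<open>cls\<close>.\<close>

definition "heq n p r <-> p - r:hid n"

lemma heq_refl [simp]: "heq n p p"
 by (simp add:heq_def)

lemma heq_sym: "heq n p r ==> heq n r p"
 using hk_idl_um[of "p - r"] by (simp add:heq_def)

lemma heq_trs [trans]: "heq n p r ==> heq n r s ==> heq n p s"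
 using hk_idl_add[of "p - r" n "r - s"] by (simp add:heq_def)

lemma heq_eq_trs [trans]: "heq n p r ==> r = s ==> heq n p s" "p = r ==> heq n r s ==> heq n p s"
 by auto

lemma heq_add: "heq n p r ==> heq n p' r' ==> heq n (p + p') (r + r')"
 using hk_idl_add[of "p - r" n "p' - r'"] by (simp add:heq_def algebra_simps)

lemma heq_diff: "heq n p r ==> heq n p' r' ==> heq n (p - p') (r - r')"
 using heq_add[of n p r "- p'" "- r'"] hk_idl_um[of "p' - r'"] by (simp add:heq_def)

lemma heq_sum: "(!!x. x:A ==> heq n (f x) (g x)) ==> heq n (sum f A) (sum g A)"
 by (induction A rule:infinite_finite_induct) (auto intro:heq_add)

lemma heq_mult_l: "heq n p r ==> s:fa n ==> heq n (s * p) (s * r)"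
 using hk_idl_mult(1)[of "p - r" n s] by (simp add:heq_def algebra_simps)

lemma heq_mult_r: "heq n p r ==> s:fa n ==> heq n (p * s) (r * s)"
 using hk_idl_mult(2)[of "p - r" n s] by (simp add:heq_def algebra_simps)

lemma heq_mult:
 "heq n p r ==> heq n p' r' ==> p':fa n ==> r:fa n ==> heq n (p * p') (r * r')"
 using heq_mult_l heq_mult_r heq_trs by blast

abbreviation "scal c p == wterm c [] * p"

lemma scal_scal: "scal a (scal b p) = scal (a * b) p"
 by (simp add:wt_mult flip:mult.assoc)

lemma scal_comm: "p * wterm c [] = scal c p"
proof (induction p rule:update_induct)
 case (update p a b)
 hence "Poly_Mapping.update a b p = p + sgl a b"
  by (intro poly_mapping_eqI) (auto simp:lookup_update lookup_add lookup_single in_keys_iff when_def)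
 thus ?case using update.IH
  by (cases a) (simp add:algebra_simps mult_single plus_gen_word_def)
qed auto

lemma scal_mult_r: "p * scal c r = scal c (p * r)"
 by (metis scal_comm mult.assoc)

lemma scal_1 [simp]: "scal 1 p = p"
 by (simp flip:one_eq_wt)

lemma scal_fa [simp]: "p:fa n ==> scal c p:fa n"
 by simp

lemma heq_scal: "heq n p r ==> heq n (scal c p) (scal c r)"
 by (rule heq_mult_l) auto

abbreviation "gen i == wterm 1 [i]"

lemma heq_quad: "i:{1..<n} ==> heq n (gen i * gen i) (scal (qv - 1) (gen i) + scal qv 1)"
 unfolding heq_def by (rule hk_rel_idl) (auto simp:hecke_relations_def wt_mult)

lemma heq_braid:
 "i:{1..<n} ==> j:{1..<n} ==> \<bar>int i - int j\<bar> = 1 ==>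
  heq n (gen i * gen j * gen i) (gen j * gen i * gen j)"
 unfolding heq_def by (rule hk_rel_idl) (auto simp:hecke_relations_def wt_mult)

lemma heq_comm:
 "i:{1..<n} ==> j:{1..<n} ==> \<bar>int i - int j\<bar> >= 2 ==>
  heq n (gen i * gen j) (gen j * gen i)"
 unfolding heq_def by (rule hk_rel_idl) (auto simp:hecke_relations_def wt_mult)

lemma wt_Cons: "wterm 1 (i # us) = gen i * wterm 1 us"
 by (simp add:wt_mult)

lemma sw_comm: "2 <= \<bar>int i - int j\<bar> ==> sw i o sw j = sw j o sw i"
 by (auto simp:fun_eq_iff transpose_def)

lemma sw_braid: assumes "\<bar>int i - int j\<bar> = 1" shows "sw i o sw j o sw i = sw j o sw i o sw j"
proof -
 note assms
 hence "j = Suc i \<or> i = Suc j" by linarith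
 thus ?thesis by (auto simp:fun_eq_iff transpose_def)
qed

text \<open>Matsumoto's theorem: if the words start with different letters \<open>i\<close> and \<open>j\<close>, the
 permutation also has a reduced word starting with the two sides of the braid relation.\<close>

lemma matsumoto:
 assumes "w:Sym n" "rword n w us" "rword n w vs"
 shows "heq n (wterm 1 us) (wterm 1 vs)"
 using assms
proof (induction "length us" arbitrary: w us vs rule:less_induct)
 case less
 show ?case
 proof (cases us)
  case Nil
  thus ?thesis using less.prems by (auto simp:rword_iff)
 next
  case (Cons i us')
  then obtain j vs' where vs: "vs = j # vs'"
  using less.prems by (cases vs) (auto simp:rword_iff)
  have w: "w:Sym n" by fact
  have i: "i:{1..<n}" "pinv w (Suc i) < pinv w i" "rword n (sw i o w) us'"
  using less.prems(2) rword_Cons[OF w] Cons by auto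
  have j: "j:{1..<n}" "pinv w (Suc j) < pinv w j" "rword n (sw j o w) vs'"
  using less.prems(3) rword_Cons[OF w] vs by auto
  have wi: "sw i o w:Sym n" and wj: "sw j o w:Sym n"
  using w i j comp_Sym by auto
  have len: "length us' < length us" "length vs' < length us"
  using Cons vs less.prems(2,3) by (auto simp:rword_iff)
  have IHi: "heq n (gen i * wterm 1 us') (gen i * wterm 1 us'')" if "rword n (sw i o w) us''" for us''
  using less.hyps[OF len(1) wi i(3) that] i(1) by (intro heq_mult_l) auto
  have IHj: "heq n (gen j * wterm 1 us'') (gen j * wterm 1 vs')" if "rword n (sw j o w) us''" for us''
  proof -
  have "length us'' = length vs'" using that j(3) by (simp add:rword_iff)
  thus ?thesis
  using less.hyps[of us'', OF _ wj that j(3)] len j(1) by (intro heq_mult_l) auto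
  qed
  have wterm: "wterm 1 us = gen i * wterm 1 us'" "wterm 1 vs = gen j * wterm 1 vs'"
  by (simp_all add:Cons vs wt_mult)
  consider "i = j" | "2 <= \<bar>int i - int j\<bar>" | "\<bar>int i - int j\<bar> = 1" by linarith
  thus ?thesis
  proof cases
  case 1
  thus ?thesis using IHi[of vs'] j wterm by auto
  next
  case 2
  have fx: "sw i j = j" "sw i (Suc j) = Suc j" "sw j i = i" "sw j (Suc i) = Suc i"
  using 2 by (auto)
  define u where "u = sw j o (sw i o w)"
  have u: "u:Sym n" "u = sw i o (sw j o w)"
  using sw_comm[OF 2] comp_Sym[OF sw_Sym[OF j(1)] wi] unfolding u_def by (simp_all only:comp_assoc[symmetric])
  obtain x where x: "rword n u x" using rword_ex[OF u(1)] by blast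
  have "rword n (sw i o w) (j # x)"
  using x[unfolded u_def] i j fx by (simp add:rword_Cons[OF wi] pinv_sw_comp[OF w])
  moreover have "rword n (sw j o w) (i # x)"
  using x[unfolded u(2)] i j fx by (simp add:rword_Cons[OF wj] pinv_sw_comp[OF w])
  moreover have "set x \<subseteq> {1..<n}" using x by (simp add:rword_iff)
  hence "heq n (gen i * wterm 1 (j # x)) (gen j * wterm 1 (i # x))"
  using heq_mult_r[OF heq_comm[OF i(1) j(1) 2], of "wterm 1 x"]
  by (simp only:wt_Cons[of _ x] mult.assoc wt_fa)
  ultimately show ?thesis
  unfolding wterm using heq_trs[OF IHi heq_trs[OF _ IHj]] by blast
  next
  case 3
  define u where "u = sw i o (sw j o (sw i o w))"
  have wij: "sw j o (sw i o w):Sym n" "sw i o (sw j o w):Sym n"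
  using comp_Sym[OF sw_Sym[OF j(1)] wi] comp_Sym[OF sw_Sym[OF i(1)] wj] .
  have u: "u:Sym n" "u = sw j o (sw i o (sw j o w))"
  using sw_braid[OF 3] comp_Sym[OF sw_Sym[OF i(1)] wij(1)] unfolding u_def by (simp_all only:comp_assoc[symmetric])
  obtain x where x: "rword n u x" using rword_ex[OF u(1)] by blast
  have eqs: "sw (Suc k) k = k" "sw k (Suc (Suc k)) = Suc (Suc k)" for k
  by (simp_all)
  have ji: "j = Suc i \<or> i = Suc j" using 3 by linarith
  have "rword n (sw i o w) (j # i # x)"
  using x[unfolded u_def] i j ji eqs
  by (auto simp:rword_Cons[OF wi] rword_Cons[OF wij(1)] pinv_sw_comp[OF w] pinv_sw_comp[OF wi])
  moreover have "rword n (sw j o w) (i # j # x)"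
  using x[unfolded u(2)] i j ji eqs
  by (auto simp:rword_Cons[OF wj] rword_Cons[OF wij(2)] pinv_sw_comp[OF w] pinv_sw_comp[OF wj])
  moreover have "set x \<subseteq> {1..<n}" using x by (simp add:rword_iff)
  hence "heq n (gen i * wterm 1 (j # i # x)) (gen j * wterm 1 (i # j # x))"
  using heq_mult_r[OF heq_braid[OF i(1) j(1) 3], of "wterm 1 x"]
  by (simp only:wt_Cons[of _ "_ # x"] wt_Cons[of _ x] mult.assoc wt_fa)
  ultimately show ?thesis
  unfolding wterm using heq_trs[OF IHi heq_trs[OF _ IHj]] by blast
  qed
 qed
qed

definition "red n w = (SOME us. rword n w us)"

abbreviation "Tw n w == wterm 1 (red n w)"

lemma rword_red: "w:Sym n ==> rword n w (red n w)"
 unfolding red_def using rword_ex by (rule someI_ex)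

lemma set_red: "w:Sym n ==> set (red n w) \<subseteq> {1..<n}"
 using rword_red by (auto simp:rword_iff)

lemma wperm_red: "w:Sym n ==> wperm (red n w) = w"
 using rword_red by (auto simp:rword_iff)

lemma len_red: "w:Sym n ==> length (red n w) = plen n w"
 using rword_red by (auto simp:rword_iff)

lemma Tw_fa [simp]: "w:Sym n ==> Tw n w:fa n"
 using set_red by simp

lemma Tw_rword:
 "w:Sym n ==> rword n w us ==> heq n (wterm 1 us) (Tw n w)"
 using matsumoto rword_red by blast

lemma Tw_up:
 assumes "w:Sym n" "i:{1..<n}" "pinv w i < pinv w (Suc i)"
 shows "heq n (gen i * Tw n w) (Tw n (sw i o w))"
proof -
 have p: "sw i o w:Sym n" using assms comp_Sym by auto
 have "rword n (sw i o w) (i # red n w)"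
  using assms rword_red[OF assms(1)] by (simp add:rword_Cons[OF p] pinv_sw_comp)
 from Tw_rword[OF p this] show ?thesis by (simp add:wt_Cons[of i "red n w"])
qed

lemma Tw_down:
 assumes "w:Sym n" "i:{1..<n}" "pinv w (Suc i) < pinv w i"
 shows "heq n (gen i * Tw n w) (scal (qv - 1) (Tw n w) + scal qv (Tw n (sw i o w)))"
proof -
 have p: "sw i o w:Sym n" using assms comp_Sym by auto
 have up: "heq n (gen i * Tw n (sw i o w)) (Tw n w)"
  using Tw_up[OF p assms(2)] assms by (simp add:pinv_sw_comp)
 have "heq n (gen i * Tw n w) (gen i * (gen i * Tw n (sw i o w)))"
  using heq_mult_l[OF heq_sym[OF up]] assms(2) by simp
 also have "... = gen i * gen i * Tw n (sw i o w)" by (simp only:mult.assoc)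
 also have "heq n ... ((scal (qv - 1) (gen i) + scal qv 1) * Tw n (sw i o w))"
  by (rule heq_mult_r[OF heq_quad[OF assms(2)]]) (use p in simp)
 also have "... = scal (qv - 1) (gen i * Tw n (sw i o w)) + scal qv (Tw n (sw i o w))"
  by (simp only:distrib_right mult.assoc mult_1_left)
 also have "heq n ... (scal (qv - 1) (Tw n w) + scal qv (Tw n (sw i o w)))"
  by (intro heq_add heq_scal up heq_refl)
 finally show ?thesis .
qed

section \<open>Spanning by the elements \<open>Tw n w\<close>\<close>

definition "Tspan n = {p. EX c. heq n p (SUM w:Sym n. scal (c w) (Tw n w))}"

lemma Tspan_heq: "r:Tspan n ==> heq n p r ==> p:Tspan n"
 unfolding Tspan_def using heq_trs by blast

lemma Tspan_Tw: assumes w: "w:Sym n" shows "Tw n w:Tspan n"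
proof -
 have "(SUM u:Sym n. scal (if u = w then 1 else 0) (Tw n u)) = (SUM u:Sym n. if u = w then Tw n u else 0)"
  by (rule sum.cong) auto
 hence "heq n (Tw n w) (SUM u:Sym n. scal (if u = w then 1 else 0) (Tw n u))"
  using w by (simp only:sum.delta fin_Sym if_True heq_refl)
 thus ?thesis unfolding Tspan_def mem_Collect_eq by (rule exI[of _ "%u. if u = w then 1 else 0"])
qed

lemma Tspan_add: assumes "p:Tspan n" "r:Tspan n" shows "p + r:Tspan n"
proof -
 note assms
 then obtain c d where "heq n p (SUM w:Sym n. scal (c w) (Tw n w))" "heq n r (SUM w:Sym n. scal (d w) (Tw n w))"
  by (auto simp:Tspan_def)
 from heq_add[OF this] have "heq n (p + r) (SUM w:Sym n. scal (c w + d w) (Tw n w))"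
  by (simp only:sum.distrib[symmetric] wt_add distrib_right)
 thus ?thesis unfolding Tspan_def mem_Collect_eq by (rule exI[of _ "%w. c w + d w"])
qed

lemma Tspan_scal: assumes "p:Tspan n" shows "scal a p:Tspan n"
proof -
 note assms
 then obtain c where "heq n p (SUM w:Sym n. scal (c w) (Tw n w))"
  by (auto simp:Tspan_def)
 from heq_scal[OF this, of a] have "heq n (scal a p) (SUM w:Sym n. scal (a * c w) (Tw n w))"
  by (simp only:sum_distrib_left scal_scal)
 thus ?thesis unfolding Tspan_def mem_Collect_eq by (rule exI[of _ "%w. a * c w"])
qed

lemma Tspan_zero: "0:Tspan n"
 using Tspan_scal[OF Tspan_Tw[OF id_Sym], of 0] by simp

lemma Tspan_sum: "(!!x. x:A ==> f x:Tspan n) ==> sum f A:Tspan n"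
 by (induction A rule:infinite_finite_induct) (auto intro:Tspan_add Tspan_zero)

lemma Tspan_gen_Tw: assumes w: "w:Sym n" and i: "i:{1..<n}" shows "gen i * Tw n w:Tspan n"
proof -
 have sww: "sw i o w:Sym n" using w i comp_Sym by simp
 from pinv_sw_cases[OF w] show ?thesis
 proof
  assume "pinv w i < pinv w (Suc i)"
  from Tspan_heq[OF Tspan_Tw[OF sww] Tw_up[OF w i this]] show ?thesis .
 next
  assume "pinv w (Suc i) < pinv w i"
  from Tspan_heq[OF Tspan_add[OF Tspan_scal[OF Tspan_Tw[OF w]] Tspan_scal[OF Tspan_Tw[OF sww]]] Tw_down[OF w i this]]
  show ?thesis .
 qed
qed

lemma Tspan_gen: assumes "p:Tspan n" and i: "i:{1..<n}" shows "gen i * p:Tspan n"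
proof -
 note assms
 then obtain c where "heq n p (SUM w:Sym n. scal (c w) (Tw n w))"
  by (auto simp:Tspan_def)
 from heq_mult_l[OF this, of "gen i"] i
 have "heq n (gen i * p) (SUM w:Sym n. scal (c w) (gen i * Tw n w))"
  by (simp add:sum_distrib_left scal_mult_r)
 thus ?thesis
  by (rule Tspan_heq[rotated]) (intro Tspan_sum Tspan_scal Tspan_gen_Tw i)
qed

lemma Tspan_wd: "set us \<subseteq> {1..<n} ==> wterm 1 us:Tspan n"
proof (induction us)
 case Nil
 have "red n id = []" using len_red[OF id_Sym, of n] by simp
 thus ?case using Tspan_Tw[OF id_Sym, of n] by simp
next
 case (Cons i us)
 thus ?case using Tspan_gen[of "wterm 1 us" n i] by (simp add:wt_Cons[of i us])
qed

lemma fa_expand: "p = (SUM u:keys p. scal (lookup p u) (wterm 1 (letters u)))"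
proof -
 have "p = (SUM u:keys p. sgl u (lookup p u))"
  by (rule poly_mapping_eqI) (simp add:lookup_sum lookup_single when_def in_keys_iff)
 thus ?thesis by (simp add:mult_single plus_gen_word_def)
qed

lemma fa_Tspan: "p:fa n ==> p:Tspan n"
 by (subst fa_expand) (intro Tspan_sum Tspan_scal Tspan_wd, auto simp:free_alg_def)

section \<open>Representations\<close>

definition lin_op :: "(('x => 'k::comm_ring_1) => 'x => 'k) => bool" where
 "lin_op A <-> (ALL f g. A (%x. f x + g x) = (%x. A f x + A g x)) &
  (ALL c f. A (%x. c * f x) = (%x. c * A f x))"

lemma lin_op_add: "lin_op A ==> A (%x. f x + g x) = (%x. A f x + A g x)"
 and lin_op_scale: "lin_op A ==> A (%x. c * f x) = (%x. c * A f x)"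
 by (auto simp:lin_op_def)

lemma lin_op_zero: "lin_op A ==> A (%x. 0) = (%x. 0)"
 using lin_op_scale[of A 0 "%x. 0"] by simp

lemma lin_op_minus: "lin_op A ==> A (%x. - f x) = (%x. - A f x)"
 using lin_op_scale[of A "- 1" f] by simp

lemma lin_op_sum: "lin_op A ==> A (%x. SUM y:Y. f y x) = (%x. SUM y:Y. A (f y) x)"
 by (induction Y rule:infinite_finite_induct) (simp_all add:lin_op_zero[of A] lin_op_add[of A])

lemma lin_op_comp: "lin_op A ==> lin_op B ==> lin_op (%f. A (B f))"
 by (auto simp:lin_op_def)

text \<open>Operators act on functions on a whole type. When the values on \<open>X\<close> depend
  only on values on \<open>X\<close>, the operator descends to the functions on \<open>X\<close>,
  and its trace there is \<open>tr X\<close>.\<close>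

definition loc_on :: "'x set => (('x => 'k) => 'x => 'k) => bool" where
 "loc_on X A <-> (ALL f g. (ALL x:X. f x = g x) --> (ALL x:X. A f x = A g x))"

lemma loc_onD: "loc_on X A ==> (!!x. x:X ==> f x = g x) ==> x:X ==> A f x = A g x"
 by (auto simp:loc_on_def)

lemma loc_on_comp: "loc_on X A ==> loc_on X B ==> loc_on X (%f. A (B f))"
 unfolding loc_on_def by blast

definition dl :: "'x => 'x => 'k::comm_ring_1" where
 "dl x y = (if y = x then 1 else 0)"

lemma dl_sum:
 "finite X ==> x:X ==> (SUM y:X. f y * dl y x) = f x"
 by (simp add:dl_def if_distrib[of "(*) _"] cong: if_cong)

lemma op_expand:
 assumes "lin_op A" "loc_on X A" "finite X" "x:X"
 shows "A f x = (SUM y:X. f y * A (dl y) x)"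
proof -
 have "A f x = A (%z. SUM y:X. f y * dl y z) x"
  by (rule loc_onD[OF assms(2) _ assms(4)]) (simp add:dl_sum[OF assms(3)])
 also have "... = (SUM y:X. A (%z. f y * dl y z) x)"
  by (simp add:lin_op_sum[OF assms(1)])
 finally show ?thesis by (simp add:lin_op_scale[OF assms(1)])
qed

definition tr :: "'x set => (('x => 'k::comm_ring_1) => 'x => 'k) => 'k" where
 "tr X A = (SUM x:X. A (dl x) x)"

lemma tr_cong: "(!!f x. x:X ==> A f x = B f x) ==> tr X A = tr X B"
 by (simp add:tr_def)

lemma tr_comm_gen:
 assumes "lin_op A" "lin_op B" "finite X" "finite Y"
  and "!!f g x. (!!y. y:Y ==> f y = g y) ==> x:X ==> A f x = A g x"
  and "!!f g y. (!!x. x:X ==> f x = g x) ==> y:Y ==> B f y = B g y"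
 shows "tr X (%f. A (B f)) = tr Y (%f. B (A f))"
proof -
 have A: "A f x = (SUM y:Y. f y * A (dl y) x)" if "x:X" for f x
 proof -
  have "A f x = A (%z. SUM y:Y. f y * dl y z) x"
  by (rule assms(5)[OF _ that]) (simp add:dl_sum[OF assms(4)])
  thus ?thesis by (simp add:lin_op_sum[OF assms(1)] lin_op_scale[OF assms(1)])
 qed
 have B: "B f y = (SUM x:X. f x * B (dl x) y)" if "y:Y" for f y
 proof -
  have "B f y = B (%z. SUM x:X. f x * dl x z) y"
  by (rule assms(6)[OF _ that]) (simp add:dl_sum[OF assms(3)])
  thus ?thesis by (simp add:lin_op_sum[OF assms(2)] lin_op_scale[OF assms(2)])
 qed
 have "tr X (%f. A (B f)) = (SUM x:X. SUM y:Y. B (dl x) y * A (dl y) x)"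
  unfolding tr_def by (rule sum.cong) (simp_all add:A[of _ "B _"])
 also have "... = (SUM y:Y. SUM x:X. A (dl y) x * B (dl x) y)"
  by (subst sum.swap) (simp add:mult.commute)
 also have "... = tr Y (%f. B (A f))"
  unfolding tr_def by (rule sum.cong) (simp_all add:B[of _ "A _"])
 finally show ?thesis .
qed

lemma tr_comm:
 assumes "lin_op A" "lin_op B" "loc_on X A" "loc_on X B" "finite X"
 shows "tr X (%f. A (B f)) = tr X (%f. B (A f))"
 by (rule tr_comm_gen) (use assms in "auto simp:loc_on_def")

lemma tr_scl: "tr X (%f x. c * A f x) = c * tr X A"
 by (simp add:tr_def sum_distrib_left)

lemma tr_sum: "tr X (%f x. SUM y:Y. A y f x) = (SUM y:Y. tr X (A y))"
 unfolding tr_def by (rule sum.swap)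

definition rhom :: "('a::comm_ring_1 => 'k::comm_ring_1) => bool" where
 "rhom th <-> th 1 = 1 & (ALL a b. th (a + b) = th a + th b) & (ALL a b. th (a * b) = th a * th b)"

lemma rhom_simps:
 assumes "rhom th"
 shows "th 1 = 1" "th (a + b) = th a + th b" "th (a * b) = th a * th b" "th 0 = 0" "th (- a) = - th a"
  "th (a - b) = th a - th b" "th (a ^ k) = th a ^ k"
proof -
 show 1: "th 1 = 1" "th (a + b) = th a + th b" "th (a * b) = th a * th b" for a b
  using assms by (auto simp:rhom_def)
 show 0: "th 0 = 0" using 1(2)[of 0 0] by simp
 show m: "th (- a) = - th a" for a using 1(2)[of a "- a"] 0 by (simp add:eq_neg_iff_add_eq_0 add.commute)
 show "th (a - b) = th a - th b" using 1(2)[of a "- b"] m by simp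
 show "th (a ^ k) = th a ^ k" by (induction k) (auto simp:1)
qed

lemma rhom_sum: "rhom th ==> th (SUM x:A. f x) = (SUM x:A. th (f x))"
 by (induction A rule:infinite_finite_induct) (auto simp:rhom_simps)

definition act :: "(laurent => 'k::comm_ring_1) => (nat => ('x => 'k) => 'x => 'k) =>
  falg => ('x => 'k) => 'x => 'k" where
 "act th t p f x = (SUM u:keys p. th (lookup p u) * foldr t (letters u) f x)"

text \<open>A representation of the Hecke algebra with scalars specialized along \<open>th\<close>.
  The parameter \<open>th\<close> covers the generic algebra, its fraction field, the point
  \<open>q = 1\<close> and, as \<open>lbar\<close>, the twist by the bar involution.\<close>

locale hk_rep =
 fixes n :: nat and th :: "laurent => 'k::comm_ring_1" and t :: "nat => ('x => 'k) => 'x => 'k"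
 assumes rhom: "rhom th"
  and lin: "!!i. lin_op (t i)"
  and quad: "!!i f x. i:{1..<n} ==> t i (t i f) x = (th qv - 1) * t i f x + th qv * f x"
  and braid: "!!i f x. 1 <= i ==> Suc i < n ==>
  t i (t (Suc i) (t i f)) x = t (Suc i) (t i (t (Suc i) f)) x"
  and comm: "!!i j f x. 1 <= i ==> Suc i < j ==> j < n ==> t i (t j f) x = t j (t i f) x"
begin

abbreviation (input) "ac == act th t"

lemmas th = rhom_simps[OF rhom]

lemma lin_wd: "lin_op (%f. foldr t us f)"
proof (induction us)
 case (Cons i us)
 from lin_op_comp[OF lin[of i] this] show ?case by simp
qed (simp add:lin_op_def)

lemma act_add: "ac (p + r) f x = ac p f x + ac r f x"
 unfolding act_def by (rule setsum_keys_plus_distrib) (simp_all add:th algebra_simps)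

lemma act_zero [simp]: "ac 0 f x = 0"
 by (simp add:act_def)

lemma act_sum: "ac (SUM a:A. f a) g x = (SUM a:A. ac (f a) g x)"
 by (induction A rule:infinite_finite_induct) (auto simp:act_add)

lemma act_wt: "ac (wterm c us) f x = th c * foldr t us f x"
 by (cases "c = 0") (simp_all add:act_def th)

lemma act_gen: "ac (gen i) f = t i f"
 by (auto simp:act_wt th)

lemma act_one [simp]: "ac 1 f = f"
 by (auto simp:one_eq_wt act_wt th)

lemma act_scal_wd_mult: "ac (wterm c us * r) f x = th c * foldr t us (ac r f) x"
proof -
 have 1: "wterm c us * r = (SUM u:keys r. wterm (c * lookup r u) (us @ letters u))"
  by (subst fa_expand[of r], subst sum_distrib_left) (simp add:mult_single plus_gen_word_def)
 have 2: "ac r f = (%x. SUM u:keys r. th (lookup r u) * foldr t (letters u) f x)"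
  by (simp add:act_def fun_eq_iff)
 show ?thesis
  unfolding 1 2 lin_op_sum[OF lin_wd] lin_op_scale[OF lin_wd]
  by (simp add:act_sum act_wt th sum_distrib_left mult.assoc)
qed

lemma act_mult: "ac (p * r) f x = ac p (ac r f) x"
proof -
 have "p * r = (SUM u:keys p. wterm (lookup p u) (letters u) * r)"
  by (subst fa_expand[of p], subst sum_distrib_right) (simp add:mult_single plus_gen_word_def)
 thus ?thesis by (simp only:act_sum act_scal_wd_mult) (simp only:act_def[of _ _ p])
qed

lemma act_scal: "ac (scal c p) f x = th c * ac p f x"
 by (simp add:act_mult act_wt)

lemma act_um: "ac (- p) f x = - ac p f x"
 using act_add[of p "- p" f x] by (simp add:eq_neg_iff_add_eq_0 add.commute)

lemma act_diff: "ac (p - r) f x = ac p f x - ac r f x"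
 using act_add[of p "- r"] by (simp add:act_um)

lemma lin_act: "lin_op (ac p)"
 unfolding lin_op_def act_def
 by (simp add:lin_op_add[OF lin_wd] lin_op_scale[OF lin_wd] sum.distrib sum_distrib_left algebra_simps)

text \<open>The elements of the free algebra that act as zero form a two-sided ideal containing the
  defining relations.\<close>

lemma act_hk_idl: "p:hid n ==> ac p f x = 0"
proof -
 define J where "J = {p:fa n. ALL f x. ac p f x = 0}"
 have z: "ac p f = (%x. 0)" if "p:J" for p f using that by (auto simp:J_def)
 have "ideal J (free_alg n)"
 proof (rule idealI[OF ring_free_alg])
  show "subgroup J (add_monoid (free_alg n))"
  proof (rule group.subgroupI)
  show "Group.group (add_monoid (free_alg n))"
  using abelian_group.a_group[OF ring.is_abelian_group[OF ring_free_alg]] .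
  have "0:J" by (simp add:J_def)
  thus "J ~= {}" by blast
  fix a assume a: "a:J"
  have "inv\<^bsub>add_monoid (free_alg n)\<^esub> a = - a"
  using a abelian_group.minus_equality[OF ring.is_abelian_group[OF ring_free_alg[of n]], of "- a" a]
  by (simp add:J_def a_inv_def)
  thus "inv\<^bsub>add_monoid (free_alg n)\<^esub> a:J" using a by (simp add:J_def act_um)
  qed (simp_all add:J_def act_add)
 next
  fix a p assume a: "a:J" and p: "p:fa n"
  show "p \<otimes>\<^bsub>free_alg n\<^esub> a:J" "a \<otimes>\<^bsub>free_alg n\<^esub> p:J"
  using a p by (simp_all add:J_def act_mult z[OF a] lin_op_zero[OF lin_act])
 qed
 moreover have "hecke_relations n \<subseteq> J"
 proof -
  have br: "t i (t j (t i f)) x = t j (t i (t j f)) x"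
  if "i:{1..<n}" "j:{1..<n}" "\<bar>int i - int j\<bar> = 1" for i j f x
  proof -
  have "j = Suc i \<or> i = Suc j" using that by linarith
  thus ?thesis using braid that by auto
  qed
  have cm: "t i (t j f) x = t j (t i f) x"
  if "i:{1..<n}" "j:{1..<n}" "2 <= \<bar>int i - int j\<bar>" for i j f x
  proof -
  have "Suc i < j \<or> Suc j < i" using that by linarith
  thus ?thesis using comm[of i j] comm[of j i] that by auto
  qed
  show ?thesis
  by (auto simp:J_def hecke_relations_def act_diff act_add act_wt th quad br cm)
 qed
 ultimately have "hid n \<subseteq> J" by (rule hk_idl_minimal)
 thus "p:hid n ==> ac p f x = 0" by (auto simp:J_def)
qed

lemma act_heq: "heq n p r ==> ac p f = ac r f"
 using act_hk_idl[of "p - r"] by (auto simp:heq_def act_diff)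

lemma act_Tw_up:
 "w:Sym n ==> i:{1..<n} ==> pinv w i < pinv w (Suc i) ==>
  t i (ac (Tw n w) f) x = ac (Tw n (sw i o w)) f x"
 using act_mult[of "gen i" "Tw n w" f x] by (simp only:act_gen act_heq[OF Tw_up])

end

section \<open>Permutation of tensor factors\<close>

text \<open>Signed \<open>q\<close>-permutation of two adjacent tensor factors, written on
  coefficient functions; \<open>tn_op_dl\<close> gives the action on basis vectors. The eigenvalue
  -1 at equal letters makes a block of equal letters sign-isotypic.\<close>

definition tn_op :: "'k::comm_ring_1 => nat => ((nat => 'c::linorder) => 'k) => (nat => 'c) => 'k" where
 "tn_op q i f h =
  (if h i = h (Suc i) then - f h
  else if h (Suc i) < h i then q * f (h o sw i)
  else (q - 1) * f h + f (h o sw i))"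

lemma comp_sw_sw [simp]: "f o sw i o sw i = f"
 by (simp add:fun_eq_iff)

lemma tn_op_quad:
 "tn_op q i (tn_op q i f) h = (q - 1) * tn_op q i f h + q * f h"
 by (auto simp:tn_op_def algebra_simps)

lemma tn_op_comm:
 assumes "Suc i < j"
 shows "tn_op q i (tn_op q j f) h = tn_op q j (tn_op q i f) h"
proof -
 have fx: "sw i j = j" "sw i (Suc j) = Suc j" "sw j i = i" "sw j (Suc i) = Suc i"
  using assms by (auto)
 have "h o sw i o sw j = h o sw j o sw i"
  using sw_comm[of i j] assms by (simp add:comp_assoc)
 thus ?thesis by (simp add:tn_op_def fx algebra_simps)
qed

lemma sw_values [simp]:
 "sw i (Suc (Suc i)) = Suc (Suc i)" "sw (Suc i) i = i"
 by (simp_all)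

lemma linorder_cases3:
 fixes a b :: "'c::linorder"
 assumes "a < b ==> a ~= b ==> b ~= a ==> ~ b < a ==> P" "a = b ==> P"
  "b < a ==> a ~= b ==> b ~= a ==> ~ a < b ==> P"
 shows P
 using assms by (cases a b rule:linorder_cases) auto

text \<open>Both sides are combinations of values of \<open>f\<close> at rearrangements of three
  letters, so the identity is checked for each relative order of these letters; inconsistent
  comparisons are discharged by \<open>order\<close>.\<close>

lemma tn_op_braid:
 "tn_op q i (tn_op q (Suc i) (tn_op q i f)) h =
  tn_op q (Suc i) (tn_op q i (tn_op q (Suc i) f)) h"
proof -
 have b: "h o sw (Suc i) o sw i o sw (Suc i) = h o sw i o sw (Suc i) o sw i"
  using sw_braid[of i "Suc i"] by (simp add:comp_assoc)
 show ?thesis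
  by (rule linorder_cases3[of "h i" "h (Suc i)"];
  rule linorder_cases3[of "h (Suc i)" "h (Suc (Suc i))"];
  rule linorder_cases3[of "h i" "h (Suc (Suc i))"];
  ((simp add:tn_op_def b algebra_simps; fail) | order))
qed

lemma lin_tn_op: "lin_op (tn_op q i)"
 by (auto simp:lin_op_def tn_op_def fun_eq_iff algebra_simps)

lemma hk_rep_tn: "rhom th ==> hk_rep n th (tn_op (th qv))"
 by unfold_locales (simp_all add:lin_tn_op tn_op_quad tn_op_braid, rule tn_op_comm)

lemma tn_op_dl:
 "tn_op q i (dl f) = (%m.
  if f i = f (Suc i) then - dl f m
  else if f (Suc i) < f i then dl (f o sw i) m
  else q * dl (f o sw i) m + (q - 1) * dl f m)"
proof
 fix m
 have 1: "m o sw i = f <-> m = f o sw i" by auto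
 have 2: "f = f o sw i <-> f i = f (Suc i)"
 proof
  show "f = f o sw i ==> f i = f (Suc i)"
  by (drule fun_cong[of _ _ i]) simp
 qed (auto simp:fun_eq_iff transpose_def)
 have 3: "f o sw i = f <-> f i = f (Suc i)" using 2 by auto
 show "tn_op q i (dl f) m = (if f i = f (Suc i) then - dl f m
  else if f (Suc i) < f i then dl (f o sw i) m
  else q * dl (f o sw i) m + (q - 1) * dl f m)"
  by (rule linorder_cases3[of "f i" "f (Suc i)"]; cases "m = f"; cases "m = f o sw i")
  (auto simp:tn_op_def dl_def 1 2 3)
qed

text \<open>Each letter of the reduced word is applied at a descent of the current word, and there
  the operator only permutes: neither a factor \<open>q\<close> nor a second term arises.\<close>

lemma tn_wd_dl:
 assumes "w:Sym n" "rword n w us"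
  and "!!a b. 1 <= a ==> a < b ==> b <= n ==> w b < w a ==> f b < f a"
 shows "foldr (tn_op q) us (dl f) = dl (f o pinv w)"
 using assms
proof (induction us arbitrary: w)
 case Nil
 thus ?case by (simp add:rword_Nil)
next
 case (Cons i us)
 have w: "w:Sym n" by fact
 have i: "i:{1..<n}" "pinv w (Suc i) < pinv w i" "rword n (sw i o w) us"
  using Cons.prems(2) by (auto simp:rword_Cons[OF w])
 have w': "sw i o w:Sym n" using w i comp_Sym by simp
 have dec: "f b < f a" if "1 <= a" "a < b" "b <= n" "(sw i o w) b < (sw i o w) a" for a b
 proof -
  have "~ (w a = i & w b = Suc i)"
  proof
  assume "w a = i & w b = Suc i"
  hence "a = pinv w i" "b = pinv w (Suc i)" using pinv_app(1)[OF w] by metis+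
  thus False using i(2) that by simp
  qed
  moreover have "w a ~= w b" using that by (auto)
  ultimately have "w b < w a" using that(4) by (auto simp:transpose_def split: if_splits)
  thus ?thesis using Cons.prems(3) that by blast
 qed
 have "foldr (tn_op q) us (dl f) = dl (f o pinv (sw i o w))"
  by (rule Cons.IH[OF w' i(3)], rule dec)
 hence IH: "foldr (tn_op q) us (dl f) = dl (f o (pinv w o sw i))"
  by (simp only:pinv_sw_comp[OF w])
 have "pinv w i:{1..n}" "pinv w (Suc i):{1..n}"
  using i(1) Sym_mem[OF pinv_Sym[OF w], of i] Sym_mem[OF pinv_Sym[OF w], of "Suc i"] by auto
 hence lt: "f (pinv w i) < f (pinv w (Suc i))"
  by (intro Cons.prems(3) i(2)) (simp_all add:pinv_app(2)[OF w])
 have "tn_op q i (dl (f o (pinv w o sw i))) = dl (f o (pinv w o sw i) o sw i)"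
  unfolding tn_op_dl using lt by (intro ext) auto
 also have "f o (pinv w o sw i) o sw i = f o pinv w"
  by (simp add:fun_eq_iff)
 finally show ?case by (simp only:IH foldr.simps comp_apply[of _ "foldr _ _"])
qed

text \<open>A strictly decreasing word. Its rearrangements are pairwise distinct, so they carry the
  regular representation, with \<open>Tw n w\<close> sent to \<open>regw w\<close>.\<close>

definition base :: "nat => int" where "base k = - int k"

definition "regw w = base o pinv w"

lemma regw_inj: "u:Sym n ==> w:Sym n ==> regw u = regw w <-> u = w"
proof
 assume u: "u:Sym n" and w: "w:Sym n" and "regw u = regw w"
 hence "pinv u = pinv w" by (simp add:regw_def base_def fun_eq_iff)
 hence "pinv (pinv u) = pinv (pinv w)" by simp
 thus "u = w" using u w by (simp add:inv_inv_eq permutes_bij[OF permsD])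
qed simp

lemma regw_sw: "w:Sym n ==> regw w o sw i = regw (sw i o w)"
 by (simp add:regw_def pinv_sw_comp comp_assoc)

lemma regw_less: "regw w i < regw w j <-> pinv w j < pinv w i"
 by (simp add:regw_def base_def)

lemma regw_id: "regw id = base"
 by (simp add:regw_def)

lemma rhom_id: "rhom (%c. c)"
 by (simp add:rhom_def)

lemmas reg_rep = hk_rep_tn[OF rhom_id]

text \<open>The coefficient of \<open>Tw n w\<close> in \<open>p\<close>, read off from the action
  of \<open>p\<close> on the base word; this also yields linear independence.\<close>

definition "cof n p w = act (%c. c) (tn_op qv) p (dl base) (regw w)"

lemma act_Tw_base:
 assumes "w:Sym n" "rhom th"
 shows "act th (tn_op q) (Tw n w) (dl base) = dl (regw w)"
proof -
 have "foldr (tn_op q) (red n w) (dl base) = dl (regw w)"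
  unfolding regw_def by (rule tn_wd_dl[OF assms(1) rword_red[OF assms(1)]]) (simp add:base_def)
 thus ?thesis by (auto simp:act_def rhom_simps[OF assms(2)])
qed

lemma cof_Tw: "u:Sym n ==> w:Sym n ==> cof n (Tw n u) w = (if w = u then 1 else 0)"
 unfolding cof_def by (subst act_Tw_base[OF _ rhom_id]) (auto simp:dl_def regw_inj)

lemma cof_scal: "cof n (scal c p) w = c * cof n p w"
 unfolding cof_def by (rule hk_rep.act_scal[OF reg_rep])

lemma cof_sum: "cof n (SUM a:A. f a) w = (SUM a:A. cof n (f a) w)"
 unfolding cof_def by (rule hk_rep.act_sum[OF reg_rep])

lemma cof_cong: "heq n p r ==> cof n p w = cof n r w"
 unfolding cof_def by (simp only:hk_rep.act_heq[OF reg_rep])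

lemma cof_comb:
 assumes "w:Sym n" shows "cof n (SUM u:Sym n. scal (c u) (Tw n u)) w = c w"
proof -
 have "cof n (SUM u:Sym n. scal (c u) (Tw n u)) w = (SUM u:Sym n. if w = u then c u else 0)"
  unfolding cof_sum cof_scal by (rule sum.cong) (use assms in "auto simp:cof_Tw")
 thus ?thesis using assms by simp
qed

lemma cof_heq:
 assumes "p:fa n" shows "heq n p (SUM w:Sym n. scal (cof n p w) (Tw n w))"
proof -
 obtain c where c: "heq n p (SUM w:Sym n. scal (c w) (Tw n w))"
  using fa_Tspan[OF assms] unfolding Tspan_def by blast
 have "(SUM w:Sym n. scal (cof n p w) (Tw n w)) = (SUM w:Sym n. scal (c w) (Tw n w))"
  by (rule sum.cong) (simp_all only:cof_cong[OF c] cof_comb)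
 with c show ?thesis by (simp only:)
qed

lemma heq_iff_cof:
 assumes "p:fa n" "r:fa n"
 shows "heq n p r <-> (ALL w:Sym n. cof n p w = cof n r w)"
proof
 assume "ALL w:Sym n. cof n p w = cof n r w"
 hence "(SUM w:Sym n. scal (cof n p w) (Tw n w)) = (SUM w:Sym n. scal (cof n r w) (Tw n w))"
  by (intro sum.cong) simp_all
 hence "heq n p (SUM w:Sym n. scal (cof n r w) (Tw n w))"
  using cof_heq[OF assms(1)] by (rule subst)
 thus "heq n p r"
  using heq_sym[OF cof_heq[OF assms(2)]] by (rule heq_trs)
qed (simp add:cof_cong)

lemma (in hk_rep) act_cof:
 "p:fa n ==> ac p f x = (SUM w:Sym n. th (cof n p w) * ac (Tw n w) f x)"
 by (simp only:act_heq[OF cof_heq] act_sum act_scal)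

section \<open>The bar involution\<close>

lemma pm_expand: "c = (SUM k:keys c. sgl k (lookup c k))"
 by (rule poly_mapping_eqI) (simp add:lookup_sum lookup_single when_def in_keys_iff)

text \<open>Evaluation of a Laurent polynomial when the \<open>k\<close>-th power of the square root
  of \<open>q\<close> goes to \<open>g k\<close>. It yields both the bar involution and the
  specialization at 1.\<close>

definition leval :: "(int => 'k::comm_ring_1) => laurent => 'k" where
 "leval g c = (SUM k:keys c. g k * of_int (lookup c k))"

lemma leval_add: "leval g (a + b) = leval g a + leval g b"
 unfolding leval_def by (rule setsum_keys_plus_distrib) (simp_all add:algebra_simps)

lemma leval_sum: "leval g (SUM x:A. f x) = (SUM x:A. leval g (f x))"
proof (induction A rule:infinite_finite_induct)
 have "leval g 0 = 0" by (simp add:leval_def)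
 thus "leval g (SUM x:{}. f x) = (SUM x:{}. leval g (f x))"
  "~ finite A ==> leval g (SUM x:A. f x) = (SUM x:A. leval g (f x))" for A by simp_all
qed (simp add:leval_add)

lemma leval_single: "leval g (sgl k a) = g k * of_int a"
 by (cases "a = 0") (auto simp:leval_def)

lemma rhom_leval:
 assumes "g 0 = 1" "!!k l. g (k + l) = g k * g l"
 shows "rhom (leval g)"
 unfolding rhom_def
proof (intro conjI allI leval_add)
 show "leval g 1 = 1" by (simp flip:single_one add:leval_single assms)
 fix a b :: laurent
 have "leval g (a * b) = (SUM k:keys a. SUM l:keys b.
  leval g (sgl (k + l) (lookup a k * lookup b l)))"
  by (subst pm_expand[of a], subst pm_expand[of b])
  (simp add:sum_distrib_left sum_distrib_right mult_single leval_sum sum.swap[of _ "keys b"])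
 also have "... = leval g a * leval g b"
  unfolding leval_single by (simp add:leval_def[of g a] leval_def[of g b] sum_product assms algebra_simps)
 finally show "leval g (a * b) = leval g a * leval g b" .
qed

definition "lbar = leval (%k. qh (- k))"

lemma q_half_add: "qh (k + l) = qh k * qh l"
 by (simp add:q_half_def mult_single)

lemma q_half_0 [simp]: "qh 0 = 1"
 by (simp add:q_half_def)

lemma q_half_cancel [simp]: "qh (- k) * qh k = 1" "qh k * qh (- k) = 1"
 by (simp_all flip:q_half_add)

lemma rhom_lbar: "rhom lbar"
 unfolding lbar_def by (rule rhom_leval) (simp_all flip:q_half_add)

lemmas lbar_simps = rhom_simps[OF rhom_lbar]

lemma lbar_single: "lbar (sgl k a) = sgl (- k) a"
 by (simp add:lbar_def leval_single q_half_def mult_single flip:single_of_int)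

lemma lbar_q_half [simp]: "lbar (qh k) = qh (- k)"
 by (simp add:lbar_single q_half_def)

lemma lookup_lbar: "lookup (lbar c) k = lookup c (- k)"
proof -
 have "lbar c = (SUM l:keys c. sgl (- l) (lookup c l))"
  by (subst pm_expand[of c]) (simp add:rhom_sum[OF rhom_lbar] lbar_single)
 hence "lookup (lbar c) k =
  (SUM l:keys c. if l = - k then lookup c l else 0)"
  by (simp add:lookup_sum lookup_single when_def minus_equation_iff[of _ k])
 thus ?thesis by (auto simp:in_keys_iff)
qed

text \<open>For \<open>r * q = 1\<close> this is the inverse of \<open>tn_op q i\<close>, by the
  quadratic relation.\<close>

definition tbar :: "'k::comm_ring_1 => 'k => nat => ((nat => 'c::linorder) => 'k) => (nat => 'c) => 'k" where
 "tbar q r i f h = r * tn_op q i f h + (r - 1) * f h"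

lemma lin_tbar: "lin_op (tbar q r i)"
 unfolding lin_op_def tbar_def
 by (simp add:lin_op_add[OF lin_tn_op] lin_op_scale[OF lin_tn_op] algebra_simps)

lemma tbar_inv:
 assumes "r * q = 1"
 shows "tbar q r i (tn_op q i f) = f" "tn_op q i (tbar q r i f) = f"
proof -
 have "r * ((q - 1) * a + q * b) + (r - 1) * a = b" for a b
 proof -
  have "r * ((q - 1) * a + q * b) + (r - 1) * a = (r * q - 1) * a + (r * q) * b"
  by (simp add:algebra_simps)
  thus ?thesis using assms by simp
 qed
 thus "tbar q r i (tn_op q i f) = f" "tn_op q i (tbar q r i f) = f"
  by (simp_all add:tbar_def[abs_def] lin_op_add[OF lin_tn_op] lin_op_scale[OF lin_tn_op] tn_op_quad fun_eq_iff)
qed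

text \<open>The inverses of the generators satisfy the Hecke relations for the inverse parameter
  \<open>lbar qv\<close>; the braid and commutation relations are those of the generators,
  inverted.\<close>

lemma hk_rep_tbar:
 "hk_rep n lbar (tbar qv (qh (- 2)) :: nat => ((nat => 'c::linorder) => laurent) => _)"
proof
 note inv = tbar_inv[of "qh (- 2)" qv, OF q_half_cancel(1)]
 let ?t = "tn_op qv :: nat => ((nat => 'c) => laurent) => _"
 let ?g = "tbar qv (qh (- 2)) :: nat => ((nat => 'c) => laurent) => _"
 show "rhom lbar" by (rule rhom_lbar)
 show "lin_op (?g i)" for i by (rule lin_tbar)
 fix f and x :: "nat => 'c" and i j
 have "?g i (?g i f) x = qh (- 2) * ?t i (?g i f) x + (qh (- 2) - 1) * ?g i f x"
  by (simp add:tbar_def[of _ _ _ "?g i f"])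
 thus "?g i (?g i f) x = (lbar qv - 1) * ?g i f x + lbar qv * f x"
  by (simp add:inv)
 show "?g i (?g (Suc i) (?g i f)) x = ?g (Suc i) (?g i (?g (Suc i) f)) x"
 proof -
  define h where "h = ?g (Suc i) (?g i (?g (Suc i) f))"
  have "f = ?t (Suc i) (?t i (?t (Suc i) h))" by (simp add:h_def inv)
  also have "... = ?t i (?t (Suc i) (?t i h))" by (rule ext) (rule tn_op_braid[symmetric])
  finally have "?g i (?g (Suc i) (?g i f)) = h" by (simp add:inv)
  thus ?thesis by (simp add:h_def)
 qed
 assume ij: "Suc i < j"
 show "?g i (?g j f) x = ?g j (?g i f) x"
 proof -
  define h where "h = ?g j (?g i f)"
  have "f = ?t i (?t j h)" by (simp add:h_def inv)
  also have "... = ?t j (?t i h)" by (rule ext) (rule tn_op_comm[OF ij])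
  finally have "?g i (?g j f) = h" by (simp add:inv)
  thus ?thesis by (simp add:h_def)
 qed
qed

abbreviation breg :: "falg => ((nat => int) => laurent) => (nat => int) => laurent" where
 "breg == act lbar (tbar qv (qh (- 2)))"

abbreviation reg :: "falg => ((nat => int) => laurent) => (nat => int) => laurent" where
 "reg == act (%c. c) (tn_op qv)"

definition "ginv i = wterm (qh (- 2)) [i] + wterm (qh (- 2) - 1) []"

text \<open>The bar involution on representatives. It respects congruence because, in the faithful
  regular representation, \<open>abar p\<close> acts as \<open>p\<close> does in the representation
  \<open>breg\<close> (see \<open>reg_abar\<close>).\<close>

definition "abar p = (SUM u:keys p.
  scal (lbar (lookup p u)) (foldr (%i r. ginv i * r) (letters u) 1))"

lemma ginv_fa: "i:{1..<n} ==> ginv i:fa n"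
 unfolding ginv_def by (intro add_fa) auto

lemma foldr_ginv_fa: "set us \<subseteq> {1..<n} ==> foldr (%i r. ginv i * r) us 1:fa n"
 by (induction us) (simp_all add:ginv_fa)

lemma abar_fa: "p:fa n ==> abar p:fa n"
 unfolding abar_def
 by (rule sum_fa, rule scal_fa, rule foldr_ginv_fa) (auto simp:free_alg_def)

lemma reg_ginv: "reg (ginv i) f x = tbar qv (qh (- 2)) i f x"
 unfolding ginv_def hk_rep.act_add[OF reg_rep] hk_rep.act_wt[OF reg_rep] by (simp add:tbar_def)

lemma reg_foldr_ginv: "reg (foldr (%i r. ginv i * r) us 1) f = foldr (tbar qv (qh (- 2))) us f"
proof (induction us)
 case (Cons i us)
 thus ?case by (intro ext) (simp add:hk_rep.act_mult[OF reg_rep] reg_ginv)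
qed (simp add:hk_rep.act_one[OF reg_rep])

lemma reg_abar: "reg (abar p) f = breg p f"
 by (simp add:abar_def hk_rep.act_sum[OF reg_rep] hk_rep.act_scal[OF reg_rep] reg_foldr_ginv fun_eq_iff act_def[of lbar])

lemma heq_reg: "p:fa n ==> r:fa n ==> (!!f. reg p f = reg r f) ==> heq n p r"
 by (simp add:heq_iff_cof cof_def)

lemma abar_cong: "p:fa n ==> r:fa n ==> heq n p r ==> heq n (abar p) (abar r)"
 by (intro heq_reg abar_fa) (simp_all only:reg_abar hk_rep.act_heq[OF hk_rep_tbar])

lemma abar_add: "p:fa n ==> r:fa n ==> heq n (abar (p + r)) (abar p + abar r)"
 by (intro heq_reg abar_fa add_fa ext)
  (simp_all only:reg_abar hk_rep.act_add[OF hk_rep_tbar] hk_rep.act_add[OF reg_rep])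

lemma abar_mult: "p:fa n ==> r:fa n ==> heq n (abar (p * r)) (abar p * abar r)"
 by (intro heq_reg abar_fa mult_fa ext)
  (simp_all only:reg_abar hk_rep.act_mult[OF hk_rep_tbar] hk_rep.act_mult[OF reg_rep])

lemma abar_const: "abar (wterm c []) = wterm (lbar c) []"
 by (cases "c = 0") (simp_all add:abar_def lbar_simps)

lemma abar_gen: "abar (gen i) = ginv i"
 by (simp add:abar_def lbar_simps)

section \<open>The quotient algebra and its bar involution\<close>

definition "cls n p = hid n +>\<^bsub>free_alg n\<^esub> p"

lemma ring_Hecke: "ring (Hecke n)"
 unfolding Hecke_def by (rule ideal.quotient_is_ring[OF idl_hk])

lemma cls_hom: "cls n:Ring.ring_hom (free_alg n) (Hecke n)"
 unfolding Hecke_def cls_def[abs_def] by (rule ideal.rcos_ring_hom[OF idl_hk])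

lemma cls_carrier [simp]: "p:fa n ==> cls n p:carrier (Hecke n)"
 using Ring.ring_hom_closed[OF cls_hom] .

lemma cls_mult: "p:fa n ==> r:fa n ==> cls n p \<otimes>\<^bsub>Hecke n\<^esub> cls n r = cls n (p * r)"
 using Ring.ring_hom_mult[OF cls_hom, of p n r] by simp

lemma cls_add: "p:fa n ==> r:fa n ==> cls n p \<oplus>\<^bsub>Hecke n\<^esub> cls n r = cls n (p + r)"
 using Ring.ring_hom_add[OF cls_hom, of p n r] by simp

lemma cls_one: "\<one>\<^bsub>Hecke n\<^esub> = cls n 1"
 using Ring.ring_hom_one[OF cls_hom, of n] by simp

lemma cls_eq_iff: assumes p: "p:fa n" "r:fa n" shows "cls n p = cls n r <-> heq n p r"
proof -
 have "\<ominus>\<^bsub>free_alg n\<^esub> r = - r"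
  using p by (intro abelian_group.minus_equality[OF ring.is_abelian_group[OF ring_free_alg]]) auto
 thus ?thesis
  using ring.quotient_eq_iff_same_a_r_cos[OF ring_free_alg idl_hk p] p
  by (simp add:cls_def heq_def a_minus_def)
qed

lemma cls_surj: "h:carrier (Hecke n) ==> EX p:fa n. h = cls n p"
 by (auto simp:Hecke_def FactRing_def A_RCOSETS_def' cls_def)

lemma cls_zero: "\<zero>\<^bsub>Hecke n\<^esub> = cls n 0"
proof -
 interpret ring "Hecke n" by (rule ring_Hecke)
 have "\<zero>\<^bsub>Hecke n\<^esub> \<oplus>\<^bsub>Hecke n\<^esub> cls n 0 = cls n 0 \<oplus>\<^bsub>Hecke n\<^esub> cls n 0" by (simp add:cls_add)
 thus ?thesis by (subst (asm) add.right_cancel) simp_all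
qed

lemma finsum_cls:
 "finite A ==> (!!a. a:A ==> f a:fa n) ==>
  finsum (Hecke n) (%a. cls n (f a)) A = cls n (sum f A)"
proof (induction A rule:finite_induct)
 interpret ring "Hecke n" by (rule ring_Hecke)
 { case empty thus ?case by (simp add:cls_zero) }
 { case (insert a A) thus ?case by (subst finsum_insert) (auto simp:cls_add intro:cls_carrier) }
qed

lemma hk_const_cls: "hecke_const n c = cls n (wterm c [])"
 by (simp add:hecke_const_def cls_def)

lemma hk_gen_cls: "hecke_gen n i = cls n (gen i)"
 by (simp add:hecke_gen_def cls_def)

lemma hk_scl_cls: "p:fa n ==> hecke_scale n c (cls n p) = cls n (scal c p)"
 by (simp add:hecke_scale_def hk_const_cls cls_mult)

lemma hk_T_cls: "w:Sym n ==> hecke_T n w = cls n (Tw n w)"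
proof -
 have "set us \<subseteq> {1..<n} ==>
  foldr (%i h. hecke_gen n i \<otimes>\<^bsub>Hecke n\<^esub> h) us \<one>\<^bsub>Hecke n\<^esub> = cls n (wterm 1 us)" for us
  by (induction us) (auto simp:cls_one one_eq_wt hk_gen_cls cls_mult wt_mult)
 from this[OF set_red] show "w:Sym n ==> hecke_T n w = cls n (Tw n w)"
  by (simp add:hecke_T_def red_def)
qed

lemma ginv_gen: "i:{1..<n} ==> heq n (ginv i * gen i) 1" "i:{1..<n} ==> heq n (gen i * ginv i) 1"
 by (intro heq_reg mult_fa ginv_fa wt_fa;
  simp add:fun_eq_iff hk_rep.act_mult[OF reg_rep] hk_rep.act_gen[OF reg_rep] hk_rep.act_one[OF reg_rep]
  reg_ginv[abs_def] tbar_inv)+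

definition "fbar n h = cls n (abar (SOME p. p:fa n & h = cls n p))"

lemma fbar_cls:
 assumes "p:fa n" shows "fbar n (cls n p) = cls n (abar p)"
proof -
 define r where "r = (SOME r. r:fa n & cls n p = cls n r)"
 have "EX r. r:fa n & cls n p = cls n r" using assms by blast
 hence "r:fa n & cls n p = cls n r" unfolding r_def by (rule someI_ex)
 hence r: "r:fa n" "heq n r p" using assms by (auto simp:cls_eq_iff heq_sym)
 hence "heq n (abar r) (abar p)" using abar_cong assms by blast
 thus ?thesis using r assms by (simp add:fbar_def cls_eq_iff abar_fa flip:r_def)
qed

lemma bar_invol_fbar: "bar_involution n (fbar n)"
 unfolding bar_involution_def
proof (intro conjI ballI)
 show "fbar n:Ring.ring_hom (Hecke n) (Hecke n)"
 proof (rule Ring.ring_hom_memI)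
  fix h k assume "h:carrier (Hecke n)" "k:carrier (Hecke n)"
  then obtain p r where "p:fa n" "h = cls n p" "r:fa n" "k = cls n r" using cls_surj by metis
  thus "fbar n (h \<otimes>\<^bsub>Hecke n\<^esub> k) = fbar n h \<otimes>\<^bsub>Hecke n\<^esub> fbar n k"
  "fbar n (h \<oplus>\<^bsub>Hecke n\<^esub> k) = fbar n h \<oplus>\<^bsub>Hecke n\<^esub> fbar n k"
  by (simp_all add:cls_mult cls_add fbar_cls abar_fa cls_eq_iff abar_mult abar_add)
 next
  fix h assume "h:carrier (Hecke n)"
  then obtain p where "p:fa n" "h = cls n p" using cls_surj by metis
  thus "fbar n h:carrier (Hecke n)" by (simp add:fbar_cls abar_fa)
 next
  show "fbar n \<one>\<^bsub>Hecke n\<^esub> = \<one>\<^bsub>Hecke n\<^esub>"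
  unfolding cls_one by (simp add:fbar_cls) (simp add:one_eq_wt abar_const lbar_simps)
 qed
 show "fbar n (hecke_const n (qh 1)) = hecke_const n (qh (- 1))"
  unfolding hk_const_cls by (simp add:fbar_cls abar_const)
 fix i assume i: "i:{1..<n}"
 hence "gen i:fa n" by simp
 thus "fbar n (hecke_gen n i) \<otimes>\<^bsub>Hecke n\<^esub> hecke_gen n i = \<one>\<^bsub>Hecke n\<^esub>"
  using i unfolding hk_gen_cls cls_one fbar_cls[OF \<open>gen i : fa n\<close>]
  by (simp add:abar_gen cls_mult ginv_fa cls_eq_iff ginv_gen)
qed

text \<open>The elements on which \<open>f\<close> and \<open>abar\<close> agree are closed under
  sums and products. They contain the square root of \<open>q\<close>, then its inverse and the
  integers, hence all scalars; and they contain each generator, since inverses in a ring are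
  unique.\<close>

lemma bar_invol_uniq:
 assumes f: "bar_involution n f" and p: "p:fa n"
 shows "f (cls n p) = cls n (abar p)"
proof -
 interpret H: ring "Hecke n" by (rule ring_Hecke)
 have hom: "f:Ring.ring_hom (Hecke n) (Hecke n)" using f by (simp add:bar_involution_def)
 define S where "S = {p:fa n. f (cls n p) = cls n (abar p)}"
 have add:"p + r:S" if "p:S" "r:S" for p r
  using that Ring.ring_hom_add[OF hom, of "cls n p" "cls n r"]
  by (simp add:S_def cls_add abar_fa cls_eq_iff abar_add heq_sym)
 have mult: "p * r:S" if "p:S" "r:S" for p r
  using that Ring.ring_hom_mult[OF hom, of "cls n p" "cls n r"]
  by (simp add:S_def cls_mult abar_fa cls_eq_iff abar_mult heq_sym)
 define T where "T = {c. wterm c []:S}"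
 have Tadd: "a + b:T" if "a:T" "b:T" for a b
  using add[of "wterm a []" "wterm b []"] that by (simp add:T_def wt_add)
 have Tmult: "a * b:T" if "a:T" "b:T" for a b
  using mult[of "wterm a []" "wterm b []"] that by (simp add:T_def wt_mult)
 have T1: "1:T"
  using Ring.ring_hom_one[OF hom] by (simp add:T_def S_def abar_const lbar_simps cls_one one_eq_wt)
 have T0: "0:T"
  using Ring.ring_hom_zero[OF hom ring_Hecke ring_Hecke] by (simp add:T_def S_def cls_zero abar_def)
 have Tm: "- 1:T"
 proof -
  have "f (cls n (wterm (- 1) [])) \<oplus>\<^bsub>Hecke n\<^esub> cls n (wterm 1 []) = f (cls n (wterm (- 1) [])) \<oplus>\<^bsub>Hecke n\<^esub> f (cls n (wterm 1 []))"
  using T1 by (simp add:T_def S_def abar_const lbar_simps)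
  also have "... = f (cls n (wterm (- 1) [] + wterm 1 []))"
  using Ring.ring_hom_add[OF hom, of "cls n (wterm (- 1) [])" "cls n (wterm 1 [])"] by (simp add:cls_add)
  also have "wterm (- 1) [] + wterm 1 [] = (0 :: falg)" by (simp flip:wt_add)
  also have "f (cls n 0) = cls n 0" using Ring.ring_hom_zero[OF hom ring_Hecke ring_Hecke] by (simp add:cls_zero)
  also have "cls n 0 = cls n (wterm (- 1) []) \<oplus>\<^bsub>Hecke n\<^esub> cls n (wterm 1 [])"
  by (simp add:cls_add flip:wt_add)
  finally have "f (cls n (wterm (- 1) [])) = cls n (wterm (- 1) [])"
  using Ring.ring_hom_closed[OF hom, of "cls n (wterm (- 1) [])"] by (subst (asm) H.add.right_cancel) auto
  thus ?thesis by (simp add:T_def S_def abar_const lbar_simps)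
 qed
 have Tq: "qh 1:T"
  using f by (simp add:bar_involution_def T_def S_def hk_const_cls abar_const)
 have Tq': "qh (- 1):T"
 proof -
  have "f (cls n (wterm (qh (- 1)) [])) = cls n (wterm (qh 1) [])"
  proof (rule H.inv_unique)
  show "f (cls n (wterm (qh (- 1)) [])) \<otimes>\<^bsub>Hecke n\<^esub> cls n (wterm (qh (- 1)) []) = \<one>\<^bsub>Hecke n\<^esub>"
  using Ring.ring_hom_mult[OF hom, of "cls n (wterm (qh (- 1)) [])" "cls n (wterm (qh 1) [])"] Tq T1
  by (simp add:T_def S_def abar_const cls_mult wt_mult cls_one one_eq_wt lbar_simps)
  show "cls n (wterm (qh (- 1)) []) \<otimes>\<^bsub>Hecke n\<^esub> cls n (wterm (qh 1) []) = \<one>\<^bsub>Hecke n\<^esub>"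
  by (simp add:cls_mult wt_mult cls_one one_eq_wt)
  qed (use Ring.ring_hom_closed[OF hom] in auto)
  thus ?thesis by (simp add:T_def S_def abar_const)
 qed
 have Tpow: "qh (int k):T" "qh (- int k):T" for k
 proof -
  show "qh (int k):T"
  proof (induction k)
  case (Suc k)
  from Tmult[OF this Tq] show ?case by (simp flip:q_half_add add:add.commute)
  qed (simp add:T1)
  show "qh (- int k):T"
  proof (induction k)
  case (Suc k)
  from Tmult[OF this Tq'] show ?case by (simp flip:q_half_add add:algebra_simps)
  qed (simp add:T1)
 qed
 have Tk: "qh k:T" for k using Tpow[of "nat k"] Tpow[of "nat (- k)"] by (cases "k >= 0") auto
 have Tint: "of_int a:T" for a
 proof (induction a rule:int_induct[of _ 0])
  case (step2 i)
  from Tadd[OF step2(2) Tm] show ?case by simp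
 qed (auto simp:T0 T1 Tadd)
 have Tall: "c:T" for c
 proof -
  have "sum h A:T" if "!!x. x:A ==> h x:T" for h :: "int => laurent" and A
  using that by (induction A rule:infinite_finite_induct) (auto simp:T0 Tadd)
  moreover have "sgl k a = qh k * of_int a" for k a
  by (simp add:q_half_def mult_single flip:single_of_int)
  ultimately show ?thesis using Tmult[OF Tk Tint] by (subst pm_expand) simp
 qed
 have Sgen: "gen i:S" if i: "i:{1..<n}" for i
 proof -
  have "f (cls n (gen i)) = cls n (ginv i)"
  proof (rule H.inv_unique)
  show "f (cls n (gen i)) \<otimes>\<^bsub>Hecke n\<^esub> cls n (gen i) = \<one>\<^bsub>Hecke n\<^esub>"
  using f i by (simp add:bar_involution_def hk_gen_cls)
  show "cls n (gen i) \<otimes>\<^bsub>Hecke n\<^esub> cls n (ginv i) = \<one>\<^bsub>Hecke n\<^esub>"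
  using i by (simp add:cls_mult ginv_fa cls_one cls_eq_iff ginv_gen)
  qed (use i Ring.ring_hom_closed[OF hom] ginv_fa in auto)
  thus ?thesis using i by (simp add:S_def abar_gen)
 qed
 have Sword: "wterm 1 us:S" if "set us \<subseteq> {1..<n}" for us
  using that
 proof (induction us)
  case Nil thus ?case using T1 by (simp add:T_def)
 next
  case (Cons i us)
  thus ?case using mult[OF Sgen[of i]] by (simp add:wt_Cons[of i us])
 qed
 have "p:S"
 proof (subst fa_expand)
  have "0:S" using T0 by (simp add:T_def)
  hence Ssum: "sum h A:S" if "!!x. x:A ==> h x:S" for h :: "gen_word => falg" and A
  using that by (induction A rule:infinite_finite_induct) (auto simp:add)
  have "wterm (lookup p u) []:S" for u using Tall by (simp add:T_def)
  moreover have "wterm 1 (letters u):S" if "u:keys p" for u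
  using p that by (intro Sword) (auto simp:free_alg_def)
  ultimately show "(SUM u:keys p. scal (lookup p u) (wterm 1 (letters u))):S"
  by (intro Ssum mult) auto
 qed
 thus ?thesis by (simp add:S_def)
qed

section \<open>The Kazhdan-Lusztig basis\<close>

text \<open>Triangularity of the bar involution: when the product of inverse generators is expanded,
  only the top term reaches length \<open>length us\<close>, and each factor contributes
  \<open>qh (- 2)\<close>, the inverse of \<open>q\<close>.\<close>

lemma bar_wd_coeff:
 assumes "set us \<subseteq> {1..<n}" "w:Sym n" "length us <= plen n w"
 shows "foldr (tbar qv (qh (- 2))) us (dl base) (regw w) =
  (if w = wperm us then qh (- 2 * int (plen n w)) else 0)"
 using assms
proof (induction us arbitrary: w)
 case Nil
 thus ?case using regw_inj[OF Nil(2) id_Sym] by (auto simp:dl_def regw_id)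
next
 case (Cons i us)
 let ?f = "foldr (tbar qv (qh (- 2))) us (dl base)"
 have w: "w:Sym n" and i: "i:{1..<n}" and us: "set us \<subseteq> {1..<n}" using Cons.prems by auto
 have w': "sw i o w:Sym n" using w i comp_Sym by simp
 have eq: "w = wperm (i # us) <-> sw i o w = wperm us"
  by (metis sw_sw_comp word_perm_Cons)
 from pinv_sw_cases[OF w] show ?case
 proof
  assume lt: "pinv w i < pinv w (Suc i)"
  have l: "plen n (sw i o w) = Suc (plen n w)" by (rule plen_sw[OF w i lt])
  have "?f (regw w) = 0"
  using Cons.IH[OF us w] Cons.prems(3) plen_wd[OF us] by auto
  moreover have "sw i o w ~= wperm us" using l Cons.prems(3) plen_wd[OF us] by auto
  moreover from this have "?f (regw (sw i o w)) = 0"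
  using Cons.IH[OF us w'] l Cons.prems(3) by (simp del:comp_apply)
  ultimately show ?thesis using eq regw_sw[OF w, of i]
  by (simp add:tbar_def[of _ _ i] tn_op_def[of _ i] del:word_perm_Cons)
 next
  assume gt: "pinv w (Suc i) < pinv w i"
  have l: "plen n w = Suc (plen n (sw i o w))" by (rule plen_sw'[OF w i gt])
  have "regw w i < regw w (Suc i)" using gt by (simp add:regw_less)
  hence "tbar qv (qh (- 2)) i ?f (regw w) =
  qh (- 2) * ((qv - 1) * ?f (regw w) + ?f (regw (sw i o w))) + (qh (- 2) - 1) * ?f (regw w)"
  using regw_sw[OF w, of i] by (auto simp:tbar_def[of _ _ i] tn_op_def[of _ i])
  also have "... = qh (- 2) * ?f (regw (sw i o w))"
  proof -
  have "qh (- 2) * ((qv - 1) * a + b) + (qh (- 2) - 1) * a = (qh (- 2) * qv - 1) * a + qh (- 2) * b" for a b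
  by (simp add:algebra_simps)
  thus ?thesis by simp
  qed
  also have "... = qh (- 2) * (if sw i o w = wperm us then qh (- 2 * int (plen n (sw i o w))) else 0)"
  using Cons.IH[OF us w'] l Cons.prems(3) by (simp del:comp_apply)
  also have "... = (if w = wperm (i # us) then qh (- 2 * int (plen n w)) else 0)"
  unfolding eq l by (simp flip:q_half_add)
  finally show ?thesis by (simp del:word_perm_Cons)
 qed
qed

lemma abar_Tw_coeff:
 assumes "u:Sym n" "w:Sym n" "plen n u <= plen n w"
 shows "cof n (abar (Tw n u)) w = (if w = u then qh (- 2 * int (plen n w)) else 0)"
proof -
 have "cof n (abar (Tw n u)) w = foldr (tbar qv (qh (- 2))) (red n u) (dl base) (regw w)"
  by (simp add:cof_def reg_abar hk_rep.act_wt[OF hk_rep_tbar] lbar_simps)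
 also have "... = (if w = u then qh (- 2 * int (plen n w)) else 0)"
  using bar_wd_coeff[OF set_red[OF assms(1)] assms(2)] assms(3)
  by (simp add:len_red[OF assms(1)] wperm_red[OF assms(1)])
 finally show ?thesis .
qed

lemma abar_scal: "p:fa n ==> heq n (abar (scal c p)) (scal (lbar c) (abar p))"
 using abar_mult[of "wterm c []" n p] by (simp add:abar_const)

lemma abar_sum:
 "finite A ==> (!!a. a:A ==> f a:fa n) ==> heq n (abar (SUM a:A. f a)) (SUM a:A. abar (f a))"
proof (induction A rule:finite_induct)
 case empty thus ?case by (simp add:abar_def)
next
 case (insert a A)
 thus ?case
  using heq_trs[OF abar_add[of "f a" n "sum f A"] heq_add[OF heq_refl[of n "abar (f a)"]]] by simp
qed

lemma abar_comb_cof: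
 "cof n (abar (SUM u:Sym n. scal (c u) (Tw n u))) w =
  (SUM u:Sym n. lbar (c u) * cof n (abar (Tw n u)) w)"
proof -
 have "heq n (abar (SUM u:Sym n. scal (c u) (Tw n u))) (SUM u:Sym n. abar (scal (c u) (Tw n u)))"
  by (rule abar_sum) simp_all
 from heq_trs[OF this heq_sum[OF abar_scal[OF Tw_fa]]]
 have "heq n (abar (SUM u:Sym n. scal (c u) (Tw n u))) (SUM u:Sym n. scal (lbar (c u)) (abar (Tw n u)))" .
 thus ?thesis by (simp add:cof_cong cof_sum cof_scal)
qed

lemma lookup_mult_q_half: "lookup (c * qh l) k = lookup c (k - l)"
proof -
 have "c * qh l = (SUM j:keys c. sgl (j + l) (lookup c j))"
  by (subst pm_expand[of c]) (simp add:sum_distrib_right q_half_def mult_single)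
 hence "lookup (c * qh l) k =
  (SUM j:keys c. if j = k - l then lookup c j else 0)"
  by (simp add:lookup_sum lookup_single when_def eq_diff_eq)
 thus ?thesis by (auto simp:in_keys_iff)
qed

text \<open>A bar invariant element whose coefficients at \<open>T\<^sub>w\<close>, scaled by \<open>q\<close> to the power
 \<open>\<ell>(w) / 2\<close>, involve negative powers only must vanish: look at a longest \<open>w\<close>.\<close>

lemma bar_invar_neg_zero:
 assumes inv: "heq n (abar (SUM u:Sym n. scal (c u) (Tw n u))) (SUM u:Sym n. scal (c u) (Tw n u))"
  and neg: "!!u k. u:Sym n ==> lookup (c u) k ~= 0 ==> k < - int (plen n u)"
  and w: "w:Sym n"
 shows "c w = 0"
proof (rule ccontr)
 assume "c w ~= 0"
 define Z where "Z = {u:Sym n. c u ~= 0}"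
 have "finite Z" "Z ~= {}" using w \<open>c w ~= 0\<close> by (auto simp:Z_def)
 hence "Max (plen n ` Z):plen n ` Z" by (intro Max_in) auto
 then obtain v where v: "v:Z" "!!u. u:Z ==> plen n u <= plen n v"
  using \<open>finite Z\<close> by auto (metis Max_ge finite_imageI imageI)
 have vp: "v:Sym n" using v by (simp add:Z_def)
 have "c v = cof n (abar (SUM u:Sym n. scal (c u) (Tw n u))) v"
  using cof_cong[OF inv] cof_comb[OF vp] by simp
 also have "... = (SUM u:Sym n. if u = v then lbar (c v) * qh (- 2 * int (plen n v)) else 0)"
  unfolding abar_comb_cof
 proof (rule sum.cong)
  fix u assume u: "u:Sym n"
  show "lbar (c u) * cof n (abar (Tw n u)) v =
  (if u = v then lbar (c v) * qh (- 2 * int (plen n v)) else 0)"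
  using v(2)[of u] u abar_Tw_coeff[OF u vp] by (cases "c u = 0") (auto simp:Z_def lbar_simps)
 qed simp
 also have "... = lbar (c v) * qh (- 2 * int (plen n v))" using vp by simp
 finally have eq: "c v = lbar (c v) * qh (- 2 * int (plen n v))" .
 have "c v ~= 0" using v by (simp add:Z_def)
 then obtain k where k: "lookup (c v) k ~= 0" by (metis poly_mapping_eqI lookup_zero)
 hence "lookup (c v) (- k - 2 * int (plen n v)) ~= 0"
  by (subst (asm) eq) (simp add:lookup_mult_q_half lookup_lbar)
 from neg[OF vp this] neg[OF vp k] show False by simp
qed

lemma ble_Sym: "ble n v w ==> v:Sym n & w:Sym n"
 by (simp add:bruhat_le_def Sym_def)

lemma fin_bruhat [simp]: "finite {v. ble n v w}"
 by (rule finite_subset[of _ "Sym n"]) (auto dest:ble_Sym)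

lemma ble_len: assumes "ble n v w" shows "v = w \<or> plen n v < plen n w"
proof -
 note assms
 hence "(%u u'. EX a b. 1 <= a & a < b & b <= n & u' = u o trp a b &
  plen n u < plen n u')\<^sup>*\<^sup>* v w" by (simp add:bruhat_le_def)
 thus ?thesis by induction auto
qed

lemma kl_element_cls:
 "kl_element n p w = cls n (SUM u:Sym n. scal (qh (- int (plen n w)) *
  (if ble n u w then poly (map_poly of_int (p u)) qv else 0)) (Tw n u))"
proof -
 have "finsum (Hecke n) (%v. hecke_scale n (poly (map_poly of_int (p v)) qv) (hecke_T n v)) {v. ble n v w}
  = finsum (Hecke n) (%v. cls n (scal (poly (map_poly of_int (p v)) qv) (Tw n v))) {v. ble n v w}"
 proof (rule abelian_monoid.finsum_cong')
  show "abelian_monoid (Hecke n)" using ring_Hecke abelian_group.axioms(1) ring.is_abelian_group by blast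
 qed (auto dest!: ble_Sym simp:hk_T_cls hk_scl_cls intro!:cls_carrier)
 also have "... = cls n (\<Sum>v | ble n v w. scal (poly (map_poly of_int (p v)) qv) (Tw n v))"
  by (rule finsum_cls) (auto dest!: ble_Sym)
 finally have "kl_element n p w = cls n (scal (qh (- int (plen n w)))
  (\<Sum>v | ble n v w. scal (poly (map_poly of_int (p v)) qv) (Tw n v)))"
  unfolding kl_element_def by (simp only:) (rule hk_scl_cls, auto dest!: ble_Sym intro!:sum_fa)
 also have "scal (qh (- int (plen n w)))
  (\<Sum>v | ble n v w. scal (poly (map_poly of_int (p v)) qv) (Tw n v)) =
  (\<Sum>v | ble n v w. scal (qh (- int (plen n w)) *
  (if ble n v w then poly (map_poly of_int (p v)) qv else 0)) (Tw n v))"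
  unfolding sum_distrib_left scal_scal by (rule sum.cong) simp_all
 also have "... = (SUM v:Sym n. scal (qh (- int (plen n w)) *
  (if ble n v w then poly (map_poly of_int (p v)) qv else 0)) (Tw n v))"
  by (rule sum.mono_neutral_left) (auto dest:ble_Sym)
 finally show ?thesis .
qed

lemma poly_q_var_lookup:
 assumes "lookup (poly (map_poly of_int p) qv) k ~= 0"
 shows "k <= 2 * int (degree p)"
proof -
 have d: "degree (map_poly of_int p :: laurent poly) <= degree p" by (rule map_poly_degree_leq)
 have "poly (map_poly of_int p) qv =
  (SUM i<=degree (map_poly of_int p :: laurent poly). sgl (2 * int i) (coeff p i))"
 proof -
  have "of_int (coeff p i) * qv ^ i = sgl (2 * int i) (coeff p i)" for i
  proof -
  have "qv ^ i = qh (2 * int i)" for i by (induction i) (simp_all flip:q_half_add)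
  thus ?thesis by (simp add:q_half_def mult_single flip:single_of_int)
  qed
  thus ?thesis by (simp add:poly_altdef coeff_map_poly)
 qed
 hence "(SUM i<=degree (map_poly of_int p :: laurent poly). lookup (sgl (2 * int i) (coeff p i)) k) ~= 0"
  using assms by (simp add:lookup_sum)
 then obtain i where "i <= degree (map_poly of_int p :: laurent poly)" "lookup (sgl (2 * int i) (coeff p i)) k ~= 0"
  by (meson atMost_iff sum.not_neutral_contains_not_neutral)
 thus ?thesis using d by (auto simp:lookup_single split: if_splits)
qed

lemma poly_q_var_inj:
 assumes "poly (map_poly of_int p) qv = poly (map_poly of_int p') qv" shows "p = p'"
proof (rule poly_eqI)
 have lk: "lookup (poly (map_poly of_int p) qv) (2 * int i) = coeff p i" for p i
 proof -
  have "qv ^ i = qh (2 * int i)" for i by (induction i) (simp_all flip:q_half_add)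
  hence 1: "of_int (coeff p i) * qv ^ i = sgl (2 * int i) (coeff p i)" for i
  by (simp add:q_half_def mult_single flip:single_of_int)
  have "lookup (poly (map_poly of_int p) qv) (2 * int i) =
  (SUM j<=degree (map_poly of_int p :: laurent poly). if j = i then coeff p i else 0)"
  by (auto simp:poly_altdef coeff_map_poly 1 lookup_sum lookup_single when_def)
  also have "... = coeff p i"
  proof -
  have "coeff p i = 0" if "~ i <= degree (map_poly of_int p :: laurent poly)"
  using coeff_eq_0[of "map_poly of_int p :: laurent poly" i] that by (simp add:coeff_map_poly)
  thus ?thesis by auto
  qed
  finally show ?thesis .
 qed
 fix i show "coeff p i = coeff p' i" using lk[of p i] lk[of p' i] assms by simp
qed

text \<open>The difference of two candidates is bar invariant and has coefficient 0 at
  \<open>w\<close>. The degree bound pushes the exponents at any other \<open>u\<close> below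
  \<open>- plen n u\<close>, so \<open>bar_invar_neg_zero\<close> applies.\<close>

lemma kl_family_uniq:
 assumes w: "w:Sym n" and p: "kl_family n w p" and p': "kl_family n w p'"
 shows "p = p'"
proof -
 define s where "s = qh (- int (plen n w))"
 define e where "e = (%p u. if ble n u w then poly (map_poly of_int (p u)) qv else 0 :: laurent)"
 define el where "el = (%p. SUM u:Sym n. scal (s * e p u) (Tw n u))"
 have elfa: "el p:fa n" for p by (simp add:el_def)
 have kl: "kl_element n p w = cls n (el p)" for p
  by (simp add:kl_element_cls el_def e_def s_def)
 have inv: "heq n (abar (el p)) (el p)" if "kl_family n w p" for p
 proof -
  from that obtain f where "bar_involution n f" "f (cls n (el p)) = cls n (el p)"
  unfolding kl_family_def kl by blast
  thus ?thesis using bar_invol_uniq[of n f "el p"] by (simp add:elfa abar_fa cls_eq_iff)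
 qed
 define c where "c = (%u. s * (e p u - e p' u))"
 have diff: "el p - el p' = (SUM u:Sym n. scal (c u) (Tw n u))"
  unfolding el_def c_def sum_subtractf[symmetric]
  by (rule sum.cong) (simp_all add:right_diff_distrib left_diff_distrib single_diff)
 have "heq n (abar (el p - el p')) (el p - el p')"
 proof -
  have "heq n (abar (el p)) (abar (el p - el p') + abar (el p'))"
  using abar_add[of "el p - el p'" n "el p'"] by (simp add:elfa)
  from heq_diff[OF this heq_refl[of n "abar (el p')"]]
  have "heq n (abar (el p - el p')) (abar (el p) - abar (el p'))" by (simp add:heq_sym)
  thus ?thesis using heq_diff[OF inv[OF p] inv[OF p']] heq_trs by blast
 qed
 hence cz: "c u = 0" if "u:Sym n" for u
  unfolding diff
 proof (rule bar_invar_neg_zero[OF _ _ that])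
  fix u k assume u: "u:Sym n" and nz: "lookup (c u) k ~= 0"
  have cu: "c u ~= 0" using nz by auto
  hence b: "ble n u w" by (auto simp:c_def e_def split: if_splits)
  have "p w = p' w" using p p' by (simp add:kl_family_def)
  hence uw: "u ~= w" using cu by (auto simp:c_def e_def split: if_splits)
  have "lookup (c u) k = lookup (e p u - e p' u) (k + int (plen n w))"
  using lookup_mult_q_half[of "e p u - e p' u" "- int (plen n w)" k] by (simp add:c_def s_def mult.commute)
  hence "lookup (e p u) (k + int (plen n w)) ~= 0 \<or> lookup (e p' u) (k + int (plen n w)) ~= 0"
  using nz by (auto simp:lookup_minus)
  hence "k + int (plen n w) <= 2 * int (degree (p u)) \<or> k + int (plen n w) <= 2 * int (degree (p' u))"
  using b by (auto simp:e_def dest:poly_q_var_lookup)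
  moreover have "2 * degree (p u) + 1 + plen n u <= plen n w"
  "2 * degree (p' u) + 1 + plen n u <= plen n w"
  using p p' b uw by (auto simp:kl_family_def)
  ultimately show "k < - int (plen n u)" by linarith
 qed
 hence ce: "e p u = e p' u" if "u:Sym n" for u
 proof -
  have "qh (int (plen n w)) * c u = 0" using that cz by simp
  hence "qh (int (plen n w)) * s * (e p u - e p' u) = 0" by (simp only:c_def mult.assoc)
  thus ?thesis by (simp add:s_def)
 qed
 show ?thesis
 proof
  fix u
  show "p u = p' u"
  proof (cases "ble n u w")
  case True
  thus ?thesis using ce[of u] ble_Sym[OF True] by (auto simp:e_def intro:poly_q_var_inj)
  qed (use p p' in "simp add:kl_family_def")
 qed
qed

text \<open>The indicator of \<open>B\<close>, as a family of constant polynomials, meets the degree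
  bound because a Bruhat-smaller permutation is shorter; the normalization by half the length turns
  \<open>inv\<close> into bar invariance. Uniqueness then identifies the family.\<close>

lemma kl_basis_indic:
 assumes w: "w:B" and B: "!!v. v:B ==> ble n v w"
  and inv: "heq n (abar (SUM v:B. Tw n v)) (scal (qh (- 2 * int (plen n w))) (SUM v:B. Tw n v))"
 shows "hecke_scale n (qh (int (plen n w))) (kl_basis n w) = cls n (SUM v:B. Tw n v)"
proof -
 define s where "s = qh (- int (plen n w))"
 have wp: "w:Sym n" and Bp: "!!v. v:B ==> v:Sym n" using B w ble_Sym by blast+
 have finB: "finite B" using Bp by (meson fin_Sym rev_finite_subset subsetI)
 have Afa: "(SUM v:B. Tw n v):fa n" using Bp by (intro sum_fa) simp
 define p where "p = (%v. if v:B then 1 else 0 :: int poly)"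
 have "(SUM u:Sym n. scal (s * (if ble n u w then poly (map_poly of_int (p u)) qv else 0)) (Tw n u))
  = (SUM u:B. scal (s * (if ble n u w then poly (map_poly of_int (p u)) qv else 0)) (Tw n u))"
  using Bp by (intro sum.mono_neutral_right) (auto simp:p_def)
 also have "... = scal s (SUM v:B. Tw n v)"
  unfolding sum_distrib_left by (rule sum.cong) (simp_all add:p_def B)
 finally have kl: "kl_element n p w = cls n (scal s (SUM v:B. Tw n v))"
  unfolding kl_element_cls s_def by (simp only:)
 have "heq n (abar (scal s (SUM v:B. Tw n v))) (scal (lbar s) (abar (SUM v:B. Tw n v)))"
  by (rule abar_scal[OF Afa])
 also have "heq n ... (scal (lbar s) (scal (qh (- 2 * int (plen n w))) (SUM v:B. Tw n v)))"
  by (rule heq_scal[OF inv])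
 also have "scal (lbar s) (scal (qh (- 2 * int (plen n w))) (SUM v:B. Tw n v)) = scal s (SUM v:B. Tw n v)"
  by (simp add:scal_scal s_def flip:q_half_add)
 finally have inv': "heq n (abar (scal s (SUM v:B. Tw n v))) (scal s (SUM v:B. Tw n v))" .
 have fam: "kl_family n w p"
  unfolding kl_family_def
 proof (intro conjI allI impI)
  fix v assume v: "ble n v w & v ~= w"
  thus "2 * degree (p v) + 1 + plen n v <= plen n w"
  using ble_len[of n v w] by (auto simp:p_def)
 next
  show "EX f. bar_involution n f & f (kl_element n p w) = kl_element n p w"
  using bar_invol_fbar inv' Afa unfolding kl
  by (intro exI[of _ "fbar n"]) (simp add:fbar_cls abar_fa cls_eq_iff)
 qed (use w B in "auto simp:p_def")
 have "(THE p. kl_family n w p) = p"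
  using fam kl_family_uniq[OF wp] by (intro the_equality) auto
 hence "kl_basis n w = cls n (scal s (SUM v:B. Tw n v))"
  by (simp add:kl_basis_def kl_poly_def kl)
 thus ?thesis using Afa
  by (simp add:hk_scl_cls scal_scal s_def)
qed

section \<open>Young subgroups\<close>

text \<open>Permutations of the interval from \<open>a\<close> to \<open>b\<close> that do not move anything across a cut
 between \<open>k\<close> and \<open>k + 1\<close> for \<open>k : F\<close>.\<close>

definition YS :: "nat => nat => nat set => (nat => nat) set" where
 "YS a b F = {u. u permutes {a..b} & (ALL k:F. ALL j. u j <= k <-> j <= k)}"

text \<open>The indices of the simple transpositions that generate \<open>YS a b F\<close>.\<close>

definition links :: "nat => nat => nat set => nat set" where
 "links a b F = {i. a <= i & i < b & i ~: F}"

lemma YS_Sym: "u:YS a b F ==> 1 <= a ==> b <= n ==> u:Sym n"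
 by (auto simp:YS_def Sym_def intro:permutes_subset)

lemma fin_YS [simp]: "finite (YS a b F)"
 by (rule finite_subset[of _ "{u. u permutes {a..b}}"]) (auto simp:YS_def finite_permutations)

lemma id_YS [simp]: "id:YS a b F"
 by (simp add:YS_def)

lemma comp_YS: "u:YS a b F ==> v:YS a b F ==> u o v:YS a b F"
 by (auto simp:YS_def intro:permutes_compose)

lemma pinv_YS: "u:YS a b F ==> pinv u:YS a b F"
 by (auto simp:YS_def intro:permutes_inv) (metis permutes_inverses(1))+

lemma sw_YS: assumes i: "i:links a b F" shows "sw i:YS a b F"
proof -
 note assms
 hence "sw i permutes {a..b}" by (intro permutes_swap_id) (auto simp:links_def)
 moreover have "sw i j <= k <-> j <= k" if "k:F" for j k
  using i that by (cases "i = k") (auto simp:links_def transpose_def)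
 ultimately show ?thesis by (simp add:YS_def)
qed

lemma YS_cut: "u:YS a b F ==> k:F ==> u j <= k <-> j <= k"
 by (simp add:YS_def)

lemma YS_mem: "u:YS a b F ==> u j:{a..b} <-> j:{a..b}"
 using permutes_in_image[of u "{a..b}"] by (simp add:YS_def)

lemma YS_out: "u:YS a b F ==> j ~: {a..b} ==> u j = j"
 unfolding YS_def by (blast dest:permutes_not_in)

lemma YS_descent:
 assumes u: "u:YS a b F" and i: "pinv u (Suc i) < pinv u i"
 shows "i:links a b F"
proof -
 note p = pinv_YS[OF u]
 have "i ~: F" using YS_cut[OF p, of i i] YS_cut[OF p, of i "Suc i"] i by auto
 moreover have "a <= i & i < b"
  using YS_mem[OF p, of i] YS_mem[OF p, of "Suc i"] YS_out[OF p, of i] YS_out[OF p, of "Suc i"] i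
  by (cases "i:{a..b}"; cases "Suc i:{a..b}") auto
 ultimately show ?thesis by (simp add:links_def)
qed

lemma links_sub: "1 <= a ==> b <= n ==> links a b F \<subseteq> {1..<n}"
 by (auto simp:links_def)

text \<open>Induction along a reduced word: by \<open>YS_descent\<close> every left descent of an
  element of the subgroup is a link, so stripping it stays in the subgroup.\<close>

lemma YS_induct [consumes 3, case_names id sw]:
 assumes "1 <= a" "b <= n" "u:YS a b F" "P id"
  and "!!i u. i:links a b F ==> u:YS a b F ==> pinv u i < pinv u (Suc i) ==> P u ==> P (sw i o u)"
 shows "P u"
 using assms(3)
proof (induction "plen n u" arbitrary: u rule:less_induct)
 case less
 have u: "u:Sym n" using YS_Sym[OF less.prems assms(1,2)] .
 show ?case
 proof (cases "u = id")
  case True thus ?thesis using assms(4) by simp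
 next
  case False
  obtain us where us: "rword n u us" using rword_ex[OF u] by blast
  then obtain i us' where "us = i # us'" using False by (cases us) (auto simp:rword_Nil)
  hence i: "i:{1..<n}" "pinv u (Suc i) < pinv u i" using us rword_Cons[OF u] by auto
  have il: "i:links a b F" using YS_descent[OF less.prems i(2)] .
  have v: "sw i o u:YS a b F" using comp_YS[OF sw_YS[OF il] less.prems] .
  have "P (sw i o u)" using less.hyps[OF _ v] plen_sw'[OF u i] by simp
  moreover have "pinv (sw i o u) i < pinv (sw i o u) (Suc i)"
  using i by (simp add:pinv_sw_comp[OF u])
  ultimately have "P (sw i o (sw i o u))" using assms(5)[OF il v] by blast
  thus ?thesis by (simp only:sw_sw_comp)
 qed
qed

lemma YS_closed:
 assumes "1 <= a" "b <= n" "u:YS a b F" "y:Y" "!!i y. i:links a b F ==> y:Y ==> sw i o y:Y"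
 shows "u o y:Y"
 using assms(1-3)
proof (induction rule:YS_induct)
 case (sw i u) show ?case using assms(5)[OF sw(1) sw(4)] by (simp only:comp_assoc)
qed (simp add:assms(4))

lemma YS_red:
 assumes ab: "1 <= a" "b <= n" and u: "u:YS a b F" and us: "rword n u us"
 shows "set us \<subseteq> links a b F"
 using u us
proof (induction us arbitrary: u)
 case (Cons i us)
 have up: "u:Sym n" using YS_Sym[OF Cons.prems(1) ab] .
 have i: "i:{1..<n}" "pinv u (Suc i) < pinv u i" "rword n (sw i o u) us"
  using Cons.prems(2) rword_Cons[OF up] by auto
 have il: "i:links a b F" using YS_descent[OF Cons.prems(1) i(2)] .
 show ?case using Cons.IH[OF comp_YS[OF sw_YS[OF il] Cons.prems(1)] i(3)] il by simp
qed simp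

text \<open>Sorting: exchanging an ascent in adjacent positions decreases the potential.\<close>

lemma YS_sort:
 fixes h :: "nat => 'c::linorder"
 assumes "finite (h ` {a..b})"
 obtains u where "u:YS a b F" "!!i. i:links a b F ==> h (u (Suc i)) <= h (u i)"
proof -
 define r where "r x = card {j:{a..b}. h j < x}" for x
 define G where "G u = (SUM i:{a..b}. i * r (h (u i)))" for u
 have "Min (G ` YS a b F):G ` YS a b F"
  by (intro Min_in finite_imageI fin_YS) (use id_YS[of a b F] in blast)
 then obtain u where u: "u:YS a b F" and m: "G u = Min (G ` YS a b F)" by auto
 have "h (u (Suc i)) <= h (u i)" if i: "i:links a b F" for i
 proof (rule ccontr)
  assume "~ ?thesis"
  hence lt: "h (u i) < h (u (Suc i))" by simp
  have ii: "i:{a..b}" "Suc i:{a..b}" using i by (auto simp:links_def)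
  have "r (h (u i)) < r (h (u (Suc i)))"
  unfolding r_def using lt ii(1) YS_mem[OF u, of i] by (intro psubset_card_mono) auto
  hence less: "i * r (h (u (Suc i))) + Suc i * r (h (u i)) < i * r (h (u i)) + Suc i * r (h (u (Suc i)))"
  by simp
  have split: "(SUM j:{a..b}. f j) = f i + f (Suc i) + (SUM j:{a..b} - {i, Suc i}. f j)" for f :: "nat => nat"
  proof -
  have "{a..b} = insert i (insert (Suc i) ({a..b} - {i, Suc i}))" using ii by auto
  thus ?thesis by (smt (verit, ccfv_SIG) DiffE add.assoc finite_Diff finite_atLeastAtMost finite_insert insertCI insertE n_not_Suc_n sum.insert)
  qed
  have "G (u o sw i) < G u"
  proof -
  have "(SUM j:{a..b} - {i, Suc i}. j * r (h ((u o sw i) j))) = (SUM j:{a..b} - {i, Suc i}. j * r (h (u j)))"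
  by (rule sum.cong) (auto)
  thus ?thesis using less unfolding G_def by (subst (1 2) split) simp
  qed
  moreover have "G u <= G (u o sw i)"
  unfolding m using comp_YS[OF u sw_YS[OF i]] by (intro Min_le) auto
  ultimately show False by simp
 qed
 thus ?thesis using that u by blast
qed

lemma YS_eq_id:
 fixes f :: "nat => 'c::linorder"
 assumes ab: "1 <= a" "b <= n" and u: "u:YS a b F"
  and f: "!!i. a <= i ==> i < b ==> f i < f (Suc i)" and fu: "!!i. a <= i ==> i < b ==> f (u i) < f (u (Suc i))"
 shows "u = id"
proof (rule incr_perm_id)
 show "u:Sym n" by (rule YS_Sym[OF u ab])
 have mono: "f i < f j" if "a <= i" "i < j" "j <= b" for i j
  using that(2,3)
 proof (induction j)
  case (Suc j)
  thus ?case using f[of j] that(1) by (cases "i = j") auto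
 qed simp
 fix i assume "i:{1..<n}"
 show "u i < u (Suc i)"
 proof (cases "i:{a..b} & Suc i:{a..b}")
  case True
  hence "f (u i) < f (u (Suc i))" "u i:{a..b}" "u (Suc i):{a..b}" using fu YS_mem[OF u] by auto
  thus ?thesis using mono[of "u (Suc i)" "u i"] by (metis atLeastAtMost_iff less_irrefl not_less_iff_gr_or_eq order_less_trans)
 next
  case False
  thus ?thesis
  using YS_mem[OF u, of i] YS_mem[OF u, of "Suc i"] YS_out[OF u, of i] YS_out[OF u, of "Suc i"]
  by (cases "i:{a..b}"; cases "Suc i:{a..b}") auto
 qed
qed

section \<open>Absorption\<close>

lemma cof_gen_mult:
 assumes "w:Sym n"
 shows "cof n (gen i * p) w = (if pinv w i < pinv w (Suc i) then qv * cof n p (sw i o w)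
  else (qv - 1) * cof n p w + cof n p (sw i o w))"
proof -
 have "regw w i ~= regw w (Suc i)" using regw_less[of w i "Suc i"] regw_less[of w "Suc i" i] pinv_sw_cases[OF assms, of i] by auto
 thus ?thesis
  using regw_less[of w "Suc i" i]
  by (simp add:cof_def hk_rep.act_mult[OF reg_rep] hk_rep.act_gen[OF reg_rep] tn_op_def[of _ i] regw_sw[OF assms])
qed

text \<open>At a left ascent \<open>w\<close> the coefficient of \<open>gen i * p\<close> is
  \<open>q\<close> times that of \<open>p\<close> at \<open>sw i o w\<close>; at a left descent the
  equation reduces to the same comparison after cancelling \<open>q - 1\<close> times the
  coefficient at \<open>w\<close>.\<close>

lemma absb_cof:
 assumes p: "p:fa n" and i: "i:{1..<n}"
 shows "heq n (gen i * p) (scal qv p) <-> (ALL w:Sym n. cof n p (sw i o w) = cof n p w)"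
proof -
 have gfa: "gen i * p:fa n" "scal qv p:fa n" using p i by (simp_all)
 have 0: "qv ~= 0" using q_half_cancel(2)[of 2] by force
 have sw: "sw i o w:Sym n" if "w:Sym n" for w using that i comp_Sym by simp
 show ?thesis unfolding heq_iff_cof[OF gfa] cof_scal
 proof
  assume L: "ALL w:Sym n. cof n (gen i * p) w = qv * cof n p w"
  show "ALL w:Sym n. cof n p (sw i o w) = cof n p w"
  proof
  fix w assume w: "w:Sym n"
  from pinv_sw_cases[OF w, of i] show "cof n p (sw i o w) = cof n p w"
  proof
  assume "pinv w i < pinv w (Suc i)"
  thus ?thesis using L[rule_format, OF w] 0 by (simp add:cof_gen_mult[OF w])
  next
  assume "pinv w (Suc i) < pinv w i"
  thus ?thesis using L[rule_format, OF w] by (simp add:cof_gen_mult[OF w] algebra_simps)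
  qed
  qed
 qed (auto simp:cof_gen_mult algebra_simps)
qed

lemma cof_indic:
 assumes "B \<subseteq> Sym n" "w:Sym n"
 shows "cof n (SUM v:B. Tw n v) w = (if w:B then 1 else 0)"
proof -
 have "cof n (SUM v:B. Tw n v) w = (SUM v:B. if w = v then 1 else 0)"
  unfolding cof_sum by (rule sum.cong) (use assms in "auto simp:cof_Tw")
 thus ?thesis using finite_subset[OF assms(1)] by simp
qed

lemma indic_fa: "B \<subseteq> Sym n ==> (SUM v:B. Tw n v):fa n"
 by (rule sum_fa) auto

lemma indic_absb:
 assumes "B \<subseteq> Sym n" "i:{1..<n}" "!!v. v:B ==> sw i o v:B"
 shows "heq n (gen i * (SUM v:B. Tw n v)) (scal qv (SUM v:B. Tw n v))"
proof -
 have "sw i o w:B <-> w:B" for w using assms(3)[of w] assms(3)[of "sw i o w"] by auto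
 moreover have "sw i o w:Sym n" if "w:Sym n" for w using assms(2) that comp_Sym by simp
 ultimately show ?thesis
  unfolding absb_cof[OF indic_fa[OF assms(1)] assms(2)] by (simp add:cof_indic[OF assms(1)])
qed

text \<open>Dual to \<open>tn_wd_dl\<close>: evaluation takes place at a descent in every step,
  where \<open>tn_op\<close> has the single term with the factor \<open>q\<close>.\<close>

lemma tn_Tw_eval:
 assumes "u:Sym n" "rhom th"
  and "!!a b. 1 <= a ==> a < b ==> b <= n ==> pinv u b < pinv u a ==> f b < f a"
 shows "act th (tn_op q) (Tw n u) g f = q ^ plen n u * g (f o u)"
proof -
 have "foldr (tn_op q) us g f = q ^ length us * g (f o u)" if "rword n u us" for us
  using assms(1) that assms(3)
 proof (induction us arbitrary: u f)
  case (Cons i us)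
  have i: "i:{1..<n}" "pinv u (Suc i) < pinv u i" "rword n (sw i o u) us"
  using Cons.prems(2) rword_Cons[OF Cons.prems(1)] by auto
  have u': "sw i o u:Sym n" using Cons.prems(1) i comp_Sym by simp
  have "(f o sw i) b < (f o sw i) a"
  if "1 <= a" "a < b" "b <= n" "pinv (sw i o u) b < pinv (sw i o u) a" for a b
  proof -
  have pp: "pinv u (sw i b) < pinv u (sw i a)" using that(4) by (simp add:pinv_sw_comp[OF Cons.prems(1)])
  have "~ (a = i & b = Suc i)" using pp i(2) by auto
  hence "sw i a < sw i b" using that(2) by (auto simp:transpose_def)
  moreover have "1 <= sw i a" "sw i b <= n" using that i(1) by (auto simp:transpose_def)
  ultimately show ?thesis using Cons.prems(3)[OF _ _ _ pp] by simp
  qed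
  hence "foldr (tn_op q) us g (f o sw i) = q ^ length us * g (f o sw i o (sw i o u))"
  by (rule Cons.IH[OF u' i(3)])
  moreover have "f o sw i o (sw i o u) = f o u" by (simp add:fun_eq_iff)
  moreover have "f (Suc i) < f i" using Cons.prems(3)[of i "Suc i"] i by auto
  moreover have "foldr (tn_op q) (i # us) g f = tn_op q i (foldr (tn_op q) us g) f" by simp
  ultimately show ?case by (auto simp:tn_op_def[of q i] simp del:comp_apply)
 qed (simp add:rword_Nil)
 from this[OF rword_red[OF assms(1)]] show ?thesis
  by (simp add:act_def rhom_simps[OF assms(2)] len_red[OF assms(1)])
qed

section \<open>Products of stars\<close>

lemma YS_inversion_range:
 assumes u: "u:YS a b F" and xy: "x < y" "u y < u x"
 shows "x:{a..b}" "y:{a..b}"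
 using YS_mem[OF u, of x] YS_mem[OF u, of y] YS_out[OF u, of x] YS_out[OF u, of y] xy
 by (cases "x:{a..b}"; cases "y:{a..b}"; auto)+

definition "star n c d = (SUM u:YS c d {}. Tw n u)"

text \<open>The Poincare polynomial of the Young subgroup.\<close>

definition "poin n c d F = (SUM u:YS c d F. qv ^ plen n u)"

definition sprod :: "nat => nat => (nat => nat) set => (nat => nat) set" where
 "sprod c d B = {u o v | u v. u:YS c d {} & v:B}"

definition "ind n B = (SUM v:B. Tw n v)"

lemma YS_sub_Sym: "1 <= a ==> b <= n ==> YS a b F \<subseteq> Sym n"
 using YS_Sym by blast

lemma strict_mono_links:
 fixes f :: "nat => 'c::order"
 assumes "!!i. c <= i ==> i < d ==> f i < f (Suc i)" "c <= x" "x < y" "y <= d"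
 shows "f x < f y"
 using assms(3,4)
proof (induction y)
 case (Suc y)
 thus ?case using assms(1)[of y] assms(2) by (cases "x = y") (auto intro:order.strict_trans)
qed simp

lemma star_absb:
 assumes "1 <= c" "d <= n" "i:links c d {}" "p:fa n"
 shows "heq n (gen i * (star n c d * p)) (scal qv (star n c d * p))"
proof -
 have i: "i:{1..<n}" using links_sub assms by blast
 have "heq n (gen i * star n c d) (scal qv (star n c d))"
  unfolding star_def
  by (rule indic_absb[OF YS_sub_Sym[OF assms(1,2)] i]) (rule comp_YS[OF sw_YS[OF assms(3)]])
 from heq_mult_r[OF this assms(4)] show ?thesis by (simp only:mult.assoc)
qed

text \<open>One star on \<open>{c..d}\<close> is multiplied onto the sum over \<open>B\<close>.
  Earlier stars overlap it in \<open>{c..L}\<close> and \<open>{R..d}\<close>: \<open>B\<close>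
  respects the cuts from \<open>L\<close> to \<open>R - 1\<close> and is closed under left
  multiplication by permutations of the two overlaps. \<open>L = c - 1\<close> and
  \<open>R = Suc d\<close> stand for an empty overlap.\<close>

locale star_step =
 fixes n c d L R :: nat and B :: "(nat => nat) set"
 assumes c: "1 <= c" and d: "d <= n" and LR: "c - 1 <= L" "L < R" "R <= Suc d"
  and B: "B \<subseteq> YS 1 n {L..<R}"
  and absorb: "!!i v. i:links c d {L..<R} ==> v:B ==> sw i o v:B"
begin

lemma Bp: "v:B ==> v:Sym n"
 using B YS_Sym[of v 1 n] by auto

lemma SIp: "u:YS c d F ==> u:Sym n"
 using YS_Sym c d by blast

lemma B_closed: "u:YS c d {L..<R} ==> v:B ==> u o v:B"
 using YS_closed[OF c d _ _ absorb] by blast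

text \<open>At a cut, an element of \<open>B\<close> keeps \<open>i\<close> and \<open>Suc i\<close>
  on different sides, so they are in order. Hence minimality for the overlap subgroup is minimality
  for the whole interval.\<close>

lemma B_incr:
 assumes v: "v:B" and inc: "!!i. i:links c d {L..<R} ==> pinv v i < pinv v (Suc i)"
  and i: "c <= i" "i < d"
 shows "pinv v i < pinv v (Suc i)"
proof (cases "i:{L..<R}")
 case True
 have "pinv v:YS 1 n {L..<R}" using v B pinv_YS by blast
 thus ?thesis using YS_cut[of "pinv v" 1 n _ i i] YS_cut[of "pinv v" 1 n _ i "Suc i"] True by fastforce
next
 case False thus ?thesis using inc i by (simp add:links_def)
qed

lemma sort_l:
 assumes w: "w:Sym n"
 obtains u where "u:YS c d F" "!!i. i:links c d F ==> pinv (u o w) i < pinv (u o w) (Suc i)"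
proof -
 obtain u where u: "u:YS c d F" and s: "!!i. i:links c d F ==> - int (pinv w (u (Suc i))) <= - int (pinv w (u i))"
  by (rule YS_sort[of "%k. - int (pinv w k)" c d F]) auto
 have up: "u:Sym n" by (rule SIp[OF u])
 have p: "pinv u:YS c d F" by (rule pinv_YS[OF u])
 have eq: "pinv (pinv u o w) = pinv w o u"
  using pinv_comp_dis[OF pinv_Sym[OF up] w] by (simp add:inv_inv_eq permutes_bij[OF permsD[OF up]])
 have "pinv (pinv u o w) i < pinv (pinv u o w) (Suc i)" if "i:links c d F" for i
 proof -
  have "u i ~= u (Suc i)" using Sym_inj[OF up] by (metis injD n_not_Suc_n)
  hence "pinv w (u i) ~= pinv w (u (Suc i))" using Sym_inj[OF pinv_Sym[OF w]] by (metis injD)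
  thus ?thesis using s[OF that] by (simp add:eq)
 qed
 thus ?thesis using that p by blast
qed

lemma coset_min_uniq:
 assumes w: "w:Sym n" and u: "u:YS c d {}"
  and "!!i. c <= i ==> i < d ==> pinv w i < pinv w (Suc i)"
  and "!!i. c <= i ==> i < d ==> pinv (u o w) i < pinv (u o w) (Suc i)"
 shows "u = id"
proof -
 have up: "u:Sym n" by (rule SIp[OF u])
 have "pinv u = id"
  by (rule YS_eq_id[OF c d pinv_YS[OF u], of "pinv w"])
  (use assms(3,4) in "simp_all add:pinv_comp_dis[OF up w]")
 thus ?thesis using pinv_comp(2)[OF up] by simp
qed

text \<open>Sort \<open>u o v\<close> by some \<open>k\<close> in the overlap subgroup. The result
  lies in \<open>B\<close> and is minimal in the coset of \<open>v\<close>, as is \<open>v\<close>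
  itself; uniqueness of the minimal element forces \<open>k o u = id\<close>.\<close>

lemma coset_mem:
 assumes v: "v:Sym n" and inc: "!!i. c <= i ==> i < d ==> pinv v i < pinv v (Suc i)"
  and u: "u:YS c d {}" and mem: "u o v:B"
 shows "v:B" "u:YS c d {L..<R}"
proof -
 have uv: "u o v:Sym n" using comp_Sym SIp[OF u] v by blast
 obtain k where k: "k:YS c d {L..<R}"
  and kinc: "!!i. i:links c d {L..<R} ==> pinv (k o (u o v)) i < pinv (k o (u o v)) (Suc i)"
  using sort_l[OF uv] by blast
 have kB: "k o (u o v):B" by (rule B_closed[OF k mem])
 have k': "k:YS c d {}" using k by (simp add:YS_def)
 have "k o u = id"
 proof (rule coset_min_uniq[OF v comp_YS[OF k' u] inc])
  fix i assume "c <= i" "i < d"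
  from B_incr[OF kB kinc this] show "pinv (k o u o v) i < pinv (k o u o v) (Suc i)"
  by (simp only:comp_assoc)
 qed simp_all
 hence ku: "k o u = id" .
 thus "v:B" using kB by (simp add:comp_assoc[symmetric])
 have "pinv k = u" using ku by (intro inv_unique_comp) (simp_all, metis SIp[OF k] pinv_comp(1) comp_assoc comp_id id_comp left_right_inverse_eq)
 thus "u:YS c d {L..<R}" using pinv_YS[OF k] by simp
qed

lemma sprod_Sym: "sprod c d B \<subseteq> Sym n"
 using Bp SIp comp_Sym by (auto simp:sprod_def)

lemma sprod_closed: "u:YS c d {} ==> v:sprod c d B ==> u o v:sprod c d B"
 by (auto simp:sprod_def) (metis comp_YS comp_assoc)

text \<open>Each product is reached once for every element of the overlap subgroup, and weighted by
  length this multiplicity is a Poincare polynomial. Both sides absorb \<open>gen i\<close> on the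
  left, so coefficients are compared only at minimal elements of cosets of
  \<open>YS c d {}\<close>.\<close>

theorem star_ind_mult: "heq n (star n c d * ind n B) (scal (poin n c d {L..<R}) (ind n (sprod c d B)))"
proof -
 have Bsub: "B \<subseteq> Sym n" using Bp by blast
 have Afa: "ind n B:fa n" unfolding ind_def by (rule indic_fa[OF Bsub])
 have starfa: "star n c d:fa n" unfolding star_def by (rule indic_fa[OF YS_sub_Sym[OF c d]])
 define X where "X = star n c d * ind n B"
 have Xfa: "X:fa n" unfolding X_def by (rule mult_fa[OF starfa Afa])
 have inv: "cof n X (u o w) = cof n X w" if "u:YS c d {}" "w:Sym n" for u w
 proof -
  have "u o w:{y:Sym n. cof n X y = cof n X w}"
  proof (rule YS_closed[OF c d that(1)])
  fix i y assume i: "i:links c d {}" and y: "y:{y:Sym n. cof n X y = cof n X w}"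
  have i': "i:{1..<n}" using i links_sub[OF c d] by blast
  have "cof n X (sw i o y) = cof n X y"
  using star_absb[OF c d i Afa] y unfolding absb_cof[OF Xfa[unfolded X_def] i'] X_def by blast
  thus "sw i o y:{y:Sym n. cof n X y = cof n X w}"
  using y i' comp_Sym[OF sw_Sym] by simp
  qed (use that in simp)
  thus ?thesis by simp
 qed
 have main: "cof n X v = poin n c d {L..<R} * (if v:sprod c d B then 1 else 0)"
  if v: "v:Sym n" and inc: "!!i. c <= i ==> i < d ==> pinv v i < pinv v (Suc i)" for v
 proof -
  \<comment> \<open>The letters of \<open>regw v\<close> decrease along \<open>{c..d}\<close>, so
    \<open>tn_Tw_eval\<close> isolates a single coefficient of \<open>ind n B\<close>, the one at
    \<open>pinv u o v\<close>.\<close>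
  have summand: "cof n (Tw n u * ind n B) v = (if u:YS c d {L..<R} & v:B then qv ^ plen n u else 0)"
  if u: "u:YS c d {}" for u
  proof -
  have up: "u:Sym n" by (rule SIp[OF u])
  have uv: "pinv u o v:Sym n" using comp_Sym[OF pinv_Sym[OF up] v] .
  have "regw v o u = regw (pinv u o v)"
  using pinv_comp_dis[OF pinv_Sym[OF up] v]
  by (simp add:regw_def comp_assoc inv_inv_eq permutes_bij[OF permsD[OF up]])
  moreover have "reg (Tw n u) (reg (ind n B) (dl base)) (regw v) =
  qv ^ plen n u * reg (ind n B) (dl base) (regw v o u)"
  proof (rule tn_Tw_eval[OF up rhom_id])
  fix a b assume ab: "a < b" "pinv u b < pinv u a"
  have "a:{c..d}" "b:{c..d}" using YS_inversion_range[OF pinv_YS[OF u] ab] by auto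
  hence "pinv v a < pinv v b" using ab(1) by (intro strict_mono_links[of c d "pinv v", OF inc]) auto
  thus "regw v b < regw v a" by (simp add:regw_less)
  qed
  ultimately have "cof n (Tw n u * ind n B) v = qv ^ plen n u * cof n (ind n B) (pinv u o v)"
  by (simp add:cof_def hk_rep.act_mult[OF reg_rep])
  also have "cof n (ind n B) (pinv u o v) = (if pinv u o v:B then 1 else 0)"
  unfolding ind_def by (rule cof_indic[OF Bsub uv])
  also have "pinv u o v:B <-> u:YS c d {L..<R} & v:B"
  proof
  assume "pinv u o v:B"
  from coset_mem[OF v inc pinv_YS[OF u] this] have "v:B" "pinv u:YS c d {L..<R}" by auto
  thus "u:YS c d {L..<R} & v:B"
  using pinv_YS[of "pinv u"] by (simp add:inv_inv_eq permutes_bij[OF permsD[OF up]])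
  qed (use B_closed pinv_YS in blast)
  finally show ?thesis by simp
  qed
  have vB: "v:sprod c d B <-> v:B"
  proof
  assume "v:sprod c d B"
  then obtain u b where ub: "u:YS c d {}" "b:B" "v = u o b" by (auto simp:sprod_def)
  hence "pinv u o v = b" using SIp[OF ub(1)] by (simp add:comp_assoc[symmetric])
  thus "v:B" using coset_mem(1)[OF v inc pinv_YS[OF ub(1)]] ub by simp
  next
  assume "v:B" thus "v:sprod c d B" unfolding sprod_def by (intro CollectI exI[of _ id] exI[of _ v]) simp
  qed
  have "cof n X v = (SUM u:YS c d {}. cof n (Tw n u * ind n B) v)"
  by (simp add:X_def star_def sum_distrib_right cof_sum)
  also have "... = (SUM u:YS c d {}. if u:YS c d {L..<R} & v:B then qv ^ plen n u else 0)"
  by (rule sum.cong) (simp_all add:summand)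
  also have "... = (SUM u:YS c d {L..<R}. if v:B then qv ^ plen n u else 0)"
  proof (rule sum.mono_neutral_cong_right)
  show "YS c d {L..<R} \<subseteq> YS c d {}" by (auto simp:YS_def)
  qed auto
  also have "... = poin n c d {L..<R} * (if v:sprod c d B then 1 else 0)"
  by (simp add:vB poin_def)
  finally show ?thesis .
 qed
 have sfa: "ind n (sprod c d B):fa n" unfolding ind_def by (rule indic_fa[OF sprod_Sym])
 have "ALL w:Sym n. cof n X w = cof n (scal (poin n c d {L..<R}) (ind n (sprod c d B))) w"
 proof
  fix w assume w: "w:Sym n"
  obtain u where u: "u:YS c d {}" and inc: "!!i. i:links c d {} ==> pinv (u o w) i < pinv (u o w) (Suc i)"
  using sort_l[OF w] by blast
  have uw: "u o w:Sym n" by (rule comp_Sym[OF SIp[OF u] w])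
  have "cof n X w = cof n X (u o w)" using inv[OF u w] by simp
  also have "... = poin n c d {L..<R} * (if u o w:sprod c d B then 1 else 0)"
  by (rule main[OF uw]) (rule inc, simp add:links_def)
  also have "u o w:sprod c d B <-> w:sprod c d B"
  proof
  assume "u o w:sprod c d B"
  from sprod_closed[OF pinv_YS[OF u] this] show "w:sprod c d B"
  using SIp[OF u] by (simp add:comp_assoc[symmetric])
  qed (rule sprod_closed[OF u])
  finally show "cof n X w = cof n (scal (poin n c d {L..<R}) (ind n (sprod c d B))) w"
  unfolding cof_scal ind_def by (simp only:cof_indic[OF sprod_Sym w])
 qed
 thus ?thesis
  using heq_iff_cof[OF Xfa scal_fa[OF sfa]] by (simp add:X_def)
qed

text \<open>The identity alone contributes the exponent 0, so the constant coefficient is 1.\<close>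

lemma poin_nz: "poin n c d {L..<R} ~= 0"
proof -
 have "qv ^ k = qh (2 * int k)" for k
  by (induction k) (simp_all flip:q_half_add)
 moreover have "plen n u = 0 ==> u = id" if "u:YS c d {L..<R}" for u
  using plen_0[OF SIp[OF that]] by blast
 ultimately have "lookup (poin n c d {L..<R}) 0 = (SUM u:YS c d {L..<R}. if u = id then 1 else 0)"
  unfolding poin_def lookup_sum by (intro sum.cong) (auto simp:q_half_def when_def)
 thus ?thesis by auto
qed

end

section \<open>Zig-zag sequences\<close>

text \<open>The conditions on zig-zag sequences without the covering of \<open>{1..n}\<close>, so
  that they pass to initial segments and allow induction on the last interval.\<close>

definition zz :: "nat => cell list => bool" where
 "zz n Is <->
  (ALL I:set Is. 1 <= fst I & fst I <= snd I & snd I <= n) &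
  distinct Is &
  (ALL I:set Is. ALL J:set Is. I ~= J --> ~ ivl I \<subseteq> ivl J) &
  (ALL i j k. i < j & j < k & k < length Is &
  ivl (Is ! i) Int ivl (Is ! j) ~= {} & ivl (Is ! j) Int ivl (Is ! k) ~= {} -->
  (fst (Is ! i) < fst (Is ! j) & fst (Is ! j) < fst (Is ! k)) \<or>
  (fst (Is ! i) > fst (Is ! j) & fst (Is ! j) > fst (Is ! k)))"

lemma zigzag_seq_zz: "zzseq n Is <-> zz n Is & (UN I:set Is. ivl I) = {1..n}"
 unfolding zigzag_sequence_def zz_def by blast

lemma zz_valid: "zz n Is ==> I:set Is ==> 1 <= fst I & fst I <= snd I & snd I <= n"
 by (simp add:zz_def)

lemma zz_nest: "zz n Is ==> I:set Is ==> J:set Is ==> fst I < fst J ==> snd I < snd J"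
 by (rule ccontr) (auto simp:zz_def ivl_def, metis atLeastatMost_subset_iff less_or_eq_imp_le linorder_not_less order_less_irrefl)

lemma zz_fst_eq: "zz n Is ==> I:set Is ==> J:set Is ==> fst I = fst J ==> I = J"
 by (auto simp:zz_def ivl_def) (metis linorder_le_cases)

lemma zz_triple:
 assumes "zz n Is" "i < j" "j < k" "k < length Is"
  "ivl (Is ! i) Int ivl (Is ! j) ~= {}" "ivl (Is ! j) Int ivl (Is ! k) ~= {}"
 shows "(fst (Is ! i) < fst (Is ! j) & fst (Is ! j) < fst (Is ! k)) \<or>
  (fst (Is ! i) > fst (Is ! j) & fst (Is ! j) > fst (Is ! k))"
 using assms unfolding zz_def by blast

lemma zz_butlast: "zz n (Is @ [I]) ==> zz n Is"
 unfolding zz_def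
proof (elim conjE, intro conjI)
 assume a: "ALL i j k. i < j & j < k & k < length (Is @ [I]) &
  ivl ((Is @ [I]) ! i) Int ivl ((Is @ [I]) ! j) ~= {} & ivl ((Is @ [I]) ! j) Int ivl ((Is @ [I]) ! k) ~= {} -->
  fst ((Is @ [I]) ! i) < fst ((Is @ [I]) ! j) & fst ((Is @ [I]) ! j) < fst ((Is @ [I]) ! k) \<or>
  fst ((Is @ [I]) ! j) < fst ((Is @ [I]) ! i) & fst ((Is @ [I]) ! k) < fst ((Is @ [I]) ! j)"
 show "ALL i j k. i < j & j < k & k < length Is &
  ivl (Is ! i) Int ivl (Is ! j) ~= {} & ivl (Is ! j) Int ivl (Is ! k) ~= {} -->
  fst (Is ! i) < fst (Is ! j) & fst (Is ! j) < fst (Is ! k) \<or>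
  fst (Is ! j) < fst (Is ! i) & fst (Is ! k) < fst (Is ! j)"
 proof (intro allI impI)
  fix i j k assume h: "i < j & j < k & k < length Is &
  ivl (Is ! i) Int ivl (Is ! j) ~= {} & ivl (Is ! j) Int ivl (Is ! k) ~= {}"
  hence "(Is @ [I]) ! i = Is ! i" "(Is @ [I]) ! j = Is ! j" "(Is @ [I]) ! k = Is ! k"
  by (auto simp:nth_append)
  thus "fst (Is ! i) < fst (Is ! j) & fst (Is ! j) < fst (Is ! k) \<or>
  fst (Is ! j) < fst (Is ! i) & fst (Is ! k) < fst (Is ! j)"
  using a[rule_format, of i j k] h by simp
 qed
qed auto

text \<open>How \<open>I\<close> meets the earlier intervals: \<open>L\<close> is the right end of
  the overlap with those starting to its left, \<open>R\<close> the left end of the overlap with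
  those starting to its right. The last two clauses name an earlier interval that realizes the
  overlap and say that no later one touches it.\<close>

definition "zcut Is I L R <-> fst I - 1 <= L & L < R & R <= Suc (snd I) &
  (ALL J:set Is. (fst J < fst I & snd J <= L) \<or> (fst I < fst J & R <= fst J)) &
  (fst I <= L --> (EX j<length Is. snd (Is ! j) = L & fst (Is ! j) < fst I &
  (ALL l. j < l & l < length Is --> ivl (Is ! l) Int {fst I..L} = {}))) &
  (R <= snd I --> (EX j<length Is. fst (Is ! j) = R & snd I < snd (Is ! j) &
  (ALL l. j < l & l < length Is --> ivl (Is ! l) Int {R..snd I} = {})))"

lemma zz_cuts:
 assumes z: "zz n (Is @ [I])"
 obtains L R where "zcut Is I L R"
proof -
 obtain c d where I: "I = (c, d)" by (cases I)
 have valid: "1 <= fst J" "fst J <= snd J" if "J:set Is" for J using zz_valid[OF z] that by auto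
 have cd: "1 <= c" "c <= d" using zz_valid[OF z, of I] I by auto
 have nin: "I ~: set Is" using z by (auto simp:zz_def)
 have ne: "fst J ~= c" if "J:set Is" for J using zz_fst_eq[OF z, of J I] that nin I by auto
 have lt: "snd J < d" if "J:set Is" "fst J < c" for J using zz_nest[OF z, of J I] that I by auto
 have gt: "d < snd J" if "J:set Is" "c < fst J" for J using zz_nest[OF z, of I J] that I by auto
 define SL where "SL = insert (c - 1) (snd ` {J:set Is. fst J < c})"
 define SR where "SR = insert (Suc d) (fst ` {J:set Is. c < fst J})"
 define L where "L = Max SL"
 define R where "R = Min SR"
 have fin: "finite SL" "finite SR" "SL ~= {}" "SR ~= {}" by (auto simp:SL_def SR_def)
 have LS: "L:SL" and RS: "R:SR" using fin by (auto simp:L_def R_def)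
 have Lm: "x <= L" if "x:SL" for x using that fin by (simp add:L_def)
 have Rm: "R <= x" if "x:SR" for x using that fin by (simp add:R_def)
 have ge: "c - 1 <= L" "R <= Suc d" using Lm[of "c - 1"] Rm[of "Suc d"] by (auto simp:SL_def SR_def)
 have side: "(fst J < c & snd J <= L) \<or> (c < fst J & R <= fst J)" if "J:set Is" for J
  using ne[OF that] Lm[of "snd J"] Rm[of "fst J"] that by (cases "fst J < c") (auto simp:SL_def SR_def)
 have triple: "(fst (Is ! i) < fst (Is ! j) & fst (Is ! j) < c) \<or> (fst (Is ! i) > fst (Is ! j) & fst (Is ! j) > c)"
  if "i < j" "j < length Is" "ivl (Is ! i) Int ivl (Is ! j) ~= {}" "ivl (Is ! j) Int {c..d} ~= {}" for i j
  using zz_triple[OF z, of i j "length Is"] that I by (simp add:nth_append ivl_def)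
 have L_cases: "L = c - 1 \<or> (EX J:set Is. fst J < c & snd J = L)" using LS by (auto simp:SL_def)
 have R_cases: "R = Suc d \<or> (EX J:set Is. c < fst J & fst J = R)" using RS by (auto simp:SR_def)
 have Ld: "L < Suc d"
  using L_cases
 proof (elim disjE bexE conjE)
  fix J assume "J:set Is" "fst J < c" "snd J = L"
  thus ?thesis using lt[of J] by simp
 qed (use cd in simp)
 have cR: "c < R" using R_cases cd by auto
 \<comment> \<open>If a left and a right neighbour of \<open>I\<close> overlapped, the later of the
   two would be the middle interval of a triple ending in \<open>I\<close>, with an extremal left
   endpoint, against the monotonicity of left endpoints.\<close>
 have LR: "L < R"
 proof (rule ccontr)
  assume "~ L < R"
  then obtain J J' where J: "J:set Is" "fst J < c" "snd J = L" and J': "J':set Is" "c < fst J'" "fst J' = R"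
  using L_cases R_cases Ld cR by fastforce
  then obtain i j where ij: "i < length Is" "Is ! i = J" "j < length Is" "Is ! j = J'" by (auto simp:in_set_conv_nth)
  have "R <= L" using \<open>~ L < R\<close> by simp
  have int: "ivl J Int ivl J' ~= {}" "ivl J Int {c..d} ~= {}" "ivl J' Int {c..d} ~= {}"
  proof -
  have "fst J':ivl J Int ivl J'" "c:ivl J Int {c..d}" "fst J':ivl J' Int {c..d}"
  using J J' \<open>R <= L\<close> valid[OF J'(1)] cd cR lt[OF J(1,2)] by (auto simp:ivl_def)
  thus "ivl J Int ivl J' ~= {}" "ivl J Int {c..d} ~= {}" "ivl J' Int {c..d} ~= {}" by blast+
  qed
  have "i ~= j" using ij J J' by auto
  then consider "i < j" | "j < i" by linarith
  thus False
  proof cases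
  case 1
  from triple[OF 1] show False using ij int J J' by auto
  next
  case 2
  from triple[OF 2] show False using ij int J J' by (auto)
  qed
 qed
 have left: "EX j<length Is. snd (Is ! j) = L & fst (Is ! j) < c &
  (ALL l. j < l & l < length Is --> ivl (Is ! l) Int {c..L} = {})" if "c <= L"
 proof -
  obtain j where j: "j < length Is" "snd (Is ! j) = L" "fst (Is ! j) < c"
  proof -
  have "L ~= c - 1" using \<open>c <= L\<close> cd by simp
  then obtain J where "J:set Is" "fst J < c" "snd J = L" using L_cases by blast
  thus ?thesis using that by (auto simp:in_set_conv_nth)
  qed
  \<comment> \<open>An interval after \<open>j\<close> that meets the overlap would start between
    \<open>Is ! j\<close> and \<open>I\<close>, hence by non-nesting end beyond
    \<open>L\<close>.\<close>
  have "ivl (Is ! l) Int {c..L} = {}" if l: "j < l" "l < length Is" for l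
  proof (rule ccontr)
  assume ne0: "ivl (Is ! l) Int {c..L} ~= {}"
  have "{c..L} \<subseteq> ivl (Is ! j)" "{c..L} \<subseteq> {c..d}" using j Ld by (auto simp:ivl_def)
  hence *: "ivl (Is ! j) Int ivl (Is ! l) ~= {}" "ivl (Is ! l) Int {c..d} ~= {}" using ne0 by blast+
  have m: "Is ! j:set Is" "Is ! l:set Is" using l by auto
  from triple[OF l *] j(3) have "fst (Is ! j) < fst (Is ! l)" "fst (Is ! l) < c" by auto
  hence "snd (Is ! j) < snd (Is ! l)" "snd (Is ! l) <= L"
  using zz_nest[OF z, of "Is ! j" "Is ! l"] side[OF m(2)] m by auto
  thus False using j by simp
  qed
  thus ?thesis using j by blast
 qed
 have right: "EX j<length Is. fst (Is ! j) = R & d < snd (Is ! j) &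
  (ALL l. j < l & l < length Is --> ivl (Is ! l) Int {R..d} = {})" if "R <= d"
 proof -
  obtain j where j: "j < length Is" "fst (Is ! j) = R" "c < fst (Is ! j)"
  proof -
  have "R ~= Suc d" using \<open>R <= d\<close> by simp
  then obtain J where "J:set Is" "c < fst J" "fst J = R" using R_cases by blast
  thus ?thesis using that by (auto simp:in_set_conv_nth)
  qed
  have jd: "d < snd (Is ! j)" using gt j by auto
  have "ivl (Is ! l) Int {R..d} = {}" if l: "j < l" "l < length Is" for l
  proof (rule ccontr)
  assume ne0: "ivl (Is ! l) Int {R..d} ~= {}"
  have "{R..d} \<subseteq> ivl (Is ! j)" "{R..d} \<subseteq> {c..d}" using j jd by (auto simp:ivl_def)
  hence *: "ivl (Is ! j) Int ivl (Is ! l) ~= {}" "ivl (Is ! l) Int {c..d} ~= {}" using ne0 by blast+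
  have m: "Is ! l:set Is" using l by auto
  from triple[OF l *] j(3) have "fst (Is ! l) < fst (Is ! j)" "c < fst (Is ! l)" by auto
  thus False using side[OF m] j by auto
  qed
  thus ?thesis using j jd by blast
 qed
 have "zcut Is I L R" unfolding zcut_def I using ge LR side left right by simp
 thus ?thesis by (rule that)
qed

section \<open>Sets of permutations that support products of stars\<close>

definition "Bz Is = foldl (%B I. sprod (fst I) (snd I) B) {id} Is"

text \<open>Later stars multiply on the left, just as later reversals in \<open>zigzag_perm\<close>
  are applied last.\<close>

lemma Bz_Nil [simp]: "Bz [] = {id}"
 and Bz_snoc [simp]: "Bz (Is @ [I]) = sprod (fst I) (snd I) (Bz Is)"
 by (simp_all add:Bz_def)

lemma YS_interval_cut:
 assumes "u:YS a b {}" "b <= k \<or> k < a" shows "u j <= k <-> j <= k"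
 using YS_mem[OF assms(1), of j] YS_out[OF assms(1), of j] assms(2) by (cases "j:{a..b}") auto

lemma Bz_cut:
 assumes "!!J. J:set Is ==> 1 <= fst J & snd J <= n"
  and "!!J k. J:set Is ==> k:F ==> snd J <= k \<or> k < fst J"
 shows "Bz Is \<subseteq> YS 1 n F"
 using assms
proof (induction Is rule:rev_induct)
 case (snoc I Is)
 have "u o v:YS 1 n F" if u: "u:YS (fst I) (snd I) {}" and v: "v:Bz Is" for u v
 proof (rule comp_YS)
  show "v:YS 1 n F" using snoc v by auto
  have "u permutes {1..n}" using YS_Sym[OF u, of n] snoc.prems(1)[of I] by (auto simp:Sym_def)
  thus "u:YS 1 n F" using YS_interval_cut[OF u snoc.prems(2)[of I]] by (simp add:YS_def)
 qed
 thus ?case by (auto simp:sprod_def)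
qed simp

text \<open>The last star that meets \<open>i\<close> or \<open>Suc i\<close> contains both. Then
  \<open>sw i\<close> commutes with all later factors and is absorbed by this one, so
  \<open>Bz Is\<close> is closed under it.\<close>

definition "absl Is i <-> (EX j<length Is. i:ivl (Is ! j) & Suc i:ivl (Is ! j) &
  (ALL l. j < l & l < length Is --> i ~: ivl (Is ! l) & Suc i ~: ivl (Is ! l)))"

lemma absl_snoc:
 assumes "absl (Is @ [I]) i"
 shows "(i:ivl I & Suc i:ivl I) \<or> (i ~: ivl I & Suc i ~: ivl I & absl Is i)"
proof -
 obtain j where j: "j < Suc (length Is)" "i:ivl ((Is @ [I]) ! j)" "Suc i:ivl ((Is @ [I]) ! j)"
  and l: "!!l. j < l ==> l < Suc (length Is) ==> i ~: ivl ((Is @ [I]) ! l) & Suc i ~: ivl ((Is @ [I]) ! l)"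
  using assms unfolding absl_def by auto
 show ?thesis
 proof (cases "j = length Is")
  case True thus ?thesis using j by simp
 next
  case False
  hence "j < length Is" using j by simp
  moreover have "i ~: ivl (Is ! l) & Suc i ~: ivl (Is ! l)" if "j < l" "l < length Is" for l
  using l[of l] that by (simp add:nth_append)
  ultimately have "absl Is i" unfolding absl_def
  using j by (intro exI[of _ j]) (simp add:nth_append)
  thus ?thesis using l[of "length Is"] \<open>j < length Is\<close> by simp
 qed
qed

lemma absl_Bz:
 assumes "absl Is i" "v:Bz Is" shows "sw i o v:Bz Is"
 using assms
proof (induction Is arbitrary: v rule:rev_induct)
 case Nil thus ?case by (simp add:absl_def)
next
 case (snoc I Is)
 then obtain u x where v: "v = u o x" "u:YS (fst I) (snd I) {}" "x:Bz Is" by (auto simp:sprod_def)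
 from absl_snoc[OF snoc.prems(1)] show ?case
 proof
  assume "i:ivl I & Suc i:ivl I"
  hence "sw i:YS (fst I) (snd I) {}" by (intro sw_YS) (auto simp:links_def ivl_def)
  hence "sw i o u:YS (fst I) (snd I) {}" using v comp_YS by blast
  thus ?thesis using v(3) unfolding Bz_snoc sprod_def v(1) mem_Collect_eq
  by (intro exI[of _ "sw i o u"] exI[of _ x]) (simp only:comp_assoc simp_thms)
 next
  assume a: "i ~: ivl I & Suc i ~: ivl I & absl Is i"
  hence fx: "u i = i" "u (Suc i) = Suc i" using YS_out[OF v(2)] by (auto simp:ivl_def)
  have inj: "u x = u y <-> x = y" for x y
  using v(2) by (auto simp:YS_def dest:permutes_inj injD)
  have "sw i o u = u o sw i"
  proof
  fix x show "(sw i o u) x = (u o sw i) x"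
  using fx inj[of x i] inj[of x "Suc i"] by (auto)
  qed
  hence "sw i o v = u o (sw i o x)" unfolding v by (simp add:comp_assoc[symmetric])
  thus ?thesis using snoc.IH[of x] a v unfolding Bz_snoc sprod_def by blast
 qed
qed

lemma zcut_absl:
 assumes "zcut Is I L R" "i:links (fst I) (snd I) {L..<R}" shows "absl Is i"
proof -
 have i: "fst I <= i" "i < snd I" "i < L \<or> R <= i" using assms(2) by (auto simp:links_def)
 then consider "i < L" | "R <= i" by blast
 thus ?thesis
 proof cases
  case 1
  hence "fst I <= L" using i by simp
  then obtain j where "j < length Is" "snd (Is ! j) = L" "fst (Is ! j) < fst I"
  "!!l. j < l ==> l < length Is ==> ivl (Is ! l) Int {fst I..L} = {}"
  using assms(1) unfolding zcut_def by blast
  thus ?thesis unfolding absl_def using i 1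
  by (intro exI[of _ j]) (fastforce simp:ivl_def)
 next
  case 2
  hence "R <= snd I" using i by simp
  then obtain j where "j < length Is" "fst (Is ! j) = R" "snd I < snd (Is ! j)"
  "!!l. j < l ==> l < length Is ==> ivl (Is ! l) Int {R..snd I} = {}"
  using assms(1) unfolding zcut_def by blast
  thus ?thesis unfolding absl_def using i 2
  by (intro exI[of _ j]) (fastforce simp:ivl_def)
 qed
qed

lemma zcut_cut: "zcut Is I L R ==> J:set Is ==> k:{L..<R} ==> snd J <= k \<or> k < fst J"
 unfolding zcut_def by fastforce

lemma star_step_zz:
 assumes z: "zz n (Is @ [I])" and cut: "zcut Is I L R"
 shows "star_step n (fst I) (snd I) L R (Bz Is)"
proof
 show "1 <= fst I" "snd I <= n" using zz_valid[OF z, of I] by auto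
 show "fst I - 1 <= L" "L < R" "R <= Suc (snd I)" using cut by (auto simp:zcut_def)
 show "Bz Is \<subseteq> YS 1 n {L..<R}"
  by (rule Bz_cut) (use zz_valid[OF z] zcut_cut[OF cut] in auto)
 show "sw i o v:Bz Is" if "i:links (fst I) (snd I) {L..<R}" "v:Bz Is" for i v
  using absl_Bz[OF zcut_absl[OF cut that(1)] that(2)] .
qed

section \<open>Interval reversals and a recursion for the zig-zag permutation\<close>

abbreviation "revs xs == fold rvi xs"

lemma reverse_ivl_mem [simp]: "x:ivl I ==> rvi I x:ivl I"
 by (auto simp:reverse_ivl_def ivl_def)

lemma reverse_ivl_out [simp]: "x ~: ivl I ==> rvi I x = x"
 by (simp add:reverse_ivl_def)

lemma reverse_ivl_comm:
 "ivl I Int ivl J = {} ==> rvi I (rvi J x) = rvi J (rvi I x)"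
 by (cases "x:ivl I"; cases "x:ivl J") (auto simp:disjoint_iff, metis reverse_ivl_mem reverse_ivl_out)+

lemma revs_commute1:
 "(!!b. b:set ys ==> ivl a Int ivl b = {}) ==> rvi a (revs ys x) = revs ys (rvi a x)"
 by (induction ys arbitrary: x) (simp_all add:reverse_ivl_comm)

lemma revs_comm:
 "(!!a b. a:set xs ==> b:set ys ==> ivl a Int ivl b = {}) ==> revs xs (revs ys x) = revs ys (revs xs x)"
 by (induction xs arbitrary: x) (simp_all add:revs_commute1)

lemma revs_disjoint_out: "(!!a. a:set ys ==> x ~: ivl a) ==> revs ys x = x"
 by (induction ys) simp_all

lemma revs_disjoint:
 "sorted_wrt (%a b. ivl a Int ivl b = {}) ys ==> a:set ys ==> x:ivl a ==> revs ys x = rvi a x"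
proof (induction ys arbitrary: x)
 case (Cons b ys)
 show ?case
 proof (cases "a = b")
  case True
  have "rvi b x:ivl b" using Cons.prems True by simp
  hence "revs ys (rvi b x) = rvi b x"
  using Cons.prems(1) by (intro revs_disjoint_out) (simp, blast)
  thus ?thesis by (simp add:True)
 next
  case False
  hence "a:set ys" "x ~: ivl b" using Cons.prems by auto
  thus ?thesis using Cons by simp
 qed
qed simp

definition meet :: "cell => cell => cell" where
 "meet I J = (max (fst I) (fst J), min (snd I) (snd J))"

lemma ivl_meet: "ivl (meet I J) = ivl I Int ivl J"
 by (auto simp:ivl_def meet_def)

definition "block Is j = Is ! j # map (%k. meet (Is ! j) (Is ! k))
  (filter (%k. covers Is j k & card (ivl (Is ! j) Int ivl (Is ! k)) > 1) [0..<length Is])"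

lemma exp_seq_block: "exseq Is = concat (map (block Is) [0..<length Is])"
 unfolding expanded_sequence_def
 by (rule arg_cong[of _ _ concat], rule map_cong) (simp_all add:block_def meet_def)

text \<open>What appending \<open>I\<close> inserts into the block of \<open>Is ! j\<close>: their
  overlap, if they form a covering pair with more than one common element.\<close>

definition "extra Is I j = (if covers (Is @ [I]) j (length Is) & card (ivl (Is ! j) Int ivl I) > 1
  then [meet (Is ! j) I] else [])"

lemma covers_snoc: "k < length Is ==> covers (Is @ [I]) j k <-> covers Is j k"
 by (auto simp:covers_def nth_append)

lemma block_snoc: assumes j: "j < length Is" shows "block (Is @ [I]) j = block Is j @ extra Is I j"
proof -
 have *: "filter (%k. covers (Is @ [I]) j k & card (ivl ((Is @ [I]) ! j) Int ivl ((Is @ [I]) ! k)) > 1) [0..<length Is] =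
  filter (%k. covers Is j k & card (ivl (Is ! j) Int ivl (Is ! k)) > 1) [0..<length Is]"
  using j by (intro filter_cong) (auto simp:covers_snoc nth_append)
 have "map (%k. meet (Is ! j) ((Is @ [I]) ! k)) (filter (%k. covers Is j k & card (ivl (Is ! j) Int ivl (Is ! k)) > 1) [0..<length Is])
  = map (%k. meet (Is ! j) (Is ! k)) (filter (%k. covers Is j k & card (ivl (Is ! j) Int ivl (Is ! k)) > 1) [0..<length Is])"
  by (intro map_cong) (auto simp:nth_append)
 thus ?thesis using j
  unfolding block_def length_append_singleton upt_Suc_append[OF le0] filter_append *
  by (simp add:extra_def nth_append)
qed

lemma block_sub: "a:set (block Is j) ==> ivl a \<subseteq> ivl (Is ! j)"
 by (auto simp:block_def ivl_meet)

lemma extra_disjoint: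
 assumes "a:set (extra Is I i)" "i < j" "j < length Is" shows "ivl a Int ivl (Is ! j) = {}"
 using assms by (auto simp:extra_def covers_def nth_append ivl_meet)

text \<open>The inserted overlaps can be moved to the end: in a covering pair the overlap is
  disjoint from every interval in between, so the reversals commute.\<close>

lemma revs_blocks:
 "m <= length Is ==> revs (concat (map (%j. block Is j @ extra Is I j) [0..<m])) x =
  revs (concat (map (extra Is I) [0..<m])) (revs (concat (map (block Is) [0..<m])) x)"
proof (induction m)
 case (Suc m)
 have "revs (block Is m) (revs (concat (map (extra Is I) [0..<m])) y) =
  revs (concat (map (extra Is I) [0..<m])) (revs (block Is m) y)" for y
 proof (rule revs_comm)
  fix a b assume "a:set (block Is m)" "b:set (concat (map (extra Is I) [0..<m]))"
  thus "ivl a Int ivl b = {}" using block_sub[of a Is m] extra_disjoint[of b Is I _ m] Suc.prems by fastforce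
 qed
 thus ?case using Suc by simp
qed simp

lemma zigzag_perm_revs: "zzp Is x = revs (exseq Is) x"
 by (simp add:zigzag_perm_def)

lemma zigzag_perm_snoc_extra:
 "zzp (Is @ [I]) x = rvi I (revs (concat (map (extra Is I) [0..<length Is])) (zzp Is x))"
proof -
 have "block (Is @ [I]) (length Is) = [I]"
  by (auto simp:block_def covers_def)
 hence "exseq (Is @ [I]) = concat (map (%j. block Is j @ extra Is I j) [0..<length Is]) @ [I]"
 proof -
  have "map (block (Is @ [I])) [0..<length Is] = map (%j. block Is j @ extra Is I j) [0..<length Is]"
  by (rule map_cong) (simp_all add:block_snoc)
  thus ?thesis using \<open>block (Is @ [I]) (length Is) = [I]\<close>
  by (simp only:exp_seq_block length_append_singleton upt_Suc_append[OF le0] map_append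
  concat_append list.map concat.simps append_Nil2)
 qed
 thus ?thesis
  unfolding zigzag_perm_revs by (simp add:revs_blocks exp_seq_block)
qed

lemma extra_srt:
 "m <= length Is ==> sorted_wrt (%a b. ivl a Int ivl b = {}) (concat (map (extra Is I) [0..<m]))"
proof (induction m)
 case (Suc m)
 have "ivl a Int ivl b = {}" if "a:set (extra Is I j)" "j < m" "b:set (extra Is I m)" for a b j
  using extra_disjoint[OF that(1,2)] that(3) Suc.prems by (auto simp:extra_def ivl_meet)
 thus ?case using Suc by (auto simp:sorted_wrt_append) (auto simp:extra_def)
qed simp

lemma card_ivl_gt: "card {a..b::nat} > 1 <-> a < b"
 by auto

text \<open>Only one interval on each side of \<open>I\<close> contributes. A covering interval
  before the one named in \<open>zcut\<close> would put an endpoint of \<open>I\<close> into a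
  forbidden triple intersection; one after it would touch an overlap that no later interval
  touches.\<close>

lemma extra_members:
 assumes z: "zz n (Is @ [I])" and cut: "zcut Is I L R"
 shows "set (concat (map (extra Is I) [0..<length Is])) =
  {J. J = (fst I, L) & fst I < L \<or> J = (R, snd I) & R < snd I}"
proof (intro equalityI subsetI)
 let ?c = "fst I" and ?d = "snd I"
 have cd: "?c <= ?d" using zz_valid[OF z, of I] by simp
 have LR: "L < R" "?c - 1 <= L" "R <= Suc ?d" and side: "!!J. J:set Is ==> (fst J < ?c & snd J <= L) \<or> (?c < fst J & R <= fst J)"
  using cut by (auto simp:zcut_def)
 note cutL = cut[unfolded zcut_def, THEN conjunct2, THEN conjunct2, THEN conjunct2, THEN conjunct2, THEN conjunct1, THEN mp]
 note cutR = cut[unfolded zcut_def, THEN conjunct2, THEN conjunct2, THEN conjunct2, THEN conjunct2, THEN conjunct2, THEN mp]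
 have gt: "?d < snd J" if "J:set Is" "?c < fst J" for J using zz_nest[OF z, of I J] that by auto
 have lt: "snd J < ?d" if "J:set Is" "fst J < ?c" for J using zz_nest[OF z, of J I] that by auto
 {
  fix a assume "a:set (concat (map (extra Is I) [0..<length Is]))"
  then obtain j where j: "j < length Is" "covers (Is @ [I]) j (length Is)" "card (ivl (Is ! j) Int ivl I) > 1" "a = meet (Is ! j) I"
  by (auto simp:extra_def)
  have btw: "ivl (Is ! j) Int ivl (Is ! l) Int ivl I = {}" if "j < l" "l < length Is" for l
  using j(1,2) that by (auto simp:covers_def nth_append)
  have J: "Is ! j:set Is" using j by simp
  from side[OF J] show "a:{J. J = (fst I, L) & fst I < L \<or> J = (R, snd I) & R < snd I}"
  proof
  assume s: "fst (Is ! j) < ?c & snd (Is ! j) <= L"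
  have a: "a = (?c, snd (Is ! j))" using s lt[OF J] j(4) by (simp add:meet_def)
  have "1 < card {?c..snd (Is ! j)}" using j(3) a j(4) by (simp) (simp add:ivl_def)
  hence c: "?c < snd (Is ! j)" by (simp only:card_ivl_gt)
  then obtain j' where j': "j' < length Is" "snd (Is ! j') = L" "fst (Is ! j') < ?c"
  "!!l. j' < l ==> l < length Is ==> ivl (Is ! l) Int {?c..L} = {}"
  proof -
  have "fst I <= L" using s c by simp
  from cutL[OF this] that show ?thesis by blast
  qed
  have "~ j < j'"
  proof
  assume "j < j'"
  from btw[OF this j'(1)] have "?c ~: ivl (Is ! j) Int ivl (Is ! j') Int ivl I" by blast
  thus False using s c j' cd by (auto simp:ivl_def)
  qed
  moreover have "~ j' < j"
  proof
  assume "j' < j"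
  from j'(4)[OF this j(1)] have "?c ~: ivl (Is ! j) Int {?c..L}" by blast
  thus False using s c by (auto simp:ivl_def)
  qed
  ultimately have "j = j'" by simp
  thus ?thesis using a c j' by simp
  next
  assume s: "?c < fst (Is ! j) & R <= fst (Is ! j)"
  have a: "a = (fst (Is ! j), ?d)" using s gt[OF J] j(4) by (simp add:meet_def)
  have "1 < card {fst (Is ! j)..?d}" using j(3) a j(4) by (simp) (simp add:ivl_def)
  hence c: "fst (Is ! j) < ?d" by (simp only:card_ivl_gt)
  then obtain j' where j': "j' < length Is" "fst (Is ! j') = R" "?d < snd (Is ! j')"
  "!!l. j' < l ==> l < length Is ==> ivl (Is ! l) Int {R..?d} = {}"
  proof -
  have "R <= snd I" using s c by simp
  from cutR[OF this] that show ?thesis by blast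
  qed
  have "~ j < j'"
  proof
  assume "j < j'"
  from btw[OF this j'(1)] have "?d ~: ivl (Is ! j) Int ivl (Is ! j') Int ivl I" by blast
  thus False using s c j' cd gt[OF J] by (auto simp:ivl_def)
  qed
  moreover have "~ j' < j"
  proof
  assume "j' < j"
  from j'(4)[OF this j(1)] have "?d ~: ivl (Is ! j) Int {R..?d}" by blast
  thus False using s c gt[OF J] by (auto simp:ivl_def)
  qed
  ultimately have "j = j'" by simp
  thus ?thesis using a c j' by simp
  qed
 }
 fix a assume "a:{J. J = (fst I, L) & fst I < L \<or> J = (R, snd I) & R < snd I}"
 then consider "a = (?c, L)" "?c < L" | "a = (R, ?d)" "R < ?d" by blast
 thus "a:set (concat (map (extra Is I) [0..<length Is]))"
 proof cases
  case 1
  then obtain j where j: "j < length Is" "snd (Is ! j) = L" "fst (Is ! j) < ?c"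
  "!!l. j < l ==> l < length Is ==> ivl (Is ! l) Int {?c..L} = {}"
  using cutL[OF less_imp_le[OF 1(2)]] by blast
  have e: "ivl (Is ! j) Int ivl I = {?c..L}" "meet (Is ! j) I = (?c, L)"
  using j LR by (auto simp:ivl_def meet_def)
  have "covers (Is @ [I]) j (length Is)"
  unfolding covers_def using j e 1 by (auto simp:nth_append)
  hence "a:set (extra Is I j)" using e 1 by (simp add:extra_def)
  thus ?thesis using j by auto
 next
  case 2
  then obtain j where j: "j < length Is" "fst (Is ! j) = R" "?d < snd (Is ! j)"
  "!!l. j < l ==> l < length Is ==> ivl (Is ! l) Int {R..?d} = {}"
  using cutR[OF less_imp_le[OF 2(2)]] by blast
  have "?c <= R" using j by (auto) (use lt[of "Is ! j"] j(1) in "force simp:in_set_conv_nth")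
  hence e: "ivl (Is ! j) Int ivl I = {R..?d}" "meet (Is ! j) I = (R, ?d)"
  using j by (auto simp:ivl_def meet_def)
  have "covers (Is @ [I]) j (length Is)"
  unfolding covers_def using j e 2 by (auto simp:nth_append)
  hence "a:set (extra Is I j)" using e 2 by (simp add:extra_def)
  thus ?thesis using j by auto
 qed
qed

text \<open>The longest element of the overlap subgroup; an empty or one-element overlap contributes
  the identity.\<close>

definition "turn I L R = rvi (fst I, L) o rvi (R, snd I)"

lemma zigzag_perm_snoc:
 assumes z: "zz n (Is @ [I])" and cut: "zcut Is I L R"
 shows "zzp (Is @ [I]) = rvi I o turn I L R o zzp Is"
proof
 fix x
 let ?ys = "concat (map (extra Is I) [0..<length Is])"
 have LR: "L < R" using cut by (simp add:zcut_def)
 note m = extra_members[OF z cut] and s = extra_srt[of "length Is" Is I, OF order_refl]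
 have "revs ?ys y = turn I L R y" for y
 proof -
  consider "y:ivl (fst I, L)" "fst I < L" | "y:ivl (R, snd I)" "R < snd I"
  | "~ (y:ivl (fst I, L) & fst I < L)" "~ (y:ivl (R, snd I) & R < snd I)" by blast
  thus ?thesis
  proof cases
  case 1
  hence "revs ?ys y = rvi (fst I, L) y" using revs_disjoint[OF s] m by blast
  moreover have "y ~: ivl (R, snd I)" using 1 LR by (auto simp:ivl_def)
  ultimately show ?thesis by (simp add:turn_def)
  next
  case 2
  hence "revs ?ys y = rvi (R, snd I) y" using revs_disjoint[OF s] m by blast
  moreover have "rvi (R, snd I) y ~: ivl (fst I, L)" using 2 LR by (auto simp:ivl_def reverse_ivl_def)
  ultimately show ?thesis by (simp add:turn_def)
  next
  case 3
  have "revs ?ys y = y"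
  proof (rule revs_disjoint_out)
  fix a assume "a:set ?ys"
  hence "a = (fst I, L) & fst I < L \<or> a = (R, snd I) & R < snd I" unfolding m by blast
  thus "y ~: ivl a" using 3 by blast
  qed
  moreover have "rvi (fst I, L) y = y" "rvi (R, snd I) y = y"
  using 3 by (auto simp:reverse_ivl_def ivl_def)
  ultimately show ?thesis by (simp add:turn_def)
  qed
 qed
 thus "zzp (Is @ [I]) x = (rvi I o turn I L R o zzp Is) x"
  by (simp add:zigzag_perm_snoc_extra)
qed

lemma reverse_ivl_invol [simp]: "rvi I (rvi I x) = x"
 by (auto simp:reverse_ivl_def ivl_def)

lemma reverse_ivl_permutes:
 assumes "ivl I \<subseteq> {a..b}" shows "rvi I permutes {a..b}"
proof (rule bij_imp_permutes)
 have "rvi I x:{a..b}" if "x:{a..b}" for x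
 proof (cases "x:ivl I")
  case True thus ?thesis using reverse_ivl_mem[of x I] assms by blast
 qed (use that in simp)
 thus "bij_betw (rvi I) {a..b} {a..b}"
  by (intro bij_betw_byWitness[of _ "rvi I"]) auto
 show "rvi I x = x" if "x ~: {a..b}" for x
  using that assms by (intro reverse_ivl_out) auto
qed

lemma reverse_ivl_YS:
 "ivl I \<subseteq> {a..b} ==> (!!k. k:F ==> snd I <= k \<or> k < fst I) ==> rvi I:YS a b F"
 by (auto simp:YS_def reverse_ivl_permutes) (fastforce simp:reverse_ivl_def ivl_def split: if_splits)+

lemma turn_YS:
 assumes "fst I - 1 <= L" "L < R" "R <= Suc (snd I)" "fst I <= snd I"
 shows "turn I L R:YS (fst I) (snd I) {L..<R}"
 unfolding turn_def using assms by (intro comp_YS reverse_ivl_YS) (auto simp:ivl_def)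

section \<open>Bruhat order\<close>

abbreviation "bruhat_step n == (%u u'. EX a b. 1 <= a & a < b & b <= n & u' = u o trp a b &
  plen n u < plen n u')"

lemma ble_iff: "ble n v w <-> v:Sym n & w:Sym n & (bruhat_step n)\<^sup>*\<^sup>* v w"
 by (simp add:bruhat_le_def Sym_def)

lemma bruhat_trs: "ble n u v ==> ble n v w ==> ble n u w"
 unfolding ble_iff by (meson rtranclp_trans)

lemma bruhat_refl: "w:Sym n ==> ble n w w"
 by (simp add:ble_iff)

lemma trp_Sym: "1 <= a ==> a < b ==> b <= n ==> trp a b:Sym n"
 unfolding Sym_def by (auto intro!:permutes_swap_id)

lemma plen_trp_iff:
 assumes w: "w:Sym n" and ab: "1 <= a" "a < b" "b <= n"
 shows "plen n w < plen n (w o trp a b) <-> w a < w b"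
proof
 assume lt: "plen n w < plen n (w o trp a b)"
 show "w a < w b"
 proof (rule ccontr)
  assume "~ w a < w b"
  moreover have "w a ~= w b" using Sym_inj[OF w] ab by (auto dest:injD)
  ultimately have "(w o trp a b) a < (w o trp a b) b" by simp
  from plen_trp[OF comp_Sym[OF w trp_Sym[OF ab]] ab this]
  have "plen n (w o trp a b) < plen n w"
  by (simp only:comp_assoc transpose_comp_involutory comp_id)
  thus False using lt by simp
 qed
qed (rule plen_trp[OF w ab])

text \<open>The lifting property. Along the chain from \<open>x\<close> to \<open>y\<close>,
  multiplying a step by \<open>sw i\<close> gives a step again, except when the step itself is this
  multiplication; then the claim is already reached.\<close>

lemma bruhat_lift:
 assumes "ble n x y" and i: "i:{1..<n}" and y: "pinv y (Suc i) < pinv y i"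
 shows "ble n (sw i o x) y"
proof -
 have yp: "y:Sym n" and xp: "x:Sym n" and rel: "(bruhat_step n)\<^sup>*\<^sup>* x y"
  using assms(1) by (auto simp:ble_iff)
 from rel xp show ?thesis
 proof (induction rule:converse_rtranclp_induct)
  case base
  define a b where "a = pinv y (Suc i)" and "b = pinv y i"
  have ab: "1 <= a" "a < b" "b <= n"
  using y i Sym_mem[OF pinv_Sym[OF yp], of i] Sym_mem[OF pinv_Sym[OF yp], of "Suc i"]
  by (auto simp:a_def b_def)
  have yab: "y a = Suc i" "y b = i" using yp by (simp_all add:a_def b_def)
  have inj: "y j = y k <-> j = k" for j k using Sym_inj[OF yp] by (auto dest:injD)
  have eq: "y = sw i o y o trp a b"
  proof
  fix j show "y j = (sw i o y o trp a b) j"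
  using yab inj[of j a] inj[of j b] ab by (auto)
  qed
  have sp: "sw i o y:Sym n" using comp_Sym[OF sw_Sym[OF i] yp] .
  have "plen n (sw i o y) < plen n y" using plen_sw'[OF yp i y] by simp
  hence "bruhat_step n (sw i o y) y" using ab eq by blast
  thus ?case using sp yp unfolding ble_iff by (intro conjI r_into_rtranclp)
 next
  case (step x z)
  obtain a b where ab: "1 <= a" "a < b" "b <= n" "z = x o trp a b"
  and len: "plen n x < plen n z" using step.hyps(1) by blast
  have zp: "z:Sym n" using ab comp_Sym[OF step.prems trp_Sym] by blast
  have IH: "ble n (sw i o z) y" using step.IH[OF zp] .
  have lt: "x a < x b" using len plen_trp_iff[OF step.prems ab(1-3)] ab(4) by simp
  have sx: "sw i o x:Sym n" using comp_Sym[OF sw_Sym[OF i] step.prems] .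
  show ?case
  proof (cases "x a = i & x b = Suc i")
  case True
  have inj: "x j = x k <-> j = k" for j k using Sym_inj[OF step.prems] by (auto dest:injD)
  have "sw i o x = z"
  proof
  fix j show "(sw i o x) j = z j"
  using True inj[of j a] inj[of j b] ab(2) unfolding ab(4) by (auto)
  qed
  thus ?thesis using step.hyps(2) zp yp by (simp add:ble_iff)
  next
  case False
  hence "(sw i o x) a < (sw i o x) b" using lt by (auto simp:transpose_def)
  hence "plen n (sw i o x) < plen n (sw i o x o trp a b)"
  using plen_trp_iff[OF sx ab(1-3)] by blast
  hence "bruhat_step n (sw i o x) (sw i o z)" using ab by (auto simp:comp_assoc)
  thus ?thesis using IH sx unfolding ble_iff by (blast intro:converse_rtranclp_into_rtranclp)
  qed
 qed
qed

lemma turn_turn: assumes "L < R" shows "turn I L R (turn I L R x) = x"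
proof -
 note assms
 hence "ivl (fst I, L) Int ivl (R, snd I) = {}" by (auto simp:ivl_def)
 from reverse_ivl_comm[OF this] show ?thesis by (simp add:turn_def)
qed

lemma pinv_invol: "(!!x. f (f x) = x) ==> pinv f = f"
 by (rule inv_unique_comp) (auto)

text \<open>Membership, descents at absorbed links and maximality are proved together: the descents
  let the lifting property push whole cosets below the new permutation.\<close>

lemma zigzag_perm_Bz:
 assumes "zz n Is"
 shows "zzp Is:Bz Is" "!!i. absl Is i ==> pinv (zzp Is) (Suc i) < pinv (zzp Is) i"
  "!!b. b:Bz Is ==> ble n b (zzp Is)"
proof -
 have "zzp Is:Bz Is & (ALL i. absl Is i --> pinv (zzp Is) (Suc i) < pinv (zzp Is) i) &
  (ALL b:Bz Is. ble n b (zzp Is))"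
  using assms
 proof (induction Is rule:rev_induct)
  case Nil
  have "zzp [] = id" by (simp add:zigzag_perm_def[abs_def] expanded_sequence_def)
  thus ?case using bruhat_refl[OF id_Sym, of n] by (simp only:Bz_Nil absl_def list.size) blast
 next
  case (snoc I Is)
  have z: "zz n (Is @ [I])" by fact
  obtain L R where cut: "zcut Is I L R" using zz_cuts[OF z] .
  have LR: "fst I - 1 <= L" "L < R" "R <= Suc (snd I)" using cut by (auto simp:zcut_def)
  have val: "1 <= fst I" "fst I <= snd I" "snd I <= n" using zz_valid[OF z, of I] by auto
  interpret star_step n "fst I" "snd I" L R "Bz Is" by (rule star_step_zz[OF z cut])
  let ?W = "zzp Is" and ?W' = "zzp (Is @ [I])"
  have IH: "?W:Bz Is" "!!i. absl Is i ==> pinv ?W (Suc i) < pinv ?W i" "!!b. b:Bz Is ==> ble n b ?W"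
  using snoc.IH[OF zz_butlast[OF z]] by auto
  have W: "?W:Sym n" by (rule Bp[OF IH(1)])
  \<comment> \<open>Undoing the overlap reversals turns the descents at links into ascents; by
    \<open>B_incr\<close>, \<open>v\<close> is then minimal for the whole interval, and reversing
    the interval makes it maximal.\<close>
  define v where "v = turn I L R o ?W"
  have tY: "turn I L R:YS (fst I) (snd I) {L..<R}" by (rule turn_YS[OF LR val(2)])
  have tp: "turn I L R:Sym n" by (rule SIp[OF tY])
  have vB: "v:Bz Is" unfolding v_def by (rule B_closed[OF tY IH(1)])
  have vp: "v:Sym n" by (rule Bp[OF vB])
  have pv: "pinv v x = pinv ?W (turn I L R x)" for x
  unfolding v_def using pinv_comp_dis[OF tp W] pinv_invol[of "turn I L R"] turn_turn[OF LR(2)] by simp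
  have inc: "pinv v i < pinv v (Suc i)" if i: "i:links (fst I) (snd I) {L..<R}" for i
  proof -
  have ii: "fst I <= i" "i < snd I" "i < L \<or> R <= i" using i by (auto simp:links_def)
  define j where "j = (if i < L then fst I + L - Suc i else R + snd I - Suc i)"
  have "turn I L R i = Suc j" "turn I L R (Suc i) = j"
  using ii LR by (auto simp:turn_def reverse_ivl_def ivl_def j_def)
  moreover have "j:links (fst I) (snd I) {L..<R}" using ii LR by (auto simp:links_def j_def)
  hence "pinv ?W (Suc j) < pinv ?W j" using IH(2) zcut_absl[OF cut] by blast
  ultimately show ?thesis by (simp add:pv)
  qed
  have vinc: "pinv v i < pinv v (Suc i)" if "fst I <= i" "i < snd I" for i
  by (rule B_incr[OF vB inc that])
  have W'eq: "?W' = rvi I o v" unfolding zigzag_perm_snoc[OF z cut] v_def by (simp add:comp_assoc)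
  have rY: "rvi I:YS (fst I) (snd I) {}" by (rule reverse_ivl_YS) (auto simp:ivl_def)
  have pW': "pinv ?W' x = pinv v (rvi I x)" for x
  unfolding W'eq using pinv_comp_dis[OF SIp[OF rY] vp] pinv_invol[of "rvi I"] by simp
  have W'dec: "pinv ?W' (Suc i) < pinv ?W' i" if "fst I <= i" "i < snd I" for i
  proof -
  define j where "j = fst I + snd I - Suc i"
  have "rvi I i = Suc j" "rvi I (Suc i) = j" "fst I <= j" "j < snd I"
  using that by (auto simp:reverse_ivl_def ivl_def j_def)
  thus ?thesis using vinc[of j] by (simp add:pW')
  qed
  have W'B: "?W':Bz (Is @ [I])" unfolding W'eq Bz_snoc sprod_def using rY vB by blast
  have W'p: "?W':Sym n" unfolding W'eq by (rule comp_Sym[OF SIp[OF rY] vp])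
  have desc: "pinv ?W' (Suc i) < pinv ?W' i" if "absl (Is @ [I]) i" for i
  using absl_snoc[OF that]
  proof
  assume "i ~: ivl I & Suc i ~: ivl I & absl Is i"
  moreover from this have "turn I L R i = i" "turn I L R (Suc i) = Suc i" using YS_out[OF tY] by (auto simp:ivl_def)
  ultimately show ?thesis using IH(2)[of i] by (simp add:pW' pv)
  qed (use W'dec in "auto simp:ivl_def")
  have down: "u o y:{x. ble n x ?W'}" if "u:YS (fst I) (snd I) {}" "ble n y ?W'" for u y
  proof (rule YS_closed[OF val(1,3) that(1)])
  fix i y assume i: "i:links (fst I) (snd I) {}" and "y:{x. ble n x ?W'}"
  thus "sw i o y:{x. ble n x ?W'}"
  using bruhat_lift[of n y ?W' i] subsetD[OF links_sub[OF val(1,3)] i] W'dec[of i] i by (auto simp:links_def)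
  qed (use that in simp)
  have tY': "turn I L R:YS (fst I) (snd I) {}" using tY by (simp add:YS_def)
  have "ble n v ?W'"
  using down[OF rY bruhat_refl[OF W'p]] unfolding W'eq by (simp add:comp_def[of "rvi I"])
  hence "ble n ?W ?W'"
  using down[OF tY', of v] turn_turn[OF LR(2)] unfolding v_def by (simp add:comp_def[of "turn I L R"])
  hence "ALL b:Bz (Is @ [I]). ble n b ?W'"
  using down bruhat_trs[OF IH(3)] unfolding Bz_snoc sprod_def by blast
  thus ?case using W'B desc by blast
 qed
 thus "zzp Is:Bz Is" "!!i. absl Is i ==> pinv (zzp Is) (Suc i) < pinv (zzp Is) i"
  "!!b. b:Bz Is ==> ble n b (zzp Is)" by auto
qed

section \<open>Bar invariance of products of stars\<close>

lemma tbar_support: "tbar q r i f h ~= 0 ==> f h ~= 0 \<or> f (h o sw i) ~= 0"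
 by (auto simp:tbar_def tn_op_def split: if_splits)

lemma tn_op_support: "tn_op q i f h ~= 0 ==> f h ~= 0 \<or> f (h o sw i) ~= 0"
 by (auto simp:tn_op_def split: if_splits)

lemma abar_star_support:
 assumes cd: "1 <= c" "d <= n" and w: "w:Sym n" and nz: "cof n (abar (star n c d)) w ~= 0"
 shows "w:YS c d {}"
proof -
 have word: "w:YS c d {}"
  if "set us \<subseteq> links c d {}" "w:Sym n" "foldr (tbar qv (qh (- 2))) us (dl base) (regw w) ~= 0" for us w
  using that
 proof (induction us arbitrary: w)
  case Nil
  hence "regw w = regw id" by (auto simp:dl_def regw_id split: if_splits)
  hence "w = id" using regw_inj[OF Nil(2) id_Sym] by simp
  thus ?case by (simp only:id_YS)
 next
  case (Cons i us)
  have i: "i:links c d {}" using Cons.prems(1) by simp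
  hence i': "i:{1..<n}" using links_sub[OF cd] by blast
  from tbar_support Cons.prems(3)
  have "foldr (tbar qv (qh (- 2))) us (dl base) (regw w) ~= 0 \<or>
  foldr (tbar qv (qh (- 2))) us (dl base) (regw w o sw i) ~= 0" by fastforce
  thus ?case
  proof
  assume "foldr (tbar qv (qh (- 2))) us (dl base) (regw w o sw i) ~= 0"
  hence "sw i o w:YS c d {}"
  using Cons.IH[of "sw i o w"] Cons.prems comp_Sym[OF sw_Sym[OF i'] Cons.prems(2)]
  by (simp add:regw_sw del:comp_apply)
  from comp_YS[OF sw_YS[OF i] this] show ?thesis by (simp only:sw_sw_comp)
  qed (use Cons in auto)
 qed
 have "cof n (abar (star n c d)) w = (SUM u:YS c d {}. breg (Tw n u) (dl base) (regw w))"
  by (simp add:cof_def reg_abar star_def hk_rep.act_sum[OF hk_rep_tbar])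
 moreover have "(SUM u:YS c d {}. breg (Tw n u) (dl base) (regw w)) = 0"
  if "!!u. u:YS c d {} ==> breg (Tw n u) (dl base) (regw w) = 0"
  using that by (rule sum.neutral[OF ballI])
 ultimately obtain u where u: "u:YS c d {}" "breg (Tw n u) (dl base) (regw w) ~= 0"
  using nz by (metis (lifting))
 have up: "u:Sym n" by (rule YS_Sym[OF u(1) cd])
 have "foldr (tbar qv (qh (- 2))) (red n u) (dl base) (regw w) ~= 0"
  using u(2) by (simp add:hk_rep.act_wt[OF hk_rep_tbar])
 from word[OF YS_red[OF cd u(1) rword_red[OF up]] w this] show ?thesis .
qed

text \<open>The bar involution carries absorption to absorption, so the coefficients are constant on
  \<open>YS c d {}\<close>, and by \<open>abar_star_support\<close> there are no others. The scalar
  stays unspecified; \<open>abar_Bz\<close> finds the total scalar from the top coefficient.\<close>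

lemma abar_star:
 assumes cd: "1 <= c" "d <= n"
 shows "EX e. heq n (abar (star n c d)) (scal e (star n c d))"
proof -
 define x where "x = abar (star n c d)"
 have sfa: "star n c d:fa n" unfolding star_def by (rule indic_fa[OF YS_sub_Sym[OF cd]])
 have xfa: "x:fa n" unfolding x_def by (rule abar_fa[OF sfa])
 have inv: "cof n x (sw i o w) = cof n x w" if i: "i:links c d {}" and w: "w:Sym n" for i w
 proof -
  have i': "i:{1..<n}" using i links_sub[OF cd] by blast
  have gfa: "gen i:fa n" using i' by simp
  have "heq n (gen i * star n c d) (scal qv (star n c d))"
  using star_absb[OF cd i one_fa] by simp
  from abar_cong[OF mult_fa[OF gfa sfa] scal_fa[OF sfa] this]
  have "heq n (abar (gen i * star n c d)) (abar (scal qv (star n c d)))" .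
  from heq_trs[OF heq_sym[OF abar_mult[OF gfa sfa]] heq_trs[OF this abar_scal[OF sfa]]]
  have "heq n (ginv i * x) (scal (qh (- 2)) x)" by (simp add:abar_gen x_def)
  from heq_scal[OF heq_mult_l[OF this gfa], of qv]
  have 1: "heq n (scal qv (gen i * (ginv i * x))) (scal qv (scal (qh (- 2)) (gen i * x)))"
  by (simp only:scal_mult_r[of "gen i"])
  have "heq n (gen i * (ginv i * x)) x"
  using heq_mult_r[OF ginv_gen(2)[OF i'] xfa] by (simp add:mult.assoc)
  from heq_trs[OF heq_sym[OF heq_scal[OF this, of qv]] 1]
  have "heq n (scal qv x) (gen i * x)" by (simp add:scal_scal)
  thus ?thesis using absb_cof[OF xfa i'] w heq_sym by blast
 qed
 have const: "cof n x u = cof n x id" if "u:YS c d {}" for u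
  using cd that
 proof (induction rule:YS_induct)
  case (sw i u) thus ?case using inv[OF sw(1) YS_Sym[OF sw(2) cd]] by (simp only:)
 qed simp
 have "heq n x (scal (cof n x id) (star n c d))"
  unfolding heq_iff_cof[OF xfa scal_fa[OF sfa]] cof_scal
 proof
  fix w assume w: "w:Sym n"
  show "cof n x w = cof n x id * cof n (star n c d) w"
  unfolding star_def using const[of w] abar_star_support[OF cd w] by (auto simp:cof_indic[OF YS_sub_Sym[OF cd] w] x_def)
 qed
 thus ?thesis unfolding x_def by blast
qed

lemma lbar_lbar [simp]: "lbar (lbar c) = c"
 by (rule poly_mapping_eqI) (simp add:lookup_lbar)

lemma abar_ind_top:
 assumes w: "w:B" and B: "!!v. v:B ==> ble n v w"
 shows "cof n (abar (ind n B)) w = qh (- 2 * int (plen n w))"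
proof -
 have Bp: "v:Sym n" if "v:B" for v using ble_Sym[OF B[OF that]] by simp
 have fin: "finite B" using Bp by (meson fin_Sym rev_finite_subset subsetI)
 have "cof n (abar (ind n B)) w = (SUM v:B. cof n (abar (Tw n v)) w)"
  unfolding ind_def using cof_cong[OF abar_sum[OF fin, of "Tw n" n]] Bp by (simp add:cof_sum)
 also have "... = (SUM v:B. if w = v then qh (- 2 * int (plen n w)) else 0)"
 proof (rule sum.cong)
  fix v assume v: "v:B"
  have "plen n v <= plen n w" using ble_len[OF B[OF v]] by auto
  thus "cof n (abar (Tw n v)) w = (if w = v then qh (- 2 * int (plen n w)) else 0)"
  using abar_Tw_coeff[OF Bp[OF v] Bp[OF w]] by simp
 qed simp
 finally show ?thesis using w fin by simp
qed

lemma Bz_sub_Sym: "zz n Is ==> Bz Is \<subseteq> Sym n"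
 using zigzag_perm_Bz(3) ble_Sym by blast

lemma ind_fa: "B \<subseteq> Sym n ==> ind n B:fa n"
 unfolding ind_def by (rule indic_fa)

text \<open>Applying the bar involution to \<open>star_ind_mult\<close> gives a multiple of the same
  element, up to the bar of a Poincare polynomial, which is cancelled. The coefficient at the Bruhat
  maximum, known from \<open>abar_ind_top\<close>, determines the multiple.\<close>

lemma abar_Bz:
 "zz n Is ==> heq n (abar (ind n (Bz Is))) (scal (qh (- 2 * int (plen n (zzp Is)))) (ind n (Bz Is)))"
proof (induction Is rule:rev_induct)
 case Nil
 have "zzp [] = id" by (simp add:zigzag_perm_def[abs_def] expanded_sequence_def)
 have "red n id = []" using len_red[OF id_Sym, of n] by simp
 have "plen n (zzp []) = 0" using \<open>zzp [] = id\<close> by (simp only:plen_id)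
 moreover have "ind n (Bz []) = wterm 1 []" using \<open>red n id = []\<close> by (simp add:ind_def)
 ultimately show ?case by (simp add:abar_const lbar_simps)
next
 case (snoc I Is)
 have z: "zz n (Is @ [I])" and z': "zz n Is" using snoc.prems zz_butlast by auto
 obtain L R where cut: "zcut Is I L R" using zz_cuts[OF z] .
 interpret star_step n "fst I" "snd I" L R "Bz Is" by (rule star_step_zz[OF z cut])
 let ?A = "ind n (Bz Is)" and ?A' = "ind n (Bz (Is @ [I]))" and ?S = "star n (fst I) (snd I)"
 let ?p = "poin n (fst I) (snd I) {L..<R}"
 define q1 where "q1 = qh (- 2 * int (plen n (zzp (Is @ [I]))))"
 have Afa: "?A:fa n" and A'fa: "?A':fa n" and Sfa: "?S:fa n"
  using ind_fa[OF Bz_sub_Sym[OF z]] ind_fa[OF Bz_sub_Sym[OF z']]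
  indic_fa[OF YS_sub_Sym[OF c d]] by (simp_all add:star_def)
 obtain e where e: "heq n (abar ?S) (scal e ?S)" using abar_star[OF c d] by blast
 obtain e' where e': "heq n (abar ?A) (scal e' ?A)" using snoc.IH[OF z'] by blast
 have mult: "heq n (?S * ?A) (scal ?p ?A')" using star_ind_mult by simp
 have "heq n (scal (lbar ?p) (abar ?A')) (abar (scal ?p ?A'))"
  by (rule heq_sym[OF abar_scal[OF A'fa]])
 also have "heq n ... (abar (?S * ?A))"
  by (rule abar_cong[OF scal_fa[OF A'fa] mult_fa[OF Sfa Afa] heq_sym[OF mult]])
 also have "heq n ... (abar ?S * abar ?A)" by (rule abar_mult[OF Sfa Afa])
 also have "heq n ... (scal e ?S * scal e' ?A)"
  by (rule heq_mult[OF e e' abar_fa[OF Afa] scal_fa[OF Sfa]])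
 also have "scal e ?S * scal e' ?A = scal (e * e') (?S * ?A)"
  by (metis mult.assoc scal_mult_r scal_scal)
 also have "heq n ... (scal (e * e') (scal ?p ?A'))" by (rule heq_scal[OF mult])
 finally have main: "heq n (scal (lbar ?p) (abar ?A')) (scal (e * e' * ?p) ?A')"
  by (simp only:scal_scal)
 have cf: "lbar ?p * cof n (abar ?A') w = e * e' * ?p * cof n ?A' w" if "w:Sym n" for w
  using cof_cong[OF main, of w] by (simp only:cof_scal)
 have Wp: "zzp (Is @ [I]):Bz (Is @ [I])" "zzp (Is @ [I]):Sym n"
  using zigzag_perm_Bz(1)[OF z] Bz_sub_Sym[OF z] by auto
 have "e * e' * ?p = lbar ?p * q1"
  using cf[OF Wp(2)] abar_ind_top[OF Wp(1) zigzag_perm_Bz(3)[OF z]] Wp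
  by (simp add:q1_def ind_def cof_indic[OF Bz_sub_Sym[OF z] Wp(2)] del:Bz_snoc)
 moreover have "lbar ?p ~= 0" using poin_nz lbar_lbar[of ?p] lbar_simps(4) by metis
 ultimately have "cof n (abar ?A') w = q1 * cof n ?A' w" if "w:Sym n" for w
  using cf[OF that] by (simp)
 thus ?case unfolding heq_iff_cof[OF abar_fa[OF A'fa] scal_fa[OF A'fa]] cof_scal q1_def by simp
qed

theorem kl_basis_zigzag:
 assumes "zz n Is"
 shows "hecke_scale n (qh (int (plen n (zzp Is)))) (kl_basis n (zzp Is)) = cls n (ind n (Bz Is))"
 unfolding ind_def
 by (rule kl_basis_indic[OF zigzag_perm_Bz(1,3)[OF assms]]) (use abar_Bz[OF assms] in "simp_all add:ind_def")

section \<open>Diagonal coefficients\<close>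

abbreviation (input) "ten == act (%c. c) (tn_op qv)"

lemma q_var_neq: "qv ~= 0" "qv + 1 ~= 0"
proof -
 show "qv ~= 0" using q_half_cancel(2)[of 2] by force
 have "lookup (qv + 1) 0 = 1"
  by (simp add:lookup_add q_half_def lookup_one when_def)
 thus "qv + 1 ~= 0" by auto
qed

text \<open>The image of \<open>p\<close> consists of eigenvectors of the generator for
  \<open>q\<close>. Comparing branches of \<open>tn_op\<close> gives invariance under
  \<open>sw i\<close>; at equal letters the operator is -1, so the value is 0 because
  \<open>q + 1\<close> is nonzero.\<close>

lemma ten_absb:
 assumes "heq n (gen i * p) (scal qv p)"
 shows "ten p f (h o sw i) = ten p f h" "h i = h (Suc i) ==> ten p f h = 0"
proof -
 have eq: "tn_op qv i (ten p f) h = qv * ten p f h"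
  using hk_rep.act_heq[OF reg_rep assms, of f]
  hk_rep.act_mult[OF reg_rep, of "gen i" p f h] hk_rep.act_scal[OF reg_rep, of qv p f h]
  by (simp add:hk_rep.act_gen[OF reg_rep])
 show "h i = h (Suc i) ==> ten p f h = 0"
 proof -
  assume "h i = h (Suc i)"
  hence "- ten p f h = qv * ten p f h" using eq by (simp add:tn_op_def)
  hence "(qv + 1) * ten p f h = - ten p f h + ten p f h" by (simp only:distrib_right mult_1)
  thus ?thesis using q_var_neq by simp
 qed
 show "ten p f (h o sw i) = ten p f h"
 proof (rule linorder_cases3[of "h i" "h (Suc i)"])
  assume "h i = h (Suc i)"
  hence "h o sw i = h" by (auto simp:fun_eq_iff transpose_def)
  thus ?thesis by (simp only:)
 qed (use eq q_var_neq in "simp_all add:tn_op_def algebra_simps")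
qed

text \<open>Splitting ascents into those inside a block of the cuts and those across a cut
  (\<open>x_pairs\<close>) separates what an overlap has already counted from what a new star
  adds.\<close>

definition asc_pairs :: "nat => nat => nat set => (nat => 'c::linorder) => cell set" where
 "asc_pairs c d F f = {(i, j). c <= i & i < j & j <= d & f i < f j & (ALL k:F. ~ (i <= k & k < j))}"

definition x_pairs :: "nat => nat => nat set => (nat => 'c::linorder) => cell set" where
 "x_pairs c d F f = {(i, j). c <= i & i < j & j <= d & f i < f j & (EX k:F. i <= k & k < j)}"

lemma fin_pairs [simp]: "finite (asc_pairs c d F f)" "finite (x_pairs c d F f)"
 by (rule finite_subset[of _ "{c..d} \<times> {c..d}"]; auto simp:asc_pairs_def x_pairs_def)+

lemma asc_pairs_split:
 "card (asc_pairs c d {} f) = card (x_pairs c d F f) + card (asc_pairs c d F f)"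
proof -
 have "asc_pairs c d {} f = x_pairs c d F f Un asc_pairs c d F f"
  "x_pairs c d F f Int asc_pairs c d F f = {}"
  unfolding asc_pairs_def x_pairs_def by blast+
 thus ?thesis by (simp add:card_Un_disjoint)
qed

lemma x_pairs_YS:
 assumes x: "x:YS c d F"
 shows "card (x_pairs c d F (f o x)) = card (x_pairs c d F f)"
proof -
 have "(%(i, j). (y i, y j)) ` x_pairs c d F (f o y) \<subseteq> x_pairs c d F f" if "y:YS c d F" for y f
 proof clarify
  fix i j assume "(i, j):x_pairs c d F (f o y)"
  then obtain k where k: "c <= i" "i < j" "j <= d" "f (y i) < f (y j)" "k:F" "i <= k" "k < j"
  by (auto simp:x_pairs_def)
  have "y i <= k" "~ y j <= k" "y i:{c..d}" "y j:{c..d}"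
  using YS_cut[OF that k(5)] YS_mem[OF that] k by auto
  thus "(y i, y j):x_pairs c d F f" using k by (auto simp:x_pairs_def)
 qed
 moreover have "inj_on (%(i, j). (y i, y j)) A" if "y:YS c d F" for y A
  using that by (auto simp:inj_on_def YS_def dest:permutes_inj injD)
 ultimately have le: "card (x_pairs c d F (f o y)) <= card (x_pairs c d F f)" if "y:YS c d F" for y f
  using that by (intro card_inj_on_le[of "%(i, j). (y i, y j)"]) auto
 have "f o x o pinv x = f" using x by (auto simp:YS_def)
 thus ?thesis using le[OF x, of f] le[OF pinv_YS[OF x], of "f o x"] by (simp only:antisym)
qed

lemma block_decr:
 fixes f :: "nat => 'c::linorder"
 assumes "!!i. i:links c d F ==> f (Suc i) < f i" "c <= i" "i < j" "j <= d" "!!k. k:F ==> ~ (i <= k & k < j)"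
 shows "f j < f i"
 using assms(3-5)
proof (induction j)
 case (Suc j)
 have "f (Suc j) < f j" using assms(1)[of j] assms(2) Suc.prems by (fastforce simp:links_def)
 moreover have "f j < f i" if "i ~= j" using Suc.IH Suc.prems that by fastforce
 ultimately show ?case by (cases "i = j") auto
qed simp

text \<open>Inside a block \<open>f\<close> is decreasing, so an ascent of \<open>f o y\<close> is
  an inversion of \<open>y\<close>; across cuts \<open>y\<close> has no inversions.\<close>

lemma asc_pairs_len:
 assumes cd: "1 <= c" "d <= n" and dec: "!!i. i:links c d F ==> f (Suc i) < f i" and y: "y:YS c d F"
 shows "card (asc_pairs c d F (f o y)) = plen n y"
proof -
 have key: "f (y i) < f (y j) <-> y j < y i" if ij: "i < j" "i:{c..d}" "j:{c..d}" "ALL k:F. ~ (i <= k & k < j)" for i j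
 proof -
  have n: "y i ~= y j" using y ij(1) by (auto simp:YS_def dest:permutes_inj injD)
  have b: "~ (y j <= k & k < y i) & ~ (y i <= k & k < y j)" if "k:F" for k
  using YS_cut[OF y that, of i] YS_cut[OF y that, of j] ij that by (auto simp:not_le)
  have m: "y i:{c..d}" "y j:{c..d}" using YS_mem[OF y] ij by auto
  have "f (y i) < f (y j)" if "y j < y i" using m b that by (intro block_decr[of c d F f, OF dec]) auto
  moreover have "f (y j) < f (y i)" if "y i < y j" using m b that by (intro block_decr[of c d F f, OF dec]) auto
  ultimately show ?thesis using n by (metis linorder_neqE_nat not_less_iff_gr_or_eq)
 qed
 have "asc_pairs c d F (f o y) = invs n y"
 proof (rule Set.set_eqI)
  fix p :: "cell"
  obtain i j where p: "p = (i, j)" by fastforce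
  have "i:{c..d} & j:{c..d} & (ALL k:F. ~ (i <= k & k < j))" if a: "i < j" "y j < y i"
  using YS_inversion_range[OF y a] YS_cut[OF y, of _ i] YS_cut[OF y, of _ j] a by (metis less_le_not_le order_trans nle_le)
  thus "p:asc_pairs c d F (f o y) <-> p:invs n y"
  using key[of i j] cd by (auto simp:p asc_pairs_def invs_def)
 qed
 thus ?thesis by (simp add:plen_invs)
qed

lemma YS_sort_strict:
 fixes f :: "nat => 'c::linorder"
 assumes "inj_on f {c..d}"
 obtains u where "u:YS c d F" "!!i. i:links c d F ==> (f o u) (Suc i) < (f o u) i"
proof -
 obtain u where u: "u:YS c d F" and le: "!!i. i:links c d F ==> f (u (Suc i)) <= f (u i)"
  by (rule YS_sort[of f c d F]) auto
 have "(f o u) (Suc i) < (f o u) i" if i: "i:links c d F" for i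
 proof -
  have "u i:{c..d}" "u (Suc i):{c..d}" using YS_mem[OF u] i by (auto simp:links_def)
  moreover have "u i ~= u (Suc i)" using u by (auto simp:YS_def dest!: permutes_inj dest:injD)
  ultimately have "f (u i) ~= f (u (Suc i))" using assms by (auto dest:inj_onD)
  thus ?thesis using le[OF i] by auto
 qed
 thus ?thesis using that u by blast
qed

lemma sum_YS_reindex:
 assumes u: "u:YS c d F"
 shows "(SUM x:YS c d F. f x) = (SUM y:YS c d F. f (u o y))"
proof (rule sum.reindex_bij_betw[symmetric])
 have p: "u o pinv u = id" "pinv u o u = id" using u by (auto simp:YS_def)
 have "u o (pinv u o x) = x" "pinv u o (u o x) = x" for x by (simp_all only:p comp_assoc[symmetric] id_comp)
 thus "bij_betw (%y. u o y) (YS c d F) (YS c d F)"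
  using comp_YS[OF u] comp_YS[OF pinv_YS[OF u]]
  by (intro bij_betw_byWitness[of _ "%x. pinv u o x"]) auto
qed

lemma asc_sum:
 assumes cd: "1 <= c" "d <= n" and inj: "inj_on f {c..d}"
 shows "(SUM x:YS c d F. qv ^ card (asc_pairs c d F (f o x))) = poin n c d F"
proof -
 obtain u where u: "u:YS c d F" and dec: "!!i. i:links c d F ==> (f o u) (Suc i) < (f o u) i"
  using YS_sort_strict[OF inj] by blast
 have "(SUM x:YS c d F. qv ^ card (asc_pairs c d F (f o x))) =
  (SUM y:YS c d F. qv ^ card (asc_pairs c d F (f o u o y)))"
  by (subst sum_YS_reindex[OF u]) (simp only:comp_assoc)
 also have "... = poin n c d F"
  unfolding poin_def by (rule sum.cong) (simp_all only:asc_pairs_len[OF cd, of F "f o u", OF dec])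
 finally show ?thesis .
qed

lemma ten_support:
 assumes "v:YS 1 n F" "ten (Tw n v) (dl f) m ~= 0"
 shows "EX g:YS 1 n F. m = f o g"
proof -
 have word: "EX g:YS 1 n F. m = f o g"
  if "set us \<subseteq> links 1 n F" "foldr (tn_op qv) us (dl f) m ~= 0" for us
  using that
 proof (induction us arbitrary: m)
  case Nil
  hence "m = f o id" by (auto simp:dl_def split: if_splits)
  thus ?case using id_YS by blast
 next
  case (Cons i us)
  have i: "i:links 1 n F" using Cons.prems by simp
  have "foldr (tn_op qv) us (dl f) m ~= 0 \<or> foldr (tn_op qv) us (dl f) (m o sw i) ~= 0"
  using tn_op_support Cons.prems(2) by fastforce
  thus ?case
  proof
  assume "foldr (tn_op qv) us (dl f) (m o sw i) ~= 0"
  hence "EX g:YS 1 n F. m o sw i = f o g"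
  by (rule Cons.IH[rotated]) (use Cons.prems(1) in simp)
  then obtain g where g: "g:YS 1 n F" "m o sw i = f o g" by blast
  have "m = m o sw i o sw i" by simp
  also have "... = f o (g o sw i)" unfolding g(2) by (rule comp_assoc)
  finally show ?thesis using comp_YS[OF g(1) sw_YS[OF i]] by blast
  qed (use Cons.IH[of m] Cons.prems(1) in auto)
 qed
 have v: "v:Sym n" using YS_Sym[OF assms(1)] by simp
 have "set (red n v) \<subseteq> links 1 n F" using YS_red[OF _ _ assms(1) rword_red[OF v]] by simp
 thus ?thesis using word assms(2) by (simp add:hk_rep.act_wt[OF reg_rep])
qed

context star_step begin

lemma ten_invar:
 assumes "!!i. i:links c d G ==> heq n (gen i * p) (scal qv p)" "u:YS c d G"
 shows "ten p f (h o u) = ten p f h"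
proof -
 have "ALL h. ten p f (h o u) = ten p f h"
  using c d assms(2)
 proof (induction rule:YS_induct)
  case (sw i u)
  thus ?case using ten_absb(1)[OF assms(1)[OF sw(1)], of f] by (simp only:comp_assoc[symmetric]) simp
 qed simp
 thus ?thesis by blast
qed

text \<open>For each cut \<open>k\<close> compare the multisets of letters on \<open>{1..k}\<close>:
  \<open>g\<close> preserves this prefix and \<open>x\<close> fixes the part before
  \<open>c\<close>, so injectivity of \<open>f\<close> on \<open>{c..d}\<close> forces
  \<open>x\<close> to preserve \<open>{c..k}\<close>.\<close>

lemma rearr_pres:
 fixes f :: "nat => 'c"
 assumes inj: "inj_on f {c..d}" and x: "x:YS c d {}" and g: "g:YS 1 n {L..<R}" and eq: "f o x = f o g"
 shows "x:YS c d {L..<R}"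
proof -
 have "x j <= k <-> j <= k" if k: "k:{L..<R}" for j k
 proof -
  have kd: "k <= d" "k <= n" "c - 1 <= k" using k LR d by auto
  have px: "inj x" "inj g" using x g by (auto simp:YS_def permutes_inj)
  have "g ` {1..k} = {1..k}"
  proof (rule card_subset_eq)
  show "g ` {1..k} \<subseteq> {1..k}" using YS_cut[OF g k] YS_mem[OF g] kd by (force simp del:One_nat_def)
  show "card (g ` {1..k}) = card {1..k}" using px by (intro card_image) (auto intro:inj_on_subset)
  qed simp
  hence gk: "image_mset g (mset_set {1..k}) = mset_set {1..k}"
  using image_mset_mset_set[OF inj_on_subset[OF px(2) subset_UNIV], of "{1..k}"] by simp
  have "x ` {1..<c} = {1..<c}" using YS_out[OF x] by force
  hence xc: "image_mset x (mset_set {1..<c}) = mset_set {1..<c}"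
  using image_mset_mset_set[OF inj_on_subset[OF px(1) subset_UNIV], of "{1..<c}"] by simp
  have "{1..k} = {1..<c} Un {c..k}" using kd c by auto
  hence sp: "mset_set {1..k} = mset_set {1..<c} + mset_set {c..k}" by (simp only:) (rule mset_set_Union, auto)
  have "image_mset f (image_mset x (mset_set {1..k})) = image_mset f (image_mset g (mset_set {1..k}))"
  unfolding multiset.map_comp eq ..
  hence "image_mset f (image_mset x (mset_set {c..k})) = image_mset f (mset_set {c..k})"
  unfolding gk by (simp only:sp image_mset_union xc add_left_cancel)
  from arg_cong[OF this, of set_mset] have "f ` (x ` {c..k}) = f ` {c..k}" by (simp add:image_image)
  hence "x ` {c..k} = {c..k}"
  by (subst (asm) inj_on_image_eq_iff[OF inj]) (use YS_mem[OF x] kd in auto)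
  hence "x j:{c..k} <-> j:{c..k}" using inj_image_mem_iff[OF px(1), of j "{c..k}"] by simp
  thus ?thesis using YS_mem[OF x, of j] YS_out[OF x, of j] kd by (cases "j:{c..d}") auto
 qed
 thus ?thesis using x by (simp add:YS_def)
qed

text \<open>The value at \<open>f\<close> of the star times \<open>ind n B\<close> is computed
  twice: by \<open>star_ind_mult\<close>, and by sorting \<open>f\<close> to a decreasing word,
  where \<open>tn_Tw_eval\<close> applies. Both results contain the Poincare polynomial of the
  overlap, which is cancelled.\<close>

lemma diag_step:
 fixes f :: "nat => 'c::linorder"
 shows "ten (ind n (sprod c d B)) (dl f) f =
  (if inj_on f {c..d} then qv ^ card (x_pairs c d {L..<R} f) * ten (ind n B) (dl f) f else 0)"
proof -
 let ?F = "{L..<R}"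
 let ?p = "poin n c d ?F"
 define h where "h = ten (ind n B) (dl f)"
 define G where "G = ten (star n c d * ind n B) (dl f)"
 have Bsub: "B \<subseteq> Sym n" using Bp by blast
 have Afa: "ind n B:fa n" by (rule ind_fa[OF Bsub])
 have G: "G m = ?p * ten (ind n (sprod c d B)) (dl f) m" for m
  unfolding G_def hk_rep.act_heq[OF reg_rep star_ind_mult] by (rule hk_rep.act_scal[OF reg_rep])
 have G2: "G m = (SUM u:YS c d {}. ten (Tw n u) h m)" for m
  unfolding G_def h_def hk_rep.act_mult[OF reg_rep] star_def by (rule hk_rep.act_sum[OF reg_rep])
 have Sabs: "heq n (gen i * (star n c d * ind n B)) (scal qv (star n c d * ind n B))" if "i:links c d {}" for i
  by (rule star_absb[OF c d that Afa])
 have Ginv: "G (m o u) = G m" if "u:YS c d {}" for u m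
  unfolding G_def by (rule ten_invar[OF Sabs that])
 have hinv: "h (m o u) = h m" if "u:YS c d ?F" for u m
  unfolding h_def
 proof (rule ten_invar[OF _ that])
  fix i assume i: "i:links c d ?F"
  hence "i:{1..<n}" using links_sub[OF c d] by blast
  from indic_absb[OF Bsub this absorb[OF i]] show "heq n (gen i * ind n B) (scal qv (ind n B))"
  by (simp only:ind_def)
 qed
 show ?thesis
 proof (cases "inj_on f {c..d}")
  case False
  then obtain a b where ab: "a:{c..d}" "b:{c..d}" "a < b" "f a = f b"
  unfolding inj_on_def by (metis linorder_neqE_nat)
  \<comment> \<open>This brings the second of two equal letters next to the first.\<close>
  define u where "u = trp (Suc a) b"
  have "u permutes {c..d}" unfolding u_def using ab by (intro permutes_swap_id) auto
  hence u: "u:YS c d {}" by (simp add:YS_def)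
  have "a:links c d {}" using ab by (auto simp:links_def)
  moreover have "(f o u) a = (f o u) (Suc a)" using ab by (auto simp:u_def)
  ultimately have "G (f o u) = 0" unfolding G_def by (intro ten_absb(2)[OF Sabs])
  hence "?p * ten (ind n (sprod c d B)) (dl f) f = 0" using G[of f] Ginv[OF u] by simp
  thus ?thesis using poin_nz False by simp
 next
  case True
  obtain u0 where u0: "u0:YS c d {}" and dec: "!!i. i:links c d {} ==> (f o u0) (Suc i) < (f o u0) i"
  using YS_sort_strict[OF True] by blast
  have "G f = G (f o u0)" using Ginv[OF u0] by simp
  also have "... = (SUM u:YS c d {}. qv ^ card (asc_pairs c d {} (f o u0 o u)) * h (f o u0 o u))"
  unfolding G2
  proof (rule sum.cong)
  fix u assume u: "u:YS c d {}"
  have "ten (Tw n u) h (f o u0) = qv ^ plen n u * h (f o u0 o u)"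
  proof (rule tn_Tw_eval[OF SIp[OF u] rhom_id])
  fix a b assume ab: "a < b" "pinv u b < pinv u a"
  have "a:{c..d}" "b:{c..d}" using YS_inversion_range[OF pinv_YS[OF u] ab] by auto
  thus "(f o u0) b < (f o u0) a"
  using ab by (intro block_decr[of c d "{}" "f o u0", OF dec]) auto
  qed
  thus "ten (Tw n u) h (f o u0) = qv ^ card (asc_pairs c d {} (f o u0 o u)) * h (f o u0 o u)"
  by (simp only:asc_pairs_len[OF c d, of "{}" "f o u0", OF dec u])
  qed simp
  also have "... = (SUM x:YS c d {}. qv ^ card (asc_pairs c d {} (f o x)) * h (f o x))"
  unfolding sum_YS_reindex[OF u0, of "%x. qv ^ card (asc_pairs c d {} (f o x)) * h (f o x)"] comp_assoc ..
  \<comment> \<open>Other \<open>x\<close> contribute nothing: the elements of \<open>B\<close>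
    rearrange letters only inside the blocks of the cuts, and by \<open>rearr_pres\<close> such a
    rearrangement comes from the overlap subgroup.\<close>
  also have "... = (SUM x:YS c d ?F. qv ^ card (asc_pairs c d {} (f o x)) * h (f o x))"
  proof (rule sum.mono_neutral_right)
  show "YS c d ?F \<subseteq> YS c d {}" by (auto simp:YS_def)
  show "ALL x:YS c d {} - YS c d ?F. qv ^ card (asc_pairs c d {} (f o x)) * h (f o x) = 0"
  proof
  fix x assume x: "x:YS c d {} - YS c d ?F"
  have "h (f o x) = 0"
  proof (rule ccontr)
  assume "h (f o x) ~= 0"
  hence "(SUM v:B. ten (Tw n v) (dl f) (f o x)) ~= 0"
  by (simp add:h_def ind_def hk_rep.act_sum[OF reg_rep])
  then obtain v where v: "v:B" "ten (Tw n v) (dl f) (f o x) ~= 0"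
  using sum.neutral[of B "%v. ten (Tw n v) (dl f) (f o x)"] by blast
  obtain g where "g:YS 1 n ?F" "f o x = f o g" using ten_support[OF _ v(2)] v(1) B by blast
  from rearr_pres[OF True _ this] show False using x by blast
  qed
  thus "qv ^ card (asc_pairs c d {} (f o x)) * h (f o x) = 0" by simp
  qed
  qed simp
  also have "... = (SUM x:YS c d ?F. qv ^ card (x_pairs c d ?F f) * h f * qv ^ card (asc_pairs c d ?F (f o x)))"
  by (rule sum.cong) (simp_all add:asc_pairs_split[of c d _ ?F] x_pairs_YS hinv power_add)
  also have "... = qv ^ card (x_pairs c d ?F f) * h f * ?p"
  by (simp add:sum_distrib_left[symmetric] asc_sum[OF c d True])
  finally have "?p * ten (ind n (sprod c d B)) (dl f) f = ?p * (qv ^ card (x_pairs c d ?F f) * h f)"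
  unfolding G by (simp)
  thus ?thesis using poin_nz True by (simp add:h_def)
 qed
qed

end

theorem diag_Bz:
 fixes f :: "nat => 'c::linorder"
 assumes "zz n Is"
 shows "ten (ind n (Bz Is)) (dl f) f =
  (if ALL J:set Is. inj_on f (ivl J)
  then qv ^ card {(i, j). i < j & f i < f j & (EX J:set Is. i:ivl J & j:ivl J)} else 0)"
 using assms
proof (induction Is rule:rev_induct)
 case Nil
 have "red n id = []" using len_red[OF id_Sym, of n] by simp
 thus ?case by (simp add:ind_def hk_rep.act_wt[OF reg_rep] dl_def)
next
 case (snoc I Is)
 have z: "zz n (Is @ [I])" and z': "zz n Is" using snoc.prems zz_butlast by auto
 obtain L R where cut: "zcut Is I L R" using zz_cuts[OF z] .
 interpret star_step n "fst I" "snd I" L R "Bz Is" by (rule star_step_zz[OF z cut])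
 let ?X = "{(i, j). i < j & f i < f j & (EX J:set Is. i:ivl J & j:ivl J)}"
 let ?C = "x_pairs (fst I) (snd I) {L..<R} f"
 have "{(i, j). i < j & f i < f j & (EX J:set (Is @ [I]). i:ivl J & j:ivl J)} = ?C Un ?X"
 proof (rule Set.set_eqI)
  fix p :: "cell"
  obtain i j where p: "p = (i, j)" by fastforce
  \<comment> \<open>A pair in the new interval that no cut separates lies in one of the overlaps,
    hence in an earlier interval, and is already counted.\<close>
  have "EX J:set Is. i:ivl J & j:ivl J"
  if ij: "fst I <= i" "i < j" "j <= snd I" and no: "~ (EX k:{L..<R}. i <= k & k < j)"
  proof -
  have "j <= L \<or> R <= i"
  proof (rule ccontr)
  assume "~ (j <= L \<or> R <= i)"
  hence "max i L:{L..<R}" "i <= max i L" "max i L < j" using LR ij by auto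
  thus False using no by blast
  qed
  thus ?thesis
  proof
  assume "j <= L"
  hence "fst I <= L" using ij by simp
  then obtain l where "l < length Is" "snd (Is ! l) = L" "fst (Is ! l) < fst I" using cut unfolding zcut_def by blast
  thus ?thesis using ij \<open>j <= L\<close> by (intro bexI[of _ "Is ! l"]) (auto simp:ivl_def)
  next
  assume "R <= i"
  hence "R <= snd I" using ij by simp
  then obtain l where "l < length Is" "fst (Is ! l) = R" "snd I < snd (Is ! l)" using cut unfolding zcut_def by blast
  thus ?thesis using ij \<open>R <= i\<close> by (intro bexI[of _ "Is ! l"]) (auto simp:ivl_def)
  qed
  qed
  thus "p:{(i, j). i < j & f i < f j & (EX J:set (Is @ [I]). i:ivl J & j:ivl J)} <-> p:?C Un ?X"
  unfolding p x_pairs_def by (auto simp:ivl_def)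
 qed
 moreover have "?C Int ?X = {}"
 proof -
  have "False" if "J:set Is" "i:ivl J" "j:ivl J" "k:{L..<R}" "i <= k" "k < j" for J i j k
  using zcut_cut[OF cut that(1,4)] that by (auto simp:ivl_def)
  thus ?thesis unfolding x_pairs_def by blast
 qed
 moreover have "finite ?X"
  by (rule finite_subset[of _ "{1..n} \<times> {1..n}"]) (use zz_valid[OF z'] in "fastforce simp:ivl_def")+
 ultimately have "card {(i, j). i < j & f i < f j & (EX J:set (Is @ [I]). i:ivl J & j:ivl J)} = card ?C + card ?X"
  by (simp add:card_Un_disjoint)
 thus ?case
  unfolding Bz_snoc diag_step snoc.IH[OF z'] by (simp add:power_add ivl_def[of I])
qed

section \<open>Paths in zig-zag networks\<close>

context
 fixes n :: nat and Is :: "cell list"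
 assumes z: "zz n Is" and cover: "(UN I:set Is. ivl I) = {1..n}"
begin

abbreviation (input) "\<N> == zigzag_network n Is"

definition "cen i = filter (%k. i:ivl (Is ! k)) [0..<length Is]"

text \<open>\<open>j\<close> and \<open>k\<close> are consecutive centers on the strand
  \<open>i\<close>.\<close>

definition "adj i j k <-> j < k & k < length Is & i:ivl (Is ! j) & i:ivl (Is ! k) & (ALL l. j < l & l < k --> i ~: ivl (Is ! l))"

lemma str_cen: "strand Is i = Source i # map Center (cen i) @ [Sink i]"
 by (simp add:strand_def cen_def)

lemma set_cen: "set (cen i) = {k. k < length Is & i:ivl (Is ! k)}"
 by (auto simp:cen_def)

lemma cen_srt: "sorted_wrt (<) (cen i)"
 unfolding cen_def by (rule sorted_wrt_filter) simp

lemma cen_ne: assumes "i:{1..n}" shows "cen i ~= []"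
proof -
 note assms
 then obtain I where "I:set Is" "i:ivl I" using cover by blast
 hence "set (cen i) ~= {}" by (auto simp:set_cen in_set_conv_nth)
 thus ?thesis by auto
qed

lemma zip_tl_middle:
 "(x, y):set (zip (xs @ [e]) (tl (xs @ [e]))) <->
  (EX us vs. xs @ [e] = us @ x # y # vs)"
proof
 assume "(x, y):set (zip (xs @ [e]) (tl (xs @ [e])))"
 then obtain t where t: "t < length (tl (xs @ [e]))" "(xs @ [e]) ! t = x" "tl (xs @ [e]) ! t = y"
  by (auto simp:in_set_zip)
 hence "Suc t < length (xs @ [e])" "(xs @ [e]) ! Suc t = y" by (auto simp:nth_tl)
 hence "xs @ [e] = take t (xs @ [e]) @ x # y # drop (Suc (Suc t)) (xs @ [e])"
  using t(2) by (metis Cons_nth_drop_Suc Suc_lessD append_take_drop_id)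
 thus "EX us vs. xs @ [e] = us @ x # y # vs" by blast
next
 assume "EX us vs. xs @ [e] = us @ x # y # vs"
 then obtain us vs where eq: "xs @ [e] = us @ x # y # vs" by blast
 show "(x, y):set (zip (xs @ [e]) (tl (xs @ [e])))"
  unfolding eq by (cases us) (auto simp:in_set_zip nth_append intro!:exI[of _ "length us"])
qed

lemma cen_adj: assumes eq: "cen i = us @ j # k # vs" shows "adj i j k"
proof -
 have s: "sorted_wrt (<) (us @ j # k # vs)" using cen_srt[of i] eq by simp
 have m: "set (us @ j # k # vs) = {k. k < length Is & i:ivl (Is ! k)}" using set_cen[of i] eq by simp
 have "j:set (us @ j # k # vs)" "k:set (us @ j # k # vs)" by simp_all
 hence "j < length Is" "k < length Is" "i:ivl (Is ! j)" "i:ivl (Is ! k)" unfolding m by auto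
 moreover have "j < k" using s by (simp add:sorted_wrt_append)
 moreover have "i ~: ivl (Is ! l)" if "j < l" "l < k" for l
 proof
  assume "i:ivl (Is ! l)"
  hence "l:set (us @ j # k # vs)" unfolding m using that \<open>k < length Is\<close> by simp
  thus False using s that by (auto simp:sorted_wrt_append)
 qed
 ultimately show ?thesis by (simp add:adj_def)
qed

lemma star_arcs: "arcs (stc n Is) =
  {(x, i, y). i:{1..n} & (EX us vs. strand Is i = us @ x # y # vs)}"
 unfolding star_concat_def str_cen by (simp add:zip_tl_middle[of _ _ "Source _ # map Center _", simplified] del:zip_Cons)

lemma str_split_cen:
 "strand Is i = us @ Center j # Center k # vs <->
  (EX us' vs'. us = Source i # map Center us' & vs = map Center vs' @ [Sink i] & cen i = us' @ j # k # vs')"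
proof
 assume eq: "strand Is i = us @ Center j # Center k # vs"
 then obtain us1 where us: "us = Source i # us1" by (cases us) (auto simp:str_cen)
 obtain vs1 where vs: "vs = vs1 @ [Sink i]"
  using eq by (cases vs rule:rev_cases) (auto simp:str_cen)
 have "map Center (cen i) = us1 @ Center j # Center k # vs1"
  using eq by (simp add:str_cen us vs)
 then obtain us' vs' where "us1 = map Center us'" "vs1 = map Center vs'" "cen i = us' @ j # k # vs'"
  by (auto simp:map_eq_append_conv)
 thus "EX us' vs'. us = Source i # map Center us' & vs = map Center vs' @ [Sink i] & cen i = us' @ j # k # vs'"
  using us vs by blast
qed (auto simp:str_cen)

lemma arc_cen_cen: "(Center j, i, Center k):arcs (stc n Is) ==> adj i j k"
 by (auto simp:star_arcs str_split_cen intro:cen_adj)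

lemma arc_from_source: assumes "(Source i, i', y):arcs (stc n Is)" shows "i' = i & y = Center (hd (cen i))"
proof -
 note assms
 then obtain us vs where e: "i':{1..n}" "strand Is i' = us @ Source i # y # vs" by (auto simp:star_arcs)
 hence us: "us = []"
 proof (cases us)
  case (Cons a us1)
  hence "map Center (cen i') @ [Sink i'] = us1 @ Source i # y # vs" using e by (simp add:str_cen)
  hence "Source i:set (map Center (cen i') @ [Sink i'])" by simp
  thus ?thesis by auto
 qed simp
 thus ?thesis using e cen_ne[OF e(1)] by (cases "cen i'") (auto simp:str_cen)
qed

lemma arc_to_sink: assumes "(x, i', Sink i):arcs (stc n Is)" shows "i' = i & x = Center (last (cen i))"
proof -
 note assms
 then obtain us vs where e: "i':{1..n}" "strand Is i' = us @ x # Sink i # vs" by (auto simp:star_arcs)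
 have vs: "vs = []"
 proof (cases vs rule:rev_cases)
  case (snoc vs1 a)
  hence "Source i' # map Center (cen i') = us @ x # Sink i # vs1" using e by (simp add:str_cen)
  hence "Sink i:set (Source i' # map Center (cen i'))" by simp
  thus ?thesis by auto
 qed
 have ne: "cen i' ~= []" by (rule cen_ne[OF e(1)])
 then obtain ks k where ks: "cen i' = ks @ [k]" by (cases "cen i'" rule:rev_cases) auto
 have "(Source i' # map Center ks) @ [Center k, Sink i'] = us @ [x, Sink i]"
  using e(2) by (auto simp:str_cen vs ks)
 hence "Center k = x & i' = i" by auto
 thus ?thesis using ks by auto
qed

lemma arc_from_cen:
 "(Center j, i', y):arcs (stc n Is) ==> (EX k. y = Center k) \<or> y = Sink i'"
proof -
 assume "(Center j, i', y):arcs (stc n Is)"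
 then obtain us vs where e: "strand Is i' = us @ Center j # y # vs" by (auto simp:star_arcs)
 hence "y:set (map Center (cen i') @ [Sink i'])"
  by (cases us) (auto simp:str_cen)
 thus ?thesis by auto
qed

lemma no_arc_from_sink: "(Sink j, i', y) ~: arcs (stc n Is)"
proof
 assume "(Sink j, i', y):arcs (stc n Is)"
 then obtain us vs where e: "strand Is i' = us @ Sink j # y # vs" by (auto simp:star_arcs)
 have "Sink j:set (butlast (strand Is i'))" unfolding e by (simp add:butlast_append)
 thus False by (auto simp:str_cen)
qed

lemma nw_simps [simp]: "tail \<N> = fst" "head \<N> = (%a. snd (snd a))" "verts \<N> = (UN i:{1..n}. set (strand Is i))"
 by (simp_all add:zigzag_network_def star_concat_def)

lemma nw_arcs: "arcs \<N> = {a:arcs (stc n Is). ~ (EX j k i i'. covers Is j k & a = (Center j, i, Center k) &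
  (Center j, i', Center k):arcs (stc n Is) & i' < i)}"
 by (simp add:zigzag_network_def Let_def)

text \<open>Both endpoints are monotone along the three intervals, so the middle one contains the
  intersection of the outer two.\<close>

lemma common_middle:
 assumes "j < l" "l < k" "k < length Is" "x:ivl (Is ! j) Int ivl (Is ! k)"
  "ivl (Is ! j) Int ivl (Is ! l) ~= {}" "ivl (Is ! l) Int ivl (Is ! k) ~= {}"
 shows "x:ivl (Is ! l)"
proof -
 have m: "Is ! j:set Is" "Is ! l:set Is" "Is ! k:set Is" using assms by auto
 from zz_triple[OF z assms(1-3,5,6)] show ?thesis
  using zz_nest[OF z m(1,2)] zz_nest[OF z m(3,2)] assms(4)
  by (auto simp:ivl_def)
qed

lemma adj_covers: assumes a: "adj i j k" shows "covers Is j k"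
proof -
 have "ivl (Is ! j) Int ivl (Is ! l) Int ivl (Is ! k) = {}" if l: "j < l" "l < k" for l
 proof (rule ccontr)
  assume "~ ?thesis"
  hence "ivl (Is ! j) Int ivl (Is ! l) ~= {}" "ivl (Is ! l) Int ivl (Is ! k) ~= {}" by blast+
  thus False using common_middle[OF l, of i] a l by (auto simp:adj_def)
 qed
 thus ?thesis using a by (auto simp:covers_def adj_def)
qed

lemma cen_arc_uniq:
 assumes "(Center j, i, Center k):arcs \<N>" "(Center j, i', Center k):arcs \<N>" shows "i = i'"
proof -
 have arcs: "(Center j, i, Center k):arcs (stc n Is)" "(Center j, i', Center k):arcs (stc n Is)"
  using assms by (simp_all add:nw_arcs)
 have "covers Is j k" using adj_covers[OF arc_cen_cen[OF arcs(1)]] .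
 hence "~ i' < i" "~ i < i'" using assms by (auto simp:nw_arcs)
 thus ?thesis by simp
qed

text \<open>The centers visited by a walk. Its arcs may belong to different strands, since of
  parallel arcs only one is retained.\<close>

definition "chain ks <-> (ALL t. Suc t < length ks --> (EX i. adj i (ks ! t) (ks ! Suc t)))"

text \<open>Consecutive intervals of a chain meet, so the condition on triples makes the endpoints
  monotone along the whole chain; membership at both ends then passes to everything in
  between.\<close>

lemma chain_mem:
 assumes ks: "chain ks" "ks ~= []" and i: "i:ivl (Is ! hd ks)" "i:ivl (Is ! last ks)" and t: "t < length ks"
 shows "i:ivl (Is ! (ks ! t))"
proof (cases "length ks <= 2")
 case True
 hence "t = 0 \<or> t = length ks - 1" using t by linarith
 thus ?thesis using i ks(2) by (auto simp:hd_conv_nth last_conv_nth)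
next
 case False
 let ?c = "%t. fst (Is ! (ks ! t))"
 have len: "ks ! t < length Is" if "t < length ks" for t
 proof (cases t)
  case 0
  thus ?thesis using ks(1) False unfolding chain_def by (auto simp:adj_def dest!: spec[of _ 0])
 next
  case (Suc s) thus ?thesis using ks(1) that unfolding chain_def by (auto simp:adj_def)
 qed
 have step: "(?c t < ?c (Suc t) & ?c (Suc t) < ?c (Suc (Suc t))) \<or> (?c t > ?c (Suc t) & ?c (Suc t) > ?c (Suc (Suc t)))"
  if tt: "Suc (Suc t) < length ks" for t
 proof -
  obtain i i' where "adj i (ks ! t) (ks ! Suc t)" "adj i' (ks ! Suc t) (ks ! Suc (Suc t))"
  using ks(1)[unfolded chain_def, rule_format, OF Suc_lessD[OF tt]] ks(1)[unfolded chain_def, rule_format, OF tt] by blast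
  thus ?thesis by (intro zz_triple[OF z]) (auto simp:adj_def)
 qed
 have mem: "Is ! (ks ! t):set Is" if "t < length ks" for t using len[OF that] by simp
 have hd: "i:ivl (Is ! (ks ! 0))" and lst: "i:ivl (Is ! (ks ! (length ks - 1)))"
  using i ks(2) by (simp_all add:hd_conv_nth last_conv_nth)
 have dir: "(ALL t. Suc t < length ks --> ?c t < ?c (Suc t)) \<or> (ALL t. Suc t < length ks --> ?c t > ?c (Suc t))"
 proof (cases "?c 0 < ?c (Suc 0)")
  case True
  have "?c t < ?c (Suc t)" if "Suc t < length ks" for t
  using that True by (induction t) (use step in fastforce)+
  thus ?thesis by blast
 next
  case F: False
  hence "?c 0 > ?c (Suc 0)" using step[of 0] False by auto
  hence "?c t > ?c (Suc t)" if "Suc t < length ks" for t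
  using that by (induction t) (use step in fastforce)+
  thus ?thesis by blast
 qed
 from dir show ?thesis
 proof
  assume inc: "ALL t. Suc t < length ks --> ?c t < ?c (Suc t)"
  have up: "?c s <= ?c r & snd (Is ! (ks ! s)) <= snd (Is ! (ks ! r))" if "s <= r" "r < length ks" for s r
  using that
  proof (induction rule:dec_induct)
  case (step r)
  have "snd (Is ! (ks ! r)) < snd (Is ! (ks ! Suc r))" using zz_nest[OF z mem mem] inc step by simp
  thus ?case using step inc by fastforce
  qed simp
  have "t <= length ks - 1" "length ks - 1 < length ks" using t by auto
  from up[OF this] up[of 0 t] t hd lst show ?thesis by (auto simp:ivl_def)
 next
  assume dec: "ALL t. Suc t < length ks --> ?c t > ?c (Suc t)"
  have up: "?c r <= ?c s & snd (Is ! (ks ! r)) <= snd (Is ! (ks ! s))" if "s <= r" "r < length ks" for s r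
  using that
  proof (induction rule:dec_induct)
  case (step r)
  have "snd (Is ! (ks ! Suc r)) < snd (Is ! (ks ! r))" using zz_nest[OF z mem mem] dec step by simp
  thus ?case using step dec by fastforce
  qed simp
  have "t <= length ks - 1" "length ks - 1 < length ks" using t by auto
  from up[OF this] up[of 0 t] t hd lst show ?thesis by (auto simp:ivl_def)
 qed
qed

text \<open>By \<open>chain_mem\<close> the chain visits only centers of strand \<open>i\<close>.
  None is skipped: a center between two consecutive ones would, by \<open>common_middle\<close>, lie
  on the strand that joins them.\<close>

lemma chain_eq_cen:
 assumes ks: "chain ks" "ks ~= []" and i: "i:{1..n}" and hl: "hd ks = hd (cen i)" "last ks = last (cen i)"
 shows "ks = cen i"
proof -
 have ne: "cen i ~= []" by (rule cen_ne[OF i])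
 have "hd (cen i):set (cen i)" "last (cen i):set (cen i)" using ne by simp_all
 hence ih: "i:ivl (Is ! hd ks)" "i:ivl (Is ! last ks)" "hd ks < length Is" "last ks < length Is"
  unfolding set_cen hl by auto
 note mem = chain_mem[OF ks ih(1,2)]
 have adj: "EX i. adj i (ks ! t) (ks ! Suc t)" if "Suc t < length ks" for t using ks(1) that by (simp add:chain_def)
 have lt: "ks ! t < ks ! Suc t" if "Suc t < length ks" for t using adj[OF that] by (auto simp:adj_def)
 have sorted: "sorted_wrt (<) ks" by (metis lt sorted_wrt_iff_nth_Suc_transp[of "(<)" ks] sorted_wrt_iff_nth_less transp_on_less)
 have len: "ks ! t < length Is" if "t < length ks" for t
 proof -
  have "ks ! t <= last ks" using sorted that ks(2) unfolding last_conv_nth[OF ks(2)] sorted_wrt_iff_nth_less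
  by (cases "t = length ks - 1") (auto simp:less_imp_le)
  thus ?thesis using ih by simp
 qed
 have "set ks = set (cen i)"
 proof
  show "set ks \<subseteq> set (cen i)" using mem len by (auto simp:set_cen in_set_conv_nth)
  show "set (cen i) \<subseteq> set ks"
  proof
  fix l assume l: "l:set (cen i)"
  hence il: "i:ivl (Is ! l)" by (simp add:set_cen)
  have bounds: "hd ks <= l" "l <= last ks"
  proof -
  obtain s where s: "s < length (cen i)" "cen i ! s = l" using l by (auto simp:in_set_conv_nth)
  show "hd ks <= l" unfolding hl hd_conv_nth[OF ne] using cen_srt[of i] s
  unfolding sorted_wrt_iff_nth_less by (cases "s = 0") (auto simp:less_imp_le)
  show "l <= last ks" unfolding hl last_conv_nth[OF ne] using cen_srt[of i] s
  unfolding sorted_wrt_iff_nth_less by (cases "s = length (cen i) - 1") (auto simp:less_imp_le)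
  qed
  define t where "t = (GREATEST t. t < length ks & ks ! t <= l)"
  have ex: "0 < length ks & ks ! 0 <= l" using bounds ks(2) by (simp add:hd_conv_nth)
  have t: "t < length ks & ks ! t <= l"
  unfolding t_def by (rule GreatestI_nat[where b = "length ks"]) (use ex in auto)
  have tmax: "s <= t" if "s < length ks" "ks ! s <= l" for s
  unfolding t_def by (rule Greatest_le_nat[where b = "length ks"]) (use that in auto)
  show "l:set ks"
  proof (cases "ks ! t = l")
  case True thus ?thesis using t by auto
  next
  case False
  hence "t ~= length ks - 1" using t bounds(2) ks(2) by (auto simp:last_conv_nth)
  hence st: "Suc t < length ks" using t by auto
  hence "l < ks ! Suc t" using tmax[of "Suc t"] by (meson Suc_n_not_le_n linorder_not_less)
  moreover have "ks ! t < l" using t False by simp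
  moreover obtain i' where i': "adj i' (ks ! t) (ks ! Suc t)" using adj[OF st] by blast
  ultimately have "i':ivl (Is ! l)"
  using mem[of t] mem[of "Suc t"] t st il
  by (intro common_middle[of "ks ! t" l "ks ! Suc t"]) (auto simp:adj_def)
  thus ?thesis using i' \<open>l < ks ! Suc t\<close> \<open>ks ! t < l\<close> by (auto simp:adj_def)
  qed
  qed
 qed
 thus ?thesis
  using sorted cen_srt[of i] by (intro sorted_distinct_set_unique) (auto simp:strict_sorted_iff)
qed

lemma walk_from_cen:
 assumes "set p \<subseteq> arcs \<N>" "pre_digraph.cas \<N> (Center k) p (Sink i)"
 shows "EX ks. hd ks = k & ks ~= [] & chain ks & last ks = last (cen i) & i:{1..n} &
  map fst p = map Center ks"
 using assms
proof (induction p arbitrary: k)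
 case Nil
 thus ?case by (simp add:pre_digraph.cas.simps)
next
 case (Cons a p)
 obtain x i' y where a: "a = (x, i', y)" by (cases a)
 have x: "x = Center k" and cas: "pre_digraph.cas \<N> y p (Sink i)"
  using Cons.prems(2) by (simp_all add:a pre_digraph.cas.simps)
 have arc: "(Center k, i', y):arcs (stc n Is)" using Cons.prems(1) by (simp add:a x nw_arcs)
 from arc_from_cen[OF arc] show ?case
 proof
  assume "EX k'. y = Center k'"
  then obtain k' where y: "y = Center k'" by blast
  obtain ks where ks: "hd ks = k'" "ks ~= []" "chain ks" "last ks = last (cen i)" "i:{1..n}" "map fst p = map Center ks"
  using Cons.IH[of k'] Cons.prems(1) cas y by auto
  have "adj i' k k'" using arc_cen_cen arc y by simp
  hence "chain (k # ks)" using ks(1-3) unfolding chain_def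
  by (auto simp:nth_Cons hd_conv_nth split: nat.splits)
  thus ?thesis using ks by (intro exI[of _ "k # ks"]) (simp add:a x)
 next
  assume y: "y = Sink i'"
  have "p = []"
  proof (cases p)
  case (Cons b p')
  hence "fst b = Sink i'" "b:arcs \<N>" using cas y Cons.prems(1) by (auto simp:pre_digraph.cas.simps)
  thus ?thesis using no_arc_from_sink[of i' "fst (snd b)" "snd (snd b)"] by (cases b) (auto simp:nw_arcs)
  qed simp
  hence "i' = i" using cas y by (simp add:pre_digraph.cas.simps)
  hence "k = last (cen i)" using arc_to_sink[of "Center k" i' i] arc y by simp
  moreover have "i:{1..n}" using arc \<open>i' = i\<close> by (simp add:star_arcs)
  ultimately show ?thesis using \<open>p = []\<close> by (intro exI[of _ "[k]"]) (simp add:a x chain_def)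
 qed
qed

lemma apath_fst:
 assumes p: "pre_digraph.apath \<N> (Source i) p (Sink i)"
 shows "map fst p = Source i # map Center (cen i)" "i:{1..n}"
proof -
 have sub: "set p \<subseteq> arcs \<N>" and cas: "pre_digraph.cas \<N> (Source i) p (Sink i)"
  using p by (auto simp:pre_digraph.apath_def pre_digraph.awalk_def)
 then obtain a p' where pp: "p = a # p'" by (cases p) (auto simp:pre_digraph.cas.simps)
 obtain x i' y where a: "a = (x, i', y)" by (cases a)
 have x: "x = Source i" and cas': "pre_digraph.cas \<N> y p' (Sink i)"
  using cas by (simp_all add:pp a pre_digraph.cas.simps)
 have "i' = i & y = Center (hd (cen i))"
  using arc_from_source[of i i' y] sub by (simp add:pp a x nw_arcs)
 then obtain ks where ks: "hd ks = hd (cen i)" "ks ~= []" "chain ks" "last ks = last (cen i)" "i:{1..n}" "map fst p' = map Center ks"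
  using walk_from_cen[of p' "hd (cen i)" i] cas' sub pp by auto
 thus "map fst p = Source i # map Center (cen i)" "i:{1..n}"
  using chain_eq_cen[OF ks(3,2,5,1,4)] by (simp_all add:pp a x)
qed

lemma apath_verts:
 assumes p: "pre_digraph.apath \<N> (Source i) p (Sink i)"
 shows "pre_digraph.awalk_verts \<N> (Source i) p = strand Is i"
proof -
 have cas: "pre_digraph.cas \<N> (Source i) p (Sink i)"
  using p by (auto simp:pre_digraph.apath_def pre_digraph.awalk_def)
 have "pre_digraph.awalk_verts \<N> u p = map fst p @ [v]" if "pre_digraph.cas \<N> u p v" for u v p
  using that by (induction p arbitrary: u) (auto simp:pre_digraph.cas.simps pre_digraph.awalk_verts.simps)
 from this[OF cas] show ?thesis by (simp add:apath_fst(1)[OF p] str_cen)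
qed

text \<open>At most one arc joins two given successive vertices: strands leave sources and enter
  sinks singly, and between centers one parallel arc is retained. So the vertices determine the
  walk.\<close>

lemma cas_det:
 assumes "pre_digraph.cas \<N> u p v" "pre_digraph.cas \<N> u p' v" "map fst p = map fst p'" "set p \<subseteq> arcs \<N>" "set p' \<subseteq> arcs \<N>"
  and "~ (EX i. u = Sink i)" "EX i. v = Sink i"
 shows "p = p'"
 using assms
proof (induction p arbitrary: u p')
 case (Cons a p)
 then obtain b q where p': "p' = b # q" by (cases p') auto
 obtain x i y where a: "a = (x, i, y)" by (cases a)
 obtain x' i' y' where b: "b = (x', i', y')" by (cases b)
 have xx: "x' = x" "u = x" using Cons.prems by (auto simp:p' a b pre_digraph.cas.simps)
 have cs: "pre_digraph.cas \<N> y p v" "pre_digraph.cas \<N> y' q v" using Cons.prems by (auto simp:p' a b pre_digraph.cas.simps)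
 have fsts: "map fst p = map fst q" using Cons.prems by (simp add:p')
 have yy: "y = y'"
 proof (cases p)
  case Nil
  thus ?thesis using cs fsts by (simp add:pre_digraph.cas.simps)
 next
  case (Cons c r)
  then obtain c' r' where "q = c' # r'" "fst c' = fst c" using fsts by (cases q) auto
  thus ?thesis using cs Cons by (simp add:pre_digraph.cas.simps)
 qed
 have arcs: "(x, i, y):arcs \<N>" "(x, i', y):arcs \<N>" using Cons.prems by (auto simp:p' a b yy)
 hence sa: "(x, i, y):arcs (stc n Is)" "(x, i', y):arcs (stc n Is)" by (auto simp:nw_arcs)
 have ii: "i = i'"
 proof (cases x)
  case (Source j) thus ?thesis using sa arc_from_source by blast
 next
  case (Sink j) thus ?thesis using sa no_arc_from_sink by blast
 next
  case (Center j)
  thus ?thesis using arc_from_cen[of j i y] sa arcs cen_arc_uniq arc_to_sink by blast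
 qed
 show ?case
 proof (cases "EX j. y = Sink j")
  case True
  hence "p = [] & q = []"
  proof -
  have "r = []" if cas: "pre_digraph.cas \<N> y r v" and sub: "set r \<subseteq> arcs \<N>" for r
  proof (cases r)
  case (Cons c r')
  hence "fst c = y" "c:arcs \<N>" using cas sub by (auto simp:pre_digraph.cas.simps)
  thus ?thesis using True no_arc_from_sink by (cases c) (auto simp:nw_arcs)
  qed simp
  thus ?thesis using cs yy Cons.prems by (auto simp:p')
  qed
  thus ?thesis by (simp add:p' a b xx yy ii)
 next
  case False
  hence "p = q" using Cons.IH[OF cs(1), of q] cs(2) fsts Cons.prems yy by (auto simp:p')
  thus ?thesis by (simp add:p' a b xx yy ii)
 qed
qed (auto simp:pre_digraph.cas.simps)

lemma cas_zip:
 "pre_digraph.cas \<N> x (map (%(a, b). (a, l a b, b)) (zip (x # xs) xs)) (last (x # xs))"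
 by (induction xs arbitrary: x) (auto simp:pre_digraph.cas.simps)

lemma apath_ex:
 assumes i: "i:{1..n}"
 shows "EX p. pre_digraph.apath \<N> (Source i) p (Sink i)"
proof -
 \<comment> \<open>The smallest index is the one that \<open>zigzag_network\<close> retains.\<close>
 define l where "l a b = (LEAST i'. (a, i', b):arcs (stc n Is))" for a b
 define xs where "xs = map Center (cen i) @ [Sink i]"
 define p where "p = map (%(a, b). (a, l a b, b)) (zip (Source i # xs) xs)"
 have S: "strand Is i = Source i # xs" by (simp add:str_cen xs_def)
 have cas: "pre_digraph.cas \<N> (Source i) p (Sink i)"
  using cas_zip[of "Source i" l xs] by (simp add:p_def xs_def)
 have sub: "set p \<subseteq> arcs \<N>"
 proof
  fix a assume "a:set p"
  then obtain x y where a: "a = (x, l x y, y)" "(x, y):set (zip (Source i # xs) xs)" by (auto simp:p_def)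
  hence "(x, i, y):arcs (stc n Is)" using i S by (simp add:star_concat_def)
  hence 1: "(x, l x y, y):arcs (stc n Is)" unfolding l_def by (rule LeastI)
  have "l x y <= i'" if "(x, i', y):arcs (stc n Is)" for i' unfolding l_def using that by (rule Least_le)
  thus "a:arcs \<N>" using 1 unfolding nw_arcs a(1) by fastforce
 qed
 have av: "pre_digraph.awalk_verts \<N> u q = map fst q @ [v]" if "pre_digraph.cas \<N> u q v" for u v q
  using that by (induction q arbitrary: u) (auto simp:pre_digraph.cas.simps pre_digraph.awalk_verts.simps)
 have "map fst p = map fst (zip (Source i # xs) xs)"
  unfolding p_def by (simp add:case_prod_beta)
 hence "map fst p = butlast (Source i # xs)" by (simp add:map_fst_zip_take butlast_conv_take)
 hence "pre_digraph.awalk_verts \<N> (Source i) p = Source i # xs"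
  using av[OF cas] by (simp add:xs_def)
 moreover have "distinct (Source i # xs)"
  using cen_srt[of i] by (auto simp:xs_def distinct_map inj_on_def strict_sorted_iff)
 moreover have "Source i:verts \<N>" using i S by (auto intro!:bexI[of _ i])
 ultimately show ?thesis using cas sub by (auto simp:pre_digraph.apath_def pre_digraph.awalk_def)
qed

lemma diagonal_path_apath:
 assumes i: "i:{1..n}" shows "pre_digraph.apath \<N> (Source i) (diagonal_path \<N> i) (Sink i)"
 unfolding diagonal_path_def
proof (rule theI')
 obtain p where p: "pre_digraph.apath \<N> (Source i) p (Sink i)" using apath_ex[OF i] by blast
 show "EX! p. pre_digraph.apath \<N> (Source i) p (Sink i)"
 proof (rule ex1I[of _ p])
  show "pre_digraph.apath \<N> (Source i) p (Sink i)" by (rule p)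
 next
  fix q assume q: "pre_digraph.apath \<N> (Source i) q (Sink i)"
  show "q = p"
  by (rule cas_det[of "Source i" q "Sink i"])
  (use p q apath_fst(1)[OF p] apath_fst(1)[OF q] in "auto simp:pre_digraph.apath_def pre_digraph.awalk_def")
 qed
qed

lemma strands_disjoint_iff:
 assumes "i < j"
 shows "set (strand Is i) Int set (strand Is j) = {} <-> ~ (EX I:set Is. i:ivl I & j:ivl I)"
proof -
 have "set (strand Is i) Int set (strand Is j) = Center ` (set (cen i) Int set (cen j))"
  using assms by (auto simp:str_cen)
 moreover have "set (cen i) Int set (cen j) = {} <-> (ALL k<length Is. ~ (i:ivl (Is ! k) & j:ivl (Is ! k)))"
  unfolding set_cen by auto
 ultimately show ?thesis by (simp add:all_set_conv_all_nth)
qed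

theorem path_poset_ivls:
 "path_poset n \<N> = {(i, j). i:{1..n} & j:{1..n} & i < j & ~ (EX I:set Is. i:ivl I & j:ivl I)}"
proof -
 have A: "set (pre_digraph.awalk_verts \<N> (Source i) (diagonal_path \<N> i)) = set (strand Is i)" if "i:{1..n}" for i
  using apath_verts[OF diagonal_path_apath[OF that]] by simp
 show ?thesis unfolding path_poset_def
  by (rule Set.set_eqI, clarify, unfold mem_Collect_eq prod.case, intro conj_cong refl) (simp only:A strands_disjoint_iff)
qed

end

section \<open>Recovering the labeled poset from its altitudes\<close>

lemma monotone_bij_eq:
 fixes a b :: "nat => int"
 assumes f: "bij_betw f {1..n} {1..n}" and ab: "!!x. x:{1..n} ==> a x = b (f x)"
  and a: "!!x y. x:{1..n} ==> y:{1..n} ==> x <= y ==> a x <= a y"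
  and b: "!!x y. x:{1..n} ==> y:{1..n} ==> x <= y ==> b x <= b y"
  and x: "x:{1..n}"
 shows "a x = b x"
proof -
 let ?xs = "[1..<Suc n]"
 have m: "mset ?xs = mset_set {1..n}" by (simp add:atLeastLessThanSuc_atLeastAtMost del:upt_Suc)
 have "mset (map a ?xs) = image_mset (b o f) (mset_set {1..n})"
  unfolding mset_map m by (intro image_mset_cong) (simp add:ab)
 also have "... = image_mset b (mset_set {1..n})"
  using f by (simp add:bij_betw_def image_mset_mset_set flip:multiset.map_comp)
 also have "... = mset (map b ?xs)" unfolding mset_map m ..
 finally have "mset (map a ?xs) = mset (map b ?xs)" .
 moreover have "sorted (map a ?xs)" "sorted (map b ?xs)"
  unfolding sorted_map by (rule sorted_wrt_mono_rel[OF _ sorted_upt], rule a b; auto)+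
 ultimately have "map a ?xs = map b ?xs" by (metis properties_for_sort)
 thus ?thesis using x by (simp del:upt_Suc)
qed

lemma poset_iso_sym:
 assumes "poset_iso A P B Q" shows "poset_iso B Q A P"
proof -
 obtain f where f: "bij_betw f A B" "ALL x:A. ALL y:A. (x, y):P <-> (f x, f y):Q"
  using assms by (auto simp:poset_iso_def)
 have g: "bij_betw (inv_into A f) B A" by (rule bij_betw_inv_into[OF f(1)])
 show ?thesis unfolding poset_iso_def
  by (rule exI[of _ "inv_into A f"]) (use f g bij_betw_apply[OF g] bij_betw_inv_into_right[OF f(1)] in auto)
qed

lemma poset_iso_trs:
 assumes "poset_iso A P B Q" "poset_iso B Q C R" shows "poset_iso A P C R"
proof -
 obtain f g where "bij_betw f A B" "ALL x:A. ALL y:A. (x, y):P <-> (f x, f y):Q"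
  and "bij_betw g B C" "ALL x:B. ALL y:B. (x, y):Q <-> (g x, g y):R"
  using assms by (auto simp:poset_iso_def)
 thus ?thesis unfolding poset_iso_def
  by (intro exI[of _ "g o f"]) (auto intro:bij_betw_trans simp:bij_betw_apply)
qed

lemma altitude_iso:
 assumes f: "bij_betw f A B" "ALL x:A. ALL y:A. (x, y):P <-> (f x, f y):Q" and x: "x:A"
 shows "altitude A P x = altitude B Q (f x)"
proof -
 have "bij_betw f {z:A. (z, x):P} {z:B. (z, f x):Q}" "bij_betw f {z:A. (x, z):P} {z:B. (f x, z):Q}"
  using f x by (auto simp:bij_betw_def inj_on_def)
 thus ?thesis unfolding altitude_def by (simp add:bij_betw_same_card)
qed

text \<open>In both posets the altitude is weakly increasing in the label, and isomorphisms preserve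
  it, so it is the same function of the label. In the path poset, elements of equal altitude have
  the same elements below and above; hence the isomorphism only permutes indistinguishable
  elements.\<close>

lemma path_poset_eq:
 assumes z: "zz n Js" and cover: "(UN J:set Js. ivl J) = {1..n}"
  and P: "P \<subseteq> {1..n} \<times> {1..n}" "altitude_respecting n P"
  and iso: "poset_iso {1..n} P {1..n} (path_poset n (zigzag_network n Js))"
 shows "P = path_poset n (zigzag_network n Js)"
proof -
 define Q where "Q = path_poset n (zigzag_network n Js)"
 have Q: "Q = {(i, j). i:{1..n} & j:{1..n} & i < j & ~ (EX I:set Js. i:ivl I & j:ivl I)}"
  unfolding Q_def by (rule path_poset_ivls[OF z cover])
 let ?D = "%x. {z:{1..n}. (z, x):Q}" and ?U = "%x. {z:{1..n}. (x, z):Q}"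
 have D: "?D x \<subseteq> ?D y" if "x <= y" "y:{1..n}" for x y using that by (auto simp:Q ivl_def)
 have U: "?U y \<subseteq> ?U x" if "x <= y" "x:{1..n}" for x y using that by (auto simp:Q ivl_def)
 have cards: "card (?D x) <= card (?D y)" "card (?U y) <= card (?U x)" if "x <= y" "y:{1..n}" "x:{1..n}" for x y
  by (intro card_mono D U that; simp)+
 have mono: "altitude {1..n} Q x <= altitude {1..n} Q y" if "x:{1..n}" "y:{1..n}" "x <= y" for x y
  using cards[OF that(3,2,1)] by (simp add:altitude_def)
 have fin: "finite (?D x)" "finite (?U x)" for x by simp_all
 have level1: "?D x = ?D y & ?U x = ?U y"
  if "altitude {1..n} Q x = altitude {1..n} Q y" "x:{1..n}" "y:{1..n}" "x <= y" for x y
 proof -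
  have c: "card (?D x) = card (?D y)" "card (?U y) = card (?U x)"
  using cards[OF that(4,3,2)] that(1) by (simp_all add:altitude_def)
  show ?thesis
  using card_subset_eq[OF fin(1) D[OF that(4,3)] c(1)] card_subset_eq[OF fin(2) U[OF that(4,2)] c(2)]
  by (intro conjI) (erule sym | assumption)+
 qed
 have level: "?D x = ?D y & ?U x = ?U y"
  if "altitude {1..n} Q x = altitude {1..n} Q y" "x:{1..n}" "y:{1..n}" for x y
 proof (cases "x <= y")
  case True thus ?thesis using level1[OF that] by blast
 next
  case False
  hence "y <= x" by simp
  from level1[OF that(1)[symmetric] that(3,2) this] show ?thesis by (elim conjE) (intro conjI; rule sym)
 qed
 obtain f where f: "bij_betw f {1..n} {1..n}" "ALL x:{1..n}. ALL y:{1..n}. (x, y):P <-> (f x, f y):Q"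
  using iso by (auto simp:poset_iso_def Q_def)
 note fx = bij_betw_apply[OF f(1)]
 have alt: "altitude {1..n} P x = altitude {1..n} Q (f x)" if "x:{1..n}" for x by (rule altitude_iso[OF f that])
 have PQ: "altitude {1..n} P x = altitude {1..n} Q x" if x: "x:{1..n}" for x
 proof (rule monotone_bij_eq[where a = "altitude {1..n} P", OF f(1) _ _ _ x])
  show "altitude {1..n} P x <= altitude {1..n} P y" if "x:{1..n}" "y:{1..n}" "x <= y" for x y
  using P(2)[unfolded altitude_respecting_def, rule_format, OF that(2,1)] that(3) by linarith
 qed (fact alt mono)+
 have lv: "?D (f x) = ?D x & ?U (f x) = ?U x" if "x:{1..n}" for x
  by (rule level[OF trans[OF alt[OF that, symmetric] PQ[OF that]] fx[OF that] that])
 have "(x, y):P <-> (x, y):Q" if xy: "x:{1..n}" "y:{1..n}" for x y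
 proof -
  have "(x, y):P <-> (f x, f y):Q" using f xy by blast
  also have "... <-> f x:?D (f y)" using fx[OF xy(1)] by blast
  also have "... <-> y:?U (f x)" using lv[OF xy(2)] fx[OF xy(1)] xy by blast
  also have "... <-> (x, y):Q" using lv[OF xy(1)] xy by blast
  finally show ?thesis .
 qed
 thus ?thesis using P(1) unfolding Q_def[symmetric] by (auto simp:Q)
qed

section \<open>Standard fillings of Young diagrams\<close>

definition dia :: "cell set => bool" where
 "dia D <-> finite D & (ALL (i, j):D. ALL i'<=i. ALL j'<=j. (i', j'):D)"

text \<open>The content of a cell, column minus row.\<close>

definition ct :: "cell => int" where
 "ct A = int (snd A) - int (fst A)"

definition cell_le :: "cell => cell => bool" where
 "cell_le A B <-> fst A <= fst B & snd A <= snd B"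

lemma diagramD: "dia D ==> B:D ==> cell_le A B ==> A:D"
 unfolding dia_def cell_le_def by (cases A, cases B) auto

lemma diagramI: "finite D ==> (!!A B. B:D ==> cell_le A B ==> A:D) ==> dia D"
 unfolding dia_def cell_le_def by auto

lemma dia_fin: "dia D ==> finite D"
 by (simp add:dia_def)

definition addb :: "cell set => cell => bool" where
 "addb D A <-> A ~: D & dia D & dia (insert A D)"

text \<open>Two different addable cells are incomparable, so one is strictly lower and strictly
  further left.\<close>

lemma addb_ct:
 assumes "addb D A" "addb D B" "A ~= B" shows "\<bar>ct A - ct B\<bar> >= 2"
proof -
 have "~ cell_le A B" "~ cell_le B A"
  using assms diagramD[of "insert B D" B A] diagramD[of "insert A D" A B] by (auto simp:addb_def)
 thus ?thesis by (auto simp:cell_le_def ct_def)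
qed

lemma addb_insert:
 assumes P: "addb P A" "addb (insert A P) B"
 shows "addb P B <-> ~ cell_le A B" and "cell_le A B ==> \<bar>ct B - ct A\<bar> = 1"
proof -
 note d = P[unfolded addb_def]
 show "addb P B <-> ~ cell_le A B"
 proof
  assume "addb P B" thus "~ cell_le A B"
  using d diagramD[of "insert B P" B A] by (auto simp:addb_def)
 next
  assume n: "~ cell_le A B"
  have "dia (insert B P)"
  proof (rule diagramI)
  fix C D assume "D:insert B P" "cell_le C D"
  thus "C:insert B P"
  using d diagramD[of P D C] diagramD[of "insert B (insert A P)" B C] n by auto
  qed (use d in "auto dest:dia_fin")
  thus "addb P B" using d by (auto simp:addb_def)
 qed
 assume le: "cell_le A B"
 have box: "C = A \<or> C = B" if "cell_le A C" "cell_le C B" for C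
  using diagramD[of "insert B (insert A P)" B C] diagramD[of P C A] that d by auto
 have ne: "A ~= B" using d by auto
 obtain i j where A: "A = (i, j)" by (cases A)
 obtain i' j' where B: "B = (i', j')" by (cases B)
 have "i <= i'" "j <= j'" using le by (auto simp:A B cell_le_def)
 show "\<bar>ct B - ct A\<bar> = 1"
 proof (cases "i = i'")
  case True
  thus ?thesis using box[of "(i, Suc j)"] ne \<open>j <= j'\<close> by (auto simp:A B cell_le_def ct_def)
 next
  case False
  thus ?thesis using box[of "(Suc i, j)"] ne \<open>i <= i'\<close> \<open>j <= j'\<close> by (auto simp:A B cell_le_def ct_def)
 qed
qed

text \<open>Standard fillings, as the map from entries to cells. The default \<open>(0, 0)\<close>
  outside \<open>{1..n}\<close> makes equality of fillings equality of functions.\<close>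

definition std :: "nat => (nat => cell) set" where
 "std n = {z. inj_on z {1..n} & (ALL k<=n. dia (z ` {1..k})) & (ALL k. k ~: {1..n} --> z k = (0, 0))}"

abbreviation shape :: "nat => (nat => cell) => cell set" where
 "shape n z == z ` {1..n}"

lemma image_Suc: "f ` {1..Suc k} = insert (f (Suc k)) (f ` {1..k})"
 by (simp add:atLeastAtMostSuc_conv)

lemma std_addb:
 assumes "z:std n" "Suc k <= n" shows "addb (z ` {1..k}) (z (Suc k))"
proof -
 have "z (Suc k) ~: z ` {1..k}" using assms by (auto simp:std_def dest!: inj_onD)
 moreover have "dia (z ` {1..k})" "dia (insert (z (Suc k)) (z ` {1..k}))"
  using assms unfolding std_def image_Suc[symmetric] by auto
 ultimately show ?thesis by (simp add:addb_def)
qed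

lemma stdI:
 assumes "!!k. k < n ==> addb (z ` {1..k}) (z (Suc k))" "!!k. k ~: {1..n} ==> z k = (0, 0)"
 shows "z:std n"
proof -
 have "inj_on z {1..k} & dia (z ` {1..k})" if "k <= n" for k
  using that
 proof (induction k)
  case 0 thus ?case by (simp add:dia_def)
 next
  case (Suc k)
  hence "inj_on z {1..k}" "addb (z ` {1..k}) (z (Suc k))" using assms(1)[of k] by auto
  moreover have "{1..Suc k} = insert (Suc k) {1..k}" by auto
  ultimately show ?case by (simp add:addb_def)
 qed
 thus ?thesis using assms(2) by (auto simp:std_def)
qed

lemma fin_std [simp]: "finite (std n)"
proof -
 have sub: "z k:{..n} \<times> {..n}" if z: "z:std n" for z k
 proof (cases "k:{1..n}")
  case True
  obtain i j where ij: "z k = (i, j)" by (cases "z k")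
  have D: "dia (z ` {1..n})" using z by (simp add:std_def)
  have "(i, j):z ` {1..n}" using True ij by (metis image_eqI)
  hence "(%i'. (i', j)) ` {..i} \<subseteq> z ` {1..n}" "(%j'. (i, j')) ` {..j} \<subseteq> z ` {1..n}"
  using diagramD[OF D, of "(i, j)"] by (auto simp:cell_le_def)
  hence "card ((%i'. (i', j)) ` {..i}) <= card (z ` {1..n})" "card ((%j'. (i, j')) ` {..j}) <= card (z ` {1..n})"
  by (auto intro:card_mono)
  moreover have "card (z ` {1..n}) <= n" using card_image_le[of "{1..n}" z] by simp
  ultimately show ?thesis by (simp add:ij card_image inj_on_def)
 qed (use z in "auto simp:std_def")
 show ?thesis
  by (rule finite_subset[OF _ finite_set_of_finite_funs[of "{1..n}" "{..n} \<times> {..n}" "(0, 0)"]])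
  (use sub in "auto simp:std_def")
qed

lemma image_sw_prefix:
 assumes "k ~= i" "1 <= i" shows "(z o sw i) ` {1..k} = z ` {1..k}"
proof -
 have "sw i ` {1..k} = {1..k}" using assms by (intro transpose_image_eq) auto
 thus ?thesis by (metis image_comp)
qed

lemma shape_sw: "i:{1..<n} ==> shape n (z o sw i) = shape n z"
 by (rule image_sw_prefix) auto

lemma image_sw_at: "1 <= i ==> (z o sw i) ` {1..i} = insert (z (Suc i)) (z ` {1..i - 1})"
 using image_sw_prefix[of "i - 1" i z] image_Suc[of "z o sw i" "i - 1"] by simp

lemma std_two:
 assumes "z:std n" "i:{1..<n}"
 shows "addb (z ` {1..i - 1}) (z i)" "addb (insert (z i) (z ` {1..i - 1})) (z (Suc i))"
proof -
 show "addb (z ` {1..i - 1}) (z i)" using std_addb[OF assms(1), of "i - 1"] assms(2) by simp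
 show "addb (insert (z i) (z ` {1..i - 1})) (z (Suc i))"
  using std_addb[OF assms(1), of i] assms(2) image_Suc[of z "i - 1"] by simp
qed

lemma std_swp_cell_le:
 assumes z: "z:std n" and i: "i:{1..<n}"
 shows "z o sw i:std n <-> ~ cell_le (z i) (z (Suc i))"
proof -
 note two = std_two[OF z i]
 have pre: "(z o sw i) ` {1..i - 1} = z ` {1..i - 1}" by (rule image_sw_prefix) (use i in auto)
 have "z o sw i:std n <-> addb (z ` {1..i - 1}) (z (Suc i))"
 proof
  assume "z o sw i:std n"
  from std_two(1)[OF this i] show "addb (z ` {1..i - 1}) (z (Suc i))"
  unfolding pre by simp
 next
  assume B: "addb (z ` {1..i - 1}) (z (Suc i))"
  show "z o sw i:std n"
  proof (rule stdI)
  fix k assume k: "k < n"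
  consider "k = i - 1" | "k = i" | "k ~= i" "Suc k ~= i" by linarith
  thus "addb ((z o sw i) ` {1..k}) ((z o sw i) (Suc k))"
  proof cases
  case 1
  show ?thesis using B i unfolding 1 pre by simp
  next
  case 2
  have "insert (z i) (insert (z (Suc i)) (z ` {1..i - 1})) = insert (z (Suc i)) (insert (z i) (z ` {1..i - 1}))" by blast
  moreover have "z i ~= z (Suc i)" using two by (auto simp:addb_def)
  ultimately show ?thesis using B two i image_sw_at[of i z] by (simp add:2 addb_def)
  next
  case 3
  thus ?thesis using std_addb[OF z, of k] k i image_sw_prefix[of k i z] by simp
  qed
  next
  fix k assume "k ~: {1..n}"
  thus "(z o sw i) k = (0, 0)" using i z by (auto simp:std_def)
  qed
 qed
 thus ?thesis using addb_insert(1)[OF two] by simp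
qed

text \<open>If the cell of \<open>Suc i\<close> can be added before that of \<open>i\<close>, both
  are addable to one diagram and their contents differ by at least 2; otherwise the cells are
  neighbours.\<close>

lemma std_swp_iff:
 assumes z: "z:std n" and i: "i:{1..<n}"
 shows "z o sw i:std n <-> \<bar>ct (z (Suc i)) - ct (z i)\<bar> ~= 1" "ct (z (Suc i)) ~= ct (z i)"
proof -
 note two = std_two[OF z i]
 have "z i ~= z (Suc i)" using two by (auto simp:addb_def)
 thus "z o sw i:std n <-> \<bar>ct (z (Suc i)) - ct (z i)\<bar> ~= 1" "ct (z (Suc i)) ~= ct (z i)"
  using std_swp_cell_le[OF z i] addb_insert[OF two] addb_ct[OF two(1), of "z (Suc i)"] by auto
qed

lemma same_diagonal: "ct A = ct B ==> cell_le A B \<or> cell_le B A"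
 by (auto simp:ct_def cell_le_def)

text \<open>Two cells on a diagonal, the second beyond the first, force the two cells next to the
  first to be filled in between; a single entry cannot do this.\<close>

lemma std_ct3:
 assumes z: "z:std n" and i: "1 <= i" "Suc (Suc i) <= n" shows "ct (z (Suc (Suc i))) ~= ct (z i)"
proof
 assume eq: "ct (z (Suc (Suc i))) = ct (z i)"
 let ?P = "z ` {1..i - 1}"
 have a: "addb ?P (z i)" "addb (insert (z i) ?P) (z (Suc i))"
  using std_two[OF z] i by auto
 have c: "addb (insert (z (Suc i)) (insert (z i) ?P)) (z (Suc (Suc i)))"
  using std_addb[OF z i(2)] image_Suc[of z "i - 1"] image_Suc[of z i] i by simp
 have ncle: "~ cell_le (z (Suc (Suc i))) (z i)"
  using a c diagramD[of "insert (z i) ?P" "z i" "z (Suc (Suc i))"] by (auto simp:addb_def)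
 hence "cell_le (z i) (z (Suc (Suc i)))" using same_diagonal[OF eq] by blast
 have box: "C:{z i, z (Suc i), z (Suc (Suc i))}" if "cell_le (z i) C" "cell_le C (z (Suc (Suc i)))" for C
  using a c that diagramD[of ?P C "z i"]
  diagramD[of "insert (z (Suc (Suc i))) (insert (z (Suc i)) (insert (z i) ?P))" "z (Suc (Suc i))" C]
  by (auto simp:addb_def)
 obtain r s where A: "z i = (r, s)" by (cases "z i")
 obtain r' s' where C: "z (Suc (Suc i)) = (r', s')" by (cases "z (Suc (Suc i))")
 have "r < r'" "s < s'" using eq ncle by (auto simp:A C ct_def cell_le_def)
 have "(Suc r, s) = z (Suc i)" "(r, Suc s) = z (Suc i)"
  using box[of "(Suc r, s)"] box[of "(r, Suc s)"] \<open>r < r'\<close> \<open>s < s'\<close> by (auto simp:A C cell_le_def)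
 hence "(Suc r, s) = (r, Suc s)" by (rule trans[OF _ sym])
 thus False by simp
qed

lemma std_ct_inj:
 assumes z: "z:std n" "z':std n" and eq: "!!k. k:{1..n} ==> ct (z k) = ct (z' k)"
 shows "z = z'"
proof -
 have "z k = z' k" if "k <= n" for k
  using that
 proof (induction k rule:less_induct)
  case (less k)
  show ?case
  proof (cases k)
  case 0 thus ?thesis using z by (simp add:std_def)
  next
  case (Suc l)
  have "z ` {1..l} = z' ` {1..l}" using less Suc by (intro image_cong) auto
  hence "addb (z ` {1..l}) (z k)" "addb (z ` {1..l}) (z' k)"
  using std_addb[OF z(1), of l] std_addb[OF z(2), of l] less.prems Suc by auto
  thus ?thesis using addb_ct[of _ "z k" "z' k"] eq[of k] less.prems Suc by fastforce
  qed
 qed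
 moreover have "z k = z' k" if "~ k <= n" for k using z that by (simp add:std_def)
 ultimately show ?thesis by blast
qed

text \<open>Bring the cell of the largest entry on which the fillings differ into place by
  successive swaps, then continue with smaller entries.\<close>

lemma std_conn:
 assumes z: "z:std n" and z': "z':std n" and sh: "shape n z = shape n z'" and Q: "Q z"
  and step: "!!z i. z:std n ==> i:{1..<n} ==> z o sw i:std n ==> Q z ==> Q (z o sw i)"
 shows "Q z'"
proof -
 have "Q z'" if "k <= n" "z:std n" "Q z" "!!l. k < l ==> z l = z' l" "z ` {1..k} = z' ` {1..k}" for k z
  using that
 proof (induction k arbitrary: z)
  case 0
  hence "z l = z' l" for l using z' by (cases "l = 0") (auto simp:std_def)
  thus ?case using 0 by (metis ext)
 next
  case (Suc k)
  let ?A = "z' (Suc k)"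
  have inj: "inj_on z' {1..n}" using z' by (simp add:std_def)
  obtain j where "j:{1..Suc k}" "z j = ?A" using Suc.prems(5) by (metis atLeastAtMost_iff imageE image_eqI le_add1 order_refl plus_1_eq_Suc)
  thus ?case using Suc.prems
  proof (induction "Suc k - j" arbitrary: j z)
  case 0
  hence A: "z (Suc k) = ?A" by auto
  have "addb (z ` {1..k}) ?A" "addb (z' ` {1..k}) ?A"
  using std_addb[OF 0(5,4)] std_addb[OF z' 0(4)] A by simp_all
  hence "z ` {1..k} = z' ` {1..k}"
  using 0(8) A unfolding image_Suc addb_def by (metis insert_ident)
  moreover have "z l = z' l" if "k < l" for l using 0 that A by (cases "l = Suc k") auto
  ultimately show ?case using Suc.IH[of z] 0 by auto
  next
  case (Suc m)
  hence j: "j:{1..<n}" "j <= k" by auto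
  let ?B = "z (Suc j)"
  \<comment> \<open>\<open>?A\<close> comes last among these cells in \<open>z'\<close>, so none of
    the others lies beyond it, and the swap stays standard.\<close>
  have "~ cell_le ?A ?B"
  proof
  assume le: "cell_le ?A ?B"
  have "?B ~= ?A" using Suc(4,6) j inj_onD[of z "{1..n}" j "Suc j"] by (auto simp:std_def)
  moreover have "?B:z ` {1..Suc k}" using j by (intro imageI) auto
  ultimately have "?B:z' ` {1..k}" using Suc(9) unfolding image_Suc[of z'] by blast
  moreover note a = std_addb[OF z' Suc(5)]
  ultimately have "?A:z' ` {1..k}" using le diagramD[of "z' ` {1..k}" ?B ?A] by (auto simp:addb_def)
  thus False using a by (simp add:addb_def)
  qed
  hence v: "z o sw j:std n" using std_swp_cell_le[OF Suc(6) j(1)] Suc(4) by simp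
  show ?case
  proof (rule Suc(1)[of "Suc j" "z o sw j"])
  show "Q (z o sw j)" by (rule step[OF Suc(6) j(1) v Suc(7)])
  show "(z o sw j) ` {1..Suc k} = z' ` {1..Suc k}" using Suc(9) j image_sw_prefix[of "Suc k" j z] by simp
  show "(z o sw j) l = z' l" if "Suc k < l" for l using Suc(8)[OF that] j that by (simp)
  qed (use Suc(2-5) j v in auto)
  qed
 qed
 from this[OF order_refl z Q _ sh] show ?thesis using z z' by (simp add:std_def)
qed

section \<open>Counting standard fillings in Young's lattice\<close>

lemma down_closed_lessThan:
 fixes S :: "nat set"
 assumes "finite S" "!!i j. j:S ==> i <= j ==> i:S"
 shows "S = {..<card S}"
proof -
 obtain m where m: "m ~: S" "!!k. k < m ==> k:S"
  using ex_new_if_finite[OF _ assms(1)] exists_least_iff[of "%m. m ~: S"] by auto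
 hence "S = {..<m}" using assms(2) by (auto simp:not_less[symmetric])
 thus ?thesis by simp
qed

lemma dia_row:
 assumes "dia D" shows "(i, j):D <-> j < card {j. (i, j):D}"
proof -
 have "finite {j. (i, j):D}"
  by (rule finite_subset[OF _ finite_imageI[OF dia_fin[OF assms], of snd]]) force
 moreover have "i':{j. (i, j):D}" if "j:{j. (i, j):D}" "i' <= j" for i' j
  using diagramD[OF assms, of "(i, j)" "(i, i')"] that by (auto simp:cell_le_def)
 ultimately show ?thesis using down_closed_lessThan[of "{j. (i, j):D}"] by blast
qed

lemma dia_rowsI:
 assumes "finite D" "!!i j. (i, j):D <-> j < r i" "!!i. r (Suc i) <= (r i :: nat)"
 shows "dia D"
proof (rule diagramI[OF assms(1)])
 fix A B assume "B:D" "cell_le A B"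
 thus "A:D"
  using lift_Suc_antimono_le[of r "fst A" "fst B"] assms(2)[of "fst A" "snd A"] assms(2)[of "fst B" "snd B"] assms(3)
  by (auto simp:cell_le_def)
qed

definition remov :: "cell set => cell set" where
 "remov D = {A:D. addb (D - {A}) A}"

text \<open>With row lengths \<open>r\<close>, row \<open>i\<close> ends in a removable cell iff row
  \<open>Suc i\<close> is shorter, that is, iff row \<open>Suc i\<close> can take a cell; row 0 can
  always take one.\<close>

lemma card_addb:
 assumes D: "dia D" shows "finite {A. addb D A}" "card {A. addb D A} = Suc (card (remov D))"
proof -
 define r where "r i = card {j. (i, j):D}" for i
 have r: "(i, j):D <-> j < r i" for i j unfolding r_def by (rule dia_row[OF D])
 have mono: "r (Suc i) <= r i" for i
  using r[of "Suc i" "r i"] r[of i "r i"] diagramD[OF D, of "(Suc i, r i)" "(i, r i)"] by (auto simp:cell_le_def)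
 have fin: "finite D" using D by (rule dia_fin)
 have lower: "~ 0 < r i" if "ALL k:fst ` D. k < i" for i
  using that r[of i 0] by force
 define R where "R = {i. r (Suc i) < r i}"
 have "R \<subseteq> fst ` D" using r by (force simp:R_def)
 hence finR: "finite R" using fin finite_subset by blast
 have cell: "A:D <-> snd A < r (fst A)" for A using r[of "fst A" "snd A"] by simp
 have rows: "dia E <-> (ALL i. r' (Suc i) <= r' i)" if "finite E" "!!i j. (i, j):E <-> j < r' i" for E r'
 proof
  assume E: "dia E"
  show "ALL i. r' (Suc i) <= r' i"
  proof
  fix i show "r' (Suc i) <= r' i"
  using that(2)[of "Suc i" "r' i"] that(2)[of i "r' i"] diagramD[OF E, of "(Suc i, r' i)" "(i, r' i)"] by (auto simp:cell_le_def)
  qed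
 qed (use dia_rowsI[OF that] in blast)
 have add:"addb D (i, j) <-> j = r i & (i = 0 \<or> r i < r (i - 1))" for i j
 proof
  assume a: "addb D (i, j)"
  hence "~ j < r i" using r by (simp add:addb_def)
  moreover have "~ r i < j" using a diagramD[of "insert (i, j) D" "(i, j)" "(i, r i)"] r[of i "r i"] by (auto simp:addb_def cell_le_def)
  ultimately have j: "j = r i" by simp
  have "r i < r (i - 1)" if "i ~= 0"
  using a that diagramD[of "insert (i, j) D" "(i, j)" "(i - 1, j)"] r[of "i - 1" j] by (auto simp:addb_def cell_le_def j)
  thus "j = r i & (i = 0 \<or> r i < r (i - 1))" using j by blast
 next
  assume a: "j = r i & (i = 0 \<or> r i < r (i - 1))"
  have "dia (insert (i, j) D)"
  by (subst rows[of _ "r(i := Suc (r i))"]) (use a fin r mono in "auto simp:less_Suc_eq Suc_le_eq intro:le_SucI split: if_splits")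
  thus "addb D (i, j)" using a D r by (simp add:addb_def)
 qed
 have rem: "(i, j):remov D <-> Suc j = r i & r (Suc i) < r i" for i j
 proof
  assume a: "(i, j):remov D"
  hence d: "dia (D - {(i, j)})" "j < r i" using r by (auto simp:remov_def addb_def)
  have "~ Suc j < r i" using diagramD[OF d(1), of "(i, Suc j)" "(i, j)"] r by (auto simp:cell_le_def)
  moreover have "~ j < r (Suc i)" using diagramD[OF d(1), of "(Suc i, j)" "(i, j)"] r by (auto simp:cell_le_def)
  ultimately show "Suc j = r i & r (Suc i) < r i" using d by auto
 next
  assume a: "Suc j = r i & r (Suc i) < r i"
  have "dia (D - {(i, j)})"
  by (subst rows[of _ "r(i := r i - 1)"])
  (use a fin r mono in "auto simp:less_Suc_eq Suc_le_eq le_diff_conv intro:le_trans le_SucI split: if_splits")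
  thus "(i, j):remov D" using a D r by (auto simp:remov_def addb_def insert_absorb)
 qed
 have A: "{A. addb D A} = insert (0, r 0) ((%i. (Suc i, r (Suc i))) ` R)"
 proof -
  have "addb D A <-> A:insert (0, r 0) ((%i. (Suc i, r (Suc i))) ` R)" for A
  by (cases A; cases "fst A") (auto simp:add R_def)
  thus ?thesis by blast
 qed
 have B: "remov D = (%i. (i, r i - 1)) ` R"
 proof -
  have "A:remov D <-> A:(%i. (i, r i - 1)) ` R" for A
  by (cases A) (auto simp:rem R_def)
  thus ?thesis by blast
 qed
 show "finite {A. addb D A}" unfolding A using finR by simp
 have "card (insert (0, r 0) ((%i. (Suc i, r (Suc i))) ` R)) = Suc (card ((%i. (Suc i, r (Suc i))) ` R))"
  using finR by (intro card_insert_disjoint) auto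
 thus "card {A. addb D A} = Suc (card (remov D))"
  unfolding A B by (simp add:card_image inj_on_def)
qed

definition "fnum n D = card {z:std n. shape n z = D}"

lemma std_extend:
 assumes z: "z:std n" and A: "addb (shape n z) A"
 shows "z(Suc n := A):std (Suc n)"
proof (rule stdI)
 fix k assume k: "k < Suc n"
 have "(z(Suc n := A)) ` {1..k} = z ` {1..k}" using k by (intro image_cong) auto
 thus "addb ((z(Suc n := A)) ` {1..k}) ((z(Suc n := A)) (Suc k))"
  using A std_addb[OF z, of k] k by (cases "k = n") auto
qed (use z in "auto simp:std_def")

lemma std_restr:
 assumes z: "z:std (Suc n)" shows "z(Suc n := (0, 0)):std n"
proof (rule stdI)
 fix k assume k: "k < n"
 have "(z(Suc n := (0, 0))) ` {1..k} = z ` {1..k}" using k by (intro image_cong) auto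
 thus "addb ((z(Suc n := (0, 0))) ` {1..k}) ((z(Suc n := (0, 0))) (Suc k))"
  using std_addb[OF z, of k] k by auto
qed (use z in "auto simp:std_def")

lemma shape_upd: "shape n (z(Suc n := A)) = shape n z"
 by (intro image_cong) auto

lemma fnum_Suc:
 assumes D: "dia D"
 shows "fnum (Suc n) D = (SUM A:remov D. fnum n (D - {A}))"
proof -
 have fin: "finite (remov D)" using dia_fin[OF D] by (simp add:remov_def)
 let ?f = "%z. (z (Suc n), z(Suc n := (0, 0)))"
 have "bij_betw ?f {z:std (Suc n). shape (Suc n) z = D} (SIGMA A:remov D. {z:std n. shape n z = D - {A}})"
 proof (rule bij_betwI[where g = "%(A, z). z(Suc n := A)"])
  show "?f:{z:std (Suc n). shape (Suc n) z = D} \<rightarrow> (SIGMA A:remov D. {z:std n. shape n z = D - {A}})"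
  proof
  fix z assume z: "z:{z:std (Suc n). shape (Suc n) z = D}"
  hence a: "addb (shape n z) (z (Suc n))" using std_addb[of z "Suc n" n] by auto
  have s: "D = insert (z (Suc n)) (shape n z)" using z by (simp only:mem_Collect_eq image_Suc)
  hence e: "D - {z (Suc n)} = shape n z" using a by (auto simp:addb_def)
  have "z (Suc n):D" using s by blast
  hence "z (Suc n):remov D" using a unfolding remov_def mem_Collect_eq e by blast
  thus "?f z:(SIGMA A:remov D. {z:std n. shape n z = D - {A}})"
  using z std_restr[of z n] by (simp only:mem_Sigma_iff mem_Collect_eq shape_upd simp_thms e)
  qed
  show "(%(A, z). z(Suc n := A)):(SIGMA A:remov D. {z:std n. shape n z = D - {A}}) \<rightarrow> {z:std (Suc n). shape (Suc n) z = D}"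
  proof
  fix q assume q: "q:(SIGMA A:remov D. {z:std n. shape n z = D - {A}})"
  then obtain A z where qq: "q = (A, z)" "A:remov D" "z:std n" "shape n z = D - {A}" by auto
  hence "z(Suc n := A):std (Suc n)" by (intro std_extend) (simp_all add:remov_def)
  moreover have "shape (Suc n) (z(Suc n := A)) = D"
  unfolding image_Suc using qq by (auto simp:remov_def)
  ultimately show "(case q of (A, z) => z(Suc n := A)):{z:std (Suc n). shape (Suc n) z = D}" by (simp add:qq)
  qed
  show "?f (case q of (A, z) => z(Suc n := A)) = q" if "q:(SIGMA A:remov D. {z:std n. shape n z = D - {A}})" for q
  using that by (auto simp:std_def)
 qed simp
 from bij_betw_same_card[OF this] show ?thesis
  using fin by (simp add:fnum_def)
qed

lemma dia_Int: "dia D ==> dia E ==> dia (D Int E)"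
 and diagram_Un: "dia D ==> dia E ==> dia (D Un E)"
 by (rule diagramI; auto dest:diagramD simp:dia_fin)+

lemma exchange_cells:
 assumes D: "dia D" and ne: "A ~= B"
 shows "addb D A & B:remov (insert A D) <-> B:remov D & addb (D - {B}) A"
proof (cases "B:D")
 case True
 define E where "E = D - {B}"
 have eq: "insert A D - {B} = insert A E" "insert B E = D" "insert B (insert A E) = insert A D" "A ~: E <-> A ~: D"
  using True ne by (auto simp:E_def)
 have int: "dia E" if "dia (insert A E)" "A ~: D"
 proof -
  have "D Int insert A E = E" using that(2) by (auto simp:E_def)
  thus ?thesis using dia_Int[OF D that(1)] by simp
 qed
 have un: "dia (insert A D)" if "dia (insert A E)"
 proof -
  have "D Un insert A E = insert A D" by (auto simp:E_def)
  thus ?thesis using diagram_Un[OF D that] by simp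
 qed
 show ?thesis unfolding remov_def addb_def mem_Collect_eq eq E_def[symmetric]
  using int un True D ne by (auto simp:E_def)
qed (use ne in "auto simp:remov_def")

text \<open>The commutation relation of Young's lattice: adding one cell and removing another can be
  interchanged (\<open>exchange_cells\<close>), and returning to \<open>D\<close> is possible in one
  more way when adding comes first (\<open>card_addb\<close>).\<close>

lemma fnum_addb:
 assumes "dia D" "card D = n"
 shows "(\<Sum>A | addb D A. fnum (Suc n) (insert A D)) = Suc n * fnum n D"
 using assms
proof (induction n arbitrary: D rule:less_induct)
 case (less n)
 note D = less.prems(1)
 have fin: "finite (remov E)" if "dia E" for E using dia_fin[OF that] by (simp add:remov_def)
 let ?P = "SIGMA A:{A. addb D A}. remov (insert A D) - {A}"
 let ?Q = "SIGMA B:remov D. {A. addb (D - {B}) A} - {B}"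
 let ?g = "%A B. fnum n (insert A (D - {B}))"
 have swap: "q:?P <-> swp q:?Q" for q
  using exchange_cells[OF D, of "fst q" "snd q"] by (cases q; cases "fst q = snd q") simp_all
 have PQ: "(SUM (A, B):?P. ?g A B) = (SUM (B, A):?Q. ?g A B)"
  by (rule sum.reindex_bij_witness[where i = swp and j = swp])
  (simp_all only:swap swap_swap split_beta fst_swap snd_swap)
 have rem: "dia (D - {B})" "card (D - {B}) = n - 1" "n > 0" "B:D" "addb (D - {B}) B" if "B:remov D" for B
  using that less.prems dia_fin[OF D] by (auto simp:remov_def addb_def card_gt_0_iff)
 have L: "fnum (Suc n) (insert A D) = fnum n D + (SUM B:remov (insert A D) - {A}. ?g A B)" if A: "addb D A" for A
 proof -
  have d: "dia (insert A D)" "A ~: D" using A by (auto simp:addb_def)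
  hence "A:remov (insert A D)" using A by (simp add:remov_def)
  hence "fnum (Suc n) (insert A D) = fnum n (insert A D - {A}) + (SUM B:remov (insert A D) - {A}. fnum n (insert A D - {B}))"
  unfolding fnum_Suc[OF d(1)] by (rule sum.remove[OF fin[OF d(1)]])
  moreover have "(SUM B:remov (insert A D) - {A}. fnum n (insert A D - {B})) = (SUM B:remov (insert A D) - {A}. ?g A B)"
  by (rule sum.cong) (auto simp:insert_Diff_if)
  ultimately show ?thesis using d by simp
 qed
 have R: "fnum n D + (SUM A:{A. addb (D - {B}) A} - {B}. ?g A B) = n * fnum (n - 1) (D - {B})" if B: "B:remov D" for B
 proof -
  note r = rem[OF B]
  have "(\<Sum>A | addb (D - {B}) A. ?g A B) = n * fnum (n - 1) (D - {B})"
  using less.IH[of "n - 1" "D - {B}"] r by simp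
  moreover have "(\<Sum>A | addb (D - {B}) A. ?g A B) = ?g B B + (SUM A:{A. addb (D - {B}) A} - {B}. ?g A B)"
  by (rule sum.remove) (use r card_addb(1) in auto)
  ultimately show ?thesis using r(4) by (simp add:insert_absorb)
 qed
 have f: "n * fnum n D = (SUM B:remov D. n * fnum (n - 1) (D - {B}))"
 proof (cases n)
  case 0
  hence "D = {}" using less.prems dia_fin[OF D] by simp
  thus ?thesis using 0 by (simp)
 next
  case (Suc m) thus ?thesis using fnum_Suc[OF D, of m] by (simp add:sum_distrib_left)
 qed
 have "(\<Sum>A | addb D A. fnum (Suc n) (insert A D)) = card {A. addb D A} * fnum n D + (SUM (A, B):?P. ?g A B)"
  using card_addb(1)[OF D] fin by (simp add:L sum.Sigma addb_def)
 also have "(SUM (A, B):?P. ?g A B) = (SUM B:remov D. SUM A:{A. addb (D - {B}) A} - {B}. ?g A B)"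
  unfolding PQ by (rule sum.Sigma[symmetric]) (use fin[OF D] card_addb(1) rem in auto)
 finally show ?case
  unfolding card_addb(2)[OF D]
  using f sum.cong[OF refl R, of "remov D"] by (simp add:sum.distrib)
qed

definition "Shp n = {D. dia D & card D = n}"

lemma std_shape: "z:std n ==> shape n z:Shp n"
 by (auto simp:std_def Shp_def card_image)


lemma fin_Shp [simp]: "finite (Shp n)"
proof (rule finite_subset)
 show "Shp n \<subseteq> Pow ({..n} \<times> {..n})"
 proof
  fix D assume D: "D:Shp n"
  hence d: "dia D" "finite D" "card D = n" by (auto simp:Shp_def dia_fin)
  have "i <= n & j <= n" if "(i, j):D" for i j
  proof -
  have "(%i'. (i', j)) ` {..i} \<subseteq> D" "(%j'. (i, j')) ` {..j} \<subseteq> D"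
  using diagramD[OF d(1) that] by (auto simp:cell_le_def)
  hence "card ((%i'. (i', j)) ` {..i}) <= n" "card ((%j'. (i, j')) ` {..j}) <= n"
  using card_mono[OF d(2)] d(3) by blast+
  thus ?thesis by (simp add:card_image inj_on_def)
  qed
  thus "D:Pow ({..n} \<times> {..n})" by auto
 qed
qed simp

text \<open>Expand one factor by \<open>fnum_Suc\<close>, sum over pairs of diagrams that differ by
  a cell, and collect the other factor by \<open>fnum_addb\<close>.\<close>

lemma sum_fnum_squares: "(SUM D:Shp n. fnum n D ^ 2) = fact n"
proof (induction n)
 case 0
 have "Shp 0 = {{}}" by (auto simp:Shp_def dia_def)
 moreover have "std 0 = {%k. (0, 0)}" by (auto simp:std_def dia_def)
 hence "fnum 0 {} = card {%k::nat. (0::nat, 0::nat)}" unfolding fnum_def by (intro arg_cong[of _ _ card]) auto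
 ultimately show ?case by simp
next
 case (Suc n)
 let ?P = "SIGMA D:Shp (Suc n). remov D"
 let ?Q = "SIGMA E:Shp n. {A. addb E A}"
 have fin: "finite (remov D)" if "D:Shp m" for D m
  using that dia_fin[of D] by (simp add:remov_def Shp_def)
 have "(SUM D:Shp (Suc n). fnum (Suc n) D ^ 2) = (SUM D:Shp (Suc n). SUM A:remov D. fnum (Suc n) D * fnum n (D - {A}))"
  by (rule sum.cong) (simp_all add:power2_eq_square Shp_def sum_distrib_left[symmetric] fnum_Suc[symmetric])
 also have "... = (SUM (D, A):?P. fnum (Suc n) D * fnum n (D - {A}))"
  by (rule sum.Sigma) (use fin in auto)
 also have "... = (SUM (E, A):?Q. fnum (Suc n) (insert A E) * fnum n E)"
 proof (rule sum.reindex_bij_witness[where i = "%(E, A). (insert A E, A)" and j = "%(D, A). (D - {A}, A)"])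
  show "(case (case q of (D, A) => (D - {A}, A)) of (E, A) => (insert A E, A)) = q" if "q:?P" for q
  using that by (auto simp:remov_def)
  show "(case q of (D, A) => (D - {A}, A)):?Q" if "q:?P" for q
  using that by (auto simp:remov_def Shp_def addb_def)
  show "(case (case q of (E, A) => (insert A E, A)) of (D, A) => (D - {A}, A)) = q" if "q:?Q" for q
  using that by (auto simp:addb_def)
  show "(case q of (E, A) => (insert A E, A)):?P" if "q:?Q" for q
  using that by (auto simp:remov_def Shp_def addb_def dia_fin)
 qed (auto simp:remov_def insert_absorb)
 also have "... = (SUM E:Shp n. \<Sum>A | addb E A. fnum (Suc n) (insert A E) * fnum n E)"
  by (rule sum.Sigma[symmetric]) (use card_addb(1) in "auto simp:Shp_def[symmetric], auto simp:Shp_def")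
 also have "... = (SUM E:Shp n. Suc n * fnum n E ^ 2)"
  by (rule sum.cong) (simp_all add:sum_distrib_right[symmetric] fnum_addb Shp_def power2_eq_square distrib_right mult.assoc)
 finally show ?case using Suc by (simp add:sum_distrib_left[symmetric])
qed

definition "spr n = {(x, y). x:std n & y:std n & shape n x = shape n y}"

lemma fin_spr [simp]: "finite (spr n)"
 by (rule finite_subset[of _ "std n \<times> std n"]) (auto simp:spr_def)

lemma card_spr: "card (spr n) = fact n"
proof -
 let ?S = "%D. {z:std n. shape n z = D}"
 have "spr n = (UN D:Shp n. ?S D \<times> ?S D)"
  using std_shape by (auto simp:spr_def)
 hence "card (spr n) = (SUM D:Shp n. card (?S D \<times> ?S D))"
  by (simp only:) (rule card_UN_disjoint; auto)
 thus ?thesis using sum_fnum_squares[of n] by (simp add:fnum_def power2_eq_square)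
qed

section \<open>The seminormal representation\<close>

text \<open>\<open>br d\<close> is the quantum integer of \<open>d\<close>:
  \<open>1 + (q - 1) * br d\<close> is the \<open>d\<close>-th power of \<open>q\<close>. The
  addition rule keeps its meaning at \<open>q = 1\<close>, where \<open>br\<close> is the embedding
  of the integers, so one construction serves both specializations.\<close>

locale snorm =
 fixes n :: nat and th :: "laurent => 'k::field_char_0" and q :: 'k and br :: "int => 'k"
 assumes rhom: "rhom th" and q_def: "q = th qv"
  and br_add: "!!d e. br (d + e) = br d + br e + (q - 1) * br d * br e"
  and br_0 [simp]: "br 0 = 0" and br_1 [simp]: "br 1 = 1" and br_nz: "!!d. d ~= 0 ==> br d ~= 0"
begin

text \<open>The diagonal entry of the seminormal form at axial distance \<open>d\<close>: it is
  \<open>q^d (q - 1) / (q^d - 1)\<close> for generic \<open>q\<close>, and \<open>1 / d\<close> at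
  \<open>q = 1\<close>.\<close>

definition aa :: "int => 'k" where "aa d = q - 1 + 1 / br d"
definition bb :: "int => 'k" where "bb d = (if \<bar>d\<bar> = 1 then 0 else 1 + aa d)"

abbreviation "dd i z == ct (z (Suc i)) - ct (z i)"

text \<open>Young's seminormal form on coefficient functions. Away from standard fillings the
  operator is the scalar \<open>q\<close>, a root of the quadratic relation, so that the relations
  hold at every \<open>z\<close>.\<close>

definition "sn i f z = (if z:std n & i:{1..<n} then aa (dd i z) * f z + bb (dd i z) * f (z o sw i) else q * f z)"

lemma br_unit: "(1 + (q - 1) * br d) * (1 + (q - 1) * br (- d)) = 1"
proof -
 have "(1 + (q - 1) * br d) * (1 + (q - 1) * br (- d)) = 1 + (q - 1) * (br d + br (- d) + (q - 1) * br d * br (- d))"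
  by (simp add:algebra_simps)
 thus ?thesis unfolding br_add[symmetric] by simp
qed

lemma br_inj: "br c = br c' ==> c = c'"
proof (rule ccontr)
 assume eq: "br c = br c'" and "c ~= c'"
 have "br c = br (c' + (c - c'))" by simp
 hence "br (c - c') * (1 + (q - 1) * br c') = 0"
  unfolding br_add using eq by (simp add:algebra_simps)
 thus False using br_nz[of "c - c'"] \<open>c ~= c'\<close> br_unit[of c'] by auto
qed

lemma aa_minus: assumes d: "d ~= 0" shows "aa (- d) = q - 1 - aa d"
proof -
 note assms
 hence "br d ~= 0" "br (- d) ~= 0" using br_nz by auto
 moreover have "br d + br (- d) + (q - 1) * br d * br (- d) = 0" using br_add[of d "- d"] by simp
 ultimately have "1 / br d + 1 / br (- d) = - (q - 1)" by (simp add:field_simps) algebra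
 thus ?thesis by (simp add:aa_def algebra_simps)
qed

text \<open>Together with \<open>bb_mult\<close>, this is what the braid relation amounts to; see
  \<open>braid_algebra\<close>.\<close>

lemma aa_mult:
 assumes "d ~= 0" "e ~= 0" "d + e ~= 0"
 shows "aa d * aa e = aa (d + e) * (aa d + aa e - (q - 1))"
proof -
 have nz: "br d ~= 0" "br e ~= 0" "br (d + e) ~= 0" using br_nz assms by auto
 have "aa d + aa e - (q - 1) = br (d + e) / (br d * br e)"
  using nz(1,2) unfolding aa_def br_add by (simp add:field_simps)
 moreover have "aa d * aa e = (q - 1 + 1 / br (d + e)) * (br (d + e) / (br d * br e))"
  using nz unfolding aa_def by (simp add:field_simps) (simp add:br_add algebra_simps)
 ultimately show ?thesis by (simp add:aa_def)
qed

lemma aa_1 [simp]: "aa 1 = q" "aa (- 1) = - 1"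
 using aa_minus[of 1] by (simp_all add:aa_def)

lemma bb_mult: assumes d: "d ~= 0" shows "bb d * bb (- d) = (1 + aa d) * (q - aa d)"
proof -
 consider "d = 1" | "d = - 1" | "\<bar>d\<bar> ~= 1" by linarith
 thus ?thesis using aa_minus[OF d] by cases (auto simp:bb_def)
qed

lemma bb_nz: "d ~= 0 ==> \<bar>d\<bar> ~= 1 ==> bb d ~= 0"
proof
 assume d: "d ~= 0" "\<bar>d\<bar> ~= 1" and "bb d = 0"
 hence "q + 1 / br d = 0" by (simp add:bb_def aa_def)
 hence "br (d + 1) = 0" using br_nz[OF d(1)] unfolding br_add by (simp add:field_simps)
 thus False using br_nz[of "d + 1"] d by auto
qed

lemma sn_eval: "z:std n ==> i:{1..<n} ==> sn i f z = aa (dd i z) * f z + bb (dd i z) * f (z o sw i)"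
 by (simp add:sn_def)

lemma bb_std: "z:std n ==> i:{1..<n} ==> bb (dd i z) ~= 0 ==> z o sw i:std n"
 using std_swp_iff(1) by (auto simp:bb_def)

text \<open>If the swapped filling is not standard, the coefficient vanishes. Keeping it as a factor
  allows the formula for \<open>sn\<close> to be used in either case.\<close>

lemma bb_sn:
 assumes "z:std n" "i:{1..<n}" "j:{1..<n}"
 shows "bb (dd i z) * sn j f (z o sw i) =
  bb (dd i z) * (aa (dd j (z o sw i)) * f (z o sw i) + bb (dd j (z o sw i)) * f (z o sw i o sw j))"
 using sn_eval[OF bb_std[OF assms(1,2)] assms(3), of f] by (cases "bb (dd i z) = 0") auto

lemma dd_sw [simp]: "dd i (z o sw i) = - dd i z"
 by simp

lemma sn_quad: "i:{1..<n} ==> sn i (sn i f) z = (q - 1) * sn i f z + q * f z"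
proof (cases "z:std n")
 case True
 assume i: "i:{1..<n}"
 have d: "dd i z ~= 0" using std_swp_iff(2)[OF True i] by simp
 let ?a = "aa (dd i z)" and ?b = "bb (dd i z)"
 have "sn i (sn i f) z = ?a * (?a * f z + ?b * f (z o sw i)) +
  ?b * (aa (- dd i z) * f (z o sw i) + bb (- dd i z) * f z)"
  using sn_eval[OF True i, of "sn i f"] sn_eval[OF True i, of f] bb_sn[OF True i i, of f]
  by (simp only:dd_sw comp_sw_sw)
 also have "... = (?a * ?a + ?b * bb (- dd i z)) * f z + (?a + aa (- dd i z)) * ?b * f (z o sw i)"
  by (simp add:algebra_simps)
 also have "... = (q - 1) * sn i f z + q * f z"
  unfolding sn_eval[OF True i, of f] bb_mult[OF d] aa_minus[OF d] by (simp add:algebra_simps)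
 finally show ?thesis .
qed (simp add:sn_def algebra_simps)

lemma sn_comm:
 assumes ij: "1 <= i" "Suc i < j" "j < n"
 shows "sn i (sn j f) z = sn j (sn i f) z"
proof (cases "z:std n")
 case True
 have i: "i:{1..<n}" "j:{1..<n}" using ij by auto
 have fx: "sw i j = j" "sw i (Suc j) = Suc j" "sw j i = i" "sw j (Suc i) = Suc i"
  using ij by (auto)
 have dij: "dd j (z o sw i) = dd j z" "dd i (z o sw j) = dd i z" by (simp_all add:fx)
 have c: "z o sw i o sw j = z o sw j o sw i"
  using sw_comm[of i j] ij by (simp add:comp_assoc)
 show ?thesis
  unfolding sn_eval[OF True i(1), of "sn j f"] sn_eval[OF True i(2), of "sn i f"]
  bb_sn[OF True i] bb_sn[OF True i(2,1)] sn_eval[OF True i(1), of f] sn_eval[OF True i(2), of f] dij c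
  by (simp add:algebra_simps)
qed (simp add:sn_def algebra_simps)

lemma braid_algebra:
 fixes a b c p :: 'k
 assumes p: "p = q - 1" and "B * B' = (1 + a) * (q - a)" "C * C' = (1 + b) * (q - b)" "a * b = c * (a + b - p)"
 shows "a * (b * (a * f1 + B * f2) + C * (c * f3 + D * f5)) + B * (c * ((p - a) * f2 + B' * f1) + D * (b * f4 + C * f6)) =
  b * (a * (b * f1 + C * f3) + B * (c * f2 + D * f4)) + C * (c * ((p - b) * f3 + C' * f1) + D * (a * f5 + B * f6))"
proof -
 have "a * b * a + c * ((1 + a) * (q - a)) - (b * a * b + c * ((1 + b) * (q - b))) = (a * b - c * (a + b - (q - 1))) * (a - b)"
  by (simp add:algebra_simps)
 hence 1: "a * b * a + c * (B * B') = b * a * b + c * (C * C')"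
  using assms by simp
 have 2: "a * b + c * (p - a) = b * c" "b * a + c * (p - b) = a * c" using assms(4) by (simp_all add:algebra_simps)
 have "a * (b * (a * f1 + B * f2) + C * (c * f3 + D * f5)) + B * (c * ((p - a) * f2 + B' * f1) + D * (b * f4 + C * f6)) =
  (a * b * a + c * (B * B')) * f1 + (a * b + c * (p - a)) * B * f2 + a * c * C * f3 + a * C * D * f5 + B * D * b * f4 + B * D * C * f6"
  by (simp add:algebra_simps)
 also have "... = (b * a * b + c * (C * C')) * f1 + b * c * B * f2 + (b * a + c * (p - b)) * C * f3 + a * C * D * f5 + B * D * b * f4 + B * D * C * f6"
  unfolding 1 2 ..
 also have "... = b * (a * (b * f1 + C * f3) + B * (c * f2 + D * f4)) + C * (c * ((p - b) * f3 + C' * f1) + D * (a * f5 + B * f6))"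
  by (simp add:algebra_simps)
 finally show ?thesis .
qed

lemma sn_braid:
 assumes ij: "1 <= i" "Suc i < n"
 shows "sn i (sn (Suc i) (sn i g)) z = sn (Suc i) (sn i (sn (Suc i) g)) z"
proof (cases "z:std n")
 case True
 note z = True
 let ?j = "Suc i"
 have i: "i:{1..<n}" "?j:{1..<n}" using ij by auto
 define d e where "d = dd i z" and "e = dd ?j z"
 have nz: "d ~= 0" "e ~= 0" "d + e ~= 0"
  using std_swp_iff(2)[OF z i(1)] std_swp_iff(2)[OF z i(2)] std_ct3[OF z ij(1)] ij(2) by (auto simp:d_def e_def)
 have dds: "dd ?j (z o sw i) = d + e" "dd i (z o sw ?j) = d + e" "dd i (z o sw i o sw ?j) = e" "dd ?j (z o sw ?j o sw i) = d"
  "dd i (z o sw i) = - d" "dd ?j (z o sw ?j) = - e"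
  by (simp_all add:d_def e_def)
 have b: "z o sw ?j o sw i o sw ?j = z o sw i o sw ?j o sw i"
  using sw_braid[of i ?j] by (simp add:comp_assoc)
 let ?f1 = "g z" and ?f2 = "g (z o sw i)" and ?f3 = "g (z o sw ?j)" and ?f4 = "g (z o sw i o sw ?j)"
  and ?f5 = "g (z o sw ?j o sw i)" and ?f6 = "g (z o sw i o sw ?j o sw i)"
 have two: "bb d * (bb (d + e) * sn i g (z o sw i o sw ?j)) = bb d * (bb (d + e) * (aa e * ?f4 + bb e * ?f6))"
  "bb e * (bb (d + e) * sn ?j g (z o sw ?j o sw i)) = bb e * (bb (d + e) * (aa d * ?f5 + bb d * ?f6))"
  using bb_sn[OF bb_std[OF z i(1)] i(2,1), of g] bb_sn[OF bb_std[OF z i(2)] i, of g]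
  unfolding dds b d_def[symmetric] e_def[symmetric] by (cases "bb d = 0"; cases "bb e = 0"; simp)+
 have one: "bb d * sn i g (z o sw i) = bb d * (aa (- d) * ?f2 + bb (- d) * ?f1)"
  "bb e * sn i g (z o sw ?j) = bb e * (aa (d + e) * ?f3 + bb (d + e) * ?f5)"
  "bb e * sn ?j g (z o sw ?j) = bb e * (aa (- e) * ?f3 + bb (- e) * ?f1)"
  "bb d * sn ?j g (z o sw i) = bb d * (aa (d + e) * ?f2 + bb (d + e) * ?f4)"
  using bb_sn[OF z i(1,1), of g] bb_sn[OF z i(2,1), of g] bb_sn[OF z i(2,2), of g] bb_sn[OF z i, of g]
  unfolding dds d_def[symmetric] e_def[symmetric] comp_sw_sw by simp_all
 have zero: "sn i g z = aa d * ?f1 + bb d * ?f2" "sn ?j g z = aa e * ?f1 + bb e * ?f3"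
  using sn_eval[OF z i(1), of g] sn_eval[OF z i(2), of g] by (simp_all only:d_def e_def)
 have L: "sn i (sn ?j (sn i g)) z = aa d * (aa e * sn i g z + bb e * sn i g (z o sw ?j)) +
  (aa (d + e) * (bb d * sn i g (z o sw i)) + bb d * (bb (d + e) * sn i g (z o sw i o sw ?j)))"
  using sn_eval[OF z i(1), of "sn ?j (sn i g)"] sn_eval[OF z i(2), of "sn i g"] bb_sn[OF z i, of "sn i g"]
  unfolding dds d_def[symmetric] e_def[symmetric] by (simp add:algebra_simps)
 have R: "sn ?j (sn i (sn ?j g)) z = aa e * (aa d * sn ?j g z + bb d * sn ?j g (z o sw i)) +
  (aa (d + e) * (bb e * sn ?j g (z o sw ?j)) + bb e * (bb (d + e) * sn ?j g (z o sw ?j o sw i)))"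
  using sn_eval[OF z i(2), of "sn i (sn ?j g)"] sn_eval[OF z i(1), of "sn ?j g"] bb_sn[OF z i(2,1), of "sn ?j g"]
  unfolding dds d_def[symmetric] e_def[symmetric] by (simp add:algebra_simps)
 show ?thesis
  unfolding L R one two zero aa_minus[OF nz(1)] aa_minus[OF nz(2)]
  using braid_algebra[OF refl bb_mult[OF nz(1)] bb_mult[OF nz(2)] aa_mult[OF nz], of ?f1 ?f2 ?f3 "bb (d + e)" ?f5 ?f4 ?f6]
  by (simp add:algebra_simps)
qed (simp add:sn_def algebra_simps)

lemma lin_sn: "lin_op (sn i)"
 by (auto simp:lin_op_def sn_def algebra_simps)

lemma hk_rep_sn: "hk_rep n th sn"
 by unfold_locales (use rhom lin_sn sn_quad sn_braid sn_comm in "auto simp:q_def[symmetric]")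

sublocale V: hk_rep n th sn
 by (rule hk_rep_sn)

lemma loc_wd: "A \<subseteq> std n ==> (!!z i. z:A ==> i:{1..<n} ==> z o sw i:std n ==> z o sw i:A) ==> loc_on A (%f. foldr sn us f)"
proof (induction us)
 case (Cons i us)
 have "loc_on A (sn i)"
  unfolding loc_on_def
 proof (intro allI impI ballI)
  fix f g :: "(nat => cell) => 'k" and z
  assume h: "ALL z:A. f z = g z" and z: "z:A"
  show "sn i f z = sn i g z"
  proof (cases "i:{1..<n} & bb (dd i z) ~= 0")
  case True
  hence "z o sw i:A" using Cons.prems z bb_std[of z i] by blast
  thus ?thesis using h z by (simp add:sn_def)
  next
  case False thus ?thesis using h z by (auto simp:sn_def)
  qed
 qed
 from loc_on_comp[OF this Cons.IH[OF Cons.prems]] show ?case by simp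
qed (simp add:loc_on_def)

definition "stdD D = {z:std n. shape n z = D}"

lemma fin_stdD [simp]: "finite (stdD D)"
 by (simp add:stdD_def)

lemma loc_act: "loc_on (std n) (V.ac p)" "loc_on (stdD D) (V.ac p)"
proof -
 have "loc_on A (V.ac p)" if "A \<subseteq> std n" "!!z i. z:A ==> i:{1..<n} ==> z o sw i:std n ==> z o sw i:A" for A
  unfolding loc_on_def act_def
  by (intro allI impI ballI sum.cong refl arg_cong[of _ _ "(*) _"] loc_onD[OF loc_wd[OF that]]) auto
 from this[of "std n"] this[of "stdD D"] show "loc_on (std n) (V.ac p)" "loc_on (stdD D) (V.ac p)"
  by (simp_all only:stdD_def mem_Collect_eq shape_sw simp_thms imp_conjL) blast+
qed

section \<open>Jucys--Murphy elements and matrix units\<close>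

text \<open>Jucys-Murphy elements, where \<open>qh (- 2)\<close> is the inverse of \<open>q\<close>.
  This normalization makes the eigenvalue at a filling the quantum integer of the content of the
  cell of \<open>k\<close>.\<close>

fun jm :: "nat => falg" where
 "jm 0 = 0"
| "jm (Suc k) = (if k = 0 then 0 else scal (qh (- 2)) (gen k * jm k * gen k + gen k))"

lemma jm_fa: "k <= n ==> jm k:fa n"
 by (induction k) (auto)

lemma act_jm:
 "1 <= k ==> k <= n ==> z:std n ==> V.ac (jm k) f z = br (ct (z k)) * f z"
proof (induction k arbitrary: z f)
 case (Suc k)
 show ?case
 proof (cases "k = 0")
  case True
  have "dia (z ` {1..1})" using Suc.prems True unfolding std_def by auto
  hence "(0, 0):{z (Suc 0)}" using diagramD[of "{z (Suc 0)}" "z (Suc 0)" "(0, 0)"] by (simp add:cell_le_def)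
  hence "z (Suc 0) = (0, 0)" by auto
  hence "ct (z (Suc 0)) = 0" by (simp add:ct_def)
  thus ?thesis using True by simp
 next
  case False
  note z = Suc.prems(3)
  have k: "k:{1..<n}" using False Suc.prems by auto
  define c d where "c = ct (z k)" and "d = dd k z"
  have c': "ct (z (Suc k)) = c + d" by (simp add:c_def d_def)
  have d: "d ~= 0" using std_swp_iff(2)[OF z k] by (simp add:d_def)
  have qq: "th (qh (- 2)) * q = 1" unfolding q_def V.th(3)[symmetric] by (simp add:V.th(1))
  have IH: "V.ac (jm k) g z' = br (ct (z' k)) * g z'" if "z':std n" for g z'
  using Suc.IH[OF _ _ that] k by auto
  have 1: "V.ac (gen k * jm k * gen k + gen k) f z = sn k (V.ac (jm k) (sn k f)) z + sn k f z"
  by (simp add:V.act_add V.act_mult V.act_gen)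
  have 2: "sn k (V.ac (jm k) (sn k f)) z = aa d * (br c * sn k f z) + br (c + d) * (bb d * sn k f (z o sw k))"
  using sn_eval[OF z k, of "V.ac (jm k) (sn k f)"] IH[OF z, of "sn k f"] IH[OF bb_std[OF z k], of "sn k f"]
  by (cases "bb d = 0") (auto simp:c_def[symmetric] d_def[symmetric] c')
  have 3: "bb d * sn k f (z o sw k) = bb d * ((q - 1 - aa d) * f (z o sw k) + bb (- d) * f z)"
  using bb_sn[OF z k k, of f] unfolding dd_sw comp_sw_sw d_def[symmetric] aa_minus[OF d] .
  have 4: "sn k f z = aa d * f z + bb d * f (z o sw k)"
  using sn_eval[OF z k, of f] by (simp add:d_def)
  have "aa d * br d = (q - 1) * br d + 1" using br_nz[OF d] by (simp add:aa_def field_simps)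
  \<comment> \<open>This identity makes the off-diagonal terms cancel and leaves the eigenvalue for
    \<open>Suc k\<close>.\<close>
  hence key: "aa d * (br (c + d) - br c) = 1 + (q - 1) * br (c + d)"
  proof -
  have "aa d * (br (c + d) - br c) = aa d * br d * (1 + (q - 1) * br c)" unfolding br_add by (simp add:algebra_simps)
  also have "... = 1 + (q - 1) * br (c + d)" unfolding \<open>aa d * br d = (q - 1) * br d + 1\<close> br_add by (simp add:algebra_simps)
  finally show ?thesis .
  qed
  have "V.ac (gen k * jm k * gen k + gen k) f z =
  aa d * (br c * (aa d * f z + bb d * f (z o sw k))) +
  br (c + d) * (bb d * (q - 1 - aa d) * f (z o sw k) + (1 + aa d) * (q - aa d) * f z) + (aa d * f z + bb d * f (z o sw k))"
  unfolding 1 2 3 4 bb_mult[OF d, symmetric] by (simp add:algebra_simps)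
  also have "... = (aa d * f z + bb d * f (z o sw k)) * (aa d * br c + br (c + d) * (q - 1 - aa d) + 1) + q * br (c + d) * f z"
  by (simp add:algebra_simps)
  also have "aa d * br c + br (c + d) * (q - 1 - aa d) + 1 = 0"
  using key by (simp add:algebra_simps)
  also have "(aa d * f z + bb d * f (z o sw k)) * 0 + q * br (c + d) * f z = q * br (c + d) * f z" by simp
  finally show ?thesis using qq by (simp add:V.act_scal c' False)
 qed
qed simp

end

section \<open>Matrix units\<close>

text \<open>The product of the Hecke algebra with scalars extended to \<open>'k\<close>, on
  coefficient functions for the basis \<open>Tw n w\<close>; matrix units need denominators.\<close>

definition conv :: "nat => (laurent => 'k::comm_ring_1) => ((nat => nat) => 'k) => ((nat => nat) => 'k) => (nat => nat) => 'k" where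
 "conv n th c d w = (SUM u:Sym n. SUM v:Sym n. c u * d v * th (cof n (Tw n u * Tw n v) w))"

context hk_rep
begin

definition "kac c f x = (SUM w:Sym n. c w * ac (Tw n w) f x)"

lemma lin_kac: "lin_op (kac c)"
 unfolding lin_op_def kac_def
 by (simp add:lin_op_add[OF lin_act] lin_op_scale[OF lin_act] sum.distrib sum_distrib_left algebra_simps)

lemma kac_cong: "(!!w. w:Sym n ==> c w = d w) ==> kac c = kac d"
 by (simp add:kac_def fun_eq_iff)

lemma act_kac: "p:fa n ==> ac p = kac (%w. th (cof n p w))"
 unfolding kac_def by (intro ext) (rule act_cof)

lemma kac_zero [simp]: "kac (%w. 0) f x = 0"
 by (simp add:kac_def)

lemma kac_conv: "kac (conv n th c d) f x = kac c (kac d f) x"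
proof -
 have m: "(SUM w:Sym n. th (cof n (Tw n u * Tw n v) w) * ac (Tw n w) f x) = ac (Tw n u) (ac (Tw n v) f) x"
  if "u:Sym n" "v:Sym n" for u v
  using act_cof[of "Tw n u * Tw n v" f x] that by (simp add:act_mult)
 have "kac (conv n th c d) f x = (SUM w:Sym n. SUM u:Sym n. SUM v:Sym n. c u * d v * (th (cof n (Tw n u * Tw n v) w) * ac (Tw n w) f x))"
  by (simp add:kac_def conv_def sum_distrib_right mult.assoc)
 also have "... = (SUM u:Sym n. SUM w:Sym n. SUM v:Sym n. c u * d v * (th (cof n (Tw n u * Tw n v) w) * ac (Tw n w) f x))"
  by (rule sum.swap)
 also have "... = (SUM u:Sym n. SUM v:Sym n. SUM w:Sym n. c u * d v * (th (cof n (Tw n u * Tw n v) w) * ac (Tw n w) f x))"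
  by (intro sum.cong refl sum.swap)
 also have "... = (SUM u:Sym n. SUM v:Sym n. c u * d v * ac (Tw n u) (ac (Tw n v) f) x)"
  by (intro sum.cong refl) (simp add:sum_distrib_left[symmetric] m)
 also have "... = (SUM u:Sym n. c u * ac (Tw n u) (%x. SUM v:Sym n. d v * ac (Tw n v) f x) x)"
  by (simp add:lin_op_sum[OF lin_act] lin_op_scale[OF lin_act] sum_distrib_left mult.assoc)
 finally show ?thesis unfolding kac_def by (simp add:kac_def)
qed

lemma kac_add: "kac (%w. c w + d w) f x = kac c f x + kac d f x"
 by (simp add:kac_def algebra_simps)

lemma kac_scl: "kac (%w. a * c w) f x = a * kac c f x"
 by (simp add:kac_def sum_distrib_left mult.assoc)

lemma kac_sum: "kac (%w. SUM y:Y. c y w) f x = (SUM y:Y. kac (c y) f x)"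
 unfolding kac_def sum_distrib_right by (rule sum.swap)

lemma kac_dl: assumes w: "w:Sym n" shows "kac (dl w) f x = ac (Tw n w) f x"
proof -
 have "kac (dl w) f x = (SUM u:Sym n. if u = w then ac (Tw n w) f x else 0)"
  unfolding kac_def dl_def by (rule sum.cong) auto
 thus ?thesis using w by simp
qed

lemma Tw_id: "ac (Tw n id) f = f"
proof -
 have "red n id = []" using len_red[OF id_Sym, of n] by simp
 thus ?thesis by (intro ext) (simp add:act_wt th)
qed

end

text \<open>A one-sided inverse of a square matrix is two-sided; the index sets are first
  numbered.\<close>

lemma inv_mats:
 fixes A :: "'p => 'w => 'k::field"
 assumes fin: "finite P" "finite W" and card: "card P = card W"
  and AB: "!!p p'. p:P ==> p':P ==> (SUM w:W. A p w * B w p') = (if p = p' then 1 else 0)"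
  and w: "w:W" "w':W"
 shows "(SUM p:P. B w p * A p w') = (if w = w' then 1 else 0)"
proof -
 let ?N = "card P"
 obtain f where f: "bij_betw f {0..<?N} P" using ex_bij_betw_nat_finite[OF fin(1)] by blast
 obtain g where g: "bij_betw g {0..<?N} W" using ex_bij_betw_nat_finite[OF fin(2)] card by metis
 define MA where "MA = mat ?N ?N (%(i, j). A (f i) (g j))"
 define MB where "MB = mat ?N ?N (%(i, j). B (g i) (f j))"
 have c: "MA:carrier_mat ?N ?N" "MB:carrier_mat ?N ?N" by (simp_all add:MA_def MB_def)
 have fP: "f i:P" if "i < ?N" for i using bij_betw_apply[OF f] that by simp
 have finj: "f i = f j <-> i = j" if "i < ?N" "j < ?N" for i j
  using bij_betw_imp_inj_on[OF f] that by (auto dest:inj_onD)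
 have "MA * MB = 1\<^sub>m ?N"
 proof (rule eq_matI)
  fix i j assume ij: "i < dim_row (1\<^sub>m ?N)" "j < dim_col (1\<^sub>m ?N)"
  have "(MA * MB) $$ (i, j) = (SUM k:{0..<?N}. A (f i) (g k) * B (g k) (f j))"
  using ij by (simp add:MA_def MB_def scalar_prod_def)
  also have "... = (SUM w:W. A (f i) w * B w (f j))" by (rule sum.reindex_bij_betw[OF g])
  finally show "(MA * MB) $$ (i, j) = 1\<^sub>m ?N $$ (i, j)" using ij fP finj by (simp add:AB)
 qed (simp_all add:MA_def MB_def)
 hence BA: "MB * MA = 1\<^sub>m ?N" by (rule mat_mult_left_right_inverse[OF c])
 have "w:g ` {0..<?N}" "w':g ` {0..<?N}" using w bij_betw_imp_surj_on[OF g] by simp_all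
 then obtain i j where ij: "i < ?N" "j < ?N" "g i = w" "g j = w'" by auto
 have "i = j <-> w = w'" using ij bij_betw_imp_inj_on[OF g] by (auto dest:inj_onD)
 have "(MB * MA) $$ (i, j) = (SUM k:{0..<?N}. B w (f k) * A (f k) w')"
  using ij by (simp add:MA_def MB_def scalar_prod_def)
 also have "... = (SUM p:P. B w p * A p w')" by (rule sum.reindex_bij_betw[OF f])
 finally show ?thesis using ij \<open>i = j <-> w = w'\<close> unfolding BA by simp
qed

context snorm
begin

lemma loc_kac: "loc_on (std n) (V.kac c)" "loc_on (stdD D) (V.kac c)"
proof -
 have "loc_on A (V.kac c)" if "!!p. loc_on A (V.ac p)" for A
  unfolding loc_on_def V.kac_def
  by (intro allI impI ballI sum.cong refl arg_cong[of _ _ "(*) _"] loc_onD[OF that]) auto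
 thus "loc_on (std n) (V.kac c)" "loc_on (stdD D) (V.kac c)" using loc_act by blast+
qed

definition "diag m <-> (EX c. ALL f. ALL z:std n. V.kac c f z = m z * f z)"

lemma diag_const: "diag (%z. a)"
proof -
 have "V.kac (%w. a * dl id w) f z = a * f z" for f z
  by (simp add:V.kac_scl V.kac_dl V.Tw_id)
 thus ?thesis unfolding diag_def by blast
qed

lemma diag_jm: "k:{1..n} ==> diag (%z. br (ct (z k)))"
 unfolding diag_def by (rule exI[of _ "%w. th (cof n (jm k) w)"])
  (simp add:V.act_kac[OF jm_fa, symmetric] act_jm)

lemma diag_add: assumes "diag m" "diag m'" shows "diag (%z. m z + m' z)"
proof -
 note assms
 then obtain c c' where "ALL f. ALL z:std n. V.kac c f z = m z * f z" "ALL f. ALL z:std n. V.kac c' f z = m' z * f z"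
  by (auto simp:diag_def)
 thus ?thesis unfolding diag_def by (intro exI[of _ "%w. c w + c' w"]) (simp add:V.kac_add distrib_right)
qed

lemma diag_mult: assumes "diag m" "diag m'" shows "diag (%z. m z * m' z)"
proof -
 note assms
 then obtain c c' where "ALL f. ALL z:std n. V.kac c f z = m z * f z" "ALL f. ALL z:std n. V.kac c' f z = m' z * f z"
  by (auto simp:diag_def)
 thus ?thesis unfolding diag_def by (intro exI[of _ "conv n th c c'"]) (simp add:V.kac_conv)
qed

lemma diag_prod: "finite A ==> (!!x. x:A ==> diag (m x)) ==> diag (%z. PROD x:A. m x z)"
 by (induction A rule:finite_induct) (auto intro:diag_const diag_mult)

text \<open>Lagrange interpolation in the Jucys-Murphy elements: contents determine a filling and
  \<open>br\<close> is injective, so the joint eigenvalues separate the fillings.\<close>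

lemma diag_point:
 assumes x: "x:std n" shows "diag (%z. if z = x then 1 else 0)"
proof -
 define C where "C = (%(z, k). ct (z k)) ` (std n \<times> {1..n})"
 have fin: "finite C" by (simp add:C_def)
 define m where "m z = (PROD k:{1..n}. PROD c:C - {ct (x k)}. (br (ct (z k)) + - br c) * (1 / (br (ct (x k)) - br c)))" for z
 have "diag m" unfolding m_def by (intro diag_prod diag_mult diag_add diag_const diag_jm) (use fin in auto)
 moreover have "m z = (if z = x then 1 else 0)" if z: "z:std n" for z
 proof (cases "z = x")
  case True
  have "(br (ct (x k)) + - br c) * (1 / (br (ct (x k)) - br c)) = 1" if "c:C - {ct (x k)}" for k c
  using br_inj[of "ct (x k)" c] that by auto
  thus ?thesis unfolding m_def True by simp
 next
  case False
  then obtain k where k: "k:{1..n}" "ct (z k) ~= ct (x k)" using std_ct_inj[OF z x] by blast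
  hence "ct (z k):C - {ct (x k)}" using z by (auto simp:C_def)
  hence "(PROD c:C - {ct (x k)}. (br (ct (z k)) + - br c) * (1 / (br (ct (x k)) - br c))) = 0"
  using fin by (intro prod_zero) (auto)
  thus ?thesis unfolding m_def using k(1) False by (auto)
 qed
 ultimately show ?thesis unfolding diag_def by simp
qed

definition "unit x y c <-> (ALL f. ALL z:std n. V.kac c f z = (if z = x then f y else 0))"

text \<open>From the idempotent of \<open>x\<close>, each admissible swap carries the unit one step
  further: multiply by the generator, project to the new filling, and divide by the off-diagonal
  coefficient, which is nonzero.\<close>

lemma unit_ex:
 assumes x: "x:std n" and y: "y:std n" and sh: "shape n x = shape n y"
 shows "EX c. unit x y c"
proof (rule std_conn[OF x y sh])
 have dg: "EX c. unit x x c" if x: "x:std n" for x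
 proof -
  obtain c where "ALL f. ALL z:std n. V.kac c f z = (if z = x then 1 else 0) * f z"
  using diag_point[OF x] unfolding diag_def by blast
  hence "unit x x c" unfolding unit_def by auto
  thus ?thesis by blast
 qed
 show "EX c. unit x x c" by (rule dg[OF x])
 fix z i assume z: "z:std n" and i: "i:{1..<n}" and zs: "z o sw i:std n" and "EX c. unit x z c"
 then obtain c where c: "unit x z c" by blast
 obtain d where d: "unit (z o sw i) (z o sw i) d" using dg[OF zs] by blast
 have b: "bb (dd i z) ~= 0" using bb_nz std_swp_iff[OF z i] zs by auto
 have ne: "z ~= z o sw i"
 proof
  assume "z = z o sw i"
  from fun_cong[OF this, of i] show False using std_swp_iff(2)[OF z i] by simp
 qed
 have "V.kac (conv n th c (conv n th (%w. th (cof n (gen i) w)) d)) f z' = (if z' = x then bb (dd i z) * f (z o sw i) else 0)"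
  if z': "z':std n" for f z'
 proof -
  have "V.kac (conv n th c (conv n th (%w. th (cof n (gen i) w)) d)) f z' =
  (if z' = x then sn i (V.kac d f) z else 0)"
  using c z' i by (simp add:V.kac_conv unit_def V.act_kac[symmetric] V.act_gen)
  also have "sn i (V.kac d f) z = bb (dd i z) * f (z o sw i)"
  using d z zs ne unfolding sn_eval[OF z i] unit_def by auto
  finally show ?thesis .
 qed
 hence "unit x (z o sw i) (%w. 1 / bb (dd i z) * conv n th c (conv n th (%w. th (cof n (gen i) w)) d) w)"
  unfolding unit_def V.kac_scl using b by auto
 thus "EX c. unit x (z o sw i) c" by blast
qed

definition "cu p = (SOME c. unit (fst p) (snd p) c)"

lemma unit_cu: "(x, y):spr n ==> z:std n ==> V.kac (cu (x, y)) f z = (if z = x then f y else 0)"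
 using someI_ex[OF unit_ex[of x y]] by (auto simp:cu_def spr_def unit_def)

definition "me p xy = V.ac p (dl (snd xy)) (fst xy)"

lemma me_expand:
 assumes "x:std n" shows "V.ac p f x = (SUM y:stdD (shape n x). me p (x, y) * f y)"
proof -
 have "x:stdD (shape n x)" using assms by (simp add:stdD_def)
 hence "V.ac p f x = (SUM y:stdD (shape n x). f y * V.ac p (dl y) x)"
  by (rule op_expand[OF V.lin_act loc_act(2) fin_stdD])
 thus ?thesis by (simp add:me_def mult.commute)
qed

lemma cu_me:
 assumes "p:spr n" "p':spr n"
 shows "(SUM w:Sym n. cu p w * me (Tw n w) p') = (if p = p' then 1 else 0)"
proof -
 obtain x y x' y' where p: "p = (x, y)" "p' = (x', y')" by (cases p, cases p')
 have "(SUM w:Sym n. cu p w * me (Tw n w) p') = V.kac (cu p) (dl y') x'"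
  by (simp add:V.kac_def me_def p)
 also have "... = (if p = p' then 1 else 0)"
  using assms by (auto simp:p unit_cu spr_def dl_def)
 finally show ?thesis .
qed

text \<open>There are as many pairs of standard fillings of equal shape as permutations, so the
  inverse relation \<open>cu_me\<close> can be turned around.\<close>

lemma me_cu:
 "w:Sym n ==> w':Sym n ==> (SUM p:spr n. me (Tw n w) p * cu p w') = (if w = w' then 1 else 0)"
 by (rule inv_mats[OF fin_spr fin_Sym _ cu_me]) (simp_all add:card_spr card_Sym)

lemma kac_faithful:
 assumes "!!f z. z:std n ==> V.kac c f z = V.kac d f z" and w: "w:Sym n"
 shows "c w = d w"
proof -
 have "(SUM u:Sym n. c u * me (Tw n u) p) = (SUM u:Sym n. d u * me (Tw n u) p)" if "p:spr n" for p
  using assms(1)[of "fst p" "dl (snd p)"] that by (auto simp:V.kac_def me_def spr_def)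
 hence eq: "(SUM p:spr n. SUM u:Sym n. c u * me (Tw n u) p * cu p w) = (SUM p:spr n. SUM u:Sym n. d u * me (Tw n u) p * cu p w)"
  by (simp add:sum_distrib_right[symmetric])
 have "(SUM p:spr n. SUM u:Sym n. c u * me (Tw n u) p * cu p w) = c w" for c
 proof -
  have "(SUM p:spr n. SUM u:Sym n. c u * me (Tw n u) p * cu p w) = (SUM u:Sym n. c u * (SUM p:spr n. me (Tw n u) p * cu p w))"
  by (subst sum.swap) (simp add:sum_distrib_left mult.assoc)
  also have "... = (SUM u:Sym n. if u = w then c w else 0)" by (rule sum.cong) (use w in "auto simp:me_cu")
  finally show ?thesis using w by simp
 qed
 thus ?thesis using eq by metis
qed

section \<open>Decomposition of representations\<close>

context
 fixes t :: "nat => ('x => 'k) => 'x => 'k"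
 assumes t: "hk_rep n th t"
begin

interpretation M: hk_rep n th t by (rule t)

text \<open>An identity checked in the seminormal module is an identity of coefficients, hence holds
  in every representation; this makes the matrix units available everywhere.\<close>

lemma kac_transfer:
 assumes "!!f z. z:std n ==> V.kac c f z = V.kac d f z" shows "M.kac c = M.kac d"
 by (rule M.kac_cong) (rule kac_faithful[OF assms])

lemma unit_mult:
 assumes "(x, y):spr n" "(x', y'):spr n"
 shows "M.kac (cu (x, y)) (M.kac (cu (x', y')) f) = (if y = x' then M.kac (cu (x, y')) f else (%_. 0))"
proof -
 have "y = x' ==> (x, y'):spr n" using assms by (auto simp:spr_def)
 hence "M.kac (conv n th (cu (x, y)) (cu (x', y'))) = M.kac (if y = x' then cu (x, y') else (%w. 0 * cu (x, y) w))"
  using assms by (intro kac_transfer) (auto simp:V.kac_conv unit_cu spr_def)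
 hence "M.kac (conv n th (cu (x, y)) (cu (x', y'))) f v = (if y = x' then M.kac (cu (x, y')) f v else 0)" for v
  by (cases "y = x'") (simp_all)
 thus ?thesis by (auto simp:M.kac_conv[symmetric])
qed

lemma kac_units: assumes p: "p:fa n" shows "M.ac p f v = (SUM xy:spr n. me p xy * M.kac (cu xy) f v)"
proof -
 have "M.kac (%w. th (cof n p w)) = M.kac (%w. SUM xy:spr n. me p xy * cu xy w)"
 proof (rule kac_transfer)
  fix f z assume z: "z:std n"
  have "(SUM xy:spr n. me p xy * V.kac (cu xy) f z) = (SUM xy:spr n. if fst xy = z then me p xy * f (snd xy) else 0)"
  by (rule sum.cong) (use z in "auto simp:unit_cu")
  also have "... = (SUM xy:Pair z ` stdD (shape n z). me p xy * f (snd xy))"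
  by (rule sum.mono_neutral_cong_right[OF fin_spr]) (use z in "auto simp:spr_def stdD_def image_iff")
  also have "... = (SUM y:stdD (shape n z). me p (z, y) * f y)"
  by (subst sum.reindex) (auto simp:inj_on_def)
  finally show "V.kac (%w. th (cof n p w)) f z = V.kac (%w. SUM xy:spr n. me p xy * cu xy w) f z"
  using z by (simp add:V.act_kac[OF p, symmetric] V.kac_sum V.kac_scl me_expand)
 qed
 thus ?thesis by (simp add:M.act_kac[OF p] M.kac_sum M.kac_scl)
qed

lemma units_one: "f v = (SUM x:std n. M.kac (cu (x, x)) f v)"
proof -
 have "M.kac (%w. th (cof n 1 w)) = M.kac (%w. SUM x:std n. cu (x, x) w)"
  by (rule kac_transfer) (simp add:V.act_kac[OF one_fa, symmetric] V.kac_sum unit_cu spr_def)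
 thus ?thesis using fun_cong[OF fun_cong[OF M.act_kac[OF one_fa]], of f v] by (simp add:M.kac_sum)
qed

end

end

section \<open>Sign-isotypic vectors\<close>

lemma Tw_r:
 assumes w: "w:Sym n" and i: "i:{1..<n}" and lt: "w i < w (Suc i)"
 shows "heq n (Tw n w * gen i) (Tw n (w o sw i))"
proof -
 have r: "rword n w (red n w)" by (rule rword_red[OF w])
 have wp: "wperm (ts @ [i]) = wperm ts o sw i" for ts
  by (induction ts) (simp_all)
 have p: "w o sw i:Sym n" using w i comp_Sym by simp
 have "plen n w < plen n (w o sw i)"
  by (rule plen_trp[OF w]) (use i lt in auto)
 moreover have "plen n (wperm (red n w @ [i])) <= length (red n w @ [i])"
  by (rule plen_wd) (use r i in "auto simp:rword_iff")
 ultimately have "rword n (w o sw i) (red n w @ [i])"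
  using r i by (auto simp:rword_iff)
 from Tw_rword[OF p this] show ?thesis
  by (simp add:mult_single plus_gen_word_def)
qed

lemma YS_perm: "u:YS 1 n F ==> u:Sym n"
 by (rule YS_Sym) auto

lemma Sym_permutation: "w:Sym n ==> permutation w"
 by (auto simp:Sym_def intro:permutation_permutes[THEN iffD2])

lemma sign_sw: "w:Sym n ==> sign (sw i o w) = - sign w" "w:Sym n ==> sign (w o sw i) = - sign w"
 by (simp_all add:sign_compose Sym_permutation permutation_swap_id sign_swap_id)

lemma YS_same_block:
 assumes u: "u:YS a b F" and i: "i:links a b F" and k: "u i <= k & k < u (Suc i) \<or> u (Suc i) <= k & k < u i"
 shows "k:links a b F"
proof -
 have ii: "u i:{a..b}" "u (Suc i):{a..b}" using YS_mem[OF u] i by (auto simp:links_def)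
 have "k ~: F"
 proof
  assume kF: "k:F"
  have "k = i" using YS_cut[OF u kF, of i] YS_cut[OF u kF, of "Suc i"] k by linarith
  thus False using kF i by (simp add:links_def)
 qed
 thus ?thesis using ii k by (auto simp:links_def)
qed

lemma YS_incr_id:
 assumes u: "u:YS 1 n F" and inc: "!!i. i:links 1 n F ==> u i < u (Suc i)"
 shows "u = id"
proof (rule incr_perm_id[OF YS_perm[OF u]])
 fix i assume i: "i:{1..<n}"
 show "u i < u (Suc i)"
 proof (cases "i:F")
  case True
  thus ?thesis using YS_cut[OF u True, of i] YS_cut[OF u True, of "Suc i"] by simp
 next
  case False thus ?thesis using inc i by (auto simp:links_def)
 qed
qed

context hk_rep
begin

definition sgnv :: "nat set => ('x => 'k) => bool" where
 "sgnv F g <-> (ALL i:links 1 n F. t i g = (%x. - g x))"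

text \<open>Lengths need not add up here. For a link \<open>i\<close>, the longer of
  \<open>w\<close> and \<open>w o sw i\<close> is obtained from the shorter by right multiplication
  with \<open>gen i\<close>, and the eigenvalue -1 is its own inverse, so the sign rule holds in
  both directions.\<close>

lemma Tw_sgnv:
 assumes g: "sgnv F g" and u: "u:YS 1 n F" and w: "w:Sym n"
 shows "ac (Tw n (w o u)) g x = of_int (sign u) * ac (Tw n w) g x"
proof -
 have one: "ac (Tw n (w o sw i)) g x = - ac (Tw n w) g x" if w: "w:Sym n" and il: "i:links 1 n F" for w i x
 proof -
  have i: "i:{1..<n}" using il by (auto simp:links_def)
  have up: "ac (Tw n (w o sw i)) g x = - ac (Tw n w) g x" if w: "w:Sym n" "w i < w (Suc i)" for w
  proof -
  have "ac (Tw n (w o sw i)) g x = ac (Tw n w) (t i g) x"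
  using act_heq[OF Tw_r[OF w(1) i w(2)], of g] act_mult[of "Tw n w" "gen i" g x] by (simp only:act_gen)
  also have "... = - ac (Tw n w) g x"
  using g il lin_op_minus[OF lin_act[of "Tw n w"], of g] by (simp add:sgnv_def)
  finally show ?thesis .
  qed
  have ws: "w o sw i:Sym n" using w i comp_Sym by simp
  have "w i ~= w (Suc i)" using inj_eq[OF Sym_inj[OF w]] by simp
  then consider "w i < w (Suc i)" | "(w o sw i) i < (w o sw i) (Suc i)" by (cases "w i < w (Suc i)") auto
  thus ?thesis
  proof cases
  case 1 thus ?thesis by (rule up[OF w])
  next
  case 2 thus ?thesis using up[OF ws 2] by (simp only:comp_sw_sw minus_minus)
  qed
 qed
 have "ALL w:Sym n. ac (Tw n (w o u)) g x = of_int (sign u) * ac (Tw n w) g x"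
  using le_refl le_refl u
 proof (induction rule:YS_induct)
  case (sw i u)
  show ?case
  proof
  fix w assume w: "w:Sym n"
  have i: "i:{1..<n}" using sw(1) by (auto simp:links_def)
  have "ac (Tw n (w o (sw i o u))) g x = of_int (sign u) * ac (Tw n (w o sw i)) g x"
  using sw(4) comp_Sym[OF w sw_Sym[OF i]] by (simp only:comp_assoc[symmetric])
  thus "ac (Tw n (w o (sw i o u))) g x = of_int (sign (sw i o u)) * ac (Tw n w) g x"
  by (simp only:one[OF w sw(1)] sign_sw(1)[OF YS_perm[OF sw(2)]]) simp
  qed
 qed simp
 thus ?thesis using w by blast
qed

end

context snorm
begin

text \<open>Each block runs through a vertical strip in the order of decreasing contents. These
  fillings index the sign-isotypic vectors (\<open>sgnv_expand\<close>) and standardize transposed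
  semistandard tableaux (\<open>card_YY_bw\<close>).\<close>

definition "YY D F = {z:stdD D. ALL i:links 1 n F. ct (z (Suc i)) < ct (z i)}"

lemma fin_YY [simp]: "finite (YY D F)"
 by (simp add:YY_def)

lemma sgnv_swp:
 assumes g: "V.sgnv F g" and z: "z:std n" and i: "i:links 1 n F"
 shows "\<bar>dd i z\<bar> ~= 1 ==> g (z o sw i) = - g z" "dd i z = 1 ==> g z = 0"
proof -
 have ii: "i:{1..<n}" using i by (auto simp:links_def)
 have eq: "aa (dd i z) * g z + bb (dd i z) * g (z o sw i) = - g z"
  using g i sn_eval[OF z ii, of g] by (simp add:V.sgnv_def)
 show "g (z o sw i) = - g z" if "\<bar>dd i z\<bar> ~= 1"
 proof -
  have "bb (dd i z) = 1 + aa (dd i z)" using that by (simp add:bb_def)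
  hence "bb (dd i z) * (g (z o sw i) + g z) = 0" using eq by (simp add:algebra_simps)
  thus ?thesis using bb_nz[OF _ that] std_swp_iff(2)[OF z ii] by (simp add:eq_neg_iff_add_eq_0)
 qed
 show "g z = 0" if "dd i z = 1"
 proof -
  have "(1 + q) * g z = 0" using eq that by (simp add:bb_def algebra_simps)
  moreover have "1 + q ~= 0" using br_nz[of 2] br_add[of 1 1] by simp
  ultimately show ?thesis by simp
 qed
qed

text \<open>Take a filling in the support with minimal \<open>G\<close>. If it is not in
  \<open>YY\<close>, some link has positive axial distance: distance 1 contradicts
  \<open>sgnv_swp\<close>, and a larger one allows a swap that lowers \<open>G\<close> within the
  support.\<close>

lemma sgnv_vanish:
 assumes g: "V.sgnv F g" and Y: "!!y. y:YY D F ==> g y = 0" and z: "z:stdD D"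
 shows "g z = 0"
proof (rule ccontr)
 assume nz: "g z ~= 0"
 define G where "G z = (SUM k:{1..n}. int k * ct (z k))" for z :: "nat => cell"
 let ?S = "{z:stdD D. g z ~= 0}"
 have "Min (G ` ?S):G ` ?S" using z nz by (intro Min_in) auto
 then obtain x where x: "x:stdD D" "g x ~= 0" and min: "G x = Min (G ` ?S)" by auto
 hence xs: "x:std n" by (simp add:stdD_def)
 obtain i where i: "i:links 1 n F" "~ ct (x (Suc i)) < ct (x i)"
  using Y[of x] x by (auto simp:YY_def)
 have ii: "i:{1..<n}" using i by (auto simp:links_def)
 have d: "dd i x > 1" using sgnv_swp(2)[OF g xs i(1)] std_swp_iff(2)[OF xs ii] x i(2) by force
 hence "\<bar>dd i x\<bar> ~= 1" by linarith
 hence "g (x o sw i) ~= 0" "x o sw i:std n"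
  using sgnv_swp(1)[OF g xs i(1)] std_swp_iff(1)[OF xs ii] x by auto
 moreover have "shape n (x o sw i) = D" using shape_sw[OF ii, of x] x by (simp only:stdD_def mem_Collect_eq)
 ultimately have "G x <= G (x o sw i)"
  unfolding min by (intro Min_le) (auto simp:stdD_def)
 moreover have "G (x o sw i) - G x = - dd i x"
 proof -
  have "G (x o sw i) - G x = (SUM k:{1..n}. int k * (ct (x (sw i k)) - ct (x k)))"
  by (simp add:G_def sum_subtractf right_diff_distrib)
  also have "... = (SUM k:{i, Suc i}. int k * (ct (x (sw i k)) - ct (x k)))"
  by (rule sum.mono_neutral_right) (use ii in "auto simp:transpose_def")
  finally show ?thesis by (simp add:algebra_simps)
 qed
 ultimately show False using d by linarith
qed

text \<open>The sign character spread from \<open>y\<close> over its orbit under the Young subgroup,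
  restricted to standard fillings. On \<open>YY\<close> these vectors are dual to evaluation
  (\<open>phy_YY\<close>).\<close>

definition phy :: "nat set => (nat => cell) => (nat => cell) => 'k" where
 "phy F y z = (if z:std n & (EX u:YS 1 n F. z = y o u) then of_int (sign (THE u. u:YS 1 n F & z = y o u)) else 0)"

lemma YS_comp_inj:
 assumes y: "y:std n" and u: "u:YS 1 n F" "v:YS 1 n F" and eq: "y o u = y o v" shows "u = v"
proof
 fix k show "u k = v k"
 proof (cases "k:{1..n}")
  case True
  hence "u k:{1..n}" "v k:{1..n}" using YS_mem u by blast+
  thus ?thesis using y fun_cong[OF eq, of k] by (auto simp:std_def dest:inj_onD)
 next
  case False thus ?thesis using YS_out u by metis
 qed
qed

lemma phy_eval:
 assumes y: "y:std n" and u: "u:YS 1 n F"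
 shows "phy F y (y o u) = (if y o u:std n then of_int (sign u) else 0)"
proof -
 have "(THE v. v:YS 1 n F & y o u = y o v) = u"
  by (rule the_equality) (use u YS_comp_inj[OF y] in blast)+
 thus ?thesis using u by (auto simp:phy_def)
qed

lemma YY_decr:
 assumes y: "y:YY D F" and "1 <= p" "p < p'" "p' <= n" "!!k. p <= k ==> k < p' ==> k:links 1 n F"
 shows "ct (y p') < ct (y p)"
 using strict_mono_links[of p p' "%k. - ct (y k)" p p'] assms by (auto simp:YY_def)

lemma sgnv_phy:
 assumes y: "y:YY D F" shows "V.sgnv F (phy F y)"
 unfolding V.sgnv_def
proof (intro ballI ext)
 fix i z assume i: "i:links 1 n F"
 have ii: "i:{1..<n}" using i by (auto simp:links_def)
 have ys: "y:std n" using y by (simp add:YY_def stdD_def)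
 consider "z ~: std n" | "z:std n" "~ (EX u:YS 1 n F. z = y o u)" | u where "z:std n" "u:YS 1 n F" "z = y o u" by blast
 thus "sn i (phy F y) z = - phy F y z"
 proof cases
  case 1 thus ?thesis by (simp add:sn_def phy_def)
 next
  case 2
  have "~ (EX u:YS 1 n F. z o sw i = y o u)"
  proof
  assume "EX u:YS 1 n F. z o sw i = y o u"
  then obtain u where u: "u:YS 1 n F" "z o sw i = y o u" by blast
  hence "z = y o (u o sw i)" by (metis comp_sw_sw comp_assoc)
  thus False using 2 comp_YS[OF u(1) sw_YS[OF i]] by blast
  qed
  hence "phy F y z = 0" "phy F y (z o sw i) = 0" using 2 by (simp_all only:phy_def simp_thms if_False)
  thus ?thesis using sn_eval[OF 2(1) ii, of "phy F y"] by simp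
 next
  case 3
  have us: "u o sw i:YS 1 n F" by (rule comp_YS[OF 3(2) sw_YS[OF i]])
  have e: "phy F y z = of_int (sign u)" using phy_eval[OF ys 3(2)] 3 by simp
  have e': "phy F y (z o sw i) = (if z o sw i:std n then - of_int (sign u) else 0)"
  using phy_eval[OF ys us] sign_sw(2)[OF YS_perm[OF 3(2)], of i] 3(3) by (simp only:comp_assoc of_int_minus)
  \<comment> \<open>Distance 1 puts the cell of \<open>Suc i\<close> right of that of
    \<open>i\<close>. If \<open>y\<close> takes the two cells in this order, contents would have to
    decrease; if not, the right cell would come before the left one in a standard filling.\<close>
  have "dd i z ~= 1"
  proof
  assume d: "dd i z = 1"
  hence le: "cell_le (y (u i)) (y (u (Suc i)))"
  using std_swp_cell_le[OF 3(1) ii] std_swp_iff(1)[OF 3(1) ii] 3(3) by simp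
  have mem: "u i:{1..n}" "u (Suc i):{1..n}" using YS_mem[OF 3(2)] ii by auto
  have "u i ~= u (Suc i)" using inj_eq[OF Sym_inj[OF YS_perm[OF 3(2)]]] by simp
  moreover have "~ u i < u (Suc i)"
  proof
  assume lt: "u i < u (Suc i)"
  have "ct (y (u (Suc i))) < ct (y (u i))"
  by (rule YY_decr[OF y _ lt _ YS_same_block[OF 3(2) i]]) (use mem in auto)
  thus False using d 3(3) by simp
  qed
  ultimately have lt: "u (Suc i) < u i" by simp
  have "dia (y ` {1..u (Suc i)})" using ys mem by (simp add:std_def)
  hence "y (u i):y ` {1..u (Suc i)}" using mem by (intro diagramD[of _ "y (u (Suc i))" "y (u i)"] le) auto
  then obtain k where "k:{1..u (Suc i)}" "y (u i) = y k" by blast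
  thus False using ys lt mem by (auto simp:std_def dest!: inj_onD)
  qed
  then consider "dd i z = - 1" | "\<bar>dd i z\<bar> ~= 1" by linarith
  thus ?thesis
  proof cases
  case 1 thus ?thesis unfolding sn_eval[OF 3(1) ii, of "phy F y"] 1 by (simp add:bb_def)
  next
  case 2
  hence "z o sw i:std n" "bb (dd i z) = 1 + aa (dd i z)" using std_swp_iff(1)[OF 3(1) ii] by (auto simp:bb_def)
  thus ?thesis unfolding sn_eval[OF 3(1) ii, of "phy F y"] e e' by (simp add:algebra_simps)
  qed
 qed
qed

lemma phy_YY:
 assumes y: "y:YY D F" "y':YY D' F" shows "phy F y y' = (if y' = y then 1 else 0)"
proof (cases "EX u:YS 1 n F. y' = y o u")
 case True
 then obtain u where u: "u:YS 1 n F" "y' = y o u" by blast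
 have "u = id"
 proof (rule YS_incr_id[OF u(1)])
  fix i assume i: "i:links 1 n F"
  have ii: "i:{1..<n}" using i by (auto simp:links_def)
  have mem: "u i:{1..n}" "u (Suc i):{1..n}" using YS_mem[OF u(1)] ii by auto
  have "u i ~= u (Suc i)" using inj_eq[OF Sym_inj[OF YS_perm[OF u(1)]]] by simp
  moreover have "~ u (Suc i) < u i"
  proof
  assume lt: "u (Suc i) < u i"
  have "ct (y (u i)) < ct (y (u (Suc i)))"
  by (rule YY_decr[OF y(1) _ lt _ YS_same_block[OF u(1) i]]) (use mem in auto)
  moreover have "ct (y' (Suc i)) < ct (y' i)" using y(2) i by (simp add:YY_def)
  ultimately show False by (simp add:u(2))
  qed
  ultimately show "u i < u (Suc i)" by simp
 qed
 hence "y' = y" using u by simp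
 thus ?thesis using phy_eval[of y id F] y by (simp add:YY_def stdD_def)
next
 case False
 hence "y' ~= y" using id_YS[of 1 n F] by (metis comp_id)
 thus ?thesis using False by (simp only:phy_def simp_thms if_False)
qed

lemma sgnv_expand:
 assumes g: "V.sgnv F g" and z: "z:stdD D"
 shows "g z = (SUM y:YY D F. g y * phy F y z)"
proof -
 let ?ch = "%z. g z + - (SUM y:YY D F. g y * phy F y z)"
 have "sn i ?ch = (%z. - ?ch z)" if i: "i:links 1 n F" for i
 proof -
  have "sn i (phy F y) = (%z. - phy F y z)" if "y:YY D F" for y
  using sgnv_phy[OF that] i by (simp add:V.sgnv_def)
  hence "sn i (%z. SUM y:YY D F. g y * phy F y z) = (%z. - (SUM y:YY D F. g y * phy F y z))"
  by (simp add:lin_op_sum[OF lin_sn] lin_op_scale[OF lin_sn] sum_negf)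
  thus ?thesis
  using g i lin_op_add[OF lin_sn, of i g "%z. - (SUM y:YY D F. g y * phy F y z)"]
  lin_op_minus[OF lin_sn, of i "%z. SUM y:YY D F. g y * phy F y z"]
  by (simp add:V.sgnv_def fun_eq_iff)
 qed
 hence "V.sgnv F ?ch" by (simp add:V.sgnv_def)
 moreover have "?ch y' = 0" if "y':YY D F" for y'
 proof -
  have "(SUM y:YY D F. g y * phy F y y') = (SUM y:YY D F. if y' = y then g y' else 0)"
  by (rule sum.cong) (use that in "auto simp:phy_YY")
  thus ?thesis using that by simp
 qed
 ultimately have "?ch z = 0" using sgnv_vanish[of F ?ch D z] z by blast
 thus ?thesis by simp
qed

end

section \<open>Traces on tensor modules\<close>

definition "words n b = (%w. b o pinv w) ` Sym n"

definition cuts :: "nat => (nat => 'c) => nat set" where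
 "cuts n b = {i:{1..<n}. b i ~= b (Suc i)}"

lemma fin_words [simp]: "finite (words n b)"
 by (simp add:words_def finite_permutations)

lemma words_sw: assumes "f:words n b" and i: "i:{1..<n}" shows "f o sw i:words n b"
proof -
 note assms
 then obtain w where w: "w:Sym n" "f = b o pinv w" by (auto simp:words_def)
 have "f o sw i = b o pinv (sw i o w)" using w by (simp add:pinv_sw_comp comp_assoc)
 thus ?thesis using comp_Sym[OF sw_Sym[OF i] w(1)] unfolding words_def by blast
qed

lemma loc_tn: assumes p: "p:fa n" shows "loc_on (words n b) (act th (tn_op q) p)"
proof -
 have w: "loc_on (words n b) (%f. foldr (tn_op q) us f)" if "set us \<subseteq> {1..<n}" for us
  using that
 proof (induction us)
  case (Cons i us)
  have "loc_on (words n b) (tn_op q i)"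
  unfolding loc_on_def using words_sw[of _ n b i] Cons.prems by (auto simp:tn_op_def)
  from loc_on_comp[OF this Cons.IH] Cons.prems show ?case by simp
 qed (simp add:loc_on_def)
 show ?thesis
  unfolding loc_on_def act_def
  by (intro allI impI ballI sum.cong refl arg_cong[of _ _ "(*) _"] loc_onD[OF w])
  (use p in "auto simp:free_alg_def")
qed

lemma act_Tw_dl:
 assumes "w:Sym n" "rhom th" "!!a c. 1 <= a ==> a < c ==> c <= n ==> w c < w a ==> b c < b a"
 shows "act th (tn_op q) (Tw n w) (dl b) = dl (b o pinv w)"
proof -
 have "foldr (tn_op q) (red n w) (dl b) = dl (b o pinv w)"
  by (rule tn_wd_dl[OF assms(1) rword_red[OF assms(1)] assms(3)])
 thus ?thesis by (auto simp:act_def rhom_simps[OF assms(2)])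
qed

text \<open>A weakly decreasing word is sign-isotypic for the Young subgroup of its blocks and
  generates the module of its rearrangements.\<close>

locale base_wd =
 fixes n :: nat and b :: "nat => 'c::linorder"
 assumes mono: "!!i. i:{1..<n} ==> b (Suc i) <= b i"
begin

abbreviation (input) "bF == cuts n b"

lemma links_eq: "i:links 1 n bF <-> i:{1..<n} & b i = b (Suc i)"
 by (auto simp:links_def cuts_def)

lemma anti: "1 <= i ==> i <= j ==> j <= n ==> b j <= b i"
proof (induction j)
 case (Suc j)
 thus ?case using mono[of j] by (cases "i = Suc j") (auto intro:order_trans)
qed simp

lemma base_YS: "u:YS 1 n bF ==> b o u = b"
 using le_refl le_refl
proof (induction rule:YS_induct)
 case (sw i u)
 have "b i = b (Suc i)" using sw(1) by (simp only:links_eq)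
 hence "b o sw i = b" by (auto simp:fun_eq_iff transpose_def)
 thus ?case using sw(4) by (simp only:comp_assoc[symmetric])
qed simp

lemma base_pinv_YS: "u:YS 1 n bF ==> b o pinv u = b"
 by (rule base_YS) (rule pinv_YS)

lemma YS_base: assumes u: "u:Sym n" and "b o u = b" shows "u:YS 1 n bF"
proof -
 note assms
 hence bu: "b (u j) = b j" for j by (metis comp_apply)
 have "u j <= k <-> j <= k" if k: "k:bF" for j k
 proof (cases "j:{1..n}")
  case True
  have kk: "1 <= k" "k < n" "b (Suc k) < b k" using k mono[of k] by (auto simp:cuts_def)
  have side: "i <= k <-> b k <= b i" if "i:{1..n}" for i
  using anti[of i k] anti[of "Suc k" i] kk that by (cases "i <= k") auto
  show ?thesis using side[of j] side[of "u j"] True Sym_mem[OF u, of j] by (simp only:bu)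
 qed (use Sym_out[OF u] in simp)
 thus ?thesis using u by (auto simp:YS_def Sym_def)
qed

lemma minimal_wd:
 assumes "h:words n b"
 shows "EX d. d:Sym n & h = b o pinv d & (ALL a c. 1 <= a & a < c & c <= n & d c < d a --> b c < b a)"
proof -
 obtain w where w: "w:Sym n" "h = b o pinv w" using assms by (auto simp:words_def)
 obtain u where u: "u:YS 1 n bF" "!!i. i:links 1 n bF ==> - int (w (u (Suc i))) <= - int (w (u i))"
  by (rule YS_sort[of "%k. - int (w k)" 1 n bF]) auto
 have up: "u:Sym n" by (rule YS_perm[OF u(1)])
 let ?d = "w o u"
 have d: "?d:Sym n" by (rule comp_Sym[OF w(1) up])
 have k: "h = b o pinv ?d"
  unfolding pinv_comp_dis[OF w(1) up] comp_assoc[symmetric] base_pinv_YS[OF u(1)] by (rule w(2))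
 have inc: "?d i < ?d (Suc i)" if "i:links 1 n bF" for i
 proof -
  have "?d i ~= ?d (Suc i)" using inj_eq[OF Sym_inj[OF d], of i "Suc i"] by simp
  thus ?thesis using u(2)[OF that] by simp
 qed
 have "b c < b a" if ac: "1 <= a" "a < c" "c <= n" "?d c < ?d a" for a c
 proof (rule ccontr)
  assume "~ b c < b a"
  hence eq: "b c = b a" using anti[of a c] ac by auto
  have "?d a < ?d c"
  proof (rule strict_mono_links[where f = ?d and c = a and d = c and x = a and y = c])
  fix i assume i: "a <= i" "i < c"
  have "b i = b a" "b (Suc i) = b a" using anti[of a i] anti[of i c] anti[of a "Suc i"] anti[of "Suc i" c] i ac eq by auto
  thus "?d i < ?d (Suc i)" using inc[of i] i ac unfolding links_eq by simp
  qed (use ac in auto)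
  thus False using ac by simp
 qed
 thus ?thesis using d k by blast
qed

text \<open>The minimal permutation that rearranges \<open>b\<close> into \<open>f\<close>,
  characterized by having no inversion inside a block.\<close>

definition "mw f = (SOME d. d:Sym n & f = b o pinv d & (ALL a c. 1 <= a & a < c & c <= n & d c < d a --> b c < b a))"

lemma mw:
 assumes "f:words n b"
 shows "mw f:Sym n" "b o pinv (mw f) = f"
  "rhom th ==> act th (tn_op q) (Tw n (mw f)) (dl b) = dl f"
proof -
 have m: "mw f:Sym n & f = b o pinv (mw f) &
  (ALL a c. 1 <= a & a < c & c <= n & mw f c < mw f a --> b c < b a)"
  unfolding mw_def by (rule someI_ex[OF minimal_wd[OF assms]])
 thus "mw f:Sym n" "b o pinv (mw f) = f" by auto
 show "act th (tn_op q) (Tw n (mw f)) (dl b) = dl f" if "rhom th"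
  using act_Tw_dl[of "mw f" n th b q] m that by metis
qed

lemma wd_mem: "w:Sym n ==> b o pinv w:words n b"
 by (simp add:words_def)

definition "ms w = pinv (mw (b o pinv w)) o w"

lemma ms:
 assumes w: "w:Sym n"
 shows "ms w:YS 1 n bF" "mw (b o pinv w) o ms w = w"
proof -
 note m = mw[OF wd_mem[OF w]]
 show 2: "mw (b o pinv w) o ms w = w" using m(1) by (simp add:ms_def fun_eq_iff)
 have p: "ms w:Sym n" unfolding ms_def by (rule comp_Sym[OF pinv_Sym[OF m(1)] w])
 have "b o ms w = (b o pinv w) o w" unfolding ms_def comp_assoc[symmetric] m(2) ..
 also have "... = b" using w by (simp add:fun_eq_iff)
 finally show "ms w:YS 1 n bF" by (rule YS_base[OF p])
qed

lemma Tw_factor: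
 assumes "hk_rep n th t" "hk_rep.sgnv n t bF g" "w:Sym n"
 shows "act th t (Tw n w) g x = of_int (sign (ms w)) * act th t (Tw n (mw (b o pinv w))) g x"
 using hk_rep.Tw_sgnv[OF assms(1,2) ms(1)[OF assms(3)] mw(1)[OF wd_mem[OF assms(3)]], of x]
 by (simp only:ms(2)[OF assms(3)])

lemma sgnv_base: "rhom th ==> hk_rep.sgnv n (tn_op (th qv)) bF (dl b)"
 unfolding hk_rep.sgnv_def[OF hk_rep_tn] by (simp add:links_eq tn_op_dl del:One_nat_def)

text \<open>The module of words is induced from the sign character of the Young subgroup: the base
  word can be sent to any sign-isotypic \<open>l\<close>. In coordinates the word \<open>g\<close>
  goes to \<open>Tw n (mw g)\<close> applied to \<open>l\<close>.\<close>

lemma kac_factor: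
 assumes h: "hk_rep n th t" and l: "hk_rep.sgnv n t bF l"
 shows "hk_rep.kac n th t c l x =
  (SUM g:words n b. hk_rep.kac n th (tn_op (th qv)) c (dl b) g * act th t (Tw n (mw g)) l x)"
proof -
 interpret M: hk_rep n th t by (rule h)
 interpret T: hk_rep n th "tn_op (th qv) :: nat => ((nat => 'c) => _) => _" by (rule hk_rep_tn[OF M.rhom])
 note f = Tw_factor[OF T.hk_rep_axioms sgnv_base[OF M.rhom]]
 have 1: "T.kac c (dl b) g = (SUM w:Sym n. if b o pinv w = g then c w * of_int (sign (ms w)) else 0)" for g
  unfolding T.kac_def
  by (rule sum.cong[OF refl]) (simp add:f mw(3)[OF wd_mem M.rhom] dl_def)
 have "(SUM g:words n b. T.kac c (dl b) g * M.ac (Tw n (mw g)) l x) =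
  (SUM g:words n b. SUM w:Sym n. if b o pinv w = g then c w * of_int (sign (ms w)) * M.ac (Tw n (mw g)) l x else 0)"
  unfolding 1 sum_distrib_right by (intro sum.cong) auto
 also have "... = (SUM w:Sym n. SUM g:words n b. if b o pinv w = g then c w * of_int (sign (ms w)) * M.ac (Tw n (mw g)) l x else 0)"
  by (rule sum.swap)
 also have "... = (SUM w:Sym n. c w * of_int (sign (ms w)) * M.ac (Tw n (mw (b o pinv w))) l x)"
  by (rule sum.cong[OF refl]) (simp add:wd_mem)
 also have "... = M.kac c l x"
  unfolding M.kac_def by (rule sum.cong[OF refl]) (simp add:Tw_factor[OF h l])
 finally show ?thesis by simp
qed

end

lemma tr_commute:
 fixes A :: "('y => 'k::comm_ring_1) => 'x => 'k" and B :: "('x => 'k) => 'y => 'k"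
 assumes A: "!!g x. A g x = (SUM y:Y. g y * A (dl y) x)"
  and B: "!!f y. B f y = (SUM x:X. f x * B (dl x) y)"
 shows "tr X (%f. A (B f)) = tr Y (%g. B (A g))"
proof -
 have "tr X (%f. A (B f)) = (SUM x:X. SUM y:Y. B (dl x) y * A (dl y) x)"
  unfolding tr_def by (rule sum.cong[OF refl A])
 also have "... = (SUM y:Y. SUM x:X. A (dl y) x * B (dl x) y)"
  by (subst sum.swap) (simp only:mult.commute)
 also have "... = tr Y (%g. B (A g))"
  unfolding tr_def by (rule sum.cong[OF refl B[symmetric]])
 finally show ?thesis .
qed

context snorm
begin

definition "ch D p = (SUM x:stdD D. me p (x, x))"

lemma stdD_UN: "std n = (UN D:Shp n. stdD D)"
 using std_shape by (auto simp:stdD_def)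

lemma sum_std: "(SUM x:std n. f x) = (SUM D:Shp n. SUM x:stdD D. f x)"
 unfolding stdD_UN by (rule sum.UNION_disjoint) (auto simp:stdD_def)

context
 fixes b :: "nat => 'c::linorder"
 assumes b: "base_wd n b"
begin

interpretation B: base_wd n b by (rule b)
interpretation T: hk_rep n th "tn_op q :: nat => ((nat => 'c) => _) => _"
 unfolding q_def by (rule hk_rep_tn[OF rhom])

lemma T_sgnv: "T.sgnv B.bF (dl b)"
 using B.sgnv_base[OF rhom] by (simp add:q_def)

lemma T_factor: "V.sgnv B.bF g ==>
  V.kac c g x = (SUM f:words n b. T.kac c (dl b) f * V.ac (Tw n (B.mw f)) g x)"
 using B.kac_factor[OF hk_rep_sn, of g c x] by (simp add:q_def)

text \<open>As a function of \<open>z\<close>, the vector obtained by applying the matrix unit \<open>(x, z)\<close> to the base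
 word is sign-isotypic; it is therefore determined by its values on \<open>YY\<close>.\<close>

lemma unit_base:
 assumes x: "x:std n" and z: "z:stdD (shape n x)"
 shows "T.kac (cu (x, z)) (dl b) v =
  (SUM y:YY (shape n x) B.bF. phy B.bF y z * T.kac (cu (x, y)) (dl b) v)"
proof -
 have pairs: "(x, z):spr n <-> x:std n & z:std n & shape n x = shape n z" for x z
  by (simp add:spr_def)
 have pairs_sw: "(x, z o sw i):spr n <-> x:std n & z o sw i:std n & shape n x = shape n z" if "i:{1..<n}" for x z i
  unfolding pairs shape_sw[OF that] ..
 define G where "G z = (if (x, z):spr n then T.kac (cu (x, z)) (dl b) v else 0)" for z
 have "sn i G z = - G z" if i: "i:links 1 n B.bF" for i z
 proof (cases "(x, z):spr n")
  case True
  have ii: "i:{1..<n}" using i by (auto simp:links_def)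
  have z: "z:std n" using True by (simp add:spr_def)
  let ?a = "aa (dd i z)" and ?b = "bb (dd i z)"
  have sp: "?b ~= 0 ==> (x, z o sw i):spr n"
  using bb_std[OF z ii] pairs_sw[OF ii, of x z] pairs[of x z] True by blast
  have "T.kac (conv n th (cu (x, z)) (%w. th (cof n (gen i) w))) =
  T.kac (%w. ?a * cu (x, z) w + ?b * cu (x, z o sw i) w)"
  proof (rule kac_transfer[OF T.hk_rep_axioms])
  fix f z' assume z': "z':std n"
  have g: "V.kac (%w. th (cof n (gen i) w)) f = sn i f" using ii by (simp add:V.act_kac[symmetric] V.act_gen)
  show "V.kac (conv n th (cu (x, z)) (%w. th (cof n (gen i) w))) f z' = V.kac (%w. ?a * cu (x, z) w + ?b * cu (x, z o sw i) w) f z'"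
  unfolding V.kac_conv g V.kac_add V.kac_scl unit_cu[OF True z'] sn_eval[OF z ii, of f]
  using unit_cu[OF sp z', of f] by (cases "?b = 0") auto
  qed
  hence "T.kac (cu (x, z)) (T.kac (%w. th (cof n (gen i) w)) (dl b)) v =
  ?a * T.kac (cu (x, z)) (dl b) v + ?b * T.kac (cu (x, z o sw i)) (dl b) v"
  by (simp only:T.kac_conv[symmetric] T.kac_add T.kac_scl)
  moreover have "T.kac (%w. th (cof n (gen i) w)) (dl b) = (%x. - dl b x)"
  using ii T_sgnv i by (simp add:T.act_kac[symmetric] T.act_gen T.sgnv_def)
  ultimately have "?a * T.kac (cu (x, z)) (dl b) v + ?b * T.kac (cu (x, z o sw i)) (dl b) v = - T.kac (cu (x, z)) (dl b) v"
  using lin_op_minus[OF T.lin_kac, of "cu (x, z)" "dl b"] by simp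
  thus ?thesis
  unfolding sn_eval[OF z ii, of G] using sp True by (cases "?b = 0") (auto simp:G_def)
 next
  case False
  hence 0: "G z = 0" by (simp add:G_def)
  show ?thesis
  proof (cases "z:std n & i:{1..<n}")
  case True
  hence "(x, z o sw i) ~: spr n" using False pairs_sw[of i x z] pairs[of x z] by blast
  thus ?thesis using 0 by (simp add:sn_def G_def)
  qed (use 0 in "auto simp:sn_def")
 qed
 hence "V.sgnv B.bF G" by (auto simp:V.sgnv_def)
 from sgnv_expand[OF this z] have "G z = (SUM y:YY (shape n x) B.bF. G y * phy B.bF y z)" .
 moreover have eq: "G y = T.kac (cu (x, y)) (dl b) v" if "y:stdD (shape n x)" for y
  using x that by (simp add:spr_def stdD_def G_def)
 moreover have "(SUM y:YY (shape n x) B.bF. G y * phy B.bF y z) =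
  (SUM y:YY (shape n x) B.bF. phy B.bF y z * T.kac (cu (x, y)) (dl b) v)"
  by (rule sum.cong[OF refl]) (simp add:eq YY_def)
 ultimately show ?thesis using z by metis
qed

text \<open>Index set of the decomposition: \<open>x\<close> labels a basis vector of an irreducible
  module, \<open>y\<close> a copy of this module in the words. \<open>GG\<close> maps such
  coordinates to words, \<open>FF\<close> reads them off.\<close>

definition "ZZ = (SIGMA x:std n. YY (shape n x) B.bF)"

definition "GG g f = (SUM xy:ZZ. g xy * T.kac (cu xy) (dl b) f)"

definition "FF f xy = (SUM h:words n b. f h * V.ac (Tw n (B.mw h)) (phy B.bF (snd xy)) (fst xy))"

lemma fin_ZZ: "finite ZZ"
 by (simp add:ZZ_def)

lemma ZZ_pairs: "xy:ZZ ==> xy:spr n"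
 by (auto simp:ZZ_def YY_def stdD_def spr_def)

lemma FF_kac: "xy:ZZ ==> FF (T.kac c (dl b)) xy = V.kac c (phy B.bF (snd xy)) (fst xy)"
 unfolding FF_def by (rule T_factor[symmetric]) (auto simp:ZZ_def intro:sgnv_phy)

lemma base_sum: "dl b v = (SUM z:std n. SUM y:YY (shape n z) B.bF. phy B.bF y z * T.kac (cu (z, y)) (dl b) v)"
 using units_one[OF T.hk_rep_axioms, of "dl b" v] unit_base by (simp add:stdD_def)

text \<open>Expand the base word by \<open>base_sum\<close> and multiply by \<open>c\<close> inside
  the matrix units; the sum over \<open>z\<close> reassembles \<open>c\<close> applied to
  \<open>phy\<close>.\<close>

lemma kac_base_sum:
 "T.kac c (dl b) v = (SUM xy:ZZ. V.kac c (phy B.bF (snd xy)) (fst xy) * T.kac (cu xy) (dl b) v)"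
proof -
 have ZS: "(SUM xy:ZZ. f xy) = (SUM x:std n. SUM y:YY (shape n x) B.bF. f (x, y))" for f :: "_ => 'k"
  unfolding ZZ_def by (subst sum.Sigma) (auto)
 have cz: "T.kac (conv n th c (cu (z, y))) = T.kac (%w. SUM x:stdD (shape n z). V.kac c (dl z) x * cu (x, y) w)"
  if zy: "z:std n" "y:YY (shape n z) B.bF" for z y
 proof (rule kac_transfer[OF T.hk_rep_axioms])
  fix h z' assume z': "z':std n"
  have sp: "(z, y):spr n" using zy by (simp add:spr_def YY_def stdD_def)
  have spx: "(x, y):spr n" if "x:stdD (shape n z)" for x
  using zy that by (simp add:spr_def YY_def stdD_def)
  have "V.kac c (V.kac (cu (z, y)) h) z' = V.kac c (%x. h y * dl z x) z'"
  by (rule loc_onD[OF loc_kac(1)]) (simp_all add:unit_cu[OF sp] dl_def z')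
  hence L: "V.kac (conv n th c (cu (z, y))) h z' = h y * V.kac c (dl z) z'"
  by (simp add:V.kac_conv lin_op_scale[OF V.lin_kac])
  have "(SUM x:stdD (shape n z). V.kac c (dl z) x * V.kac (cu (x, y)) h z') = (SUM x:stdD (shape n z). if z' = x then V.kac c (dl z) z' * h y else 0)"
  by (rule sum.cong) (use spx z' in "auto simp:unit_cu")
  also have "... = V.kac c (dl z) z' * h y"
  proof (cases "z':stdD (shape n z)")
  case False
  hence "z':stdD (shape n z')" "z ~: stdD (shape n z')" using z' by (auto simp:stdD_def)
  hence "V.kac c (dl z) z' = V.kac c (%x. 0 * 0) z'"
  by (intro loc_onD[OF loc_kac(2)]) (auto simp:dl_def)
  thus ?thesis using lin_op_zero[OF V.lin_kac, of c] by simp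
  qed simp
  finally show "V.kac (conv n th c (cu (z, y))) h z' = V.kac (%w. SUM x:stdD (shape n z). V.kac c (dl z) x * cu (x, y) w) h z'"
  unfolding L V.kac_sum V.kac_scl by simp
 qed
 have "T.kac c (dl b) v = T.kac c (%v. SUM z:std n. SUM y:YY (shape n z) B.bF. phy B.bF y z * T.kac (cu (z, y)) (dl b) v) v"
  by (rule arg_cong[of _ _ "%f. T.kac c f v"]) (rule ext, rule base_sum)
 also have "... = (SUM z:std n. SUM y:YY (shape n z) B.bF. phy B.bF y z * T.kac (conv n th c (cu (z, y))) (dl b) v)"
  by (simp add:lin_op_sum[OF T.lin_kac] lin_op_scale[OF T.lin_kac] T.kac_conv)
 also have "... = (SUM z:std n. SUM y:YY (shape n z) B.bF. SUM x:stdD (shape n z). phy B.bF y z * V.kac c (dl z) x * T.kac (cu (x, y)) (dl b) v)"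
  by (intro sum.cong refl) (simp add:cz T.kac_sum T.kac_scl sum_distrib_left mult.assoc)
 also have "... = (SUM D:Shp n. SUM z:stdD D. SUM y:YY D B.bF. SUM x:stdD D. phy B.bF y z * V.kac c (dl z) x * T.kac (cu (x, y)) (dl b) v)"
  unfolding sum_std by (intro sum.cong refl) (auto simp:stdD_def)
 also have "... = (SUM D:Shp n. SUM x:stdD D. SUM y:YY D B.bF. SUM z:stdD D. phy B.bF y z * V.kac c (dl z) x * T.kac (cu (x, y)) (dl b) v)"
 proof (rule sum.cong[OF refl])
  fix D
  let ?g = "%z y x. phy B.bF y z * V.kac c (dl z) x * T.kac (cu (x, y)) (dl b) v"
  have "(SUM z:stdD D. SUM y:YY D B.bF. SUM x:stdD D. ?g z y x) = (SUM y:YY D B.bF. SUM z:stdD D. SUM x:stdD D. ?g z y x)" by (rule sum.swap)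
  also have "... = (SUM y:YY D B.bF. SUM x:stdD D. SUM z:stdD D. ?g z y x)" by (intro sum.cong refl sum.swap)
  also have "... = (SUM x:stdD D. SUM y:YY D B.bF. SUM z:stdD D. ?g z y x)" by (rule sum.swap)
  finally show "(SUM z:stdD D. SUM y:YY D B.bF. SUM x:stdD D. ?g z y x) = (SUM x:stdD D. SUM y:YY D B.bF. SUM z:stdD D. ?g z y x)" .
 qed
 also have "... = (SUM D:Shp n. SUM x:stdD D. SUM y:YY D B.bF. V.kac c (phy B.bF y) x * T.kac (cu (x, y)) (dl b) v)"
 proof (intro sum.cong refl)
  fix D x y assume x: "x:stdD D"
  have "V.kac c (phy B.bF y) x = (SUM z:stdD D. phy B.bF y z * V.kac c (dl z) x)"
  by (rule op_expand[OF V.lin_kac loc_kac(2) fin_stdD x])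
  thus "(SUM z:stdD D. phy B.bF y z * V.kac c (dl z) x * T.kac (cu (x, y)) (dl b) v) =
  V.kac c (phy B.bF y) x * T.kac (cu (x, y)) (dl b) v" by (simp add:sum_distrib_right)
 qed
 also have "... = (SUM x:std n. SUM y:YY (shape n x) B.bF. V.kac c (phy B.bF y) x * T.kac (cu (x, y)) (dl b) v)"
  unfolding sum_std by (intro sum.cong refl) (auto simp:stdD_def)
 finally show ?thesis by (simp add:ZS)
qed

lemma FF_dl: assumes m: "u:words n b" shows "FF (dl u) xy = V.ac (Tw n (B.mw u)) (phy B.bF (snd xy)) (fst xy)"
proof -
 have "FF (dl u) xy = (SUM f:words n b. if f = u then V.ac (Tw n (B.mw u)) (phy B.bF (snd xy)) (fst xy) else 0)"
  unfolding FF_def by (rule sum.cong) (auto simp:dl_def)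
 thus ?thesis using m by simp
qed

lemma GG_FF:
 assumes k: "h:words n b" shows "GG (FF f) h = f h"
proof -
 have d: "GG (FF (dl u)) h = dl u h" if m: "u:words n b" for u
 proof -
  have e: "T.kac (dl (B.mw u)) (dl b) = dl u"
  by (rule ext) (simp only:T.kac_dl[OF B.mw(1)[OF m]] B.mw(3)[OF m rhom])
  show ?thesis
  using kac_base_sum[of "dl (B.mw u)" h] FF_kac[of _ "dl (B.mw u)"]
  unfolding e GG_def by simp
 qed
 have "GG (FF f) h = (SUM xy:ZZ. (SUM u:words n b. f u * FF (dl u) xy) * T.kac (cu xy) (dl b) h)"
  unfolding GG_def by (intro sum.cong refl) (simp add:FF_dl FF_def[of f])
 also have "... = (SUM u:words n b. f u * GG (FF (dl u)) h)"
  unfolding GG_def sum_distrib_left sum_distrib_right mult.assoc by (rule sum.swap)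
 also have "... = (SUM u:words n b. f u * dl u h)" by (rule sum.cong) (auto simp:d)
 also have "... = f h" by (rule dl_sum) (use k in auto)
 finally show ?thesis .
qed

lemma GG_dl: "xy:ZZ ==> GG (dl xy) = T.kac (cu xy) (dl b)"
proof
 fix f assume xy: "xy:ZZ"
 have "GG (dl xy) f = (SUM xy':ZZ. if xy' = xy then T.kac (cu xy) (dl b) f else 0)"
  unfolding GG_def by (rule sum.cong) (auto simp:dl_def)
 thus "GG (dl xy) f = T.kac (cu xy) (dl b) f" using xy fin_ZZ by simp
qed

lemma FF_act_GG:
 assumes p: "p:fa n" and xy: "xy:ZZ"
 shows "FF (T.ac p (GG (dl xy))) xy = me p (fst xy, fst xy)"
proof -
 have fs: "fst xy:std n" "snd xy:YY (shape n (fst xy)) B.bF" using xy by (auto simp:ZZ_def)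
 have sp: "(fst xy, snd xy):spr n" using ZZ_pairs[OF xy] by simp
 have "T.ac p (GG (dl xy)) = T.kac (conv n th (%w. th (cof n p w)) (cu xy)) (dl b)"
  unfolding GG_dl[OF xy] T.act_kac[OF p] by (rule ext) (rule T.kac_conv[symmetric])
 hence "FF (T.ac p (GG (dl xy))) xy = V.ac p (V.kac (cu xy) (phy B.bF (snd xy))) (fst xy)"
  by (simp only:FF_kac[OF xy] V.kac_conv V.act_kac[OF p])
 also have "... = V.ac p (dl (fst xy)) (fst xy)"
 proof (rule loc_onD[OF loc_act(1) _ fs(1)])
  fix z assume "z:std n"
  from unit_cu[OF sp this, of "phy B.bF (snd xy)"]
  show "V.kac (cu xy) (phy B.bF (snd xy)) z = dl (fst xy) z"
  by (simp add:dl_def phy_YY[OF fs(2) fs(2)])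
 qed
 finally show ?thesis by (simp add:me_def)
qed

text \<open>\<open>GG\<close> undoes \<open>FF\<close> on words (\<open>GG_FF\<close>), so by
  cyclicity the trace can be taken on \<open>ZZ\<close>. There the diagonal entry at
  \<open>(x, y)\<close> is that of the irreducible module at \<open>x\<close>, whatever
  \<open>y\<close> is.\<close>

lemma trace_tn:
 assumes p: "p:fa n"
 shows "tr (words n b) (act th (tn_op q) p) = (SUM D:Shp n. of_nat (card (YY D B.bF)) * ch D p)"
proof -
 have "tr (words n b) (T.ac p) = tr (words n b) (%f. GG (FF (T.ac p f)))"
  by (rule tr_cong) (rule GG_FF[symmetric])
 also have "... = tr ZZ (%g. FF (T.ac p (GG g)))"
 proof (rule tr_commute)
  show "GG g h = (SUM xy:ZZ. g xy * GG (dl xy) h)" for g h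
  unfolding GG_def[of g] by (rule sum.cong) (simp_all add:GG_dl)
  show "FF (T.ac p f) xy = (SUM m:words n b. f m * FF (T.ac p (dl m)) xy)" for f xy
  proof -
  have "FF (T.ac p f) xy = (SUM h:words n b. SUM m:words n b. f m * T.ac p (dl m) h * V.ac (Tw n (B.mw h)) (phy B.bF (snd xy)) (fst xy))"
  unfolding FF_def sum_distrib_right[symmetric]
  by (intro sum.cong refl arg_cong2[of _ _ _ _ "(*)"] op_expand[OF T.lin_act loc_tn[OF p]]) simp_all
  also have "... = (SUM m:words n b. f m * FF (T.ac p (dl m)) xy)"
  unfolding FF_def sum_distrib_left mult.assoc by (rule sum.swap)
  finally show ?thesis .
  qed
 qed
 also have "... = (SUM xy:ZZ. me p (fst xy, fst xy))"
  unfolding tr_def by (rule sum.cong[OF refl FF_act_GG[OF p]])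
 also have "... = (SUM x:std n. SUM y:YY (shape n x) B.bF. me p (x, x))"
  unfolding ZZ_def by (subst sum.Sigma) (auto simp:split_def)
 also have "... = (SUM D:Shp n. of_nat (card (YY D B.bF)) * ch D p)"
  unfolding sum_std ch_def sum_distrib_left by (intro sum.cong refl) (auto simp:stdD_def)
 finally show ?thesis .
qed

end

end

section \<open>Partitions and semistandard tableaux\<close>

text \<open>The diagram with column lengths \<open>u\<close>, the transpose of
  \<open>YD u\<close>.\<close>

definition DT :: "nat list => cell set" where
 "DT u = {(i, j). j < length u & i < u ! j}"

lemma YD_iff: "(i, j):YD m <-> i < length m & j < m ! i"
 by (simp add:young_diagram_def)

lemma DT_swp: "DT u = swp ` YD u"
 by (auto simp:DT_def young_diagram_def)

lemma fin_YD [simp]: "finite (YD m)"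
 by (simp add:young_diagram_def)

lemma card_YD: "card (YD m) = sum_list m"
 by (simp add:young_diagram_def sum_list_sum_nth lessThan_atLeast0)

lemma swp_image_mem: "x:swp ` D <-> swp x:D"
 by (metis imageE imageI swap_swap)

lemma swp_dia: "dia (swp ` D) <-> dia D"
proof -
 have "dia (swp ` D)" if "dia D" for D
 proof (rule diagramI)
  fix A B assume "B:swp ` D" "cell_le A B"
  hence "swp A:D" using diagramD[OF that, of "swp B" "swp A"] by (auto simp:cell_le_def)
  thus "A:swp ` D" by (metis imageI swap_swap)
 qed (use that dia_fin in auto)
 from this[of D] this[of "swp ` D"] show ?thesis by (auto simp:image_image)
qed

lemma Shp_swp: "swp ` D:Shp n <-> D:Shp n"
 by (simp add:Shp_def swp_dia card_image)

lemma part_shape: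
 assumes "m:partitions n" shows "YD m:Shp n"
proof -
 have "sorted_wrt (>=) m" using assms by (simp add:partitions_def)
 hence mono: "m ! j <= m ! i" if "i <= j" "j < length m" for i j
  using that by (cases "i = j") (auto simp:sorted_wrt_iff_nth_less)
 have "dia (YD m)"
 proof (rule diagramI)
  fix A B assume "B:YD m" "cell_le A B"
  thus "A:YD m"
  using mono[of "fst A" "fst B"] by (cases A; cases B) (auto simp:YD_iff cell_le_def)
 qed simp
 thus ?thesis using assms by (simp add:Shp_def card_YD partitions_def)
qed

lemma YD_inj:
 assumes "m:partitions n" "u:partitions n" "YD m = YD u" shows "m = u"
proof (rule nth_equalityI)
 have pos: "i < length m ==> 0 < m ! i" "i < length u ==> 0 < u ! i" for i using assms by (auto simp:partitions_def)
 have eq: "i < length m & j < m ! i <-> i < length u & j < u ! i" for i j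
  using assms(3) by (simp flip:YD_iff)
 have "i < length m <-> i < length u" for i using eq[of i 0] pos[of i] by blast
 thus l: "length m = length u" by (metis linorder_neqE_nat less_irrefl)
 show "m ! i = u ! i" if "i < length m" for i
  using eq[of i "m ! i"] eq[of i "u ! i"] that l by (metis linorder_neqE_nat less_irrefl)
qed

lemma shape_part:
 assumes "D:Shp n" shows "EX m:partitions n. YD m = D"
proof -
 have D: "dia D" "card D = n" using assms by (simp_all add:Shp_def)
 define r where "r i = card {j. (i, j):D}" for i
 have r: "(i, j):D <-> j < r i" for i j unfolding r_def by (rule dia_row[OF D(1)])
 define l where "l = card {i. (i, 0):D}"
 have l: "(i, 0):D <-> i < l" for i
  using dia_row[of "swp ` D" 0 i] D(1) unfolding l_def swp_dia swp_image_mem swap_simp by blast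
 define m where "m = map r [0..<l]"
 have mono: "r j <= r i" if "i <= j" for i j
 proof (rule ccontr)
  assume "~ r j <= r i"
  hence "(i, r i):D" using diagramD[OF D(1), of "(j, r i)" "(i, r i)"] r that by (simp add:cell_le_def)
  thus False using r by simp
 qed
 have rl: "0 < r i <-> i < l" for i using r[of i 0] l[of i] by blast
 have "(i, j):YD m <-> (i, j):D" for i j
 proof -
  have "(i, j):YD m <-> i < l & j < r i" by (auto simp:young_diagram_def m_def)
  also have "... <-> j < r i" using rl[of i] by linarith
  finally show ?thesis by (simp only:r)
 qed
 hence Y: "YD m = D" by (intro Set.set_eqI) (simp only:split_paired_all)
 have "m:partitions n"
  unfolding partitions_def mem_Collect_eq
 proof (intro conjI)
  show "sorted_wrt (>=) m" by (simp add:m_def sorted_wrt_iff_nth_less mono)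
  show "ALL x:set m. 0 < x" using rl by (auto simp:m_def)
  show "sum_list m = n" using card_YD[of m] Y D(2) by simp
 qed
 thus ?thesis using Y by blast
qed

lemma bij_YD: "bij_betw YD (partitions n) (Shp n)"
 unfolding bij_betw_def inj_on_def using YD_inj part_shape shape_part by blast

lemma filter_srt_len:
 "sorted_wrt (>=) m ==> j < length (filter (%y. i < y) m) <-> j < length m & (i::nat) < m ! j"
proof (induction m arbitrary: j)
 case (Cons x m)
 show ?case
 proof (cases "i < x")
  case True
  thus ?thesis using Cons by (cases j) auto
 next
  case False
  hence "ALL y:set (x # m). ~ i < y" using Cons.prems by auto
  thus ?thesis using nth_mem[of j "x # m"] by (auto)
 qed
qed simp

lemma YD_conj:
 assumes "m:partitions n" shows "YD (conjugate m) = swp ` YD m"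
proof -
 have s: "sorted_wrt (>=) m" using assms by (simp add:partitions_def)
 have "(i, j):YD (conjugate m) <-> (j, i):YD m" for i j
 proof (cases m)
  case (Cons x xs)
  have "conjugate m = map (%j. length (filter (%y. j < y) m)) [0..<x]" using Cons by simp
  moreover have "i < x" if "j < length m" "i < m ! j"
  using that s Cons by (cases j) (auto, metis (no_types, lifting) nth_mem order_less_le_trans)
  ultimately show ?thesis
  unfolding YD_iff using filter_srt_len[OF s, of j i] by auto
 qed (simp add:young_diagram_def)
 thus ?thesis by (auto simp:image_iff) (metis swap_simp)
qed

lemma DT_conj: "m:partitions n ==> DT (conjugate m) = YD m"
 by (simp add:DT_swp YD_conj image_image)

lemma sum_list_conj: "m:partitions n ==> sum_list (conjugate m) = n"
 using card_YD[of "conjugate m"] card_YD[of m]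
 by (simp add:YD_conj card_image partitions_def)

text \<open>Fillings of \<open>D\<close> whose transposes are semistandard of content \<open>u\<close>.\<close>

definition SSD :: "cell set => nat list => (cell => nat) set" where
 "SSD D u = {t:D \<rightarrow>\<^sub>E {..<length u}.
  (ALL i i' j. (i, j):D & (i', j):D & i < i' --> t (i, j) <= t (i', j)) &
  (ALL i j j'. (i, j):D & (i, j'):D & j < j' --> t (i, j) < t (i, j')) &
  (ALL k<length u. card {x:D. t x = k} = u ! k)}"

lemma kostka_SSD:
 assumes "m:partitions n" shows "kostka (conjugate m) u = card (SSD (YD m) u)"
proof -
 let ?D = "YD m" and ?E = "YD (conjugate m)"
 have E: "?E = swp ` ?D" by (rule YD_conj[OF assms])
 have mem: "swp x:?E <-> x:?D" "swp x:?D <-> x:?E" for x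
  unfolding E swp_image_mem by simp_all
 have mem': "(j, i):?E <-> (i, j):?D" for i j using mem(1)[of "(i, j)"] by simp
 let ?f = "%t. \<lambda>x\<in>?D. t (swp x)" and ?g = "%t. \<lambda>x\<in>?E. t (swp x)"
 have c: "card {x:?D. t (swp x) = k} = card {x:?E. t x = k}" for t :: "cell => nat" and k
  by (rule bij_betw_same_card[of swp], rule bij_betw_byWitness[of _ swp]) (auto simp:mem')
 have f: "?f t:SSD ?D u" if "t:semistandard_tableaux (conjugate m) u" for t
 proof -
  have "{x:?D. ?f t x = k} = {x:?D. t (swp x) = k}" for k by auto
  thus ?thesis using that c[of t] by (auto simp:SSD_def semistandard_tableaux_def mem mem' PiE_iff)
 qed
 have g: "?g t:semistandard_tableaux (conjugate m) u" if "t:SSD ?D u" for t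
 proof -
  have "{x:?E. ?g t x = k} = {x:?E. t (swp x) = k}" for k by auto
  hence "card {x:?E. ?g t x = k} = card {x:?D. t x = k}" for k
  using c[of "%x. t (swp x)" k] by simp
  thus ?thesis using that by (auto simp:SSD_def semistandard_tableaux_def mem mem' PiE_iff)
 qed
 have "bij_betw ?f (semistandard_tableaux (conjugate m) u) (SSD ?D u)"
 proof (rule bij_betw_byWitness[of _ ?g])
  show "ALL t:semistandard_tableaux (conjugate m) u. ?g (?f t) = t"
  proof
  fix t assume "t:semistandard_tableaux (conjugate m) u"
  hence "t:extensional ?E" by (auto simp:semistandard_tableaux_def PiE_iff)
  thus "?g (?f t) = t" by (auto simp:mem extensional_def)
  qed
  show "ALL t:SSD ?D u. ?f (?g t) = t"
  proof
  fix t assume "t:SSD ?D u"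
  hence "t:extensional ?D" by (auto simp:SSD_def PiE_iff)
  thus "?f (?g t) = t" by (auto simp:mem extensional_def)
  qed
 qed (use f g in blast)+
 thus ?thesis unfolding kostka_def by (rule bij_betw_same_card)
qed

lemma sum_ge_card: "finite S ==> (SUM i<card S. i) <= \<Sum>(S::nat set)"
proof (induction "card S" arbitrary: S)
 case (Suc m)
 hence ne: "S ~= {}" by auto
 let ?M = "Max S"
 have M: "?M:S" using Suc ne by simp
 have "S \<subseteq> {..?M}" using Suc by auto
 hence "card S <= Suc ?M" using card_mono[of "{..?M}" S] by simp
 moreover have "(SUM i<m. i) <= \<Sum>(S - {?M})" using Suc M by (metis card_Diff_singleton diff_Suc_1 finite_Diff)
 moreover have "\<Sum>S = ?M + \<Sum>(S - {?M})" using Suc M by (simp add:sum.remove)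
 moreover have "(SUM i<card S. i) = (SUM i<m. i) + m" unfolding Suc(2)[symmetric] by simp
 ultimately show ?case using Suc(2) by linarith
qed simp

text \<open>Numerical consequences of dominance. Entries increase strictly along rows, so they are
  at least the column indices; equal entries lie in different rows, so their row indices sum to at
  least those of a full column. Equality in the first bound makes each entry its column
  index.\<close>

lemma SSD_sums:
 assumes D: "dia D" and t: "t:SSD D u"
 shows "(SUM A:D. snd A) <= (SUM A:DT u. snd A)" "(SUM A:DT u. fst A) <= (SUM A:D. fst A)"
  "(SUM A:D. snd A) = (SUM A:DT u. snd A) ==> D = DT u & t = (\<lambda>A\<in>D. snd A)"
proof -
 have fin: "finite D" using D by (rule dia_fin)
 have tk: "t A < length u" if "A:D" for A using t that by (auto simp:SSD_def)
 have cnt: "card {A:D. t A = k} = u ! k" if "k < length u" for k using t that by (simp add:SSD_def)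
 have row: "t (i, j) < t (i, j')" if "(i, j):D" "(i, j'):D" "j < j'" for i j j' using t that unfolding SSD_def by blast
 have Dpart: "D = (\<Union>k<length u. {A:D. t A = k})" using tk by auto
 have split: "(SUM A:D. f A) = (SUM k<length u. \<Sum>A | A:D & t A = k. f A)" for f :: "cell => nat"
  by (subst (1) Dpart, rule sum.UNION_disjoint) (use fin in auto)
 have DTs: "DT u = swp ` (SIGMA j:{..<length u}. {..<u ! j})" by (auto simp:DT_def)
 have DTsum: "(SUM A:DT u. f A) = (SUM k<length u. SUM i<u ! k. f (i, k))" for f :: "cell => nat"
  unfolding DTs by (subst sum.reindex, simp) (simp add:sum.Sigma split_def prod.swap_def)
 have tsum: "(SUM A:D. t A) = (SUM A:DT u. snd A)"
  unfolding split[of t] DTsum[of snd]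
 proof (rule sum.cong[OF refl])
  fix k assume "k:{..<length u}"
  thus "(\<Sum>A | A:D & t A = k. t A) = (SUM i<u ! k. snd (i, k))" using cnt[of k] by simp
 qed
 have ge: "snd A <= t A" if "A:D" for A
 proof -
  have "j <= t (i, j)" if "(i, j):D" for i j
  using that
  proof (induction j)
  case (Suc j)
  hence "(i, j):D" using diagramD[OF D Suc.prems, of "(i, j)"] by (simp add:cell_le_def)
  thus ?case using Suc row[of i j "Suc j"] by simp
  qed simp
  thus ?thesis using that by (cases A) auto
 qed
 thus "(SUM A:D. snd A) <= (SUM A:DT u. snd A)" unfolding tsum[symmetric] by (intro sum_mono)
 show "(SUM A:DT u. fst A) <= (SUM A:D. fst A)"
  unfolding split[of fst] DTsum
 proof (rule sum_mono)
  fix k assume k: "k:{..<length u}"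
  let ?S = "{A:D. t A = k}"
  have inj: "inj_on fst ?S"
  proof (rule inj_onI)
  fix A B assume "A:?S" "B:?S" "fst A = fst B"
  thus "A = B" using row[of "fst A" "snd A" "snd B"] row[of "fst A" "snd B" "snd A"]
  by (cases A; cases B) (auto, metis linorder_neqE_nat less_irrefl)
  qed
  have "(SUM i<card (fst ` ?S). i) <= \<Sum>(fst ` ?S)" by (rule sum_ge_card) (use fin in simp)
  thus "(SUM i<u ! k. fst (i, k)) <= (\<Sum>A | A:D & t A = k. fst A)"
  using k cnt[of k] by (simp add:card_image[OF inj] sum.reindex[OF inj])
 qed
 assume eq: "(SUM A:D. snd A) = (SUM A:DT u. snd A)"
 have ts: "t A = snd A" if "A:D" for A
 proof (rule ccontr)
  assume "t A ~= snd A"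
  hence "snd A < t A" using ge[OF that] by simp
  hence "(SUM A:D. snd A) < (SUM A:D. t A)" by (intro sum_strict_mono_ex1[OF fin]) (use ge that in auto)
  thus False using eq tsum by simp
 qed
 have "(i, j):D <-> (i, j):DT u" for i j
 proof (cases "j < length u")
  case True
  have "{A:D. t A = j} = (%i. (i, j)) ` {i. (i, j):D}" using ts by (auto)
  hence "card {i. (i, j):D} = u ! j" using cnt[OF True] by (simp add:card_image inj_on_def)
  moreover have "{j'. (j, j'):swp ` D} = {i. (i, j):D}" by (auto)
  moreover have "(i, j):D <-> (j, i):swp ` D" by (auto)
  ultimately show ?thesis using dia_row[of "swp ` D" j i] D True by (simp add:swp_dia DT_def)
 next
  case False
  thus ?thesis using tk[of "(i, j)"] ts[of "(i, j)"] by (auto simp:DT_def)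
 qed
 hence "D = DT u" by auto
 moreover have "t = (\<lambda>A\<in>D. snd A)" using t ts by (auto simp:SSD_def PiE_iff extensional_def)
 ultimately show "D = DT u & t = (\<lambda>A\<in>D. snd A)" by blast
qed

lemma SSD_DT:
 assumes "DT u:Shp n" shows "SSD (DT u) u = {\<lambda>A\<in>DT u. snd A}"
proof -
 have "(\<lambda>A\<in>DT u. snd A):SSD (DT u) u"
 proof -
  have "{x:DT u. (\<lambda>A\<in>DT u. snd A) x = k} = (%i. (i, k)) ` {..<u ! k}" if "k < length u" for k
  using that by (auto simp:DT_def)
  thus ?thesis by (auto simp:SSD_def card_image inj_on_def) (auto simp:DT_def)
 qed
 moreover have "t = (\<lambda>A\<in>DT u. snd A)" if "t:SSD (DT u) u" for t
  using SSD_sums(3)[OF _ that] assms by (simp add:Shp_def)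
 ultimately show ?thesis by blast
qed

section \<open>Blocks of a content and standardization of tableaux\<close>

definition psum :: "nat list => nat => nat" where
 "psum u k = sum_list (take k u)"

text \<open>For \<open>i\<close> from 1 to \<open>sum_list u\<close> the index of the block that
  contains \<open>i\<close>, obtained as the number of blocks that end before it.\<close>

definition "blk u i = card {k. k < length u & psum u (Suc k) < i}"

lemma psum_Suc: "k < length u ==> psum u (Suc k) = psum u k + u ! k"
 by (simp add:psum_def take_Suc_conv_app_nth)

lemma psum_mono: "k <= k' ==> psum u k <= psum u k'"
 using take_add[of k "k' - k" u] by (simp add:psum_def)

lemma psum_sum: "k <= length u ==> psum u k = (SUM l<k. u ! l)"
 by (induction k) (simp_all add:psum_Suc, simp add:psum_def)

lemma blk_iff:
 assumes "k < length u" "psum u k < i" "i <= psum u (Suc k)" shows "blk u i = k"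
proof -
 have "l < length u & psum u (Suc l) < i <-> l < k" for l
  using assms psum_mono[of "Suc k" "Suc l" u] psum_mono[of "Suc l" k u] by (cases "l < k") auto
 thus ?thesis by (simp add:blk_def)
qed

lemma blk_props:
 assumes i: "i:{1..sum_list u}"
 shows "blk u i < length u" "psum u (blk u i) < i" "i <= psum u (Suc (blk u i))"
proof -
 let ?S = "{k. k < length u & psum u (Suc k) < i}"
 have S: "?S = {..<blk u i}"
  unfolding blk_def by (rule down_closed_lessThan) (auto dest:le_less_trans[OF psum_mono, rotated])
 have "psum u (length u) = sum_list u" by (simp add:psum_def)
 show 1: "blk u i < length u"
 proof (rule ccontr)
  assume n: "~ ?thesis"
  have "length u ~= 0" using i by auto
  hence "length u - 1 < blk u i" using n by linarith
  hence "length u - 1:?S" unfolding S by simp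
  thus False using i \<open>psum u (length u) = sum_list u\<close> \<open>length u ~= 0\<close> by auto
 qed
 show "i <= psum u (Suc (blk u i))"
 proof (rule ccontr)
  assume "~ ?thesis"
  hence "blk u i:?S" using 1 by simp
  thus False unfolding S by simp
 qed
 show "psum u (blk u i) < i"
 proof (cases "blk u i")
  case 0 thus ?thesis using i by (simp add:psum_def)
 next
  case (Suc k)
  hence "k:?S" unfolding S by simp
  thus ?thesis using Suc by simp
 qed
qed

lemma blk_mono: "i <= j ==> blk u i <= blk u j"
 unfolding blk_def by (rule card_mono) auto

lemma card_blk: assumes k: "k < length u" shows "card {i:{1..sum_list u}. blk u i = k} = u ! k"
proof -
 have "psum u (Suc k) <= sum_list u" using psum_mono[of "Suc k" "length u" u] k by (simp add:psum_def)
 hence "i:{1..sum_list u} & blk u i = k <-> psum u k < i & i <= psum u (Suc k)" for i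
  using blk_props[of i u] blk_iff[OF k, of i] by auto
 hence "{i:{1..sum_list u}. blk u i = k} = {psum u k<..psum u (Suc k)}"
  by (intro Set.set_eqI) (simp only:mem_Collect_eq greaterThanAtMost_iff)
 thus ?thesis using k by (simp add:psum_Suc)
qed

text \<open>The base word of content \<open>u\<close>; subtracting the block index makes it weakly
  decreasing, as \<open>base_wd\<close> requires.\<close>

definition "bw u i = length u - blk u i"

lemma base_wd_bw: "base_wd n (bw u)"
 by unfold_locales (simp add:bw_def diff_le_mono2 blk_mono)

lemma bw_eq: "bw u i = bw u j <-> blk u i = blk u j"
proof -
 have "blk u i <= length u" for i
  unfolding blk_def by (rule order_trans[OF card_mono[of "{..<length u}"]]) auto
 from this[of i] this[of j] show ?thesis unfolding bw_def by arith
qed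

lemma rank_bij:
 fixes f :: "'a => int"
 assumes fin: "finite D" and inj: "inj_on f D"
 shows "bij_betw (%A. card {B:D. f B <= f A}) D {1..card D}"
proof -
 let ?r = "%A. card {B:D. f B <= f A}"
 have less: "?r A < ?r B" if "A:D" "B:D" "f A < f B" for A B
 proof (rule psubset_card_mono)
  have "B:{C:D. f C <= f B}" "B ~: {C:D. f C <= f A}" using that by auto
  moreover have "{C:D. f C <= f A} \<subseteq> {C:D. f C <= f B}" using that by auto
  ultimately show "{C:D. f C <= f A} \<subset> {C:D. f C <= f B}" by blast
 qed (use fin in simp)
 have i: "inj_on ?r D"
 proof (rule inj_onI)
  fix A B assume AB: "A:D" "B:D" "?r A = ?r B"
  hence "f A = f B" using less[of A B] less[of B A] by (cases "f A" "f B" rule:linorder_cases) simp_all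
  thus "A = B" using inj AB by (auto dest:inj_onD)
 qed
 have sub: "?r ` D \<subseteq> {1..card D}"
 proof
  fix k assume "k:?r ` D"
  then obtain A where A: "A:D" "k = ?r A" by blast
  have "0 < ?r A" using A fin by (subst card_gt_0_iff) auto
  moreover have "?r A <= card D" using fin by (intro card_mono) auto
  ultimately show "k:{1..card D}" using A by simp
 qed
 thus ?thesis unfolding bij_betw_def using i card_image[OF i]
  by (intro conjI card_subset_eq) simp_all
qed

context
 fixes n :: nat and D :: "cell set" and nu :: "nat list"
 assumes D: "D:Shp n" and nu: "sum_list nu = n"
begin

definition "SY = {z:std n. shape n z = D & (ALL i:{1..<n}. blk nu i = blk nu (Suc i) --> ct (z (Suc i)) < ct (z i))}"

text \<open>Standardization orders cells by entry and, for equal entries, by decreasing content; the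
  factor exceeds every difference of two contents.\<close>

definition "key t A = int (t A) * (2 * (SUM B:D. \<bar>ct B\<bar>) + 1) - ct A"

definition "rk t A = card {B:D. key t B <= key t A}"

definition "of_tab t p = (if p:{1..n} then inv_into D (rk t) p else (0, 0))"

definition "to_tab z = (\<lambda>A\<in>D. blk nu (inv_into {1..n} z A))"

lemma D_simps: "dia D" "finite D" "card D = n"
 using D by (auto simp:Shp_def dia_fin)

lemma key_less:
 assumes "A:D" "B:D" shows "key t A < key t B <-> t A < t B \<or> (t A = t B & ct B < ct A)"
proof -
 let ?S = "SUM B:D. \<bar>ct B\<bar>"
 have ab: "\<bar>ct A\<bar> <= ?S" "\<bar>ct B\<bar> <= ?S"
  using assms D_simps(2) by (auto intro:member_le_sum)
 have lt: "key t A < key t B" if "t A < t B" "\<bar>ct A\<bar> <= ?S" "\<bar>ct B\<bar> <= ?S" for A B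
 proof -
  have "int (t A) + 1 <= int (t B)" using that by simp
  hence "(int (t A) + 1) * (2 * ?S + 1) <= int (t B) * (2 * ?S + 1)"
  by (intro mult_right_mono) auto
  thus ?thesis using that unfolding key_def by (simp add:algebra_simps)
 qed
 consider "t A < t B" | "t B < t A" | "t A = t B" by linarith
 thus ?thesis
  using lt[of A B] lt[of B A] ab by cases (auto simp:key_def)
qed

lemma to_tab_SSD:
 assumes z: "z:SY" shows "to_tab z:SSD D nu"
  and "p:{1..n} ==> rk (to_tab z) (z p) = p"
proof -
 have zs: "z:std n" and sh: "z ` {1..n} = D" and dec: "i:{1..<n} ==> blk nu i = blk nu (Suc i) ==> ct (z (Suc i)) < ct (z i)" for i
  using z by (auto simp:SY_def)
 have inj: "inj_on z {1..n}" using zs by (simp add:std_def)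
 let ?t = "to_tab z"
 have tz: "?t (z p) = blk nu p" if "p:{1..n}" for p
  using that inj sh by (auto simp:to_tab_def)
 have decr: "ct (z p') < ct (z p)" if "1 <= p" "p < p'" "p' <= n" "blk nu p = blk nu p'" for p p'
 proof -
  have "- ct (z p) < - ct (z p')"
  proof (rule strict_mono_links[where f = "%p. - ct (z p)" and c = p and d = p' and x = p and y = p'])
  fix i assume i: "p <= i" "i < p'"
  have "blk nu i = blk nu (Suc i)"
  using blk_mono[of p i nu] blk_mono[of i "Suc i" nu] blk_mono[of "Suc i" p' nu] i that by simp
  thus "- ct (z i) < - ct (z (Suc i))" using dec[of i] i that by simp
  qed (use that in auto)
  thus ?thesis by simp
 qed
 have pos: "p <= p'" if "p:{1..n}" "p':{1..n}" "cell_le (z p) (z p')" for p p'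
 proof -
  have "dia (z ` {1..p'})" using zs that by (simp add:std_def)
  hence "z p:z ` {1..p'}" by (rule diagramD[OF _ _ that(3)]) (use that in auto)
  then obtain l where "l:{1..p'}" "z p = z l" by blast
  thus ?thesis using inj that by (auto dest!: inj_onD)
 qed
 have ex: "EX p:{1..n}. A = z p" if "A:D" for A using that sh by blast
 have "card {A:D. ?t A = k} = nu ! k" if "k < length nu" for k
 proof -
  have "{A:D. ?t A = k} = z ` {p:{1..n}. blk nu p = k}" using sh tz by auto
  hence "card {A:D. ?t A = k} = card {p:{1..n}. blk nu p = k}"
  by (simp only:) (intro card_image inj_on_subset[OF inj], auto)
  thus ?thesis using card_blk[OF that] nu by simp
 qed
 moreover have "?t (i, j) <= ?t (i', j)" if ij: "(i, j):D" "(i', j):D" "i < i'" for i i' j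
 proof -
  obtain p p' where p: "p:{1..n}" "(i, j) = z p" "p':{1..n}" "(i', j) = z p'" using ex[OF ij(1)] ex[OF ij(2)] by blast
  have "cell_le (z p) (z p')" unfolding p(2,4)[symmetric] using ij by (simp add:cell_le_def)
  hence "p <= p'" using pos p by blast
  thus ?thesis unfolding p(2,4) tz[OF p(1)] tz[OF p(3)] by (rule blk_mono)
 qed
 moreover have "?t (i, j) < ?t (i, j')" if ij: "(i, j):D" "(i, j'):D" "j < j'" for i j j'
 proof -
  obtain p p' where p: "p:{1..n}" "(i, j) = z p" "p':{1..n}" "(i, j') = z p'" using ex[OF ij(1)] ex[OF ij(2)] by blast
  have "cell_le (z p) (z p')" unfolding p(2,4)[symmetric] using ij by (simp add:cell_le_def)
  hence le: "p <= p'" using pos p by blast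
  have ct: "ct (z p) < ct (z p')" unfolding p(2,4)[symmetric] using ij by (simp add:ct_def)
  hence "p ~= p'" by auto
  hence "blk nu p ~= blk nu p'" using decr[of p p'] le ct p(1,3) by auto
  thus ?thesis unfolding p(2,4) tz[OF p(1)] tz[OF p(3)] using blk_mono[OF le, of nu] by simp
 qed
 moreover have "?t:D \<rightarrow>\<^sub>E {..<length nu}"
  unfolding PiE_iff
 proof
  show "ALL A:D. ?t A:{..<length nu}"
  proof
  fix A assume "A:D"
  then obtain p where p: "p:{1..n}" "A = z p" using ex by blast
  thus "?t A:{..<length nu}" using tz[OF p(1)] blk_props(1)[of p nu] nu by simp
  qed
 qed (simp add:to_tab_def)
 ultimately show "?t:SSD D nu" unfolding SSD_def by blast
 assume p: "p:{1..n}"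
 have lt: "key ?t (z p) < key ?t (z p')" if "p:{1..n}" "p':{1..n}" "p < p'" for p p'
 proof -
  have "z p:D" "z p':D" using that sh by auto
  thus ?thesis unfolding key_less[OF \<open>z p : D\<close> \<open>z p' : D\<close>] tz[OF that(1)] tz[OF that(2)]
  using blk_mono[of p p' nu] decr[of p p'] that by force
 qed
 have "{B:D. key ?t B <= key ?t (z p)} = z ` {1..p}"
 proof (intro equalityI subsetI)
  fix B assume "B:{B:D. key ?t B <= key ?t (z p)}"
  then obtain l where l: "l:{1..n}" "B = z l" "key ?t (z l) <= key ?t (z p)" using ex by blast
  hence "l <= p" using lt[OF p l(1)] by force
  thus "B:z ` {1..p}" using l by auto
 next
  fix B assume "B:z ` {1..p}"
  then obtain l where l: "l:{1..p}" "B = z l" by blast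
  hence "key ?t (z l) <= key ?t (z p)" using lt[of l p] p by (cases "l = p") auto
  thus "B:{B:D. key ?t B <= key ?t (z p)}" using l p sh by auto
 qed
 thus "rk ?t (z p) = p" using p inj by (simp add:rk_def card_image inj_on_subset)
qed

lemma of_tab_SY:
 assumes t: "t:SSD D nu"
 shows "inj_on (rk t) D" "of_tab t:SY" "to_tab (of_tab t) = t"
proof -
 have col: "t (i, j) <= t (i', j)" if "(i, j):D" "(i', j):D" "i <= i'" for i i' j
  using t that unfolding SSD_def by (cases "i = i'") auto
 have row: "t (i, j) < t (i, j')" if "(i, j):D" "(i, j'):D" "j < j'" for i j j' using t that unfolding SSD_def by blast
 have le: "key t A < key t B" if AB: "A:D" "B:D" "cell_le A B" "A ~= B" for A B
 proof -
  obtain i j where A: "A = (i, j)" by (cases A)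
  obtain i' j' where B: "B = (i', j')" by (cases B)
  have c: "i <= i'" "j <= j'" "(i, j'):D" using AB diagramD[OF D_simps(1), of B "(i, j')"] by (auto simp:A B cell_le_def)
  show ?thesis unfolding key_less[OF AB(1,2)]
  proof (cases "j = j'")
  case True
  thus "t A < t B \<or> t A = t B & ct B < ct A" using col[of i j i'] AB c by (auto simp:A B ct_def)
  next
  case False
  thus "t A < t B \<or> t A = t B & ct B < ct A" using row[of i j j'] col[of i j' i'] AB c by (auto simp:A B)
  qed
 qed
 have kinj: "inj_on (key t) D"
 proof (rule inj_onI, rule ccontr)
  fix A B assume AB: "A:D" "B:D" "key t A = key t B" "A ~= B"
  hence "ct A = ct B" using key_less[of A B t] key_less[of B A t] by auto
  thus False using same_diagonal[of A B] le[of A B] le[of B A] AB by auto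
 qed
 have bij: "bij_betw (rk t) D {1..n}"
  using rank_bij[OF D_simps(2) kinj] D_simps(3) by (simp add:rk_def[abs_def])
 thus ri: "inj_on (rk t) D" by (simp add:bij_betw_def)
 let ?z = "of_tab t"
 have z: "?z p:D & rk t (?z p) = p" if "p:{1..n}" for p
 proof -
  have "p:rk t ` D" using bij that by (simp add:bij_betw_def)
  thus ?thesis using that by (simp add:of_tab_def inv_into_into f_inv_into_f)
 qed
 have zr: "?z (rk t A) = A" "rk t A:{1..n}" if "A:D" for A
  using bij_betw_apply[OF bij that] ri that by (auto simp:of_tab_def)
 have zinj: "inj_on ?z {1..n}" by (rule inj_on_inverseI[of _ "rk t"]) (use z in auto)
 have pre: "?z ` {1..k} = {A:D. rk t A <= k}" if "k <= n" for k
 proof (intro equalityI subsetI)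
  fix A assume "A:{A:D. rk t A <= k}"
  thus "A:?z ` {1..k}" using zr[of A] by (intro image_eqI[of _ _ "rk t A"]) auto
 qed (use z that in auto)
 have rle: "rk t A <= rk t B" if "key t A <= key t B" for A B
  unfolding rk_def by (rule card_mono) (use D_simps that in auto)
 have rlt: "key t A < key t B" if "A:D" "B:D" "rk t A < rk t B" for A B
  using rle[of B A] that by force
 have zs: "?z:std n"
  unfolding std_def mem_Collect_eq
 proof (intro conjI allI impI zinj)
  fix k assume k: "k <= n"
  show "dia (?z ` {1..k})" unfolding pre[OF k]
  proof (rule diagramI)
  fix A B assume B: "B:{A:D. rk t A <= k}" and AB: "cell_le A B"
  hence "A:D" using diagramD[OF D_simps(1)] by blast
  moreover have "rk t A <= rk t B" using rle[of A B] le[of A B] B AB calculation by (cases "A = B") auto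
  ultimately show "A:{A:D. rk t A <= k}" using B by auto
  qed (use D_simps in auto)
 qed (auto simp:of_tab_def)
 have sh: "shape n ?z = D" using pre[of n] zr(2) by auto
 have tb: "blk nu (rk t A) = t A" if A: "A:D" for A
 proof -
  have tl: "t B < length nu" if "B:D" for B using t that by (auto simp:SSD_def)
  have cnt: "card {B:D. t B < k} = psum nu k" if "k <= length nu" for k
  proof -
  have "{B:D. t B < k} = (\<Union>l<k. {B:D. t B = l})" by auto
  hence "card {B:D. t B < k} = (SUM l<k. card {B:D. t B = l})"
  by (simp only:) (rule card_UN_disjoint; use D_simps in auto)
  also have "... = (SUM l<k. nu ! l)" by (rule sum.cong) (use t that in "auto simp:SSD_def")
  finally show ?thesis using psum_sum[OF that] by simp
  qed
  show ?thesis
  proof (rule blk_iff[OF tl[OF A]])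
  have "psum nu (t A) = card {B:D. t B < t A}" using cnt[of "t A"] tl[OF A] by simp
  also have "... < rk t A"
  unfolding rk_def
  proof (rule psubset_card_mono)
  show "{B:D. t B < t A} \<subset> {B:D. key t B <= key t A}"
  using A key_less[of _ A t] by (auto simp:less_le)
  qed (use D_simps in auto)
  finally show "psum nu (t A) < rk t A" .
  have "rk t A <= card {B:D. t B < Suc (t A)}"
  unfolding rk_def
  proof (rule card_mono)
  show "{B:D. key t B <= key t A} \<subseteq> {B:D. t B < Suc (t A)}"
  using A key_less[of A _ t] by (auto simp:not_less[symmetric])
  qed (use D_simps in auto)
  thus "rk t A <= psum nu (Suc (t A))" using cnt[of "Suc (t A)"] tl[OF A] by simp
  qed
 qed
 show "?z:SY"
  unfolding SY_def mem_Collect_eq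
 proof (intro conjI ballI impI zs sh)
  fix i assume i: "i:{1..<n}" and b: "blk nu i = blk nu (Suc i)"
  have ii: "?z i:D & rk t (?z i) = i" "?z (Suc i):D & rk t (?z (Suc i)) = Suc i" using z i by auto
  have "t (?z i) = t (?z (Suc i))" using tb[of "?z i"] tb[of "?z (Suc i)"] ii b by simp
  moreover have "key t (?z i) < key t (?z (Suc i))" by (rule rlt) (use ii in auto)
  ultimately show "ct (?z (Suc i)) < ct (?z i)" using key_less[of "?z i" "?z (Suc i)" t] ii by auto
 qed
 show "to_tab ?z = t"
 proof
  fix A show "to_tab ?z A = t A"
  proof (cases "A:D")
  case True
  have "inv_into {1..n} ?z A = rk t A"
  using inv_into_f_f[OF zinj zr(2)[OF True]] zr(1)[OF True] by simp
  thus ?thesis using tb[OF True] True by (simp add:to_tab_def)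
  next
  case False
  moreover have "t A = undefined" using t False by (auto simp:SSD_def)
  ultimately show ?thesis by (simp add:to_tab_def)
  qed
 qed
qed

lemma card_SY: "card SY = card (SSD D nu)"
proof (rule bij_betw_same_card[of to_tab], rule bij_betw_byWitness[of _ of_tab])
 show "ALL z:SY. of_tab (to_tab z) = z"
 proof (intro ballI ext)
  fix z p assume z: "z:SY"
  note t = to_tab_SSD[OF z]
  show "of_tab (to_tab z) p = z p"
  proof (cases "p:{1..n}")
  case True
  have "z p:D" using z True by (auto simp:SY_def)
  from inv_into_f_f[OF of_tab_SY(1)[OF t(1)] this] show ?thesis unfolding t(2)[OF True] using True by (simp add:of_tab_def)
  next
  case False thus ?thesis using z by (auto simp:of_tab_def SY_def std_def)
  qed
 qed
qed (use of_tab_SY to_tab_SSD in blast)+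

end

lemma (in snorm) card_YY_bw:
 assumes "D:Shp n" "sum_list u = n"
 shows "card (YY D (cuts n (bw u))) = card (SSD D u)"
proof -
 have "YY D (cuts n (bw u)) = SY n D u"
  by (auto simp:YY_def SY_def[OF assms] stdD_def links_def cuts_def bw_eq)
 thus ?thesis using card_SY[OF assms] by simp
qed

section \<open>Irreducible characters\<close>

lemma kac_loc:
 assumes "hk_rep n th t" "!!p. p:fa n ==> loc_on X (act th t p)"
 shows "loc_on X (hk_rep.kac n th t c)"
 unfolding loc_on_def hk_rep.kac_def[OF assms(1)]
 by (intro allI impI ballI sum.cong refl arg_cong[of _ _ "(*) _"] loc_onD[OF assms(2)]) auto

lemma (in hk_rep) kac_conv_fun: "kac (conv n th c d) f = kac c (kac d f)"
 by (rule ext) (rule kac_conv)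

context snorm
begin

text \<open>The filling by column indices in \<open>SSD_DT\<close>, whose content lists the column
  lengths of \<open>D\<close>, standardizes to a filling of shape \<open>D\<close>.\<close>

lemma stdD_ne: assumes D: "D:Shp n" shows "stdD D ~= {}"
proof -
 obtain u where u: "u:partitions n" "YD u = swp ` D"
  using shape_part[of "swp ` D" n] D by (auto simp:Shp_swp)
 have DT: "DT u = D" unfolding DT_swp u(2) by (simp add:image_image)
 have "card (YY D (cuts n (bw u))) = 1"
  using card_YY_bw[OF D, of u] SSD_DT[of u n] D u(1) by (simp add:DT partitions_def)
 hence "YY D (cuts n (bw u)) ~= {}" by auto
 thus ?thesis by (auto simp:YY_def)
qed

lemma irr_stdD:
 assumes "v:stdD D" "w v ~= 0"
 shows "EX c. ALL z:stdD D. u z = V.kac c w z"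
proof (intro exI ballI)
 fix z assume z: "z:stdD D"
 have "V.kac (%x. SUM y:stdD D. u y / w v * cu (y, v) x) w z = (SUM y:stdD D. if z = y then u z else 0)"
  unfolding V.kac_sum V.kac_scl
  by (rule sum.cong) (use assms z in "auto simp:unit_cu spr_def stdD_def")
 thus "u z = V.kac (%x. SUM y:stdD D. u y / w v * cu (y, v) x) w z" using z by simp
qed

context
 fixes t :: "nat => ('x => 'k) => 'x => 'k" and X :: "'x set"
 assumes t: "hk_rep n th t" and fin: "finite X"
  and loc: "!!p. p:fa n ==> loc_on X (act th t p)"
begin

interpretation M: hk_rep n th t by (rule t)

lemma tr_unit:
 assumes "(x, y):spr n"
 shows "x ~= y ==> tr X (M.kac (cu (x, y))) = 0" "tr X (M.kac (cu (x, x))) = tr X (M.kac (cu (y, y)))"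
proof -
 have sp: "(x, x):spr n" "(y, y):spr n" "(y, x):spr n" using assms by (auto simp:spr_def)
 have c: "tr X (%f. M.kac a (M.kac b f)) = tr X (%f. M.kac b (M.kac a f))" for a b
  by (rule tr_comm[OF M.lin_kac M.lin_kac kac_loc[OF t loc] kac_loc[OF t loc] fin])
 show "tr X (M.kac (cu (x, x))) = tr X (M.kac (cu (y, y)))"
  using c[of "cu (x, y)" "cu (y, x)"] by (simp add:unit_mult[OF t] assms sp)
 show "tr X (M.kac (cu (x, y))) = 0" if "x ~= y"
  using c[of "cu (x, x)" "cu (x, y)"] that by (simp add:unit_mult[OF t] assms sp) (simp add:tr_def)
qed

text \<open>Some diagonal unit, at a filling \<open>x\<close>, acts nontrivially. By irreducibility
  its image is a line, so its trace is 1, and diagonal units of other shapes act as zero. The traces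
  of all units, hence of all elements, are then those of the module of shape
  \<open>shape n x\<close>.\<close>

lemma irr_chr:
 assumes v0: "v0:X" and irr: "!!w u. EX v:X. w v ~= 0 ==> EX c. ALL v:X. u v = M.kac c w v"
 shows "EX D:Shp n. ALL p:fa n. tr X (M.ac p) = ch D p"
proof -
 have "(SUM x:std n. M.kac (cu (x, x)) (dl v0) v0) ~= 0"
  using units_one[OF t, of "dl v0" v0] by (simp add:dl_def)
 then obtain x where x: "x:std n" and "M.kac (cu (x, x)) (dl v0) v0 ~= 0" by (meson sum.neutral)
 define w where "w = M.kac (cu (x, x)) (dl v0)"
 have w: "w v0 ~= 0" by (simp add:w_def) fact
 have xx: "(x, x):spr n" using x by (simp add:spr_def)
 have w1: "M.kac (cu (x, x)) w = w" unfolding w_def by (simp add:unit_mult[OF t xx xx])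
 have zero: "M.kac (cu (y, y)) u v = 0" if y: "y:std n" "shape n y ~= shape n x" and v: "v:X" for y u v
 proof -
  have yy: "(y, y):spr n" using y by (simp add:spr_def)
  obtain c where c: "ALL v:X. u v = M.kac c w v" using irr v0 w by meson
  have "M.kac (conv n th (cu (y, y)) (conv n th c (cu (x, x)))) = M.kac (%w. 0)"
  proof (rule kac_transfer[OF t])
  fix f z assume z: "z:std n"
  have "V.kac c (V.kac (cu (x, x)) f) y = V.kac c (%z. 0) y"
  by (rule loc_onD[OF loc_kac(2)[of "shape n y"]])
  (use y unit_cu[OF xx] in "auto simp:stdD_def")
  thus "V.kac (conv n th (cu (y, y)) (conv n th c (cu (x, x)))) f z = V.kac (%w. 0) f z"
  using lin_op_zero[OF V.lin_kac, of c] by (simp add:V.kac_conv unit_cu[OF yy z])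
  qed
  hence "M.kac (conv n th (cu (y, y)) (conv n th c (cu (x, x)))) w v = 0" by simp
  hence "M.kac (cu (y, y)) (M.kac c (M.kac (cu (x, x)) w)) v = 0"
  by (simp only:M.kac_conv_fun)
  moreover have "M.kac (cu (y, y)) u v = M.kac (cu (y, y)) (M.kac c w) v"
  by (rule loc_onD[OF kac_loc[OF t loc] _ v]) (use c in auto)
  ultimately show ?thesis by (simp add:w1)
 qed
 have one: "EX l. ALL v:X. M.kac (cu (x, x)) u v = l * w v" for u
 proof -
  obtain c where c: "ALL v:X. u v = M.kac c w v" using irr v0 w by meson
  let ?l = "V.kac c (dl x) x"
  have "M.kac (conv n th (cu (x, x)) (conv n th c (cu (x, x)))) = M.kac (%w. ?l * cu (x, x) w)"
  proof (rule kac_transfer[OF t])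
  fix f z assume z: "z:std n"
  have "V.kac c (V.kac (cu (x, x)) f) x = V.kac c (%z. f x * dl x z) x"
  by (rule loc_onD[OF loc_kac(1)]) (use x unit_cu[OF xx] in "auto simp:dl_def")
  thus "V.kac (conv n th (cu (x, x)) (conv n th c (cu (x, x)))) f z = V.kac (%w. ?l * cu (x, x) w) f z"
  by (simp add:V.kac_conv V.kac_scl unit_cu[OF xx z] lin_op_scale[OF V.lin_kac])
  qed
  hence e: "M.kac (cu (x, x)) (M.kac c (M.kac (cu (x, x)) w)) v = ?l * M.kac (cu (x, x)) w v" for v
  unfolding M.kac_conv_fun[symmetric] M.kac_scl[symmetric] by (rule fun_cong[OF fun_cong])
  have "M.kac (cu (x, x)) u v = ?l * w v" if v: "v:X" for v
  proof -
  have "M.kac (cu (x, x)) u v = M.kac (cu (x, x)) (M.kac c w) v"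
  by (rule loc_onD[OF kac_loc[OF t loc] _ v]) (use c in auto)
  thus ?thesis using e[of v] by (simp add:w1)
  qed
  thus ?thesis by blast
 qed
 obtain l where l: "!!u v. v:X ==> M.kac (cu (x, x)) u v = l u * w v" using one by metis
 have trx: "tr X (M.kac (cu (x, x))) = 1"
 proof -
  have "w v0 = (SUM y:X. w y * M.kac (cu (x, x)) (dl y) v0)"
  using op_expand[OF M.lin_kac kac_loc[OF t loc] fin v0, of "cu (x, x)" w] by (simp add:w1)
  also have "... = (SUM y:X. l (dl y) * w y) * w v0" unfolding sum_distrib_right by (rule sum.cong) (use v0 in "simp_all add:l")
  finally have "(SUM y:X. l (dl y) * w y) = 1" using w by simp
  thus ?thesis by (simp add:tr_def l)
 qed
 have tru: "tr X (M.kac (cu (y, z))) = (if y = z & y:stdD (shape n x) then 1 else 0)" if yz: "(y, z):spr n" for y z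
 proof (cases "y = z")
  case True
  show ?thesis
  proof (cases "shape n y = shape n x")
  case True
  hence "(x, y):spr n" "y:stdD (shape n x)" using x yz by (auto simp:spr_def stdD_def)
  thus ?thesis using tr_unit(2)[of x y] trx \<open>y = z\<close> by simp
  next
  case False
  thus ?thesis using zero[of y] yz \<open>y = z\<close> by (auto simp:tr_def stdD_def spr_def)
  qed
 qed (use tr_unit(1)[OF yz] in simp)
 have "tr X (M.ac p) = ch (shape n x) p" if p: "p:fa n" for p
 proof -
  have "tr X (M.ac p) = (SUM yz:spr n. me p yz * tr X (M.kac (cu yz)))"
  unfolding tr_scl[symmetric] tr_sum[symmetric] by (rule tr_cong) (rule kac_units[OF t p])
  also have "... = (SUM yz:spr n. if yz:(%y. (y, y)) ` stdD (shape n x) then me p yz else 0)"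
  by (rule sum.cong[OF refl]) (auto simp:tru split: if_splits)
  also have "... = (SUM yz:(%y. (y, y)) ` stdD (shape n x). me p yz)"
  by (rule sum.mono_neutral_cong_right[OF fin_spr]) (auto simp:spr_def stdD_def)
  also have "... = ch (shape n x) p" by (subst sum.reindex) (auto simp:inj_on_def ch_def)
  finally show ?thesis .
 qed
 thus ?thesis using std_shape[OF x] by blast
qed

end

lemma ch_tr: "ch D p = tr (stdD D) (V.ac p)"
 by (simp add:ch_def me_def tr_def)

lemma ch_expand: "p:fa n ==> ch D p = (SUM w:Sym n. th (cof n p w) * ch D (Tw n w))"
 unfolding ch_tr tr_scl[symmetric] tr_sum[symmetric] by (rule tr_cong) (rule V.act_cof)

text \<open>The coefficients of a diagonal matrix unit serve: it has trace 1 on its own module and 0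
  on the others.\<close>

lemma ch_dual:
 assumes D: "D:Shp n"
 shows "EX c. ALL G. (SUM w:Sym n. c w * ch G (Tw n w)) = (if G = D then 1 else 0)"
proof -
 obtain x where x: "x:stdD D" using stdD_ne[OF D] by blast
 have xx: "(x, x):spr n" using x by (simp add:spr_def stdD_def)
 have "(SUM w:Sym n. cu (x, x) w * ch G (Tw n w)) = (if G = D then 1 else 0)" for G
 proof -
  have "(SUM w:Sym n. cu (x, x) w * ch G (Tw n w)) = tr (stdD G) (V.kac (cu (x, x)))"
  unfolding ch_tr tr_scl[symmetric] tr_sum[symmetric] by (rule tr_cong) (simp add:V.kac_def)
  also have "... = (SUM z:stdD G. if z = x then 1 else 0)"
  unfolding tr_def by (rule sum.cong) (auto simp:unit_cu[OF xx] stdD_def dl_def)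
  finally show ?thesis using x by (auto simp:stdD_def)
 qed
 thus ?thesis by blast
qed

lemma ch_inj:
 assumes "D:Shp n" "!!w. w:Sym n ==> ch D (Tw n w) = ch E (Tw n w)"
 shows "D = E"
proof -
 obtain c where c: "!!G. (SUM w:Sym n. c w * ch G (Tw n w)) = (if G = D then 1 else 0)" using ch_dual[OF assms(1)] by blast
 have "(SUM w:Sym n. c w * ch D (Tw n w)) = (SUM w:Sym n. c w * ch E (Tw n w))" by (rule sum.cong) (simp_all add:assms(2))
 thus ?thesis unfolding c by (auto split: if_splits)
qed

end

text \<open>Split off one nonzero column \<open>v\<close> of \<open>e\<close> by clearing the row
  \<open>y\<close>: the rest \<open>f\<close> is again idempotent, kills one more basis vector, and
  has trace smaller by 1.\<close>

lemma idempotent_trace: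
 fixes e :: "('x => 'k::field_char_0) => 'x => 'k"
 assumes "finite X" "lin_op e" "loc_on X e" "!!g x. x:X ==> e (e g) x = e g x"
 shows "EX k. tr X e = of_nat k & ((EX g. EX x:X. e g x ~= 0) --> k ~= 0)"
 using assms(2-)
proof (induction "card {z:X. EX x:X. e (dl z) x ~= 0}" arbitrary: e rule:less_induct)
 case less
 show ?case
 proof (cases "EX z:X. EX y:X. e (dl z) y ~= 0")
  case False
  hence z: "e g x = 0" if "x:X" for g x
  using op_expand[OF less.prems(1,2) assms(1) that] that by simp
  thus ?thesis by (intro exI[of _ 0]) (auto simp:tr_def)
 next
  case True
  then obtain z y where z: "z:X" "y:X" "e (dl z) y ~= 0" by blast
  define v where "v = e (dl z)"
  define f where "f g x = e g x - e g y / v y * v x" for g x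
  have vy: "v y ~= 0" using z by (simp add:v_def)
  have ev: "e v x = v x" if "x:X" for x unfolding v_def by (rule less.prems(3)[OF that])
  have f_lin: "lin_op f"
  using less.prems(1) by (auto simp:lin_op_def f_def fun_eq_iff add_divide_distrib ring_distribs)
  have f_loc: "loc_on X f"
  unfolding loc_on_def f_def using loc_onD[OF less.prems(2)] z(2) by metis
  have ef: "e (f g) x = f g x" if "x:X" for g x
  proof -
  have "e (f g) x = e (%x. e g x + (- (e g y / v y)) * v x) x" by (simp add:f_def[abs_def])
  also have "... = e (e g) x + (- (e g y / v y)) * e v x"
  by (simp only:lin_op_add[OF less.prems(1)] lin_op_scale[OF less.prems(1)])
  finally show ?thesis using that by (simp add:ev less.prems(3) f_def)
  qed
  have ff: "f (f g) x = f g x" if "x:X" for g x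
  proof -
  have "f g y = 0" using vy by (simp add:f_def)
  thus ?thesis using ef[OF that] ef[OF z(2)] by (simp add:f_def[of "f g"])
  qed
  have "card {z:X. EX x:X. f (dl z) x ~= 0} < card {z:X. EX x:X. e (dl z) x ~= 0}"
  proof (rule psubset_card_mono)
  have "f (dl z) x = 0" for x using vy by (simp add:f_def v_def[symmetric])
  moreover have "EX x:X. e (dl a) x ~= 0" if "a:X" "b:X" "f (dl a) b ~= 0" for a b
  proof (cases "e (dl a) y = 0")
  case True thus ?thesis using that by (auto simp:f_def)
  qed (use z in blast)
  ultimately show "{z:X. EX x:X. f (dl z) x ~= 0} \<subset> {z:X. EX x:X. e (dl z) x ~= 0}" using z by blast
  qed (use assms(1) in simp)
  then obtain k where k: "tr X f = of_nat k" using less.hyps[OF _ f_lin f_loc ff] by blast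
  have "(SUM x:X. e (dl x) y / v y * v x) = (SUM x:X. v x * e (dl x) y) / v y"
  by (simp add:sum_divide_distrib mult.commute)
  also have "... = 1" using op_expand[OF less.prems(1,2) assms(1) z(2), of v] ev[OF z(2)] vy by simp
  finally have "tr X e = of_nat (Suc k)" using k by (simp add:tr_def f_def sum_subtractf algebra_simps)
  thus ?thesis by blast
 qed
qed

section \<open>Matrix representations\<close>

text \<open>A matrix as an operator on functions on all indices. Beyond the size it is the scalar
  \<open>q\<close>, so that the Hecke relations hold there too.\<close>

definition opm :: "'k::comm_ring_1 => nat => 'k mat => (nat => 'k) => nat => 'k" where
 "opm q d A f x = (if x < d then SUM j<d. A $$ (x, j) * f j else q * f x)"

lemma lin_opm: "lin_op (opm q d A)"
 by (auto simp:lin_op_def opm_def fun_eq_iff algebra_simps sum_distrib_left)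

lemma loc_opm: "loc_on {..<d} (opm q d A)"
 by (auto simp:loc_on_def opm_def)

lemma opm_mult:
 assumes "A:carrier_mat d d" "B:carrier_mat d d" "x < d"
 shows "opm q d A (opm q d B f) x = opm q d (A * B) f x"
proof -
 have "(A * B) $$ (x, k) = (SUM j<d. A $$ (x, j) * B $$ (j, k))" if "k < d" for k
  using assms that by (simp add:scalar_prod_def lessThan_atLeast0)
 hence "opm q d (A * B) f x = (SUM k<d. SUM j<d. A $$ (x, j) * B $$ (j, k) * f k)"
  using assms by (simp add:opm_def sum_distrib_right)
 also have "... = (SUM j<d. SUM k<d. A $$ (x, j) * B $$ (j, k) * f k)" by (rule sum.swap)
 also have "... = opm q d A (opm q d B f) x"
  using assms by (simp add:opm_def sum_distrib_left mult.assoc)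
 finally show ?thesis ..
qed

lemma opm_add: "A:carrier_mat d d ==> B:carrier_mat d d ==> x < d ==> opm q d (A + B) f x = opm q d A f x + opm q d B f x"
 and opm_smult: "A:carrier_mat d d ==> x < d ==> opm q d (c \<cdot>\<^sub>m A) f x = c * opm q d A f x"
 by (simp_all add:opm_def algebra_simps sum_distrib_left)

lemma opm_one: assumes x: "x < d" shows "opm q d (1\<^sub>m d) f x = f x"
proof -
 note assms
 hence "opm q d (1\<^sub>m d) f x = (SUM j<d. if j = x then f x else 0)"
  unfolding opm_def if_P[OF x] by (intro sum.cong) auto
 thus ?thesis using \<open>x < d\<close> by simp
qed

lemma tr_opm: "A:carrier_mat d d ==> tr {..<d} (opm q d A) = mat_trace A"
 by (simp add:tr_def opm_def mat_trace_def dl_def if_distrib[of "%x. _ * x"] cong: if_cong)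

lemma opm_rep:
 assumes "rhom th" and A: "!!i. i:{1..<n} ==> A i:carrier_mat d d"
  and quad: "!!i. i:{1..<n} ==> A i * A i = (th qv - 1) \<cdot>\<^sub>m A i + th qv \<cdot>\<^sub>m 1\<^sub>m d"
  and braid: "!!i. 1 <= i ==> Suc i < n ==> A i * (A (Suc i) * A i) = A (Suc i) * (A i * A (Suc i))"
  and comm: "!!i j. 1 <= i ==> Suc i < j ==> j < n ==> A i * A j = A j * A i"
 shows "hk_rep n th (%i. opm (th qv) d (A i))"
proof
 let ?o = "%i. opm (th qv) d (A i)"
 have o: "?o i f x = th qv * f x" if "~ x < d" for i f x using that by (simp add:opm_def)
 fix i j f x
 show "?o i (?o i f) x = (th qv - 1) * ?o i f x + th qv * f x" if i: "i:{1..<n}"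
  by (cases "x < d")
  (simp_all add:opm_mult[OF A[OF i] A[OF i]] quad[OF i] opm_add opm_smult opm_one A[OF i] o left_diff_distrib)
 show "?o i (?o (Suc i) (?o i f)) x = ?o (Suc i) (?o i (?o (Suc i) f)) x" if i: "1 <= i" "Suc i < n"
 proof (cases "x < d")
  case True
  have c: "A i:carrier_mat d d" "A (Suc i):carrier_mat d d" using A i by auto
  have three: "opm q d B (opm q d C (opm q d D f)) x = opm q d (B * (C * D)) f x"
  if "B:carrier_mat d d" "C:carrier_mat d d" "D:carrier_mat d d" for B C D q
  proof -
  have "opm q d B (opm q d C (opm q d D f)) x = opm q d B (opm q d (C * D) f) x"
  by (rule loc_onD[OF loc_opm]) (use True that opm_mult in auto)
  thus ?thesis using opm_mult[OF that(1) mult_carrier_mat[OF that(2,3)] True] by simp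
  qed
  show ?thesis by (simp add:three c braid[OF i])
 qed (simp add:o)
 show "?o i (?o j f) x = ?o j (?o i f) x" if ij: "1 <= i" "Suc i < j" "j < n"
  using A[of i] A[of j] ij comm[OF ij] by (cases "x < d") (simp_all add:opm_mult o)
qed (use assms(1) lin_opm in auto)

lemma irr_mats_iff:
 "irreducible_mats d M <-> d > 0 & (ALL W::'k::field vec set. W \<subseteq> carrier_vec d & 0\<^sub>v d:W &
  (ALL v:W. ALL w:W. v + w:W) & (ALL c. ALL v:W. c \<cdot>\<^sub>v v:W) & (ALL A:M. ALL x:W. A *\<^sub>v x:W)
  --> W = {0\<^sub>v d} \<or> W = carrier_vec d)"
proof -
 have "VectorSpace.subspace class_ring W (module_vec TYPE('k) d) <-> W \<subseteq> carrier_vec d & 0\<^sub>v d:W &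
  (ALL v:W. ALL w:W. v + w:W) & (ALL c. ALL v:W. c \<cdot>\<^sub>v v:W)" for W
  unfolding VectorSpace.subspace_def submodule_def using vec_vs[of d] vec_module[of d]
  by (auto simp:module_vec_simps class_ring_simps)
 thus ?thesis unfolding irreducible_mats_def by auto
qed

text \<open>The vectors obtained from \<open>w\<close> by the algebra form an invariant subspace
  that contains \<open>w\<close>.\<close>

lemma irr_mats_kac:
 assumes t: "hk_rep n th t" and loc: "!!c. loc_on {..<d} (hk_rep.kac n th t c)"
  and irr: "irreducible_mats d M" and M: "!!A. A:M ==> A:carrier_mat d d & (EX c. ALL f. ALL x<d. opm q d A f x = hk_rep.kac n th t c f x)"
  and w: "EX v:{..<d}. (w :: nat => 'k::field) v ~= 0"
 shows "EX c. ALL v:{..<d}. u v = hk_rep.kac n th t c w v"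
proof -
 interpret M: hk_rep n th t by (rule t)
 define W where "W = {vec d (M.kac c w) | c. True}"
 have "W \<subseteq> carrier_vec d" by (auto simp:W_def)
 moreover have "0\<^sub>v d:W"
  unfolding W_def by (intro CollectI exI[of _ "%w. 0"]) (auto)
 moreover have "x + y:W" if xy: "x:W" "y:W" for x y
 proof -
  obtain c c' where "x = vec d (M.kac c w)" "y = vec d (M.kac c' w)" using xy by (auto simp:W_def)
  hence "x + y = vec d (M.kac (%w. c w + c' w) w)" by (auto simp:M.kac_add)
  thus ?thesis by (auto simp:W_def)
 qed
 moreover have "a \<cdot>\<^sub>v x:W" if x: "x:W" for a x
 proof -
  obtain c where "x = vec d (M.kac c w)" using x by (auto simp:W_def)
  hence "a \<cdot>\<^sub>v x = vec d (M.kac (%w. a * c w) w)" by (auto simp:M.kac_scl)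
  thus ?thesis by (auto simp:W_def)
 qed
 moreover have "A *\<^sub>v x:W" if A: "A:M" and x: "x:W" for A x
 proof -
  obtain c where c: "x = vec d (M.kac c w)" using x by (auto simp:W_def)
  obtain c' where c': "ALL f. ALL x<d. opm q d A f x = M.kac c' f x" "A:carrier_mat d d" using M[OF A] by blast
  have "A *\<^sub>v x = vec d (M.kac (conv n th c' c) w)"
  proof (rule eq_vecI)
  fix i assume i: "i < dim_vec (vec d (M.kac (conv n th c' c) w))"
  hence "(A *\<^sub>v x) $ i = opm q d A (M.kac c w) i"
  using c'(2) by (simp add:c opm_def scalar_prod_def lessThan_atLeast0)
  thus "(A *\<^sub>v x) $ i = vec d (M.kac (conv n th c' c) w) $ i" using c'(1) i by (simp add:M.kac_conv)
  qed (use c' in auto)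
  thus ?thesis by (auto simp:W_def)
 qed
 ultimately have "W \<subseteq> carrier_vec d & 0\<^sub>v d:W & (ALL v:W. ALL w:W. v + w:W) &
  (ALL c. ALL v:W. c \<cdot>\<^sub>v v:W) & (ALL A:M. ALL x:W. A *\<^sub>v x:W)" by blast
 with irr[unfolded irr_mats_iff, THEN conjunct2, THEN spec, of W]
 have "W = {0\<^sub>v d} \<or> W = carrier_vec d" by (rule mp)
 moreover have "vec d w:W"
  unfolding W_def by (intro CollectI exI[of _ "dl id"]) (auto simp:M.kac_dl M.Tw_id)
 moreover have "vec d w ~= 0\<^sub>v d" using w by (metis index_vec index_zero_vec(1) lessThan_iff)
 ultimately have "vec d u:W" by auto
 then obtain c where "vec d u = vec d (M.kac c w)" by (auto simp:W_def)
 thus ?thesis by (metis index_vec lessThan_iff)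
qed

context snorm
begin

definition "en D = (SOME e. bij_betw e {..<card (stdD D)} (stdD D))"

lemma en: "bij_betw (en D) {..<card (stdD D)} (stdD D)"
 using ex_bij_betw_nat_finite[OF fin_stdD, of D] unfolding en_def lessThan_atLeast0 by (rule someI_ex)

definition "mm D p = mat (card (stdD D)) (card (stdD D)) (%(i, j). me p (en D i, en D j))"

lemma mm_carrier [simp]: "mm D p:carrier_mat (card (stdD D)) (card (stdD D))"
 by (simp add:mm_def)

lemma sum_en: "(SUM i<card (stdD D). f (en D i)) = (SUM x:stdD D. f x)"
 by (rule sum.reindex_bij_betw[OF en])

lemma mm_comp:
 assumes "!!f x. x:stdD D ==> V.ac r f x = V.ac p (V.ac p' f) x" shows "mm D r = mm D p * mm D p'"
proof (rule eq_matI)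
 fix i j assume "i < dim_row (mm D p * mm D p')" "j < dim_col (mm D p * mm D p')"
 hence ij: "i < card (stdD D)" "j < card (stdD D)" by (simp_all add:mm_def)
 have e: "en D i:stdD D" using bij_betw_apply[OF en] ij by blast
 hence s: "shape n (en D i) = D" "en D i:std n" by (simp_all add:stdD_def)
 have "me r (en D i, en D j) = (SUM y:stdD D. me p (en D i, y) * me p' (y, en D j))"
  using me_expand[OF s(2), of p "V.ac p' (dl (en D j))", unfolded s(1)] by (simp add:me_def assms[OF e])
 also have "... = (SUM k<card (stdD D). me p (en D i, en D k) * me p' (en D k, en D j))" by (rule sum_en[symmetric])
 finally show "mm D r $$ (i, j) = (mm D p * mm D p') $$ (i, j)"
  using ij by (simp add:mm_def scalar_prod_def lessThan_atLeast0)
qed (simp_all add:mm_def)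

lemma mm_wt: "mm D (wterm c []) = th c \<cdot>\<^sub>m 1\<^sub>m (card (stdD D))"
proof (rule eq_matI)
 fix i j assume "i < dim_row (th c \<cdot>\<^sub>m 1\<^sub>m (card (stdD D)))" "j < dim_col (th c \<cdot>\<^sub>m 1\<^sub>m (card (stdD D)))"
 hence ij: "i < card (stdD D)" "j < card (stdD D)" by simp_all
 hence "en D i = en D j <-> i = j" using bij_betw_imp_inj_on[OF en, of D] by (auto dest:inj_onD)
 thus "mm D (wterm c []) $$ (i, j) = (th c \<cdot>\<^sub>m 1\<^sub>m (card (stdD D))) $$ (i, j)"
  using ij by (auto simp:mm_def me_def V.act_wt dl_def)
qed (simp_all add:mm_def)

lemma mm_trace: "mat_trace (mm D p) = ch D p"
 by (simp add:mat_trace_def mm_def ch_def sum_en[of "%x. me p (x, x)" D])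

lemma mm_heq: "heq n p r ==> mm D p = mm D r"
 by (simp add:mm_def me_def V.act_heq)

lemma mm_irr:
 assumes D: "D:Shp n" and M: "!!w. w:Sym n ==> mm D (Tw n w):M"
 shows "irreducible_mats (card (stdD D)) M"
 unfolding irr_mats_iff
proof (intro conjI allI impI)
 let ?f = "card (stdD D)"
 show "?f > 0" using stdD_ne[OF D] by (simp add:card_gt_0_iff)
 fix W :: "'k vec set"
 assume "W \<subseteq> carrier_vec ?f & 0\<^sub>v ?f:W & (ALL v:W. ALL w:W. v + w:W) & (ALL c. ALL v:W. c \<cdot>\<^sub>v v:W) &
  (ALL A:M. ALL x:W. A *\<^sub>v x:W)"
 hence W: "W \<subseteq> carrier_vec ?f" "0\<^sub>v ?f:W" "!!v w. v:W ==> w:W ==> v + w:W" "!!c v. v:W ==> c \<cdot>\<^sub>v v:W"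
  and inv: "!!A x. A:M ==> x:W ==> A *\<^sub>v x:W" by auto
 show "W = {0\<^sub>v ?f} \<or> W = carrier_vec ?f"
 proof (cases "W = {0\<^sub>v ?f}")
  case False
  then obtain w where w: "w:W" "w ~= 0\<^sub>v ?f" using W(2) by auto
  hence wc: "w:carrier_vec ?f" using W(1) by blast
  then obtain k where k: "k < ?f" "w $ k ~= 0" using w(2) by (metis carrier_vecD eq_vecI index_zero_vec)
  let ?e = "inv_into {..<?f} (en D)"
  define g where "g z = w $ ?e z" for z
  have einv: "?e (en D i) = i" if "i < ?f" for i using bij_betw_imp_inj_on[OF en, of D] that by simp
  have ez: "en D i:stdD D" if "i < ?f" for i using bij_betw_apply[OF en] that by blast
  have step: "vec ?f (%i. V.kac c g (en D i)):W" for c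
  proof -
  have "vec ?f (%i. SUM u:U. c u * V.ac (Tw n u) g (en D i)):W" if "finite U" "U \<subseteq> Sym n" for U
  using that
  proof (induction U rule:finite_induct)
  case empty
  have "vec ?f (%i. 0) = (0\<^sub>v ?f :: 'k vec)" by auto
  thus ?case using W(2) by simp
  next
  case (insert u U)
  have "mm D (Tw n u) *\<^sub>v w = vec ?f (%i. V.ac (Tw n u) g (en D i))"
  proof (rule eq_vecI)
  fix i assume "i < dim_vec (vec ?f (%i. V.ac (Tw n u) g (en D i)))"
  hence i: "i < ?f" by simp
  have s: "shape n (en D i) = D" "en D i:std n" using ez[OF i] by (simp_all add:stdD_def)
  have "V.ac (Tw n u) g (en D i) = (SUM j<?f. me (Tw n u) (en D i, en D j) * g (en D j))"
  unfolding me_expand[OF s(2), of "Tw n u" g, unfolded s(1)] by (rule sum_en[symmetric])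
  also have "... = (SUM j<?f. me (Tw n u) (en D i, en D j) * w $ j)"
  by (rule sum.cong) (auto simp:g_def einv)
  finally have "V.ac (Tw n u) g (en D i) = (SUM j<?f. me (Tw n u) (en D i, en D j) * w $ j)" .
  thus "(mm D (Tw n u) *\<^sub>v w) $ i = vec ?f (%i. V.ac (Tw n u) g (en D i)) $ i"
  using i wc by (simp add:mm_def scalar_prod_def lessThan_atLeast0)
  qed (simp add:mm_def)
  hence "c u \<cdot>\<^sub>v vec ?f (%i. V.ac (Tw n u) g (en D i)) + vec ?f (%i. SUM u:U. c u * V.ac (Tw n u) g (en D i)):W"
  using W(3,4) inv[OF M w(1), of u] insert by simp
  moreover have "c u \<cdot>\<^sub>v vec ?f (%i. V.ac (Tw n u) g (en D i)) + vec ?f (%i. SUM u:U. c u * V.ac (Tw n u) g (en D i)) =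
  vec ?f (%i. SUM u:insert u U. c u * V.ac (Tw n u) g (en D i))" using insert by auto
  ultimately show ?case by simp
  qed
  from this[OF fin_Sym order_refl] show ?thesis by (simp add:V.kac_def)
  qed
  have "v:W" if v: "v:carrier_vec ?f" for v
  proof -
  have "g (en D k) ~= 0" using k by (simp add:g_def einv)
  from irr_stdD[OF ez[OF k(1)], of g, OF this, of "%z. v $ ?e z"]
  obtain c where c: "ALL z:stdD D. v $ ?e z = V.kac c g z" by blast
  have "v = vec ?f (%i. V.kac c g (en D i))"
  proof (rule eq_vecI)
  fix i assume "i < dim_vec (vec ?f (%i. V.kac c g (en D i)))"
  hence i: "i < ?f" by simp
  show "v $ i = vec ?f (%i. V.kac c g (en D i)) $ i"
  using c[rule_format, OF ez[OF i]] i by (simp only:einv[OF i] index_vec)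
  qed (use v in simp)
  thus ?thesis using step by simp
  qed
  thus ?thesis using W(1) by blast
 qed simp
qed

end

section \<open>Specializations\<close>

instance fract :: ("{idom, ring_char_0}") field_char_0
proof
 show "inj (of_nat :: nat => 'a fract)"
 proof (rule injI)
  fix m n assume eq: "(of_nat m :: 'a fract) = of_nat n"
  have "of_nat k = tf (of_nat k :: 'a)" for k by (induction k) simp_all
  thus "m = n" using eq by simp
 qed
qed

definition at1 :: "laurent => complex" where
 "at1 c = of_int (laurent_at_one c)"

lemma at1_leval: "at1 = leval (%k. 1)"
 by (simp add:fun_eq_iff at1_def laurent_at_one_def leval_def)

lemma rhom_at1: "rhom at1"
 unfolding at1_leval by (rule rhom_leval) simp_all

lemma at1_q [simp]: "at1 qv = 1"
 by (simp add:at1_leval q_half_def leval_single)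

lemma rhom_to_fract: "rhom tf"
 by (simp add:rhom_def)

text \<open>The quantum integer of \<open>d\<close>; the exponent \<open>2 * d\<close> counts half
  powers of \<open>q\<close>.\<close>

definition "brL d = (tf (qh (2 * d)) - 1) / (tf qv - 1)"

lemma snorm_at1: "snorm at1 1 of_int"
 by unfold_locales (simp_all add:rhom_at1)

lemma q_half_eq_1: "qh k = 1 <-> k = 0"
proof
 assume "qh k = 1"
 hence "lookup (qh k) 0 = lookup (1 :: laurent) 0" by simp
 thus "k = 0" by (simp add:q_half_def lookup_one when_def split: if_splits)
qed simp

lemma snorm_fract: "snorm tf (tf qv) brL"
proof
 have q1: "tf qv - 1 ~= (0 :: laurent fract)"
  using q_half_eq_1[of 2] to_fract_eq_iff[of qv 1] by simp
 show "brL (d + e) = brL d + brL e + (tf qv - 1) * brL d * brL e" for d e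
 proof -
  have "tf (qh (2 * (d + e))) = tf (qh (2 * d)) * tf (qh (2 * e))"
  by (simp add:q_half_add)
  hence "tf (qh (2 * (d + e))) - 1 = (tf (qh (2 * d)) - 1) + (tf (qh (2 * e)) - 1) +
  (tf (qh (2 * d)) - 1) * (tf (qh (2 * e)) - 1)" by (simp add:algebra_simps)
  note e = this
  have "(tf qv - 1) * ((tf (qh (2 * d)) - 1) / (tf qv - 1)) * ((tf (qh (2 * e)) - 1) / (tf qv - 1)) =
  (tf (qh (2 * d)) - 1) * (tf (qh (2 * e)) - 1) / (tf qv - 1 :: laurent fract)" by simp
  thus ?thesis unfolding brL_def e add_divide_distrib by (simp only:)
 qed
 show "brL 1 = 1" using q1 by (simp add:brL_def)
 show "brL d ~= 0" if "d ~= 0" for d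
  using q1 q_half_eq_1[of "2 * d"] to_fract_eq_iff[of "qh (2 * d)" 1] that by (simp add:brL_def)
qed (simp_all add:rhom_to_fract brL_def)

abbreviation "chiC n == snorm.ch n at1 1 (of_int :: int => complex)"
abbreviation "chiL n == snorm.ch n tf (tf qv) brL"

lemma act_loc:
 assumes "!!i. loc_on X (t i)" shows "loc_on X (act th t p)"
proof -
 have w: "loc_on X (%f. foldr t us f)" for us
 proof (induction us)
  case (Cons i us)
  from loc_on_comp[OF assms[of i] this] show ?case by simp
 qed (simp add:loc_on_def)
 show ?thesis
  unfolding loc_on_def act_def
  by (intro allI impI ballI sum.cong refl arg_cong[of _ _ "(*) _"] loc_onD[OF w]) auto
qed

lemma Sym_YS: "w:Sym n <-> w:YS 1 n {}"
 by (simp add:Sym_def YS_def)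

lemma Sym_induct [consumes 1, case_names id sw]:
 assumes "w:Sym n" "P id" "!!i u. i:{1..<n} ==> u:Sym n ==> pinv u i < pinv u (Suc i) ==> P u ==> P (sw i o u)"
 shows "P w"
proof -
 have "w:YS 1 n {}" using assms(1) by (simp only:Sym_YS)
 from le_refl le_refl this show ?thesis
 proof (induction rule:YS_induct)
  case (sw i u)
  show ?case by (rule assms(3)) (use sw in "simp_all only:Sym_YS, auto simp:links_def")
 qed (rule assms(2))
qed

lemma one_smult_mat [simp]: "1 \<cdot>\<^sub>m (A :: 'a::semiring_1 mat) = A"
 by (rule eq_matI) auto

text \<open>At \<open>q = 1\<close> the generators act as involutions, so left multiplication by
  \<open>sw i\<close> follows one rule at ascents and descents alike.\<close>

lemma (in hk_rep) Tw_grp: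
 assumes q: "th qv = 1" and u: "u:Sym n" and v: "v:Sym n"
 shows "ac (Tw n (u o v)) f = ac (Tw n u) (ac (Tw n v) f)"
proof -
 have up: "ac (Tw n (sw i o w)) f = t i (ac (Tw n w) f)" if w: "w:Sym n" and i: "i:{1..<n}" for w i
  using pinv_sw_cases[OF w, of i]
 proof
  assume lt: "pinv w i < pinv w (Suc i)"
  show ?thesis by (rule ext) (rule act_Tw_up[OF w i lt, symmetric])
 next
  assume lt: "pinv w (Suc i) < pinv w i"
  have w': "sw i o w:Sym n" using comp_Sym[OF sw_Sym[OF i] w] .
  have "t i (ac (Tw n (sw i o w)) f) = ac (Tw n (sw i o (sw i o w))) f"
  by (rule ext, rule act_Tw_up[OF w' i]) (use lt in "simp add:pinv_sw_comp[OF w]")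
  hence "t i (ac (Tw n w) f) = t i (t i (ac (Tw n (sw i o w)) f))" by (simp only:sw_sw_comp)
  thus ?thesis using quad[OF i] by (simp add:fun_eq_iff q)
 qed
 show ?thesis using u
 proof (induction rule:Sym_induct)
  case id thus ?case by (simp only:Tw_id id_comp)
 next
  case (sw i u)
  have "ac (Tw n (sw i o u o v)) f = t i (ac (Tw n (u o v)) f)"
  unfolding comp_assoc by (rule up[OF comp_Sym[OF sw(2) v] sw(1)])
  also have "... = ac (Tw n (sw i o u)) (ac (Tw n v) f)"
  unfolding sw(4) by (rule ext) (rule act_Tw_up[OF sw(2,1,3)])
  finally show ?case .
 qed
qed

section \<open>Characters of the symmetric group\<close>

lemma carrier_sym [simp]: "carrier (sym_group n) = Sym n"
 by (auto simp:sym_group_def Sym_def)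

lemma mult_sym [simp]: "u \<otimes>\<^bsub>sym_group n\<^esub> v = u o v"
 by (simp add:sym_group_def)

lemma (in snorm) matrix_chr:
 assumes t: "hk_rep n th (%i. opm r d (A i))" and irr: "irreducible_mats d M"
  and M: "!!B. B:M ==> B:carrier_mat d d & (EX c. ALL f. ALL x<d. opm r d B f x = hk_rep.kac n th (%i. opm r d (A i)) c f x)"
 shows "EX D:Shp n. ALL p:fa n. tr {..<d} (act th (%i. opm r d (A i)) p) = ch D p"
proof -
 have loc: "loc_on {..<d} (act th (%i. opm r d (A i)) p)" for p by (rule act_loc) (rule loc_opm)
 show ?thesis
 proof (rule irr_chr[OF t _ loc, of 0])
  fix w u :: "nat => 'k" assume "EX v:{..<d}. w v ~= 0"
  from irr_mats_kac[OF t kac_loc[OF t loc] irr M this]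
  show "EX c. ALL v:{..<d}. u v = hk_rep.kac n th (%i. opm r d (A i)) c w v" .
 qed (use irr in "auto simp:irreducible_mats_def")
qed

lemma sym_irr_char_iff: "sym_irr_char n y <-> (EX D:Shp n. y = (\<lambda>s\<in>Sym n. chiC n D (Tw n s)))"
proof
 interpret C: snorm n at1 1 of_int by (rule snorm_at1)
 assume "sym_irr_char n y"
 then obtain d r where r: "r:hom (sym_group n) (ring_mat TYPE(complex) d ())" "r id = 1\<^sub>m d"
  "irreducible_mats d (r ` Sym n)" "y = (\<lambda>s\<in>Sym n. mat_trace (r s))" by (auto simp:sym_irr_char_def)
 have c: "r w:carrier_mat d d" if "w:Sym n" for w
  using r(1) that by (auto simp:hom_def ring_mat_simps)
 have m: "r (u o v) = r u * r v" if "u:Sym n" "v:Sym n" for u v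
  using r(1) that by (auto simp:hom_def ring_mat_simps)
 have p: "sw i:Sym n" if "i:{1..<n}" for i using sw_Sym[OF that] .
 let ?t = "%i. opm 1 d (r (sw i))"
 have "hk_rep n at1 (%i. opm (at1 qv) d (r (sw i)))"
 proof (rule opm_rep[OF rhom_at1])
  show "r (sw i) * r (sw i) = (at1 qv - 1) \<cdot>\<^sub>m r (sw i) + at1 qv \<cdot>\<^sub>m 1\<^sub>m d" if i: "i:{1..<n}" for i
  proof -
  have "0 \<cdot>\<^sub>m r (sw i) + 1 \<cdot>\<^sub>m 1\<^sub>m d = (1\<^sub>m d :: complex mat)" using c[OF p[OF i]] by (intro eq_matI) auto
  moreover have "sw i o sw i = id" by (simp)
  ultimately show ?thesis using m[OF p[OF i] p[OF i]] r(2) by simp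
  qed
  show "r (sw i) * (r (sw (Suc i)) * r (sw i)) = r (sw (Suc i)) * (r (sw i) * r (sw (Suc i)))" if i: "1 <= i" "Suc i < n" for i
  using sw_braid[of i "Suc i", unfolded comp_assoc] p[of i] i by (simp flip:m add:comp_Sym)
  show "r (sw i) * r (sw j) = r (sw j) * r (sw i)" if i: "1 <= i" "Suc i < j" "j < n" for i j
  using sw_comm[of i j] i by (simp flip:m)
 qed (use c p in auto)
 hence t: "hk_rep n at1 ?t" by simp
 interpret M: hk_rep n at1 ?t by (rule t)
 have Tw: "M.ac (Tw n w) f x = opm 1 d (r w) f x" if "w:Sym n" "x < d" for w f x
  using that
 proof (induction arbitrary: x rule:Sym_induct)
  case id thus ?case by (simp only:M.Tw_id r(2) opm_one)
 next
  case (sw i u)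
  have "M.ac (Tw n (sw i o u)) f x = opm 1 d (r (sw i)) (M.ac (Tw n u) f) x"
  by (rule M.act_Tw_up[OF sw(2,1,3), symmetric])
  also have "... = opm 1 d (r (sw i)) (opm 1 d (r u) f) x"
  by (rule loc_onD[OF loc_opm]) (use sw in auto)
  also have "... = opm 1 d (r (sw i o u)) f x"
  unfolding m[OF p[OF sw(1)] sw(2)] by (rule opm_mult[OF c[OF p[OF sw(1)]] c[OF sw(2)] sw(5)])
  finally show ?case .
 qed
 have "EX D:Shp n. ALL p:fa n. tr {..<d} (M.ac p) = C.ch D p"
 proof (rule C.matrix_chr[OF t r(3)])
  fix A assume "A:r ` Sym n"
  then obtain u where u: "u:Sym n" "A = r u" by blast
  hence "ALL f. ALL x<d. opm 1 d A f x = M.kac (dl u) f x" by (simp add:M.kac_dl Tw)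
  thus "A:carrier_mat d d & (EX c. ALL f. ALL x<d. opm 1 d A f x = M.kac c f x)" using c u by blast
 qed
 then obtain D where D: "D:Shp n" "!!p. p:fa n ==> tr {..<d} (M.ac p) = C.ch D p" by blast
 have "mat_trace (r w) = C.ch D (Tw n w)" if w: "w:Sym n" for w
 proof -
  have "tr {..<d} (M.ac (Tw n w)) = tr {..<d} (opm 1 d (r w))" by (rule tr_cong) (use Tw w in auto)
  thus ?thesis using D(2)[of "Tw n w"] w c[OF w] by (simp add:tr_opm)
 qed
 thus "EX D:Shp n. y = (\<lambda>s\<in>Sym n. C.ch D (Tw n s))"
  using D(1) r(4) by (intro bexI[of _ D]) (auto)
next
 interpret C: snorm n at1 1 of_int by (rule snorm_at1)
 assume "EX D:Shp n. y = (\<lambda>s\<in>Sym n. C.ch D (Tw n s))"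
 then obtain D where D: "D:Shp n" "y = (\<lambda>s\<in>Sym n. C.ch D (Tw n s))" by blast
 have "C.mm D (Tw n (u o v)) = C.mm D (Tw n u) * C.mm D (Tw n v)" if "u:Sym n" "v:Sym n" for u v
  by (rule C.mm_comp) (simp add:C.V.Tw_grp that)
 hence "(%s. C.mm D (Tw n s)):hom (sym_group n) (ring_mat TYPE(complex) (card (C.stdD D)) ())"
  by (auto simp:hom_def ring_mat_simps)
 moreover have "C.mm D (Tw n id) = 1\<^sub>m (card (C.stdD D))"
 proof -
  have "red n id = []" using len_red[OF id_Sym, of n] by simp
  thus ?thesis using C.mm_wt[of D 1] by (simp add:C.V.th)
 qed
 moreover have "irreducible_mats (card (C.stdD D)) ((%s. C.mm D (Tw n s)) ` Sym n)"
  by (rule C.mm_irr[OF D(1)]) blast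
 moreover have "y = (\<lambda>s\<in>Sym n. mat_trace (C.mm D (Tw n s)))" by (simp only:D(2) C.mm_trace)
 ultimately show "sym_irr_char n y" unfolding sym_irr_char_def carrier_sym by blast
qed

section \<open>Characters of the Hecke algebra\<close>

lemma hk_irr_char_D:
 assumes "hecke_irr_char n F"
 shows "EX D:Shp n. ALL p:fa n. tf (F (cls n p)) = chiL n D p"
proof -
 let ?q = "tf qv"
 interpret L: snorm n tf ?q brL by (rule snorm_fract)
 obtain d y where y: "y:Ring.ring_hom (Hecke n) (ring_mat TYPE(laurent fract) d ())"
  "!!c. y (hecke_const n c) = tf c \<cdot>\<^sub>m 1\<^sub>m d" "irreducible_mats d (y ` carrier (Hecke n))"
  "!!h. h:carrier (Hecke n) ==> tf (F h) = mat_trace (y h)"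
  using assms by (auto simp:hecke_irr_char_def)
 define R where "R p = y (cls n p)" for p
 have c: "R p:carrier_mat d d" if "p:fa n" for p
  using Ring.ring_hom_closed[OF y(1) cls_carrier[OF that]] by (simp add:R_def ring_mat_simps)
 have m: "R (p * r) = R p * R r" if "p:fa n" "r:fa n" for p r
  using Ring.ring_hom_mult[OF y(1) cls_carrier[OF that(1)] cls_carrier[OF that(2)]] that by (simp add:R_def ring_mat_simps cls_mult)
 have a: "R (p + r) = R p + R r" if "p:fa n" "r:fa n" for p r
  using Ring.ring_hom_add[OF y(1) cls_carrier[OF that(1)] cls_carrier[OF that(2)]] that by (simp add:R_def ring_mat_simps cls_add)
 have k: "R (wterm b []) = tf b \<cdot>\<^sub>m 1\<^sub>m d" for b using y(2)[of b] by (simp add:R_def hk_const_cls)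
 have h: "R p = R r" if "heq n p r" "p:fa n" "r:fa n" for p r using that by (simp add:R_def cls_eq_iff[symmetric])
 have s: "R (scal b p) = tf b \<cdot>\<^sub>m R p" if "p:fa n" for b p
  using m[of "wterm b []" p] that c[OF that] by (simp add:k mult_smult_assoc_mat[OF one_carrier_mat c[OF that]])
 have o: "R 1 = 1\<^sub>m d" using k[of 1] by (simp add:one_eq_wt)
 have g: "gen i:fa n" if "i:{1..<n}" for i using that by simp
 let ?t = "%i. opm ?q d (R (gen i))"
 have t: "hk_rep n tf ?t"
 proof (rule opm_rep[OF rhom_to_fract])
  show "R (gen i) * R (gen i) = (?q - 1) \<cdot>\<^sub>m R (gen i) + ?q \<cdot>\<^sub>m 1\<^sub>m d" if i: "i:{1..<n}" for i
  proof -
  have "R (gen i) * R (gen i) = R (scal (qv - 1) (gen i) + scal qv 1)"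
  unfolding m[OF g[OF i] g[OF i], symmetric] by (rule h[OF heq_quad[OF i]]) (use g[OF i] in simp_all)
  also have "... = R (scal (qv - 1) (gen i)) + R (scal qv 1)"
  by (rule a) (use g[OF i] in simp_all)
  finally show ?thesis using s[OF g[OF i], of "qv - 1"] s[of 1 qv] by (simp add:o)
  qed
  show "R (gen i) * (R (gen (Suc i)) * R (gen i)) = R (gen (Suc i)) * (R (gen i) * R (gen (Suc i)))" if i: "1 <= i" "Suc i < n" for i
  proof -
  have gg: "gen i:fa n" "gen (Suc i):fa n" using i by auto
  have "heq n (gen i * (gen (Suc i) * gen i)) (gen (Suc i) * (gen i * gen (Suc i)))"
  using heq_braid[of i n "Suc i"] i by (simp add:mult.assoc)
  from h[OF this] show ?thesis by (simp only:gg m mult_fa)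
  qed
  show "R (gen i) * R (gen j) = R (gen j) * R (gen i)" if i: "1 <= i" "Suc i < j" "j < n" for i j
  proof -
  have gg: "gen i:fa n" "gen j:fa n" using i by auto
  have "heq n (gen i * gen j) (gen j * gen i)" using heq_comm[of i n j] i by simp
  from h[OF this] show ?thesis by (simp only:gg m mult_fa)
  qed
 qed (rule c[OF g])
 interpret M: hk_rep n tf ?t by (rule t)
 have wd: "M.ac (wterm 1 us) l x = opm ?q d (R (wterm 1 us)) l x" if "set us \<subseteq> {1..<n}" "x < d" for us l x
  using that
 proof (induction us arbitrary: x)
  case Nil thus ?case using o by (simp add:M.act_wt opm_one one_eq_wt)
 next
  case (Cons i us)
  have i: "gen i:fa n" "wterm 1 us:fa n" using Cons.prems by auto
  have e: "wterm 1 (i # us) = gen i * wterm 1 us" by (simp add:wt_mult)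
  have "M.ac (wterm 1 (i # us)) l x = ?t i (M.ac (wterm 1 us) l) x" unfolding e by (simp only:M.act_mult M.act_gen)
  also have "... = ?t i (opm ?q d (R (wterm 1 us)) l) x"
  by (rule loc_onD[OF loc_opm]) (use Cons in auto)
  also have "... = opm ?q d (R (wterm 1 (i # us))) l x"
  unfolding e m[OF i] by (rule opm_mult[OF c[OF i(1)] c[OF i(2)] Cons.prems(2)])
  finally show ?case .
 qed
 have ac: "M.ac p l x = opm ?q d (R p) l x" if p: "p:fa n" and x: "x < d" for p l x
 proof -
  have "opm ?q d (R (SUM w:U. scal (cof n p w) (Tw n w))) l x = (SUM w:U. tf (cof n p w) * M.ac (Tw n w) l x)"
  if "finite U" "U \<subseteq> Sym n" for U
  using that
  proof (induction U rule:finite_induct)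
  case empty
  have "R 0 = tf 0 \<cdot>\<^sub>m R 1" using s[of 1 0] by simp
  thus ?case using opm_smult[OF c[OF one_fa] x, of ?q 0] by simp
  next
  case (insert w U)
  have f: "Tw n w:fa n" "scal (cof n p w) (Tw n w):fa n" "(SUM w:U. scal (cof n p w) (Tw n w)):fa n"
  using insert by (auto intro!:sum_fa Tw_fa)
  have "set (red n w) \<subseteq> {1..<n}" using insert set_red by auto
  thus ?case
  using insert wd[of "red n w", OF _ x] opm_add[OF c[OF f(2)] c[OF f(3)] x] opm_smult[OF c[OF f(1)] x]
  by (simp add:a[OF f(2,3)] s[OF f(1)] del:wt_mult)
  qed
  from this[OF fin_Sym order_refl]
  have "opm ?q d (R (SUM w:Sym n. scal (cof n p w) (Tw n w))) l x = M.ac p l x"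
  by (simp only:M.act_cof[OF p])
  moreover have "R p = R (SUM w:Sym n. scal (cof n p w) (Tw n w))"
  by (rule h[OF cof_heq[OF p] p]) (auto)
  ultimately show ?thesis by simp
 qed
 have "EX D:Shp n. ALL p:fa n. tr {..<d} (M.ac p) = L.ch D p"
 proof (rule L.matrix_chr[OF t y(3)])
  fix A assume "A:y ` carrier (Hecke n)"
  then obtain p where p: "p:fa n" "A = R p" using cls_surj by (auto simp:R_def)
  have "ALL l. ALL x<d. opm ?q d A l x = M.kac (%w. tf (cof n p w)) l x"
  using ac[OF p(1)] by (simp add:p M.act_kac[OF p(1), symmetric])
  thus "A:carrier_mat d d & (EX c. ALL l. ALL x<d. opm ?q d A l x = M.kac c l x)" using c[OF p(1)] p(2) by blast
 qed
 then obtain D where D: "D:Shp n" "!!p. p:fa n ==> tr {..<d} (M.ac p) = L.ch D p" by blast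
 have "tf (F (cls n p)) = L.ch D p" if p: "p:fa n" for p
 proof -
  have "tr {..<d} (M.ac p) = tr {..<d} (opm ?q d (R p))" by (rule tr_cong) (use ac p in auto)
  thus ?thesis using D(2)[OF p] y(4)[OF cls_carrier[OF p]] tr_opm[OF c[OF p]] by (simp add:R_def)
 qed
 thus ?thesis using D(1) by blast
qed

lemma hk_irr_char_I:
 assumes D: "D:Shp n" and y: "y:extensional (carrier (Hecke n))"
  "!!p. p:fa n ==> tf (y (cls n p)) = chiL n D p"
 shows "hecke_irr_char n y"
proof -
 interpret L: snorm n tf "tf qv" brL by (rule snorm_fract)
 define f where "f h = L.mm D (SOME p. p:fa n & h = cls n p)" for h
 have f: "f (cls n p) = L.mm D p" if p: "p:fa n" for p
 proof -
  define r where "r = (SOME r. r:fa n & cls n p = cls n r)"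
  have "r:fa n & cls n p = cls n r"
  unfolding r_def by (rule someI_ex) (use p in blast)
  hence "heq n r p" using cls_eq_iff[of r n p] p by metis
  thus ?thesis unfolding f_def r_def[symmetric] by (rule L.mm_heq)
 qed
 let ?d = "card (L.stdD D)"
 have "f:Ring.ring_hom (Hecke n) (ring_mat TYPE(laurent fract) ?d ())"
 proof (rule Ring.ring_hom_memI)
  fix h k assume "h:carrier (Hecke n)" "k:carrier (Hecke n)"
  then obtain p r where p: "p:fa n" "h = cls n p" "r:fa n" "k = cls n r" using cls_surj by metis
  have "L.mm D (p * r) = L.mm D p * L.mm D r" by (rule L.mm_comp) (rule L.V.act_mult)
  moreover have "L.mm D (p + r) = L.mm D p + L.mm D r"
  by (rule eq_matI) (simp_all add:L.mm_def L.me_def L.V.act_add)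
  ultimately show "f (h \<otimes>\<^bsub>Hecke n\<^esub> k) = f h \<otimes>\<^bsub>ring_mat TYPE(laurent fract) ?d ()\<^esub> f k"
  "f (h \<oplus>\<^bsub>Hecke n\<^esub> k) = f h \<oplus>\<^bsub>ring_mat TYPE(laurent fract) ?d ()\<^esub> f k"
  using p by (simp_all add:cls_mult cls_add f ring_mat_simps)
 next
  fix h assume "h:carrier (Hecke n)"
  then obtain p where "p:fa n" "h = cls n p" using cls_surj by metis
  thus "f h:carrier (ring_mat TYPE(laurent fract) ?d ())" by (simp add:f ring_mat_simps)
 next
  show "f \<one>\<^bsub>Hecke n\<^esub> = \<one>\<^bsub>ring_mat TYPE(laurent fract) ?d ()\<^esub>"
  using L.mm_wt[of D 1] by (simp add:cls_one f ring_mat_simps one_eq_wt)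
 qed
 moreover have "f (hecke_const n c) = tf c \<cdot>\<^sub>m 1\<^sub>m ?d" for c
  unfolding hk_const_cls by (subst f) (simp_all add:L.mm_wt)
 moreover have "irreducible_mats ?d (f ` carrier (Hecke n))"
 proof (rule L.mm_irr[OF D])
  fix w assume "w:Sym n"
  thus "L.mm D (Tw n w):f ` carrier (Hecke n)"
  by (intro image_eqI[of _ _ "cls n (Tw n w)"]) (simp_all add:f)
 qed
 moreover have "tf (y h) = mat_trace (f h)" if "h:carrier (Hecke n)" for h
  using cls_surj[OF that] y(2) by (auto simp:f L.mm_trace)
 ultimately show ?thesis unfolding hecke_irr_char_def using y(1) by blast
qed

section \<open>Identification of the symmetric group characters\<close>

lemma young_subgroup_YS:
 assumes "sum_list u = n" shows "young_subgroup u = YS 1 n (cuts n (bw u))"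
proof -
 interpret B: base_wd n "bw u" by (rule base_wd_bw)
 let ?B = "%k. {i:{1..n}. blk u i = k}"
 have block: "{sum_list (take k u) <.. sum_list (take (Suc k) u)} = ?B k" if "k < length u" for k
 proof -
  have "psum u (Suc k) <= n" using psum_mono[of "Suc k" "length u" u] that assms by (simp add:psum_def)
  hence "i:?B k <-> psum u k < i & i <= psum u (Suc k)" for i
  using blk_props[of i u] blk_iff[OF that, of i] assms by auto
  thus ?thesis by (intro Set.set_eqI) (simp only:psum_def greaterThanAtMost_iff)
 qed
 have "s:YS 1 n B.bF" if s: "s permutes {1..n}" "!!k. k < length u ==> s ` ?B k = ?B k" for s
 proof (rule B.YS_base)
  show "bw u o s = bw u"
  proof
  fix i show "(bw u o s) i = bw u i"
  proof (cases "i:{1..n}")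
  case True
  hence "s i:?B (blk u i)" using s(2)[of "blk u i"] blk_props(1)[of i u] assms by blast
  thus ?thesis by (simp add:bw_def)
  qed (use permutes_not_in[OF s(1)] in simp)
  qed
 qed (use s in "simp add:Sym_def")
 moreover have "s ` ?B k = ?B k" if s: "s:YS 1 n B.bF" for s k
 proof (rule card_subset_eq)
  have "blk u (s i) = blk u i" for i using fun_cong[OF B.base_YS[OF s], of i] by (simp add:bw_eq)
  thus "s ` ?B k \<subseteq> ?B k" using YS_mem[OF s] by auto
  show "card (s ` ?B k) = card (?B k)" by (rule card_image) (use Sym_inj[OF YS_perm[OF s]] in "auto intro:inj_on_subset")
 qed simp
 moreover have "s:young_subgroup u <-> s permutes {1..n} & (ALL k<length u. s ` ?B k = ?B k)" for s
  using assms by (simp only:young_subgroup_def Let_def block mem_Collect_eq cong: conj_cong imp_cong)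
 moreover have "s permutes {1..n}" if "s:YS 1 n B.bF" for s using YS_perm[OF that] by (simp only:Sym_def mem_Collect_eq)
 ultimately show ?thesis by (intro Set.set_eqI) meson
qed

context
 fixes n :: nat
begin

interpretation C: snorm n at1 1 of_int by (rule snorm_at1)

lemma chiC_class:
 assumes u: "u:Sym n" and w: "w:Sym n"
 shows "chiC n D (Tw n (u o w o pinv u)) = chiC n D (Tw n w)"
proof -
 have p: "pinv u:Sym n" "u o w:Sym n" using u w by (auto intro:pinv_Sym comp_Sym)
 have g: "C.V.ac (Tw n (a o b)) f = C.V.ac (Tw n a) (C.V.ac (Tw n b) f)" if "a:Sym n" "b:Sym n" for a b f
  by (rule C.V.Tw_grp[OF at1_q that])
 have "C.ch D (Tw n (u o w o pinv u)) = tr (C.stdD D) (%f. C.V.ac (Tw n (u o w)) (C.V.ac (Tw n (pinv u)) f))"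
  unfolding C.ch_tr g[OF p(2,1)] ..
 also have "... = tr (C.stdD D) (%f. C.V.ac (Tw n (pinv u)) (C.V.ac (Tw n (u o w)) f))"
  by (rule tr_comm) (simp_all add:C.V.lin_act C.loc_act)
 also have "... = C.ch D (Tw n w)"
 proof -
  have "pinv u o (u o w) = w" using u by (simp add:fun_eq_iff)
  thus ?thesis unfolding C.ch_tr by (simp only:g[OF p, symmetric])
 qed
 finally show ?thesis .
qed

text \<open>Frobenius reciprocity: conjugation by \<open>l\<close> permutes the group and preserves
  the character, so every \<open>l\<close> contributes the same sum over \<open>H\<close>.\<close>

lemma char_inner_ind2:
 assumes H: "H \<subseteq> Sym n"
 shows "char_inner n (\<lambda>s\<in>Sym n. chiC n D (Tw n s)) (induced_char n H g) =
  (SUM h:H. chiC n D (Tw n h) * cnj (g h)) / of_nat (card H)"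
proof -
 let ?c = "%w. chiC n D (Tw n w)" and ?f = "%w. if w:H then g w else 0"
 have inner: "(SUM s:Sym n. ?c s * cnj (?f (pinv l o s o l))) = (SUM h:H. ?c h * cnj (g h))" if t: "l:Sym n" for l
 proof -
  have "(SUM s:Sym n. ?c s * cnj (?f (pinv l o s o l))) = (SUM h:Sym n. ?c (l o h o pinv l) * cnj (?f h))"
  by (rule sum.reindex_bij_witness[where i = "%h. l o h o pinv l" and j = "%s. pinv l o s o l"])
  (use t in "auto simp:fun_eq_iff comp_Sym pinv_Sym simp del:comp_apply", auto simp:comp_def)
  also have "... = (SUM h:Sym n. if h:H then ?c h * cnj (g h) else 0)"
  by (rule sum.cong) (auto simp:chiC_class[OF t])
  finally show ?thesis using H by (simp add:sum.inter_restrict[symmetric] Int_absorb1)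
 qed
 have "char_inner n (\<lambda>s\<in>Sym n. ?c s) (induced_char n H g) =
  (SUM s:Sym n. SUM l:Sym n. ?c s * cnj (?f (pinv l o s o l))) / (of_nat (card H) * fact n)"
  by (simp add:char_inner_def induced_char_def Let_def sum_distrib_left sum_divide_distrib)
 also have "(SUM s:Sym n. SUM l:Sym n. ?c s * cnj (?f (pinv l o s o l))) = fact n * (SUM h:H. ?c h * cnj (g h))"
  by (subst sum.swap) (simp add:inner card_Sym)
 finally show ?thesis by (simp only:mult.commute[of _ "fact n"] mult_divide_mult_cancel_left[OF fact_nonzero])
qed

definition semi :: "nat set => ((nat => nat) => int) => ((nat => cell) => complex) => bool" where
 "semi F f g <-> (ALL h:YS 1 n F. C.V.ac (Tw n h) g = (%z. of_int (f h) * g z))"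

text \<open>The average is the trace of the projection \<open>e\<close> onto the vectors on which
  the Young subgroup acts through \<open>m\<close>, and a nonzero idempotent has nonzero trace in
  characteristic 0.\<close>

lemma avg_nz:
 assumes m: "!!u v. u:Sym n ==> v:Sym n ==> m (u o v) = m u * m v" "!!u. m u * m u = 1"
 shows "(SUM h:YS 1 n F. chiC n D (Tw n h) * of_int (m h)) / of_nat (card (YS 1 n F)) ~= 0 <->
  (EX l. semi F m l & (EX z:C.stdD D. l z ~= 0))"
proof -
 let ?H = "YS 1 n F"
 define e where "e f z = (SUM h:?H. of_int (m h) / of_nat (card ?H) * C.V.ac (Tw n h) f z)" for f z
 have H: "?H \<subseteq> Sym n" using YS_perm by blast
 have c: "of_nat (card ?H) ~= (0::complex)" using id_YS[of 1 n F] fin_YS[of 1 n F] card_0_eq by (metis empty_iff of_nat_eq_0_iff)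
 have lin: "lin_op e"
  unfolding lin_op_def e_def
  by (simp add:lin_op_add[OF C.V.lin_act] lin_op_scale[OF C.V.lin_act] sum.distrib sum_distrib_left algebra_simps)
 have loc: "loc_on (C.stdD D) e"
  unfolding loc_on_def e_def
  by (intro allI impI ballI sum.cong refl arg_cong[of _ _ "(*) _"] loc_onD[OF C.loc_act(2)]) auto
 have semi_e: "C.V.ac (Tw n g) (e f) z = of_int (m g) * e f z" if g: "g:?H" for g f z
 proof -
  have gp: "g:Sym n" using g H by blast
  have "C.V.ac (Tw n g) (e f) z = (SUM h:?H. of_int (m h) / of_nat (card ?H) * C.V.ac (Tw n (g o h)) f z)"
  unfolding e_def[abs_def] lin_op_sum[OF C.V.lin_act] lin_op_scale[OF C.V.lin_act]
  by (rule sum.cong) (use H in "auto simp:C.V.Tw_grp[OF at1_q gp] simp del:comp_apply")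
  also have "... = (SUM h:?H. of_int (m (pinv g o h)) / of_nat (card ?H) * C.V.ac (Tw n h) f z)"
  proof (rule sum.reindex_bij_witness[where i = "%h. pinv g o h" and j = "%h. g o h"])
  fix h assume h: "h:?H"
  show "pinv g o (g o h) = h" "g o (pinv g o h) = h" using gp by (simp_all add:fun_eq_iff)
  thus "of_int (m (pinv g o (g o h))) / of_nat (card ?H) * C.V.ac (Tw n (g o h)) f z =
  of_int (m h) / of_nat (card ?H) * C.V.ac (Tw n (g o h)) f z" by (simp only:)
  show "g o h:?H" "pinv g o h:?H" using g h by (auto intro:comp_YS pinv_YS)
  qed
  also have "... = of_int (m g) * e f z"
  proof -
  have "m (pinv g o h) = m g * m h" if h: "h:?H" for h
  proof -
  have "m h = m (g o (pinv g o h))" using gp by (intro arg_cong[of _ _ m]) (simp add:fun_eq_iff)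
  also have "... = m g * m (pinv g o h)" by (rule m(1)[OF gp comp_Sym[OF pinv_Sym[OF gp]]]) (use h H in blast)
  finally show ?thesis using m(2)[of g] by (simp)
  qed
  thus ?thesis by (simp add:e_def sum_distrib_left mult.assoc)
  qed
  finally show ?thesis .
 qed
 have fx: "e l z = l z" if "semi F m l" for l z
 proof -
  have "e l z = (SUM h:?H. 1 / of_nat (card ?H) * l z)"
  unfolding e_def
  proof (rule sum.cong[OF refl])
  fix h assume "h:?H"
  moreover have "of_int (m h) * of_int (m h) = (1::complex)" using m(2)[of h] by (metis of_int_1 of_int_mult)
  ultimately show "of_int (m h) / of_nat (card ?H) * C.V.ac (Tw n h) l z = 1 / of_nat (card ?H) * l z"
  using that by (simp add:semi_def)
  qed
  thus ?thesis using c by simp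
 qed
 have se: "semi F m (e f)" for f by (auto simp:semi_def semi_e)
 have "tr (C.stdD D) e = (SUM h:?H. C.ch D (Tw n h) * of_int (m h)) / of_nat (card ?H)"
  unfolding e_def[abs_def] tr_sum tr_scl C.ch_tr sum_divide_distrib by (rule sum.cong) auto
 moreover have "tr (C.stdD D) e ~= 0 <-> (EX f. EX z:C.stdD D. e f z ~= 0)"
 proof -
  obtain k where "tr (C.stdD D) e = of_nat k" "(EX f. EX z:C.stdD D. e f z ~= 0) --> k ~= 0"
  using idempotent_trace[OF C.fin_stdD lin loc] fx[OF se] by blast
  moreover have "tr (C.stdD D) e = 0" if "~ (EX f. EX z:C.stdD D. e f z ~= 0)" using that by (simp add:tr_def)
  ultimately show ?thesis by auto
 qed
 moreover have "(EX f. EX z:C.stdD D. e f z ~= 0) <-> (EX l. semi F m l & (EX z:C.stdD D. l z ~= 0))"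
  using se fx by metis
 ultimately show ?thesis by simp
qed

lemma Tw_sw: "i:{1..<n} ==> C.V.ac (Tw n (sw i)) f = C.sn i f"
proof
 fix z assume i: "i:{1..<n}"
 have "C.sn i (C.V.ac (Tw n id) f) z = C.V.ac (Tw n (sw i o id)) f z" by (rule C.V.act_Tw_up[OF id_Sym i]) simp
 thus "C.V.ac (Tw n (sw i)) f z = C.sn i f z" by (simp only:C.V.Tw_id comp_id)
qed

lemma semi_links: "semi F f g ==> i:links 1 n F ==> C.sn i g = (%z. of_int (f (sw i)) * g z)"
 using sw_YS[of i 1 n F] Tw_sw[of i g] by (auto simp:semi_def links_def)

lemma sign_avg:
 "(EX g. semi F sign g & (EX z:C.stdD D. g z ~= 0)) <-> C.YY D F ~= {}"
proof
 assume "EX g. semi F sign g & (EX z:C.stdD D. g z ~= 0)"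
 then obtain g z where p: "semi F sign g" "z:C.stdD D" "g z ~= 0" by blast
 have "C.V.sgnv F g"
  unfolding C.V.sgnv_def using semi_links[OF p(1)] by (auto simp:sign_swap_id)
 thus "C.YY D F ~= {}" using C.sgnv_vanish[of F g D z] p by blast
next
 assume "C.YY D F ~= {}"
 then obtain y where y: "y:C.YY D F" by blast
 have "semi F sign (C.phy F y)"
  unfolding semi_def using C.V.Tw_sgnv[OF C.sgnv_phy[OF y] _ id_Sym] by (auto simp:C.V.Tw_id)
 moreover have "C.phy F y y = 1" "y:C.stdD D" using C.phy_YY[OF y y] y by (auto simp:C.YY_def)
 ultimately show "EX g. semi F sign g & (EX z:C.stdD D. g z ~= 0)" by (metis zero_neq_one)
qed

text \<open>Mirror image of \<open>sgnv_vanish\<close>, with a filling in the support that maximizes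
  the potential.\<close>

lemma triv_avg:
 assumes "semi F (%_. 1) g" "z:C.stdD D" "g z ~= 0"
 shows "EX z:C.stdD D. ALL i:links 1 n F. ct (z i) < ct (z (Suc i))"
proof -
 define G where "G z = (SUM k:{1..n}. int k * ct (z k))" for z :: "nat => cell"
 let ?S = "{z:C.stdD D. g z ~= 0}"
 have "Max (G ` ?S):G ` ?S" using assms by (intro Max_in) auto
 then obtain x where x: "x:C.stdD D" "g x ~= 0" and max: "G x = Max (G ` ?S)" by auto
 have xs: "x:std n" using x by (simp add:C.stdD_def)
 have "ct (x i) < ct (x (Suc i))" if i: "i:links 1 n F" for i
 proof (rule ccontr)
  assume n: "~ ?thesis"
  have ii: "i:{1..<n}" using i by (auto simp:links_def)
  let ?d = "C.dd i x"
  have d: "?d < 0" using n std_swp_iff(2)[OF xs ii] by simp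
  have eq: "C.aa ?d * g x + C.bb ?d * g (x o sw i) = g x"
  using semi_links[OF assms(1) i] C.sn_eval[OF xs ii, of g] by simp
  have "?d ~= - 1" using eq x(2) by (auto simp:C.bb_def)
  hence d1: "\<bar>?d\<bar> ~= 1" using d by linarith
  have "C.aa ?d ~= 1"
  proof -
  have "of_int ?d ~= (1::complex)" using d by (simp only:of_int_eq_1_iff)
  thus ?thesis by (simp add:C.aa_def)
  qed
  hence nz: "g (x o sw i) ~= 0" using eq x(2) by auto
  have "x o sw i:C.stdD D"
  using std_swp_iff(1)[OF xs ii] d1 shape_sw[OF ii, of x] x(1) by (simp only:C.stdD_def) simp
  hence "G (x o sw i) <= G x" unfolding max using nz by (intro Max_ge) (auto)
  moreover have "G (x o sw i) - G x = - ?d"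
  proof -
  have "G (x o sw i) - G x = (SUM k:{1..n}. int k * (ct (x (sw i k)) - ct (x k)))"
  by (simp add:G_def sum_subtractf right_diff_distrib)
  also have "... = (SUM k:{i, Suc i}. int k * (ct (x (sw i k)) - ct (x k)))"
  by (rule sum.mono_neutral_right) (use ii in "auto simp:transpose_def")
  finally show ?thesis by (simp add:algebra_simps)
  qed
  ultimately show False using d by linarith
 qed
 thus ?thesis using x by blast
qed

lemma swp_std: "z:std n ==> swp o z:std n"
 unfolding std_def mem_Collect_eq image_comp[symmetric]
 by (simp add:swp_dia comp_inj_on)

lemma ct_swp [simp]: "ct (swp A) = - ct A"
 by (simp add:ct_def)

lemma swp_stdD: "z:C.stdD D ==> swp o z:C.stdD (swp ` D)"
 unfolding C.stdD_def mem_Collect_eq image_comp[symmetric] using swp_std[of z] by blast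

text \<open>In the filling that runs along the rows, consecutive entries of a block are neighbours
  in a row, where the generator acts as \<open>q\<close>, here 1; so its basis vector is
  invariant.\<close>

lemma triv_ex:
 assumes m: "m:partitions n"
 shows "EX g. semi (cuts n (bw m)) (%_. 1) g & (EX z:C.stdD (YD m). g z ~= 0)"
proof -
 let ?F = "cuts n (bw m)"
 have s: "DT m:Shp n" "sum_list m = n"
  using part_shape[OF m] m by (simp_all add:DT_swp Shp_swp partitions_def)
 have "SY n (DT m) m ~= {}" using card_SY[OF s] SSD_DT[OF s(1)] by auto
 then obtain y where y: "y:SY n (DT m) m" by blast
 have ys: "y:std n" "shape n y = DT m" using y by (auto simp:SY_def[OF s])
 have row: "blk m p = snd (y p)" if p: "p:{1..n}" for p
 proof -
  have "to_tab n (DT m) m y = (\<lambda>A\<in>DT m. snd A)" using to_tab_SSD(1)[OF s y] SSD_DT[OF s(1)] by simp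
  moreover have "y p:DT m" "inv_into {1..n} y (y p) = p" using ys p by (auto simp:std_def)
  ultimately show ?thesis unfolding to_tab_def[OF s] by (metis restrict_apply')
 qed
 define z where "z = swp o y"
 have z: "z:C.stdD (YD m)"
 proof -
  have "swp ` DT m = YD m" by (simp add:DT_swp image_image)
  moreover have "y:C.stdD (DT m)" unfolding C.stdD_def using ys by blast
  ultimately show ?thesis unfolding z_def using swp_stdD[of y "DT m"] by simp
 qed
 hence zs: "z:std n" by (simp add:C.stdD_def)
 have sz: "C.sn i (dl z) = dl z" if i: "i:links 1 n ?F" for i
 proof
  fix x
  have ii: "i:{1..<n}" "blk m i = blk m (Suc i)" using i by (auto simp:links_def cuts_def bw_eq)
  have dec: "ct (y (Suc i)) < ct (y i)" using y ii by (simp add:SY_def[OF s])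
  have "snd (y i) = snd (y (Suc i))" using row[of i] row[of "Suc i"] ii by simp
  hence "cell_le (z i) (z (Suc i))" "ct (z i) < ct (z (Suc i))"
  using dec by (auto simp:z_def cell_le_def ct_def)
  hence d: "z o sw i ~: std n" "C.dd i z = 1"
  using std_swp_cell_le[OF zs ii(1)] std_swp_iff(1)[OF zs ii(1)] by auto
  show "C.sn i (dl z) x = dl z x"
  proof (cases "x = z")
  case True
  thus ?thesis using ii d by (simp add:C.sn_def C.bb_def)
  next
  case False
  have "x o sw i ~= z" if "x:std n" using that d(1) by (metis comp_sw_sw)
  thus ?thesis using False by (auto simp:C.sn_def dl_def)
  qed
 qed
 have "semi ?F (%_. 1) (dl z)"
  unfolding semi_def
 proof
  fix h assume "h:YS 1 n ?F"
  from le_refl le_refl this have "C.V.ac (Tw n h) (dl z) = dl z"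
  proof (induction rule:YS_induct)
  case id show ?case by (rule C.V.Tw_id)
  next
  case (sw i u)
  have "i:{1..<n}" using sw(1) by (auto simp:links_def)
  hence "C.V.ac (Tw n (sw i o u)) (dl z) = C.sn i (C.V.ac (Tw n u) (dl z))"
  by (intro ext) (rule C.V.act_Tw_up[OF YS_perm[OF sw(2)] _ sw(3), symmetric])
  thus ?case by (simp only:sw(4) sz[OF sw(1)])
  qed
  thus "C.V.ac (Tw n h) (dl z) = (%x. of_int 1 * dl z x)" by simp
 qed
 moreover have "dl z z ~= (0::complex)" by (simp add:dl_def)
 ultimately show ?thesis using z by blast
qed

text \<open>For a common constituent of shape \<open>D\<close>, the invariant vector bounds the sum
  of the row indices of \<open>D\<close> from above and the sign vector bounds it from below, by the
  two inequalities of \<open>SSD_sums\<close>; equality forces \<open>D = YD m\<close>.\<close>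

theorem sym_char_chiC:
 assumes m: "m:partitions n"
 shows "sym_char n m = (\<lambda>s\<in>Sym n. chiC n (YD m) (Tw n s))"
proof -
 let ?c = "%D. (\<lambda>s\<in>Sym n. chiC n D (Tw n s))"
 let ?u = "conjugate m"
 let ?F = "cuts n (bw m)" and ?G = "cuts n (bw ?u)"
 have sum: "sum_list m = n" "sum_list ?u = n" using m sum_list_conj by (auto simp:partitions_def)
 have sub: "YS 1 n F \<subseteq> Sym n" for F using YS_perm by blast
 have triv: "char_inner n (?c D) (induced_char n (young_subgroup m) (%_. 1)) ~= 0 <->
  (EX g. semi ?F (%_. 1) g & (EX z:C.stdD D. g z ~= 0))" for D
 proof -
  have "(SUM h:YS 1 n ?F. chiC n D (Tw n h) * of_int 1) / of_nat (card (YS 1 n ?F)) ~= 0 <->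
  (EX g. semi ?F (%_. 1) g & (EX z:C.stdD D. g z ~= 0))"
  by (rule avg_nz) simp_all
  thus ?thesis unfolding young_subgroup_YS[OF sum(1)] char_inner_ind2[OF sub] by (simp only:complex_cnj_one of_int_1)
 qed
 have sgn: "char_inner n (?c D) (induced_char n (young_subgroup ?u) (%s. of_int (sign s))) ~= 0 <-> C.YY D ?G ~= {}" for D
  unfolding young_subgroup_YS[OF sum(2)] char_inner_ind2[OF sub] complex_cnj_of_int sign_avg[symmetric]
  by (rule avg_nz) (auto simp:sign_compose Sym_permutation)
 have Y: "YD m:Shp n" by (rule part_shape[OF m])
 show ?thesis unfolding sym_char_def
 proof (rule the_equality)
  have "C.YY (YD m) ?G ~= {}"
  using C.card_YY_bw[OF Y sum(2)] SSD_DT[of ?u n] Y by (auto simp:DT_conj[OF m])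
  thus "sym_irr_char n (?c (YD m)) &
  char_inner n (?c (YD m)) (induced_char n (young_subgroup m) (%_. 1)) ~= 0 &
  char_inner n (?c (YD m)) (induced_char n (young_subgroup ?u) (%s. of_int (sign s))) ~= 0"
  unfolding triv sgn sym_irr_char_iff using triv_ex[OF m] Y by blast
 next
  fix y assume a: "sym_irr_char n y &
  char_inner n y (induced_char n (young_subgroup m) (%_. 1)) ~= 0 &
  char_inner n y (induced_char n (young_subgroup ?u) (%s. of_int (sign s))) ~= 0"
  then obtain D where D: "D:Shp n" "y = ?c D" unfolding sym_irr_char_iff by blast
  have dD: "dia D" "dia (swp ` D)" "swp ` D:Shp n"
  using D(1) by (simp_all add:Shp_def swp_dia card_image)
  obtain g z where "semi ?F (%_. 1) g" "z:C.stdD D" "g z ~= 0" using a unfolding D(2) triv by blast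
  from triv_avg[OF this] obtain z where z: "z:C.stdD D" "!!i. i:links 1 n ?F ==> ct (z i) < ct (z (Suc i))" by blast
  have "swp o z:C.YY (swp ` D) ?F"
  using swp_stdD[OF z(1)] z(2) by (simp add:C.YY_def)
  hence "SSD (swp ` D) m ~= {}"
  using C.card_YY_bw[OF dD(3) sum(1)] C.fin_YY by (metis card.empty empty_iff card_0_eq)
  then obtain t where t: "t:SSD (swp ` D) m" by blast
  have "C.YY D ?G ~= {}" using a unfolding D(2) sgn by blast
  hence "SSD D ?u ~= {}"
  using C.card_YY_bw[OF D(1) sum(2)] C.fin_YY by (metis card.empty card_0_eq)
  then obtain t' where t': "t':SSD D ?u" by blast
  have swap_sum: "(SUM A:swp ` E. snd A) = (SUM A:E. fst A)" for E :: "cell set"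
  by (subst sum.reindex) simp_all
  have "(SUM A:swp ` D. snd A) = (SUM A:DT m. snd A)"
  using SSD_sums(1)[OF dD(2) t] SSD_sums(2)[OF dD(1) t', unfolded DT_conj[OF m]] by (simp add:DT_swp swap_sum)
  hence "swp ` D = DT m" using SSD_sums(3)[OF dD(2) t] by blast
  hence "swp ` swp ` D = swp ` DT m" by simp
  hence "D = YD m" by (simp add:DT_swp image_image)
  thus "y = ?c (YD m)" using D(2) by simp
 qed
qed

end

section \<open>Induced sign characters as traces\<close>

definition "ttr n b p = tr (words n b) (act (%c. c) (tn_op qv) p)"

lemma rhom_tn_wd:
 assumes "rhom th" shows "th (foldr (tn_op q) us (dl f) m) = foldr (tn_op (th q)) us (dl f) m"
 by (induction us arbitrary: m) (simp_all add:dl_def tn_op_def rhom_simps[OF assms])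

lemma rhom_ttr:
 assumes "rhom th" shows "th (ttr n b p) = tr (words n b) (act th (tn_op (th qv)) p)"
 by (simp add:ttr_def tr_def act_def rhom_sum[OF assms] rhom_simps[OF assms] rhom_tn_wd[OF assms])

lemma rhom_of_nat: "rhom th ==> th (of_nat k) = of_nat k"
 by (induction k) (simp_all add:rhom_simps)

lemma ttr_SSD:
 assumes "snorm th q br" "sum_list u = n" "p:fa n"
 shows "th (ttr n (bw u) p) = (SUM D:Shp n. of_nat (card (SSD D u)) * snorm.ch n th q br D p)"
proof -
 interpret snorm n th q br by (rule assms)
 show ?thesis
  unfolding rhom_ttr[OF rhom] q_def[symmetric] trace_tn[OF base_wd_bw assms(3)]
  by (rule sum.cong) (simp_all add:card_YY_bw[OF _ assms(2)])
qed

text \<open>By \<open>SSD_sums\<close> the multiplicities are unitriangular, so the traces on words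
  can be solved for the characters with integer coefficients, by induction on the sum of column
  indices. The same Laurent polynomial serves both specializations because \<open>ttr_SSD\<close>
  reads alike in each; this links \<open>hecke_char\<close> to \<open>sym_char\<close>.\<close>

lemma intg_chr:
 "D:Shp n ==> EX y. ALL p:fa n. tf (y p) = chiL n D p & at1 (y p) = chiC n D p"
proof (induction "SUM A:D. snd A" arbitrary: D rule:less_induct)
 case less
 obtain u where nu: "u:partitions n" "YD u = swp ` D"
  using shape_part Shp_swp less.prems by blast
 hence D: "DT u = D" "sum_list u = n" by (simp_all add:DT_swp image_image partitions_def)
 have "ALL E. EX y. E:Shp n --> (SUM A:E. snd A) < (SUM A:D. snd A) -->
  (ALL p:fa n. tf (y p) = chiL n E p & at1 (y p) = chiC n E p)"
  using less.hyps by blast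
 then obtain X where X: "tf (X E p) = chiL n E p" "at1 (X E p) = chiC n E p"
  if "E:Shp n" "(SUM A:E. snd A) < (SUM A:D. snd A)" "p:fa n" for E p by metis
 have small: "(SUM A:E. snd A) < (SUM A:D. snd A)" if E: "E:Shp n" "E ~= D" "SSD E u ~= {}" for E
 proof -
  obtain t where t: "t:SSD E u" using E(3) by blast
  have "dia E" using E(1) by (simp add:Shp_def)
  from SSD_sums(1)[OF this t] SSD_sums(3)[OF this t] show ?thesis using E(2) D(1) by fastforce
 qed
 define y where "y p = ttr n (bw u) p - (SUM E:Shp n - {D}. of_nat (card (SSD E u)) * X E p)" for p
 have "th (y p) = snorm.ch n th q br D p"
  if s: "snorm th q br" and p: "p:fa n"
  and X: "!!E. E:Shp n ==> (SUM A:E. snd A) < (SUM A:D. snd A) ==> th (X E p) = snorm.ch n th q br E p"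
  for th :: "laurent => 'k::field_char_0" and q br p
 proof -
  interpret S: snorm n th q br by (rule s)
  have "of_nat (card (SSD E u)) * th (X E p) = of_nat (card (SSD E u)) * S.ch E p" if "E:Shp n - {D}" for E
  using that X[of E] small[of E] by (cases "SSD E u = {}") auto
  hence "(SUM E:Shp n - {D}. of_nat (card (SSD E u)) * th (X E p)) =
  (SUM E:Shp n - {D}. of_nat (card (SSD E u)) * S.ch E p)" by (intro sum.cong refl)
  moreover have "card (SSD D u) = 1" using SSD_DT[of u n] less.prems by (simp add:D)
  ultimately show ?thesis
  by (simp add:y_def rhom_simps[OF S.rhom] rhom_sum[OF S.rhom] rhom_of_nat[OF S.rhom] ttr_SSD[OF s D(2) p]
  sum.remove[OF fin_Shp less.prems])
 qed
 from this[OF snorm_fract _ X(1)] this[OF snorm_at1 _ X(2)] show ?case by blast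
qed

lemma hk_char_chiL:
 assumes m: "m:partitions n" and p: "p:fa n"
 shows "tf (hecke_char n m (cls n p)) = chiL n (YD m) p"
proof -
 interpret L: snorm n tf "tf qv" brL by (rule snorm_fract)
 interpret C: snorm n at1 1 of_int by (rule snorm_at1)
 let ?D = "YD m"
 have D: "?D:Shp n" by (rule part_shape[OF m])
 obtain X where X: "!!p. p:fa n ==> tf (X p) = L.ch ?D p & at1 (X p) = C.ch ?D p"
  using intg_chr[OF D] by blast
 define y where "y = (\<lambda>h\<in>carrier (Hecke n). X (SOME p. p:fa n & h = cls n p))"
 have y: "tf (y (cls n p)) = L.ch ?D p" "at1 (y (cls n p)) = C.ch ?D p" if p: "p:fa n" for p
 proof -
  define r where "r = (SOME r. r:fa n & cls n p = cls n r)"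
  have r: "r:fa n & cls n p = cls n r"
  unfolding r_def by (rule someI_ex) (use p in blast)
  hence "cof n r w = cof n p w" if "w:Sym n" for w
  using cls_eq_iff[of r n p] heq_iff_cof[of r n p] p that by auto
  hence "L.ch ?D r = L.ch ?D p" "C.ch ?D r = C.ch ?D p"
  unfolding L.ch_expand[OF p] C.ch_expand[OF p] L.ch_expand[OF r[THEN conjunct1]] C.ch_expand[OF r[THEN conjunct1]]
  by (simp_all only:cong: sum.cong)
  moreover have "y (cls n p) = X r" unfolding y_def r_def using p by simp
  ultimately show "tf (y (cls n p)) = L.ch ?D p" "at1 (y (cls n p)) = C.ch ?D p" using X r by simp_all
 qed
 have "hecke_char n m = y" unfolding hecke_char_def
 proof (rule the_equality)
  have "hecke_irr_char n y" by (rule hk_irr_char_I[OF D _ y(1)]) (simp_all only:y_def restrict_extensional)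
  thus "hecke_irr_char n y &
  (ALL w:carrier (sym_group n). of_int (laurent_at_one (y (hecke_T n w))) = sym_char n m w)"
  by (simp add:hk_T_cls sym_char_chiC[OF m] carrier_sym y(2) flip:at1_def)
 next
  fix f assume a: "hecke_irr_char n f &
  (ALL w:carrier (sym_group n). of_int (laurent_at_one (f (hecke_T n w))) = sym_char n m w)"
  obtain E where E: "E:Shp n" "!!p. p:fa n ==> tf (f (cls n p)) = L.ch E p"
  using hk_irr_char_D a by blast
  obtain Y where Y: "!!p. p:fa n ==> tf (Y p) = L.ch E p & at1 (Y p) = C.ch E p"
  using intg_chr[OF E(1)] by blast
  have eta: "f (cls n p) = Y p" if "p:fa n" for p
  using E(2)[OF that] Y[OF that] by (metis to_fract_eq_iff)
  \<comment> \<open>Characters of different shapes remain different at \<open>q = 1\<close>.\<close>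
  have "E = ?D"
  proof (rule C.ch_inj[OF E(1)])
  fix w assume w: "w:Sym n"
  have "at1 (f (hecke_T n w)) = sym_char n m w" unfolding at1_def using a w by (simp)
  thus "C.ch E (Tw n w) = C.ch ?D (Tw n w)"
  using w Y[OF Tw_fa[OF w]] by (simp add:hk_T_cls eta sym_char_chiC[OF m])
  qed
  hence "f (cls n p) = y (cls n p)" if "p:fa n" for p
  using E(2)[OF that] y(1)[OF that] by (metis to_fract_eq_iff)
  hence "f h = y h" if "h:carrier (Hecke n)" for h using cls_surj[OF that] by blast
  moreover have "f:extensional (carrier (Hecke n))" using a by (auto simp:hecke_irr_char_def)
  moreover have "y:extensional (carrier (Hecke n))" by (simp add:y_def)
  ultimately show "f = y" by (metis extensionalityI)
 qed
 thus ?thesis using y(1)[OF p] by simp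
qed

lemma hk_ind2_sign_trace:
 assumes "sum_list u = n" "p:fa n"
 shows "hecke_induced_sign n u (cls n p) = ttr n (bw u) p"
proof -
 have "tf (hecke_induced_sign n u (cls n p)) =
  (SUM m:partitions n. of_nat (card (SSD (YD m) u)) * chiL n (YD m) p)"
  unfolding hecke_induced_sign_def rhom_sum[OF rhom_to_fract]
  by (rule sum.cong)
  (simp_all add:rhom_of_nat[OF rhom_to_fract] kostka_SSD hk_char_chiL[OF _ assms(2)])
 also have "... = (SUM D:Shp n. of_nat (card (SSD D u)) * chiL n D p)"
  by (rule sum.reindex_bij_betw[OF bij_YD])
 also have "... = tf (ttr n (bw u) p)"
  by (rule ttr_SSD[OF snorm_fract assms, symmetric])
 finally show ?thesis by (simp only:to_fract_eq_iff)
qed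

section \<open>Colorings of given content\<close>

text \<open>All colorings of the given content, proper or not; the improper ones will have diagonal
  coefficient 0.\<close>

definition cols :: "nat => (nat \<Rightarrow>\<^sub>0 nat) => (nat => nat) set" where
 "cols n g = {f:{1..n} \<rightarrow>\<^sub>E {1..}. ALL c. lookup g c = card {i:{1..n}. f i = c}}"

lemma coloringsD:
 assumes "f:cols n g"
 shows "card {i:{1..n}. f i = c} = lookup g c" "i:{1..n} ==> 1 <= f i" "i ~: {1..n} ==> f i = undefined"
  "i:{1..n} ==> f i:keys g"
proof -
 show c: "card {i:{1..n}. f i = c} = lookup g c" for c using assms unfolding cols_def by simp
 show "i:{1..n} ==> 1 <= f i" "i ~: {1..n} ==> f i = undefined"
  using assms unfolding cols_def by (auto dest:PiE_arb)
 assume "i:{1..n}"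
 hence "i:{j:{1..n}. f j = f i}" by blast
 thus "f i:keys g" unfolding in_keys_iff c[symmetric] by (simp) blast
qed

lemma equal_fibers_perm:
 assumes "!!c. card {i:{1..n}. f i = c} = card {i:{1..n}. g i = c}"
 shows "EX u:Sym n. ALL i:{1..n}. g (u i) = f i"
proof -
 have "ALL c. EX h. bij_betw h {i:{1..n}. f i = c} {i:{1..n}. g i = c}"
  using assms by (intro allI finite_same_card_bij) simp_all
 then obtain h where h: "!!c. bij_betw (h c) {i:{1..n}. f i = c} {i:{1..n}. g i = c}" by metis
 define u where "u i = (if i:{1..n} then h (f i) i else i)" for i
 have u: "u i:{1..n} & g (u i) = f i" if "i:{1..n}" for i
  using bij_betwE[OF h[of "f i"]] that by (simp add:u_def)
 have "inj_on u {1..n}"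
 proof (rule inj_onI)
  fix i j assume ij: "i:{1..n}" "j:{1..n}" "u i = u j"
  hence eq: "f i = f j" using u by metis
  hence "h (f i) i = h (f i) j" using ij by (simp add:u_def)
  thus "i = j" using inj_onD[OF bij_betw_imp_inj_on[OF h[of "f i"]]] ij eq by simp
 qed
 moreover have "u ` {1..n} \<subseteq> {1..n}" using u by blast
 ultimately have "bij_betw u {1..n} {1..n}" by (simp add:bij_betw_def endo_inj_surj)
 hence "u permutes {1..n}" by (rule bij_imp_permutes) (simp only:u_def if_False)
 thus ?thesis using u unfolding Sym_def by blast
qed

text \<open>Symmetry of Kostka numbers in the content. At \<open>q = 1\<close> the operators only
  ask whether letters are equal, so an injective relabeling preserves traces; \<open>ch_dual\<close>
  then compares multiplicities shape by shape.\<close>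

lemma card_YY_relab:
 fixes b b' :: "nat => 'c::linorder"
 assumes b: "base_wd n b" "base_wd n b'" and u: "u:Sym n" "!!i. i:{1..n} ==> b' (u i) = g (b i)"
  and inj: "inj_on g (b ` {1..n})" and D: "D:Shp n"
 shows "card (snorm.YY n D (cuts n b)) = card (snorm.YY n D (cuts n b'))"
proof -
 interpret C: snorm n at1 1 of_int by (rule snorm_at1)
 \<comment> \<open>Outside \<open>{1..n}\<close> every word agrees with its base word, so there the
   relabeling must replace \<open>b\<close> by \<open>b'\<close>.\<close>
 define r where "r h i = (if i:{1..n} then g (h i) else b' i)" for h i
 have wd: "h i:b ` {1..n} & i:{1..n} \<or> h i = b i & i ~: {1..n}" if h: "h:words n b" for h i
 proof -
  obtain w where w: "w:Sym n" "h = b o pinv w" using h by (auto simp:words_def)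
  show ?thesis
  proof (cases "i:{1..n}")
  case True thus ?thesis using Sym_mem[OF pinv_Sym[OF w(1)], of i] by (simp only:w(2) comp_apply) blast
  next
  case False thus ?thesis using Sym_out[OF pinv_Sym[OF w(1)] False] by (simp only:w(2)) simp
  qed
 qed
 have inj_r: "inj_on r (words n b)"
 proof (intro inj_onI ext)
  fix h l i assume k: "h:words n b" "l:words n b" "r h = r l"
  show "h i = l i"
  using fun_cong[OF k(3), of i] wd[OF k(1), of i] wd[OF k(2), of i] inj_onD[OF inj, of "h i" "l i"] unfolding r_def by metis
 qed
 have r_u: "r (b o pinv w) = b' o (u o pinv w)" if "w:Sym n" for w
  using Sym_mem[OF pinv_Sym[OF that]] Sym_out[OF pinv_Sym[OF that]] Sym_out[OF u(1)] u(2)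
  by (auto simp:r_def fun_eq_iff)
 have words: "words n b' = r ` words n b"
 proof (intro Set.set_eqI iffI)
  fix h assume "h:words n b'"
  then obtain w where w: "w:Sym n" "h = b' o pinv w" by (auto simp:words_def)
  have "u o pinv (w o u) = pinv w" using u(1) w(1) by (simp add:pinv_comp_dis fun_eq_iff)
  hence "h = r (b o pinv (w o u))" unfolding r_u[OF comp_Sym[OF w(1) u(1)]] by (simp only:w(2))
  thus "h:r ` words n b" unfolding words_def using comp_Sym[OF w(1) u(1)] by blast
 next
  fix h assume "h:r ` words n b"
  then obtain w where w: "w:Sym n" "h = r (b o pinv w)" by (auto simp:words_def)
  have "u o pinv w = pinv (w o pinv u)"
  unfolding pinv_comp_dis[OF w(1) pinv_Sym[OF u(1)]] inv_inv_eq[OF permutes_bij[OF permsD[OF u(1)]]] ..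
  thus "h:words n b'" unfolding words_def w(2) r_u[OF w(1)] using comp_Sym[OF w(1) pinv_Sym[OF u(1)]] by (metis image_eqI)
 qed
 have fold: "foldr (tn_op 1) us (dl (r h)) (r l) = (foldr (tn_op 1) us (dl h) l :: complex)"
  if "h:words n b" "l:words n b" "set us \<subseteq> {1..<n}" for us h l
  using that(2,3)
 proof (induction us arbitrary: l)
  case Nil
  thus ?case using inj_on_eq_iff[OF inj_r Nil(1) that(1)] by (simp add:dl_def)
 next
  case (Cons i us)
  have i: "i:{1..<n}" "i:{1..n}" "Suc i:{1..n}" using Cons.prems(2) by auto
  have eq: "r l i = r l (Suc i) <-> l i = l (Suc i)"
  using wd[OF Cons.prems(1), of i] wd[OF Cons.prems(1), of "Suc i"] i inj_on_eq_iff[OF inj] by (simp add:r_def)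
  have "r l o sw i = r (l o sw i)" using i by (auto simp:r_def transpose_def)
  moreover have "foldr (tn_op 1) (i # us) f m = (if m i = m (Suc i) then - foldr (tn_op 1) us f m else foldr (tn_op 1) us f (m o sw i))"
  for f :: "(nat => 'c) => complex" and m by (simp add:tn_op_def)
  ultimately show ?case using Cons.IH[OF Cons.prems(1)] Cons.IH[OF words_sw[OF Cons.prems(1) i(1)]] Cons.prems(2)
  by (simp add:eq del:comp_apply foldr.simps)
 qed
 have "tr (words n b') (act at1 (tn_op 1) p) = tr (words n b) (act at1 (tn_op 1) p)" if "p:fa n" for p
  unfolding tr_def words sum.reindex[OF inj_r] comp_def act_def
  by (intro sum.cong refl arg_cong[of _ _ "(*) _"] fold) (use that in "auto simp:free_alg_def")
 hence eq: "(SUM E:Shp n. of_nat (card (C.YY E (cuts n b'))) * C.ch E p) = (SUM E:Shp n. of_nat (card (C.YY E (cuts n b))) * C.ch E p)"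
  if "p:fa n" for p using C.trace_tn[OF b(1) that] C.trace_tn[OF b(2) that] that by simp
 obtain c where c: "!!G. (SUM w:Sym n. c w * C.ch G (Tw n w)) = (if G = D then 1 else 0)" using C.ch_dual[OF D] by blast
 have co: "(SUM w:Sym n. c w * (SUM E:Shp n. a E * C.ch E (Tw n w))) = a D" for a
 proof -
  have "(SUM w:Sym n. c w * (SUM E:Shp n. a E * C.ch E (Tw n w))) = (SUM E:Shp n. a E * (SUM w:Sym n. c w * C.ch E (Tw n w)))"
  unfolding sum_distrib_left by (subst sum.swap) (simp only:mult.left_commute)
  also have "... = a D" unfolding c using D by (simp add:if_distrib[of "%x. _ * x"] cong: if_cong)
  finally show ?thesis .
 qed
 have "(SUM w:Sym n. c w * (SUM E:Shp n. of_nat (card (C.YY E (cuts n b'))) * C.ch E (Tw n w))) =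
  (SUM w:Sym n. c w * (SUM E:Shp n. of_nat (card (C.YY E (cuts n b))) * C.ch E (Tw n w)))"
  by (rule sum.cong) (simp_all add:eq[OF Tw_fa])
 thus ?thesis unfolding co by (simp only:of_nat_eq_iff)
qed

lemma card_bw:
 assumes "k < length u" "sum_list u = n"
 shows "card {i:{1..n}. bw u i = length u - k} = u ! k"
proof -
 have "bw u i = length u - k <-> blk u i = k" if "i:{1..n}" for i
  using that assms by (auto simp:bw_def)
 hence "{i:{1..n}. bw u i = length u - k} = {i:{1..n}. blk u i = k}" by blast
 thus ?thesis using card_blk[OF assms(1)] by (simp only:assms(2))
qed

lemma ttr_YY:
 assumes "base_wd n b" "p:fa n"
 shows "tf (ttr n b p) =
  (SUM D:Shp n. of_nat (card (snorm.YY n D (cuts n b))) * chiL n D p)"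
proof -
 interpret L: snorm n tf "tf qv" brL by (rule snorm_fract)
 show ?thesis unfolding rhom_ttr[OF rhom_to_fract] by (rule L.trace_tn[OF assms])
qed

lemma srt_key_list:
 fixes f :: "nat => nat"
 assumes "sorted_wrt (>=) u" "mset u = image_mset f (mset_set A)" "finite A"
 shows "EX cs. distinct cs & set cs = A & map f cs = u"
proof -
 define cs where "cs = sort_key f (sorted_list_of_set A)"
 have "sort (map f cs) = rev u"
 proof (rule properties_for_sort)
  show "sorted (rev u)" using assms(1) by (simp add:sorted_wrt_rev)
  show "mset (rev u) = mset (map f cs)" using assms by (simp add:cs_def flip:sorted_list_of_mset_set)
 qed
 moreover have "sort (map f cs) = map f cs" by (rule sorted_sort_id) (simp add:cs_def)
 ultimately have "map f (rev cs) = u" by (simp add:rev_map[symmetric])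
 moreover have "distinct (rev cs)" "set (rev cs) = A" using assms(3) by (simp_all add:cs_def)
 ultimately show ?thesis by blast
qed

lemma card_fibers_comp:
 assumes u: "u:Sym n" shows "card {i:{1..n}. f (u i) = c} = card {i:{1..n}. f i = c}"
proof (rule bij_betw_same_card[of u, OF bij_betw_byWitness[of _ "pinv u"]])
 show "u ` {i:{1..n}. f (u i) = c} \<subseteq> {i:{1..n}. f i = c}"
  by (intro image_subsetI) (simp only:mem_Collect_eq Sym_mem[OF u] simp_thms)
 show "pinv u ` {i:{1..n}. f i = c} \<subseteq> {i:{1..n}. f (u i) = c}"
  by (intro image_subsetI) (simp only:mem_Collect_eq Sym_mem[OF pinv_Sym[OF u]] pinv_app[OF u] simp_thms)
qed (use u in simp_all)

text \<open>The exponents of a monomial come in any order and on any colors. Relabel the letters of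
  \<open>bw g\<close> by the colors \<open>cs\<close>, sort the result to a base word
  \<open>b\<close> whose rearrangements are the colorings, and compare the traces by
  \<open>card_YY_relab\<close>.\<close>

lemma ttr_cont:
 fixes h :: "nat \<Rightarrow>\<^sub>0 nat"
 assumes h: "0 ~: keys h" and g: "g:partitions n"
  and ms: "image_mset (lookup h) (mset_set (keys h)) = mset g" and p: "p:fa n"
 shows "ttr n (bw g) p = (SUM f:cols n h. act (%c. c) (tn_op qv) p (dl f) f)"
proof -
 let ?l = "lookup h"
 have nu: "sum_list g = n" "sorted_wrt (>=) g" using g by (simp_all add:partitions_def)
 obtain cs where cs: "distinct cs" "set cs = keys h" "map ?l cs = g"
  using srt_key_list[OF nu(2) ms[symmetric]] by auto
 have len: "length g = length cs" "!!k. k < length g ==> g ! k = ?l (cs ! k)" unfolding cs(3)[symmetric] by simp_all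
 define r where "r x = cs ! (length g - x)" for x
 have rho: "bw g i:(%k. length g - k) ` {..<length g}" if "i:{1..n}" for i
  using blk_props(1)[of i g] that nu(1) by (auto simp:bw_def)
 have inj: "inj_on r (bw g ` {1..n})"
 proof (rule inj_on_subset)
  show "inj_on r ((%k. length g - k) ` {..<length g})"
  using nth_eq_iff_index_eq[OF cs(1)] by (auto simp:inj_on_def r_def len(1))
 qed (use rho in blast)
 define a where "a = (\<lambda>i\<in>{1..n}. r (bw g i))"
 have a_eq: "a i = r (bw g i)" if "i:{1..n}" for i using that by (simp add:a_def)
 have a_keys: "a i:set cs" if "i:{1..n}" for i using rho[OF that] a_eq[OF that] by (auto simp:r_def len(1))
 have a_card: "card {i:{1..n}. a i = c} = ?l c" for c
 proof (cases "c:set cs")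
  case True
  then obtain k where k: "k < length g" "c = cs ! k" by (metis in_set_conv_nth len(1))
  have "a i = c <-> bw g i = length g - k" if "i:{1..n}" for i
  using rho[OF that] k nth_eq_iff_index_eq[OF cs(1)] by (auto simp:r_def len(1) a_eq[OF that])
  hence "{i:{1..n}. a i = c} = {i:{1..n}. bw g i = length g - k}" by blast
  thus ?thesis using card_bw[OF k(1) nu(1)] by (simp only:len(2)[OF k(1)] k(2))
 next
  case False
  hence "{i:{1..n}. a i = c} = {}" using a_keys by blast
  thus ?thesis using False unfolding cs(2) by (simp only:card.empty in_keys_iff) simp
 qed
 obtain s where s: "s:YS 1 n {}" "!!i. i:links 1 n {} ==> a (s (Suc i)) <= a (s i)"
  by (rule YS_sort[of a 1 n "{}"]) auto
 have sp: "s:Sym n" by (rule YS_perm[OF s(1)])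
 define b where "b = a o s"
 have B: "base_wd n b" by unfold_locales (use s(2) in "simp add:b_def links_def")
 have words: "words n b = cols n h"
 proof (intro Set.set_eqI iffI)
  fix f assume "f:words n b"
  then obtain w where w: "w:Sym n" "f = b o pinv w" by (auto simp:words_def)
  define v where "v = s o pinv w"
  have v: "v:Sym n" "!!i. f i = a (v i)" using comp_Sym[OF sp pinv_Sym[OF w(1)]] by (simp_all add:v_def w(2) b_def)
  have "f i:{1..}" if "i:{1..n}" for i
  using a_keys[of "v i"] Sym_mem[OF v(1), of i] that h unfolding v(2) cs(2) by (metis atLeast_iff less_one not_le)
  moreover have "f i = undefined" if "i ~: {1..n}" for i
  using that by (simp only:v(2) Sym_out[OF v(1) that] a_def restrict_apply if_False)
  moreover have "?l c = card {i:{1..n}. f i = c}" for c by (simp only:v(2) card_fibers_comp[OF v(1)] a_card)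
  ultimately show "f:cols n h" unfolding cols_def by (intro CollectI conjI PiE_I allI)
 next
  fix f assume k: "f:cols n h"
  hence "card {i:{1..n}. f i = c} = card {i:{1..n}. b i = c}" for c
  by (simp only:coloringsD(1) b_def comp_apply card_fibers_comp[OF sp] a_card)
  from equal_fibers_perm[OF this] obtain u where u: "u:Sym n" "!!i. i:{1..n} ==> b (u i) = f i" by blast
  have "f i = b (u i)" for i
  proof (cases "i:{1..n}")
  case False
  thus ?thesis using coloringsD(3)[OF k False] Sym_out[OF u(1) False] Sym_out[OF sp False]
  by (simp only:b_def comp_apply a_def restrict_apply if_False)
  qed (rule u(2)[symmetric])
  hence "f = b o u" by auto
  moreover have "pinv (pinv u) = u" using inv_inv_eq permutes_bij[OF permsD[OF u(1)]] by blast
  ultimately show "f:words n b" unfolding words_def using pinv_Sym[OF u(1)] by (metis image_eqI)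
 qed
 have "b (pinv s i) = r (bw g i)" if "i:{1..n}" for i using sp by (simp add:b_def a_eq[OF that])
 from card_YY_relab[OF base_wd_bw B pinv_Sym[OF sp] this inj]
 have "tf (ttr n (bw g) p) = tf (ttr n b p)"
  by (simp add:ttr_YY[OF B p] ttr_YY[OF base_wd_bw p] cong: sum.cong)
 hence "ttr n (bw g) p = ttr n b p" by (simp only:to_fract_eq_iff)
 thus ?thesis unfolding ttr_def[of n b] tr_def words .
qed

lemma cont_part:
 assumes "f:cols n g"
 shows "0 ~: keys g &
  (EX u:partitions n. image_mset (lookup g) (mset_set (keys g)) = mset u)"
proof -
 let ?l = "lookup g" and ?K = "keys g"
 note k = coloringsD[OF assms]
 have "{i:{1..n}. f i = 0} = {}" using k(2) by fastforce
 hence 0: "0 ~: ?K" unfolding in_keys_iff k(1)[symmetric] by simp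
 define u where "u = rev (sort (map ?l (sorted_list_of_set ?K)))"
 have m: "mset u = image_mset ?l (mset_set ?K)" by (simp add:u_def flip:sorted_list_of_mset_set)
 have "sorted_wrt (>=) u" by (simp add:u_def sorted_wrt_rev)
 moreover have "set u = ?l ` ?K" by (simp add:u_def)
 hence "ALL x:set u. 0 < x" by (auto simp:in_keys_iff)
 moreover have "sum_list u = n"
 proof -
  have "sum_list u = (SUM c:?K. ?l c)" by (simp add:m sum_unfold_sum_mset flip:sum_mset_sum_list)
  also have "... = (SUM c:?K. card {i:{1..n}. f i = c})" by (simp only:k(1))
  also have "... = card (UN c:?K. {i:{1..n}. f i = c})" by (rule card_UN_disjoint[symmetric]) auto
  also have "(UN c:?K. {i:{1..n}. f i = c}) = {1..n}"
  using k(4) by blast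
  finally show ?thesis by simp
 qed
 ultimately have "u:partitions n" by (simp add:partitions_def)
 thus ?thesis using 0 m by metis
qed

lemma part_uniq:
 assumes "m:partitions n" "u:partitions n" "mset m = mset u" shows "m = u"
proof -
 have "sort (rev m) = rev u" "sort (rev m) = rev m"
  by (rule properties_for_sort; use assms in "simp add:partitions_def sorted_wrt_rev")+
 thus ?thesis by simp
qed

lemma fin_part: "finite (partitions n)"
 using bij_YD[of n] fin_Shp[of n] bij_betw_finite by blast

lemma ttr_mono:
 assumes p: "p:fa n"
 shows "(SUM u:partitions n. ttr n (bw u) p * monomial_sym u g) =
  (SUM f:cols n g. act (%c. c) (tn_op qv) p (dl f) f)"
proof (cases "0 ~: keys g &
  (EX u:partitions n. image_mset (lookup g) (mset_set (keys g)) = mset u)")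
 case True
 then obtain u where u: "0 ~: keys g" "u:partitions n"
  "image_mset (lookup g) (mset_set (keys g)) = mset u" by blast
 have "monomial_sym m g = (if m = u then 1 else 0)" if "m:partitions n" for m
  using part_uniq[OF u(2) that] u by (auto simp:monomial_sym_def)
 hence "(SUM m:partitions n. ttr n (bw m) p * monomial_sym m g) =
  (SUM m:partitions n. if m = u then ttr n (bw m) p else 0)"
  by (intro sum.cong) auto
 also have "... = ttr n (bw u) p" using u(2) by (simp add:fin_part)
 finally show ?thesis using ttr_cont[OF u p] by simp
next
 case False
 hence "cols n g = {}" using cont_part by blast
 moreover have "monomial_sym m g = 0" if "m:partitions n" for m using False that by (auto simp:monomial_sym_def)
 ultimately show ?thesis by simp
qed

theorem theorem7p4:
  fixes n :: nat
    and P :: "nat rel"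
    and v w :: "nat \<Rightarrow> nat"
    and Is Js :: "(nat \<times> nat) list"
  assumes "unit_interval_order {1..n} P"
    and "altitude_respecting n P"
    and "v permutes {1..n}" and "avoids n v [3, 1, 2]"
    and "zigzag_sequence n Is" and "zigzag_perm Is = v"
    and "poset_iso {1..n} (path_poset n (zigzag_network n Is)) {1..n} P"
    and "w permutes {1..n}" and "avoids n w [3, 4, 1, 2]" and "avoids n w [4, 2, 3, 1]"
    and "zigzag_sequence n Js" and "zigzag_perm Js = w"
    and "poset_iso {1..n} (path_poset n (zigzag_network n Js))
                   {1..n} (path_poset n (zigzag_network n Is))"
  shows "chromatic_quasisym n P =
    (\<lambda>\<alpha>. \<Sum>\<nu>\<in>partitions n.
       hecke_induced_sign n \<nu> (hecke_scale n (q_half (int (perm_length n w))) (kl_basis n w))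
         * monomial_sym \<nu> \<alpha>)"
proof
 fix g
 have zz: "zz n Js" and cover: "(UN J:set Js. ivl J) = {1..n}" using assms(11) by (simp_all only:zigzag_seq_zz)
 define p where "p = ind n (Bz Js)"
 have p: "p:fa n" unfolding p_def by (rule ind_fa[OF Bz_sub_Sym[OF zz]])
 have sub: "P \<subseteq> {1..n} \<times> {1..n}" using assms(1) by (simp add:unit_interval_order_def strict_poset_on_def)
 \<comment> \<open>The altitude condition on the labels turns the abstract isomorphism into
   equality.\<close>
 have "P = path_poset n (zigzag_network n Js)"
  using path_poset_eq[OF zz cover sub assms(2)] poset_iso_sym[OF poset_iso_trs[OF assms(13,7)]] by blast
 hence P: "P = {(i, j). i:{1..n} & j:{1..n} & i < j & ~ (EX J:set Js. i:ivl J & j:ivl J)}"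
  unfolding path_poset_ivls[OF zz cover] .
 have inc: "incomparable P i j <-> i ~= j & (EX J:set Js. i:ivl J & j:ivl J)"
  if "i:{1..n}" "j:{1..n}" for i j
  using that unfolding P incomparable_def by (cases i j rule:linorder_cases) auto
 have ivl: "i:{1..n}" if "J:set Js" "i:ivl J" for i J using cover that by blast
 have proper: "(ALL i:{1..n}. ALL j:{1..n}. incomparable P i j --> f i ~= f j) <-> (ALL J:set Js. inj_on f (ivl J))" for f :: "nat => nat"
  unfolding inj_on_def using inc ivl by meson
 have "i:{1..n} & j:{1..n} & incomparable P i j & i < j & f i < f j <->
  i < j & f i < f j & (EX J:set Js. i:ivl J & j:ivl J)" for i j and f :: "nat => nat"
  using inc[of i j] ivl by (metis less_irrefl)
 hence asc: "asc n P f = card {(i, j). i < j & f i < f j & (EX J:set Js. i:ivl J & j:ivl J)}" for f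
  unfolding asc_def by (simp only:)
 have diag: "act (%c. c) (tn_op qv) p (dl f) f =
  (if ALL J:set Js. inj_on f (ivl J) then qv ^ asc n P f else 0)" for f
  unfolding p_def asc by (rule diag_Bz[OF zz])
 have "{f. f:proper_colorings n P & (ALL c. lookup g c = card {i:{1..n}. f i = c})} =
  {f:cols n g. ALL J:set Js. inj_on f (ivl J)}"
  unfolding proper_colorings_def cols_def proper by blast
 moreover have "finite (cols n g)"
 proof (rule finite_subset)
  show "cols n g \<subseteq> {1..n} \<rightarrow>\<^sub>E keys g"
  proof
  fix f assume k: "f:cols n g"
  show "f:{1..n} \<rightarrow>\<^sub>E keys g"
  by (rule PiE_I) (use coloringsD[OF k] in blast)+
  qed
 qed (simp add:finite_PiE)
 \<comment> \<open>The sum extends from proper colorings to all colorings of content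
   \<open>g\<close>, as the others have diagonal coefficient 0.\<close>
 ultimately have "chromatic_quasisym n P g =
  (SUM f:cols n g. act (%c. c) (tn_op qv) p (dl f) f)"
  unfolding chromatic_quasisym_def diag by (simp add:sum.inter_filter)
 also have "... = (SUM u:partitions n. ttr n (bw u) p * monomial_sym u g)"
  by (rule ttr_mono[OF p, symmetric])
 also have "... = (SUM u:partitions n.
  hecke_induced_sign n u (hecke_scale n (qh (int (perm_length n w))) (kl_basis n w)) * monomial_sym u g)"
  using kl_basis_zigzag[OF zz]
  by (intro sum.cong) (simp_all add:assms(12) hk_ind2_sign_trace[OF _ p] partitions_def flip:p_def)
 finally show "chromatic_quasisym n P g = (SUM u:partitions n.
  hecke_induced_sign n u (hecke_scale n (qh (int (perm_length n w))) (kl_basis n w)) * monomial_sym u g)" .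
qed

end
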